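(* Let $\varphi:\mathscr S(\mathbb R^d)\to\mathbb C$ be a positive definite functional which is continuous with respect to the norm $|||\cdot|||$ and satisfies $\varphi(0)=1$. Then there is a unique probability measure $\mu$ on $(\mathscr S'(\mathbb R^d),\mathfrak B(\mathscr S'))$ such that $\hat\mu=\varphi$. Moreover, $\mu(\mathscr S_q')=1$ for every $q>\frac{3d}{4}$.
   Context: $\mathscr S=\mathscr S(\mathbb R^d)$ is the real Schwartz space, $\mathscr S'$ its dual, $\mathfrak B(\mathscr S')$ the Borel $\sigma$-algebra of the weak-* topology, and $\hat\mu(f)=\int_{\mathscr S'}e^{i\omega(f)}\mu(\mathrm d\omega)$. For $f\in\mathscr S$, $|||f|||:=(\|f\|_{L^1(\mathbb R^d)}^2+\|f\|_{L^2(\mathbb R^d)}^2)^{1/2}$. Positive definite: $[\varphi(f_i-f_j)]_{i,j}$ is Hermitian positive semidefinite for all finite families. With $h_{\boldsymbol\alpha}$, $\boldsymbol\alpha\in\mathbb N_0^d$, the tensorized Hermite functions (orthonormal basis of $L^2(\mathbb R^d)$), set $|f|_q^2:=\sum_{\boldsymbol\alpha}(2|\boldsymbol\alpha|+d)^{2q}|(f,h_{\boldsymbol\alpha})_{L^2}|^2$; $\mathscr S_q'$ is the set of $\omega\in\mathscr S'$ for which there is $C>0$ with $|\omega(f)|\le C|f|_q$ for all $f\in\mathscr S$. *)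

theory Defs
  imports "HOL-Analysis.Analysis" "HOL-Probability.Probability"
begin

fun pd :: "'n::finite list \<Rightarrow> (real^'n \<Rightarrow> real) \<Rightarrow> real^'n \<Rightarrow> real" where
  "pd [] f = f"
| "pd (i # is) f = (\<lambda>x. frechet_derivative (pd is f) (at x) (axis i 1))"

definition schwartz :: "(real^'n::finite \<Rightarrow> real) set" where
  "schwartz = {f. \<forall>is. (\<forall>x. pd is f differentiable (at x)) \<and>
       (\<forall>k::nat. bounded (range (\<lambda>x. (1 + norm x) ^ k * pd is f x)))}"

definition schwartz_seminorm :: "nat \<Rightarrow> 'n::finite list \<Rightarrow> (real^'n \<Rightarrow> real) \<Rightarrow> real" where
  "schwartz_seminorm k is f = (SUP x. (1 + norm x) ^ k * \<bar>pd is f x\<bar>)"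

text \<open>Tempered distributions S': continuous linear functionals on S (for the Frechet topology
  given by the seminorms), represented extensionally (value undefined off S).\<close>
definition tempered :: "((real^'n::finite \<Rightarrow> real) \<Rightarrow> real) set" where
  "tempered = {\<omega>. \<omega> \<in> extensional schwartz \<and>
     (\<forall>f\<in>schwartz. \<forall>g\<in>schwartz. \<forall>a b. \<omega> (\<lambda>x. a * f x + b * g x) = a * \<omega> f + b * \<omega> g) \<and>
     (\<exists>C N. \<forall>f\<in>schwartz. \<bar>\<omega> f\<bar> \<le> C * (\<Sum>k\<le>N. \<Sum>is\<in>{is::'n list. length is \<le> N}.
                                             schwartz_seminorm k is f))}"

definition weak_star :: "((real^'n::finite \<Rightarrow> real) \<Rightarrow> real) topology" where
  "weak_star = subtopology (product_topology (\<lambda>_. euclideanreal) schwartz) tempered"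

definition tempered_borel :: "((real^'n::finite \<Rightarrow> real) \<Rightarrow> real) measure" where
  "tempered_borel = sigma tempered {U. openin weak_star U}"

definition char_fun :: "((real^'n::finite \<Rightarrow> real) \<Rightarrow> real) measure \<Rightarrow> (real^'n \<Rightarrow> real) \<Rightarrow> complex" where
  "char_fun \<mu> f = (\<integral>\<omega>. cis (\<omega> f) \<partial>\<mu>)"

definition L1_norm :: "(real^'n::finite \<Rightarrow> real) \<Rightarrow> real" where
  "L1_norm f = (\<integral>x. \<bar>f x\<bar> \<partial>lborel)"
definition L2_norm :: "(real^'n::finite \<Rightarrow> real) \<Rightarrow> real" where
  "L2_norm f = sqrt (\<integral>x. (f x)\<^sup>2 \<partial>lborel)"
definition trip_norm :: "(real^'n::finite \<Rightarrow> real) \<Rightarrow> real" where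
  "trip_norm f = sqrt ((L1_norm f)\<^sup>2 + (L2_norm f)\<^sup>2)"

definition trip_continuous :: "((real^'n::finite \<Rightarrow> real) \<Rightarrow> complex) \<Rightarrow> bool" where
  "trip_continuous \<phi> \<longleftrightarrow> (\<forall>f\<in>schwartz. \<forall>\<epsilon>>0. \<exists>\<delta>>0. \<forall>g\<in>schwartz.
      trip_norm (\<lambda>x. g x - f x) < \<delta> \<longrightarrow> cmod (\<phi> g - \<phi> f) < \<epsilon>)"

definition positive_definite :: "((real^'n::finite \<Rightarrow> real) \<Rightarrow> complex) \<Rightarrow> bool" where
  "positive_definite \<phi> \<longleftrightarrow> (\<forall>(n::nat) (fs :: nat \<Rightarrow> real^'n \<Rightarrow> real). (\<forall>i<n. fs i \<in> schwartz) \<longrightarrow>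
      (let A = (\<lambda>i j. \<phi> (\<lambda>x. fs i x - fs j x)) in
        (\<forall>i<n. \<forall>j<n. A i j = cnj (A j i)) \<and>
        (\<forall>c :: nat \<Rightarrow> complex. let s = (\<Sum>i<n. \<Sum>j<n. cnj (c i) * A i j * c j) in
             Im s = 0 \<and> Re s \<ge> 0)))"

fun hermite_poly :: "nat \<Rightarrow> real \<Rightarrow> real" where
  "hermite_poly 0 x = 1"
| "hermite_poly (Suc 0) x = 2 * x"
| "hermite_poly (Suc (Suc n)) x = 2 * x * hermite_poly (Suc n) x - 2 * real (Suc n) * hermite_poly n x"

definition hermite_fun :: "nat \<Rightarrow> real \<Rightarrow> real" where
  "hermite_fun n x = hermite_poly n x * exp (- (x\<^sup>2) / 2) / sqrt (2 ^ n * fact n * sqrt pi)"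

definition hermite_tensor :: "('n::finite \<Rightarrow> nat) \<Rightarrow> real^'n \<Rightarrow> real" where
  "hermite_tensor \<alpha> x = (\<Prod>i\<in>UNIV. hermite_fun (\<alpha> i) (x $ i))"

definition hermite_norm :: "real \<Rightarrow> (real^'n::finite \<Rightarrow> real) \<Rightarrow> real" where
  "hermite_norm q f = sqrt (\<Sum>\<^sub>\<infinity>\<alpha>\<in>(UNIV :: ('n \<Rightarrow> nat) set).
       (2 * real (sum \<alpha> UNIV) + real CARD('n)) powr (2 * q) *
       (\<integral>x. f x * hermite_tensor \<alpha> x \<partial>lborel)\<^sup>2)"

definition tempered_q :: "real \<Rightarrow> ((real^'n::finite \<Rightarrow> real) \<Rightarrow> real) set" where
  "tempered_q q = {\<omega>\<in>tempered. \<exists>C>0. \<forall>f\<in>schwartz. \<bar>\<omega> f\<bar> \<le> C * hermite_norm q f}"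

end

theory Submission
  imports Defs "HOL-Probability.Probability"
begin

text \<open>Expanding in Hermite functions turns \<open>\<phi>\<close> into a positive definite function of finitely many
  coordinates at a time. Countably many real variables \<open>Z j\<close> with these joint characteristic functions
  are obtained by discretisation: Fejer kernels turn the values of \<open>\<phi>\<close> on finer and finer grids into
  finitely supported laws, which are tight, and a subsequence converges.

  On \<open>|||f|||\<close> small, \<open>1 - Re (\<phi> f)\<close> is small. For \<open>1/2 < s \<le> 1\<close>, Cauchy-Schwarz bounds \<open>|||f|||\<^sup>2\<close> by a
  multiple of the quadratic form \<open>\<integral> f\<^sup>2 (\<Prod>\<^sub>i (1 + x\<^sub>i\<^sup>2))\<^sup>s\<close>, whose value at \<open>h\<^sub>\<alpha>\<close> is at most of order
  \<open>(\<Prod>\<^sub>i (2 \<alpha>\<^sub>i + 1))\<^sup>s \<le> (2|\<alpha>| + d)\<^bsup>sd\<^esup>\<close>. Averaging the bound on \<open>1 - Re \<phi>\<close> against Gaussian weights gives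
  almost sure convergence of \<open>\<Sum>\<^sub>\<alpha> (2|\<alpha>| + d)\<^bsup>-2q\<^esup> Z\<^sub>\<alpha>\<^sup>2\<close> as soon as
  \<open>\<Sum>\<^sub>\<alpha> (2|\<alpha>| + d)\<^bsup>-2q\<^esup> (\<Prod>\<^sub>i (2 \<alpha>\<^sub>i + 1))\<^sup>s\<close> is finite. Since \<open>\<Prod>\<^sub>i (2 \<alpha>\<^sub>i + 1) \<le> (2|\<alpha>| + d)\<^sup>d\<close>, it is
  enough that \<open>2q/d - s > 1\<close>, and \<open>s\<close> close to \<open>1/2\<close> is possible exactly when \<open>q > 3d/4\<close>. The law of the
  functional \<open>\<omega> f = \<Sum>\<^sub>\<alpha> (f, h\<^sub>\<alpha>) Z\<^sub>\<alpha>\<close> is then the measure sought.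

  For uniqueness, the joint laws of the Hermite evaluations are determined by \<open>\<phi>\<close>, and these
  evaluations generate the Borel sets of the weak-* topology.\<close>

section \<open>Trigonometric polynomials\<close>

text \<open>The norm \<open>|||.|||\<close> is not Hilbertian because of its L1 part, whereas
  averaging over Gaussian weights needs a quadratic form. A weighted L2 form dominates L1 as soon as
  the reciprocal weight is integrable, and this forces \<open>s > 1/2\<close>. In the threshold
  3d/4, the share d/2 is the cost of summing squares over all multi-indices, and the share d/4 is
  the price of that weight on the Hermite functions.

  Weak-* open sets may be uncountable unions of cylinders, so it is not evident that countably many
  evaluations generate all Borel sets; the polynomial growth of the Hermite evaluations restores
  countability.

  Two uniqueness statements, of a law given its characteristic function and of a function given its
  Hermite coefficients, have the same form: an identity of integrals known for a small family of
  bounded functions has to reach indicators. \<open>bp_closure\<close>, the closure under linear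
  combinations and bounded pointwise limits, is what dominated convergence preserves; it is applied
  both to exponentials and to Hermite functions.\<close>

inductive bp_closure :: "(real \<Rightarrow> complex) set \<Rightarrow> (real \<Rightarrow> complex) \<Rightarrow> bool" for B where
  base: "u \<in> B \<Longrightarrow> bp_closure B u"
| lincomb: "bp_closure B u \<Longrightarrow> bp_closure B v \<Longrightarrow> bp_closure B (\<lambda>x. a * u x + b * v x)"
| lim: "(\<And>k::nat. bp_closure B (U k)) \<Longrightarrow> (\<And>k x. cmod (U k x) \<le> C) \<Longrightarrow>
        (\<And>x. (\<lambda>k. U k x) \<longlonglongrightarrow> u x) \<Longrightarrow> bp_closure B u"

lemma bp_closure_add: "bp_closure B u \<Longrightarrow> bp_closure B v \<Longrightarrow> bp_closure B (\<lambda>x. u x + v x)"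
  using bp_closure.lincomb[of B u v 1 1] by simp

lemma bp_closure_scale: "bp_closure B u \<Longrightarrow> bp_closure B (\<lambda>x. a * u x)"
  using bp_closure.lincomb[of B u u a 0] by simp

lemma bp_closure_zero: "bp_closure B u \<Longrightarrow> bp_closure B (\<lambda>x. 0)"
  using bp_closure.lincomb[of B u u 0 0] by simp

lemma bp_closure_sum:
  assumes "finite I" "\<And>i. i \<in> I \<Longrightarrow> bp_closure B (f i)" "bp_closure B v"
  shows "bp_closure B (\<lambda>x. \<Sum>i\<in>I. f i x)"
  using assms(1,2)
proof (induction I rule: finite_induct)
  case empty
  then show ?case using bp_closure_zero[OF assms(3)] by simp
next
  case (insert i I)
  then show ?case using bp_closure_add[of B "f i" "\<lambda>x. \<Sum>i\<in>I. f i x"] by simp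
qed

lemma bp_closure_measurable_bounded:
  assumes B: "\<And>u. u \<in> B \<Longrightarrow> u \<in> borel_measurable borel" "\<And>u. u \<in> B \<Longrightarrow> \<exists>C. \<forall>x. cmod (u x) \<le> C"
  assumes "bp_closure B u"
  shows "u \<in> borel_measurable borel \<and> (\<exists>C. \<forall>x. cmod (u x) \<le> C)"
  using assms(3)
proof (induction rule: bp_closure.induct)
  case (lincomb u v a b)
  then obtain C D where "\<And>x. cmod (u x) \<le> C" "\<And>x. cmod (v x) \<le> D" by blast
  then have "cmod (a * u x + b * v x) \<le> cmod a * C + cmod b * D" for x
    by (intro norm_triangle_le add_mono) (auto simp: norm_mult mult_left_mono)
  moreover have "(\<lambda>x. a * u x + b * v x) \<in> borel_measurable borel" using lincomb.IH by (intro borel_measurable_add borel_measurable_times) auto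
  ultimately show ?case by blast
next
  case (lim U C u)
  have "u \<in> borel_measurable borel"
    by (rule borel_measurable_LIMSEQ_metric[of U]) (use lim in auto)
  moreover have "cmod (u x) \<le> C" for x
    by (rule LIMSEQ_le_const2[OF tendsto_norm[OF lim(3)]]) (use lim(2) in blast)
  ultimately show ?case by blast
qed (use B in auto)

text \<open>For a fixed bounded \<open>w\<close>, the functions \<open>u\<close> with
  \<open>w * u\<close> in the closure of \<open>B'\<close> are themselves closed under linear
  combinations and bounded limits. Products of closure elements and changes of the base family are
  both obtained this way.\<close>

lemma bp_closure_mult_right:
  assumes "bp_closure B u" "\<And>v. v \<in> B \<Longrightarrow> bp_closure B' (\<lambda>x. w x * v x)" "\<And>x. cmod (w x) \<le> D"
  shows "bp_closure B' (\<lambda>x. w x * u x)"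
  using assms(1)
proof (induction rule: bp_closure.induct)
  case (lincomb u v a b)
  have "bp_closure B' (\<lambda>x. a * (w x * u x) + b * (w x * v x))"
    by (rule bp_closure.lincomb) (use lincomb in auto)
  then show ?case by (simp add: algebra_simps)
next
  case (lim U C u)
  show ?case
  proof (rule bp_closure.lim[where U="\<lambda>k x. w x * U k x" and C="D * C"])
    fix k x
    have "D \<ge> 0" using assms(3)[of x] norm_ge_zero order_trans by blast
    then show "cmod (w x * U k x) \<le> D * C"
      unfolding norm_mult using lim(2)[of k x] assms(3) by (intro mult_mono) auto
    show "(\<lambda>k. w x * U k x) \<longlonglongrightarrow> w x * u x" by (intro tendsto_intros lim)
  qed (use lim in auto)
qed (use assms in auto)

definition trig :: "(real \<Rightarrow> complex) set" where
  "trig = range (\<lambda>t x. cis (t * x))"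

lemma trig_bounded: "bp_closure trig u \<Longrightarrow> \<exists>C. \<forall>x. cmod (u x) \<le> C"
  and trig_measurable: "bp_closure trig u \<Longrightarrow> u \<in> borel_measurable borel"
proof -
  have "v \<in> borel_measurable borel" if "v \<in> trig" for v
    using that unfolding trig_def by (auto intro!: borel_measurable_continuous_onI continuous_intros)
  moreover have "\<exists>C. \<forall>x. cmod (v x) \<le> C" if "v \<in> trig" for v
    using that unfolding trig_def by (auto intro!: exI[of _ 1])
  ultimately show "bp_closure trig u \<Longrightarrow> \<exists>C. \<forall>x. cmod (u x) \<le> C"
    and "bp_closure trig u \<Longrightarrow> u \<in> borel_measurable borel"
    using bp_closure_measurable_bounded[of trig u] by blast+
qed

text \<open>Exponentials multiply to exponentials, so one factor can be moved through the closure
  while the other is a fixed exponential, and then the other one in turn. This makes the closure an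
  algebra, as substitution into polynomials requires.\<close>

lemma trig_mult:
  assumes u: "bp_closure trig u" and v: "bp_closure trig v"
  shows "bp_closure trig (\<lambda>x. u x * v x)"
proof -
  have 1: "bp_closure trig (\<lambda>x. cis (t * x) * v x)" for t
    using v
  proof (rule bp_closure_mult_right[where D=1])
    fix w assume "w \<in> trig"
    then obtain s where "w = (\<lambda>x. cis (s * x))" by (auto simp: trig_def)
    then have "(\<lambda>x. cis (t * x) * w x) = (\<lambda>x. cis ((t + s) * x))" by (auto simp: cis_mult algebra_simps)
    then show "bp_closure trig (\<lambda>x. cis (t * x) * w x)" by (auto intro!: bp_closure.base simp: trig_def)
  qed auto
  obtain C where C: "\<And>x. cmod (v x) \<le> C" using trig_bounded[OF v] by auto
  have "bp_closure trig (\<lambda>x. v x * u x)"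
    using u
  proof (rule bp_closure_mult_right[where D=C])
    fix w assume "w \<in> trig"
    then show "bp_closure trig (\<lambda>x. v x * w x)" using 1 by (auto simp: trig_def mult.commute)
  qed (use C in auto)
  then show ?thesis by (simp add: mult.commute)
qed

lemma trig_cis: "bp_closure trig (\<lambda>x. cis (t * x))"
  by (auto intro!: bp_closure.base simp: trig_def)

lemma trig_const: "bp_closure trig (\<lambda>x. c)"
  using bp_closure_scale[OF trig_cis[of 0], of c] by simp

lemma trig_sin: "bp_closure trig (\<lambda>x. of_real (sin (t * x)))"
proof -
  have "(\<lambda>x. of_real (sin (t * x))) = (\<lambda>x. (- \<i>/2) * cis (t * x) + (\<i>/2) * cis (- t * x))"
    by (auto simp: complex_eq_iff)
  then show ?thesis using bp_closure.lincomb[OF trig_cis trig_cis, of "- \<i>/2" t "\<i>/2" "- t"] by simp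
qed

lemma trig_polynomial:
  assumes "real_polynomial_function p" "bp_closure trig (\<lambda>x. of_real (u x))"
  shows "bp_closure trig (\<lambda>x. of_real (p (u x)))"
  using assms(1)
proof (induction rule: real_polynomial_function.induct)
  case (linear h)
  have "h (u x) = h 1 * u x" for x
    using linear_scale[OF bounded_linear.linear[OF linear.hyps], of "u x" 1] by (simp add: mult.commute)
  then show ?case using bp_closure_scale[OF assms(2), of "of_real (h 1)"] by simp
qed (auto simp: trig_const intro: bp_closure_add trig_mult)

text \<open>The inner function \<open>L * sin (x / L)\<close> confines the argument to
  \<open>[-L, L]\<close>, where Weierstrass polynomials are available, and turns them into
  trigonometric polynomials. As \<open>L\<close> grows it tends to \<open>x\<close>; both limits are
  bounded ones.\<close>

lemma trig_continuous:
  fixes G :: "real \<Rightarrow> real"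
  assumes G: "continuous_on UNIV G" "\<And>x. \<bar>G x\<bar> \<le> C"
  shows "bp_closure trig (\<lambda>x. of_real (G x))"
proof -
  have C: "C \<ge> 0" using G(2)[of 0] by linarith
  have 1: "bp_closure trig (\<lambda>x. of_real (G (L * sin (x / L))))" if L: "L > 0" for L
  proof -
    have "\<exists>p. real_polynomial_function p \<and> (\<forall>x\<in>{-L..L}. \<bar>G x - p x\<bar> < 1 / real (Suc k))" for k
      by (rule Stone_Weierstrass_real_polynomial_function[of "{-L..L}" G "1 / real (Suc k)"]) (auto intro: continuous_on_subset[OF G(1)])
    then obtain p where p: "\<And>k. real_polynomial_function (p k)"
      "\<And>k x. x\<in>{-L..L} \<Longrightarrow> \<bar>G x - p k x\<bar> < 1 / real (Suc k)" by metis
    have s: "L * sin (x / L) \<in> {-L..L}" for x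
      using L mult_left_mono[OF sin_le_one[of "x/L"], of L] mult_left_mono[OF sin_ge_minus_one[of "x/L"], of L] by auto
    have "bp_closure trig (\<lambda>x. of_real L * of_real (sin ((1/L) * x)))"
      by (rule bp_closure_scale[OF trig_sin])
    then have u: "bp_closure trig (\<lambda>x. of_real (L * sin (x / L)))" by simp
    show ?thesis
    proof (rule bp_closure.lim[where U="\<lambda>k x. of_real (p k (L * sin (x / L)))" and C="C + 1"])
      show "bp_closure trig (\<lambda>x. of_real (p k (L * sin (x / L))))" for k
        by (rule trig_polynomial[OF p(1) u])
      show "cmod (of_real (p k (L * sin (x / L)))) \<le> C + 1" for k x
      proof -
        have "1 / real (Suc k) \<le> 1" by simp
        then have "\<bar>p k (L * sin (x / L))\<bar> \<le> C + 1"
          using p(2)[OF s, of x k] G(2)[of "L * sin (x / L)"] by linarith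
        then show ?thesis by simp
      qed
      show "(\<lambda>k. of_real (p k (L * sin (x / L)))) \<longlonglongrightarrow> complex_of_real (G (L * sin (x / L)))" for x
      proof (rule tendsto_of_real, rule Lim_transform)
        show "(\<lambda>k. p k (L * sin (x / L)) - G (L * sin (x / L))) \<longlonglongrightarrow> 0"
        proof (rule Lim_null_comparison)
          show "\<forall>\<^sub>F k in sequentially. norm (p k (L * sin (x / L)) - G (L * sin (x / L))) \<le> 1 / real (Suc k)"
            using p(2)[OF s] by (intro always_eventually) (auto simp: abs_minus_commute less_imp_le simp del: of_nat_Suc)
          show "(\<lambda>k. 1 / real (Suc k)) \<longlonglongrightarrow> 0" by (rule LIMSEQ_Suc[OF lim_1_over_n])
        qed
      qed auto
    qed
  qed
  show ?thesis
  proof (rule bp_closure.lim[where U="\<lambda>k x. of_real (G (real (Suc k) * sin (x / real (Suc k))))" and C=C])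
    show "(\<lambda>k. of_real (G (real (Suc k) * sin (x / real (Suc k))))) \<longlonglongrightarrow> complex_of_real (G x)" for x
    proof -
      have "(\<lambda>k. real (Suc k) * sin (x / real (Suc k))) \<longlonglongrightarrow> x"
      proof (cases "x = 0")
        case False
        have "((\<lambda>h. sin h / h) \<longlongrightarrow> 1) (at (0::real))"
          using DERIV_sin[of 0] by (simp add: DERIV_def)
        moreover have "filterlim (\<lambda>k. x / real (Suc k)) (at 0) sequentially"
        proof (rule filterlim_atI)
          show "(\<lambda>k. x / real (Suc k)) \<longlonglongrightarrow> 0"
            using LIMSEQ_Suc[OF lim_const_over_n[of x]] by simp
        qed (use False in auto)
        ultimately have "(\<lambda>k. sin (x / real (Suc k)) / (x / real (Suc k))) \<longlonglongrightarrow> 1"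
          by (rule filterlim_compose)
        then have "(\<lambda>k. x * (sin (x / real (Suc k)) / (x / real (Suc k)))) \<longlonglongrightarrow> x * 1"
          by (intro tendsto_intros)
        then show ?thesis using False by (simp add: mult.commute del: of_nat_Suc)
      qed simp
      then show ?thesis
        using G(1) by (intro tendsto_of_real) (auto simp: continuous_on_eq_continuous_at intro!: isCont_tendsto_compose[of _ G])
    qed
  qed (use 1 G(2) in auto)
qed

text \<open>Half-lines are limits of piecewise linear cutoffs of slope k; complements and countable
  disjoint unions stay in the closure, so the pi-lambda theorem covers all Borel sets.\<close>

lemma trig_indicator:
  assumes "A \<in> sets borel"
  shows "bp_closure trig (\<lambda>x. indicator A x)"
proof -
  have 1: "bp_closure trig (\<lambda>x. indicator {..a} x)" for a :: real
  proof (rule bp_closure.lim[where U="\<lambda>k x. of_real (max 0 (min 1 (1 - real k * (x - a))))" and C=1])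
    show "bp_closure trig (\<lambda>x. of_real (max 0 (min 1 (1 - real k * (x - a)))))" for k
      by (rule trig_continuous[where C=1]) (auto intro!: continuous_intros)
    show "(\<lambda>k. of_real (max 0 (min 1 (1 - real k * (x - a))))) \<longlonglongrightarrow> (indicator {..a} x :: complex)" for x
    proof (cases "x \<le> a")
      case True
      then have "max 0 (min 1 (1 - real k * (x - a))) = 1" for k
        by (simp add: max_def min_def mult_nonneg_nonpos not_le)
      then show ?thesis using True by simp
    next
      case False
      then have ev: "\<forall>\<^sub>F k in sequentially. max 0 (min 1 (1 - real k * (x - a))) = 0"
      proof -
        obtain n where n: "real n * (x - a) > 1" using False reals_Archimedean3[of "x-a"] by auto
        have "real k * (x - a) \<ge> 1" if "k \<ge> n" for k
          using order_trans[OF less_imp_le[OF n] mult_right_mono[of "real n" "real k" "x - a"]] that False by simp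
        then have "max 0 (min 1 (1 - real k * (x - a))) = 0" if "k \<ge> n" for k
          using that by (smt (verit, best))
        then show ?thesis unfolding eventually_sequentially by blast
      qed
      show ?thesis using False
        by (intro tendsto_eventually eventually_mono[OF ev]) auto
    qed
  qed (auto simp: max_def min_def)
  have "A \<in> sigma_sets UNIV (range (\<lambda>a::real. {..a}))"
    using assms unfolding borel_eq_atMost by simp
  then show ?thesis
  proof (rule sigma_sets_induct_disjoint[rotated 2])
    show "Int_stable (range (\<lambda>a::real. {..a}))"
      by (auto simp: Int_stable_def)
    fix A assume "bp_closure trig (\<lambda>x. indicator A x :: complex)"
    from bp_closure.lincomb[OF trig_const this, of 1 1 "-1"]
    show "bp_closure trig (\<lambda>x. indicator (UNIV - A) x :: complex)"
      by (rule back_subst[of "bp_closure trig"]) (auto simp: indicator_def)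
  next
    fix A :: "nat \<Rightarrow> real set"
    assume A: "disjoint_family A" "\<And>i. bp_closure trig (\<lambda>x. indicator (A i) x :: complex)"
    have eq: "(\<Sum>i<k. indicator (A i) x :: complex) = indicator (\<Union>i<k. A i) x" for k x
      using A(1) by (subst indicator_UN_disjoint) (auto intro: disjoint_family_on_mono)
    show "bp_closure trig (\<lambda>x. indicator (\<Union> (range A)) x :: complex)"
    proof (rule bp_closure.lim[where U="\<lambda>k x. \<Sum>i<k. indicator (A i) x" and C=1])
      show "bp_closure trig (\<lambda>x. \<Sum>i<k. indicator (A i) x :: complex)" for k
        by (rule bp_closure_sum) (use A trig_const in auto)
      show "cmod (\<Sum>i<k. indicator (A i) x) \<le> 1" for k x
        unfolding eq by (simp add: indicator_def)
      show "(\<lambda>k. \<Sum>i<k. indicator (A i) x :: complex) \<longlonglongrightarrow> indicator (\<Union> (range A)) x" for x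
        unfolding eq by (rule LIMSEQ_indicator_UN)
    qed
  qed (auto simp: 1 bp_closure_zero[OF trig_const])
qed

lemma integrable_bounded_mult:
  fixes V v :: "'a \<Rightarrow> complex"
  assumes V: "integrable K V" and v: "v \<in> borel_measurable K" "\<And>x. cmod (v x) \<le> C"
  shows "integrable K (\<lambda>x. V x * v x)"
proof (rule Bochner_Integration.integrable_bound)
  show "integrable K (\<lambda>x. C * norm (V x))" using V by auto
  show "AE x in K. norm (V x * v x) \<le> norm (C * norm (V x))"
  proof (rule AE_I2)
    fix x
    have "norm (V x * v x) \<le> C * norm (V x)"
      unfolding norm_mult by (subst mult.commute) (intro mult_right_mono v, simp)
    then show "norm (V x * v x) \<le> norm (C * norm (V x))" by simp
  qed
qed (use V v in auto)

text \<open>The integrable weights \<open>W\<close> and \<open>W'\<close> make room for densities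
  that are not positive and, in the product version below, for the factors that are held
  fixed.\<close>

lemma bp_integral_eq:
  assumes B: "\<And>u. u \<in> B \<Longrightarrow> u \<in> borel_measurable borel" "\<And>u. u \<in> B \<Longrightarrow> \<exists>C. \<forall>x. cmod (u x) \<le> C"
  assumes W: "integrable M W" "integrable N W'" "X \<in> borel_measurable M" "Y \<in> borel_measurable N"
  assumes eq: "\<And>u. u \<in> B \<Longrightarrow> (\<integral>x. W x * u (X x) \<partial>M) = (\<integral>x. W' x * u (Y x) \<partial>N)"
  assumes u: "bp_closure B u"
  shows "(\<integral>x. W x * u (X x) \<partial>M) = (\<integral>x. W' x * u (Y x) \<partial>N)"
  using u
proof (induction rule: bp_closure.induct)
  have int: "integrable K (\<lambda>x. V x * v (Z x))" if "bp_closure B v" "integrable K V" "Z \<in> borel_measurable K"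
    for v V K and Z :: "_ \<Rightarrow> real"
  proof -
    obtain C where "v \<in> borel_measurable borel" "\<And>x. cmod (v x) \<le> C"
      using bp_closure_measurable_bounded[OF B \<open>bp_closure B v\<close>] by blast
    then show ?thesis using that by (intro integrable_bounded_mult[where C=C]) auto
  qed
  {
    case (lincomb u v a b)
    have "(\<integral>x. V x * (a * u (Z x) + b * v (Z x)) \<partial>K) = a * (\<integral>x. V x * u (Z x) \<partial>K) + b * (\<integral>x. V x * v (Z x) \<partial>K)"
      if "integrable K V" "Z \<in> borel_measurable K" for K V and Z :: "_ \<Rightarrow> real"
    proof -
      have "V x * (a * u (Z x) + b * v (Z x)) = a * (V x * u (Z x)) + b * (V x * v (Z x))" for x
        by (simp add: algebra_simps)
      then show ?thesis
        using int[OF lincomb(1) that] int[OF lincomb(2) that] by simp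
    qed
    from this[OF W(1,3)] this[OF W(2,4)] show ?case by (simp only: lincomb.IH)
  next
    case (lim U C u)
    have ubp: "bp_closure B u" by (rule bp_closure.lim[OF lim(1,2,3)])
    have conv: "(\<lambda>k. \<integral>x. V x * U k (Z x) \<partial>K) \<longlonglongrightarrow> (\<integral>x. V x * u (Z x) \<partial>K)"
      if "integrable K V" "Z \<in> borel_measurable K" for K V and Z :: "_ \<Rightarrow> real"
    proof (rule integral_dominated_convergence[where w="\<lambda>x. C * norm (V x)"])
      show "AE x in K. (\<lambda>k. V x * U k (Z x)) \<longlonglongrightarrow> V x * u (Z x)"
        by (intro AE_I2 tendsto_intros lim)
      show "AE x in K. norm (V x * U k (Z x)) \<le> C * norm (V x)" for k
        using lim(2) by (intro AE_I2) (auto simp: norm_mult mult.commute[of C] intro: mult_left_mono)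
    qed (use int[OF ubp that] int[OF lim(1) that] that in auto)
    show ?case
      using conv[OF W(1,3)] conv[OF W(2,4)] unfolding lim(4) by (rule LIMSEQ_unique)
  }
qed (use eq in auto)

text \<open>Induction on the set \<open>S\<close> of coordinates whose factor is already a general
  closure element. Enlarging \<open>S\<close> by \<open>k\<close> moves only the factor at
  \<open>k\<close> through the closure, while all other factors are absorbed into the
  weights.\<close>

lemma bp_integral_prod_eq:
  assumes B: "\<And>u. u \<in> B \<Longrightarrow> u \<in> borel_measurable borel" "\<And>u. u \<in> B \<Longrightarrow> \<exists>C. \<forall>x. cmod (u x) \<le> C"
  assumes W: "integrable M W" "integrable N W'"
  assumes X: "finite I" "\<And>i. i \<in> I \<Longrightarrow> X i \<in> borel_measurable M" "\<And>i. i \<in> I \<Longrightarrow> Y i \<in> borel_measurable N"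
  assumes eq: "\<And>u. (\<And>i. i \<in> I \<Longrightarrow> u i \<in> B) \<Longrightarrow>
      (\<integral>x. W x * (\<Prod>i\<in>I. u i (X i x)) \<partial>M) = (\<integral>x. W' x * (\<Prod>i\<in>I. u i (Y i x)) \<partial>N)"
  assumes u: "\<And>i. i \<in> I \<Longrightarrow> bp_closure B (u i)"
  shows "(\<integral>x. W x * (\<Prod>i\<in>I. u i (X i x)) \<partial>M) = (\<integral>x. W' x * (\<Prod>i\<in>I. u i (Y i x)) \<partial>N)"
proof -
  have "(\<integral>x. W x * (\<Prod>i\<in>I. u i (X i x)) \<partial>M) = (\<integral>x. W' x * (\<Prod>i\<in>I. u i (Y i x)) \<partial>N)"
    if "finite S" "S \<subseteq> I" "\<And>i. i \<in> S \<Longrightarrow> bp_closure B (u i)" "\<And>i. i \<in> I - S \<Longrightarrow> u i \<in> B" for S u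
    using that
  proof (induction S arbitrary: u rule: finite_induct)
    case empty
    then show ?case using eq by auto
  next
    case (insert k S)
    have all: "bp_closure B (u i)" if "i \<in> I" for i
      using insert.prems(2)[of i] insert.prems(3)[of i] that bp_closure.base[of "u i" B] by (cases "i \<in> insert k S") auto
    have mb: "u i \<in> borel_measurable borel" "\<exists>C. \<forall>x. cmod (u i x) \<le> C" if "i \<in> I" for i
      using bp_closure_measurable_bounded[OF B all[OF that]] by auto
    have split: "W * (\<Prod>i\<in>I. f i) = (W * (\<Prod>i\<in>I - {k}. f i)) * f k" for f :: "_ \<Rightarrow> complex" and W
      using X(1) insert.prems(1) by (subst prod.remove[of I k]) (auto simp: mult_ac)
    have int: "integrable K (\<lambda>x. V x * (\<Prod>i\<in>J. u i (Z i x)))"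
      if V: "integrable K V" and J: "J \<subseteq> I" and Z: "\<And>i. i \<in> I \<Longrightarrow> Z i \<in> borel_measurable K" for V K J and Z :: "_ \<Rightarrow> _ \<Rightarrow> real"
      using finite_subset[OF J X(1)] J
    proof (induction J rule: finite_induct)
      case (insert j J)
      obtain C where C: "\<And>x. cmod (u j x) \<le> C" "u j \<in> borel_measurable borel" using mb[of j] insert by auto
      have m: "(\<lambda>x. u j (Z j x)) \<in> borel_measurable K"
        using measurable_compose[OF Z C(2)] insert by auto
      have "integrable K (\<lambda>x. (V x * (\<Prod>i\<in>J. u i (Z i x))) * u j (Z j x))"
        by (rule integrable_bounded_mult[OF _ m C(1)]) (use insert in auto)
      then show ?case using insert by (simp add: mult_ac)
    qed (use V in auto)
    have k: "k \<in> I" using insert by auto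
    have "(\<integral>x. (W x * (\<Prod>i\<in>I-{k}. u i (X i x))) * u k (X k x) \<partial>M) = (\<integral>x. (W' x * (\<Prod>i\<in>I-{k}. u i (Y i x))) * u k (Y k x) \<partial>N)"
    proof (rule bp_integral_eq[OF B])
      show "integrable M (\<lambda>x. W x * (\<Prod>i\<in>I - {k}. u i (X i x)))" by (rule int) (use W X in auto)
      show "integrable N (\<lambda>x. W' x * (\<Prod>i\<in>I - {k}. u i (Y i x)))" by (rule int) (use W X in auto)
      fix v assume v: "v \<in> B"
      have "(\<integral>x. W x * (\<Prod>i\<in>I. (u(k := v)) i (X i x)) \<partial>M) = (\<integral>x. W' x * (\<Prod>i\<in>I. (u(k := v)) i (Y i x)) \<partial>N)"
        by (rule insert.IH) (use insert v bp_closure.base in auto)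
      moreover have "(\<Prod>i\<in>I-{k}. (if i = k then v else u i) (Z i x)) = (\<Prod>i\<in>I-{k}. u i (Z i x))" for Z :: "_ \<Rightarrow> 'z \<Rightarrow> real" and x
        by (intro prod.cong) auto
      ultimately have "(\<integral>x. W x * (\<Prod>i\<in>I-{k}. u i (X i x)) * (u(k := v)) k (X k x) \<partial>M) = (\<integral>x. W' x * (\<Prod>i\<in>I-{k}. u i (Y i x)) * (u(k := v)) k (Y k x) \<partial>N)"
        unfolding split by simp
      then show "(\<integral>x. W x * (\<Prod>i\<in>I - {k}. u i (X i x)) * v (X k x) \<partial>M) = (\<integral>x. W' x * (\<Prod>i\<in>I - {k}. u i (Y i x)) * v (Y k x) \<partial>N)"
        by simp
    qed (use X k all in auto)
    then show ?case unfolding split .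
  qed
  from this[of I u] show ?thesis using X u by auto
qed

section \<open>Limits of laws of countably many variables\<close>

text \<open>For 0/1 sequences the value is a point of the Cantor set; the gaps between its pieces
  are what allows a continuous function to read off digits.\<close>

definition ternary :: "(nat \<Rightarrow> real) \<Rightarrow> real" where
  "ternary b = (\<Sum>m. 2 * b m / 3 ^ Suc m)"

lemma ternary_bounds:
  assumes b: "\<And>m. b m \<in> {0, 1}"
  shows "summable (\<lambda>m. 2 * b m / 3 ^ Suc m)" "ternary b \<in> {0..1}"
    "3 * ternary b = 2 * b 0 + ternary (\<lambda>m. b (Suc m))"
proof -
  have geo: "(\<lambda>m. 2 / 3 ^ Suc m :: real) sums 1"
    using sums_mult[OF geometric_sums[of "1/3::real"], of "2/3"] by (simp add: power_one_over field_simps)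
  have s: "summable (\<lambda>m. 2 * b m / 3 ^ Suc m)" if b: "\<And>m. b m \<in> {0, 1}" for b :: "nat \<Rightarrow> real"
  proof (rule summable_comparison_test'[OF sums_summable[OF geo]])
    show "norm (2 * b m / 3 ^ Suc m) \<le> 2 / 3 ^ Suc m" for m
      using b[of m] by auto
  qed
  show "summable (\<lambda>m. 2 * b m / 3 ^ Suc m)" by (rule s[OF b])
  have le: "2 * b m / 3 ^ Suc m \<le> 2 / 3 ^ Suc m" and ge: "0 \<le> 2 * b m / 3 ^ Suc m" for m
    using b[of m] by auto
  have "ternary b \<le> 1"
    unfolding ternary_def sums_unique[OF geo] by (rule suminf_le[OF le s[OF b] sums_summable[OF geo]])
  moreover have "0 \<le> ternary b" unfolding ternary_def by (rule suminf_nonneg[OF s[OF b] ge])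
  ultimately show "ternary b \<in> {0..1}" by simp
  have "ternary b = 2 * b 0 / 3 + (\<Sum>m. 2 * b (Suc m) / 3 ^ Suc (Suc m))"
    unfolding ternary_def using suminf_split_head[of "\<lambda>m. 2 * b m / 3 ^ Suc m", OF s] b by simp
  also have "(\<Sum>m. 2 * b (Suc m) / 3 ^ Suc (Suc m)) = (1/3) * ternary (\<lambda>m. b (Suc m))"
    unfolding ternary_def using b by (subst suminf_mult[symmetric, OF s]) auto
  finally show "3 * ternary b = 2 * b 0 + ternary (\<lambda>m. b (Suc m))" by simp
qed

text \<open>The digit reader of Schoenberg's curve: a truncated cosine of period 2 that is 0 on
  \<open>[0, 1/3]\<close> and 1 on \<open>[2/3, 1]\<close>.\<close>

definition bump :: "real \<Rightarrow> real" where
  "bump t = max 0 (min 1 (1/2 - cos (pi * t)))"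

lemma bump_ternary:
  assumes b: "\<And>m. b m \<in> {0, 1}"
  shows "bump (3 ^ k * ternary b) = b k"
  using b
proof (induction k arbitrary: b)
  case 0
  let ?r = "ternary (\<lambda>m. b (Suc m)) / 3"
  have r: "?r \<in> {0..1/3}" using ternary_bounds(2)[of "\<lambda>m. b (Suc m)"] 0 by auto
  have t: "ternary b = 2 * b 0 / 3 + ?r" using ternary_bounds(3)[of b] 0 by auto
  consider "b 0 = 0" | "b 0 = 1" using 0 by auto
  then show ?case
  proof cases
    case 1
    have "cos (pi * ?r) \<ge> cos (pi / 3)"
      using r pi_gt_zero by (intro cos_monotone_0_pi_le mult_nonneg_nonneg) (auto simp: field_simps)
    then have "cos (pi * ternary b) \<ge> 1/2" unfolding t using 1 by (simp add: cos_60)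
    then show ?thesis using 1 by (simp add: bump_def)
  next
    case 2
    have "cos (pi * (2/3 + ?r)) \<le> cos (2 * pi / 3)"
      using r pi_gt_zero by (intro cos_monotone_0_pi_le) (auto simp: field_simps)
    also have "cos (2 * pi / 3) = - 1/2" using cos_120 by simp
    finally have "cos (pi * ternary b) \<le> - 1/2" unfolding t using 2 by simp
    then show ?thesis using 2 by (simp add: bump_def)
  qed
next
  case (Suc k)
  have "3 ^ Suc k * ternary b = 3 ^ k * (3 * ternary b)" by simp
  also have "\<dots> = 3 ^ k * (2 * b 0) + 3 ^ k * ternary (\<lambda>m. b (Suc m))"
    using ternary_bounds(3)[of b] Suc.prems by (simp add: algebra_simps)
  finally have e: "3 ^ Suc k * ternary b = 3 ^ k * (2 * b 0) + 3 ^ k * ternary (\<lambda>m. b (Suc m))" .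
  \<comment> \<open>The digit split off by the shift contributes the even integer
    \<open>2 * n\<close>, which the period 2 of \<open>bump\<close> discards.\<close>
  obtain n :: nat where n: "3 ^ k * b 0 = real n"
  proof (cases "b 0 = 0")
    case False
    then show ?thesis using that[of "3 ^ k"] Suc.prems[of 0] by simp
  qed (use that[of 0] in simp)
  have "bump (3 ^ Suc k * ternary b) = bump (3 ^ k * ternary (\<lambda>m. b (Suc m)))"
  proof -
    have "pi * (3 ^ Suc k * ternary b) = pi * (3 ^ k * ternary (\<lambda>m. b (Suc m))) + real n * (2 * pi)"
      unfolding e using n by (simp add: algebra_simps)
    moreover have "cos (z + real n * (2 * pi)) = cos z" for z
      using cos.plus_of_nat[of z n] by simp
    ultimately show ?thesis unfolding bump_def by simp
  qed
  also have "\<dots> = b (Suc k)" using Suc.IH[of "\<lambda>m. b (Suc m)"] Suc.prems by simp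
  finally show ?case .
qed

lemma binary_expansion:
  assumes "y \<in> {0..1::real}"
  shows "\<exists>a :: nat \<Rightarrow> real. (\<forall>k. a k \<in> {0, 1}) \<and> (\<lambda>k. a k / 2 ^ Suc k) sums y"
proof -
  \<comment> \<open>Digit and remainder of the doubling map. The digit at 1 is 1, so 1 is a fixed
    point and \<open>y = 1\<close> gets the expansion with all digits equal to 1.\<close>
  define d where "d z = (if z \<ge> 1/2 then 1 else 0 :: real)" for z :: real
  define T where "T z = 2 * z - d z" for z
  define z where "z k = (T ^^ k) y" for k
  have z: "z k \<in> {0..1}" for k
    by (induction k) (use assms in \<open>auto simp: z_def T_def d_def\<close>)
  have zs: "z (Suc k) = 2 * z k - d (z k)" for k by (simp add: z_def T_def)
  have eq: "(\<Sum>l<k. d (z l) / 2 ^ Suc l) = y - z k / 2 ^ k" for k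
    by (induction k) (auto simp: zs field_simps, simp add: z_def)
  have "(\<lambda>k. z k / 2 ^ k) \<longlonglongrightarrow> 0"
  proof (rule Lim_null_comparison)
    show "\<forall>\<^sub>F k in sequentially. norm (z k / 2 ^ k) \<le> (1/2) ^ k"
      using z by (intro always_eventually) (auto simp: field_simps power_one_over)
    show "(\<lambda>k. (1/2::real) ^ k) \<longlonglongrightarrow> 0" by (rule LIMSEQ_realpow_zero) auto
  qed
  then have "(\<lambda>k. d (z k) / 2 ^ Suc k) sums y"
    unfolding sums_def eq using tendsto_diff[OF tendsto_const, of "\<lambda>k. z k / 2 ^ k" 0 sequentially y] by simp
  then show ?thesis by (intro exI[of _ "\<lambda>k. d (z k)"]) (simp add: d_def)
qed

text \<open>Schoenberg's space-filling curve: \<open>bump\<close> reads off ternary digits of \<open>s\<close>, and the digits are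
  distributed over the coordinates as binary digits by a pairing function.\<close>

lemma space_filling:
  "\<exists>g :: nat \<Rightarrow> real \<Rightarrow> real. (\<forall>j. continuous_on UNIV (g j)) \<and> (\<forall>j s. g j s \<in> {0..1}) \<and>
    (\<forall>y. (\<forall>j. y j \<in> {0..1}) \<longrightarrow> (\<exists>s\<in>{0..1}. \<forall>j. g j s = y j))"
proof -
  have geo: "(\<lambda>m. 1 / 2 ^ Suc m :: real) sums 1"
    using power_half_series by (simp add: power_one_over field_simps)
  have bb: "0 \<le> bump t" "bump t \<le> 1" for t by (auto simp: bump_def)
  define f where "f j m s = bump (3 ^ prod_encode (j, m) * s) / 2 ^ Suc m" for j m and s :: real
  have f: "norm (f j m s) \<le> 1 / 2 ^ Suc m" "0 \<le> f j m s" for j m s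
    using bb[of "3 ^ prod_encode (j, m) * s"] by (simp_all add: f_def divide_right_mono del: power_Suc)
  have sf: "summable (\<lambda>m. f j m s)" for j s
    by (rule summable_comparison_test'[OF sums_summable[OF geo]]) (use f in auto)
  define g where "g j s = (\<Sum>m. f j m s)" for j s
  show ?thesis
  proof (intro exI[of _ g] conjI allI impI)
    fix j
    have ul: "uniform_limit UNIV (\<lambda>n s. \<Sum>m<n. f j m s) (\<lambda>s. \<Sum>m. f j m s) sequentially"
      by (rule Weierstrass_m_test[OF f(1) sums_summable[OF geo]])
    have fc: "continuous_on UNIV (\<lambda>s. f j m s)" for m
      unfolding f_def bump_def by (intro continuous_intros) simp
    have sc: "continuous_on UNIV (\<lambda>s. \<Sum>m<n. f j m s)" for n
      by (rule continuous_on_sum) (rule fc)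
    show "continuous_on UNIV (g j)"
      unfolding g_def
      by (rule uniform_limit_theorem[OF always_eventually[OF allI[OF sc]] ul]) simp
    show "g j s \<in> {0..1}" for s
    proof -
      have "f j m s \<le> 1 / 2 ^ Suc m" for m
        by (rule order_trans[OF abs_ge_self f(1)[unfolded real_norm_def]])
      then have "g j s \<le> (\<Sum>m. 1 / 2 ^ Suc m)"
        unfolding g_def by (rule suminf_le[OF _ sf sums_summable[OF geo]])
      then have "g j s \<le> 1" by (simp only: sums_unique[OF geo, symmetric])
      moreover have "g j s \<ge> 0" unfolding g_def by (rule suminf_nonneg[OF sf f(2)])
      ultimately show ?thesis by simp
    qed
  next
    fix y :: "nat \<Rightarrow> real" assume y: "\<forall>j. y j \<in> {0..1}"
    have "\<forall>j. \<exists>a. (\<forall>k. a k \<in> {0, 1}) \<and> (\<lambda>k. a k / 2 ^ Suc k) sums y j"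
    proof
      fix j
      show "\<exists>a. (\<forall>k. a k \<in> {0, 1}) \<and> (\<lambda>k. a k / 2 ^ Suc k) sums y j"
        by (rule binary_expansion[OF y[rule_format]])
    qed
    from choice[OF this] obtain a :: "nat \<Rightarrow> nat \<Rightarrow> real"
      where a0: "\<forall>j. (\<forall>k. a j k \<in> {0, 1}) \<and> (\<lambda>k. a j k / 2 ^ Suc k) sums y j" ..
    have a: "a j k \<in> {0, 1}" "(\<lambda>k. a j k / 2 ^ Suc k) sums y j" for j k
      using a0[rule_format, of j] by simp_all
    define b where "b n = (case prod_decode n of (j, k) \<Rightarrow> a j k)" for n
    have b: "b n \<in> {0, 1}" for n using a(1) by (auto simp: b_def split: prod.split)
    have "g j (ternary b) = y j" for j
      unfolding g_def f_def bump_ternary[OF b] using sums_unique[OF a(2)[of j]] by (simp add: b_def)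
    then show "\<exists>s\<in>{0..1}. \<forall>j. g j s = y j" by (intro bexI[OF _ ternary_bounds(2)[OF b]] allI)
  qed
qed

section \<open>Tightness and convergent subsequences of laws on a countable product\<close>

lemma real_distribution_distr_pmf: "real_distribution (distr (measure_pmf p) borel f)"
  by (simp add: real_distribution_def real_distribution_axioms_def prob_space.prob_space_distr prob_space_measure_pmf)

text \<open>Transporting by the curve turns laws on a countable product into laws on the unit interval,
  to which Helly's theorem applies.\<close>

lemma pmf_subseq_limit:
  fixes p :: "nat \<Rightarrow> 'a pmf" and X :: "nat \<Rightarrow> nat \<Rightarrow> 'a \<Rightarrow> real"
  assumes tight: "\<And>j \<epsilon>. \<epsilon> > 0 \<Longrightarrow> \<exists>R>0. \<forall>\<^sub>F k in sequentially. measure (p k) {\<omega>. \<bar>X k j \<omega>\<bar> \<ge> R} \<le> \<epsilon>"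
  obtains \<nu> :: "real measure" and Z :: "nat \<Rightarrow> real \<Rightarrow> real" and r :: "nat \<Rightarrow> nat"
  where "real_distribution \<nu>" "strict_mono r" "\<And>j. Z j \<in> borel_measurable borel"
    "\<And>n t. (\<lambda>k. \<integral>\<omega>. cis (\<Sum>j<n. t j * X (r k) j \<omega>) \<partial>p (r k)) \<longlonglongrightarrow> (\<integral>s. cis (\<Sum>j<n::nat. t j * Z j s) \<partial>\<nu>)"
proof -
  from space_filling obtain g :: "nat \<Rightarrow> real \<Rightarrow> real" where
    g0: "(\<forall>j. continuous_on UNIV (g j)) \<and> (\<forall>j s. g j s \<in> {0..1}) \<and>
      (\<forall>y. (\<forall>j. y j \<in> {0..1}) \<longrightarrow> (\<exists>s\<in>{0..1}. \<forall>j. g j s = y j))" ..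
  note g = g0[THEN conjunct1, rule_format] g0[THEN conjunct2, THEN conjunct1, rule_format]
    and g3 = g0[THEN conjunct2, THEN conjunct2, rule_format]
  \<comment> \<open>A homeomorphism of the line onto the open unit interval, so that all values of
    \<open>X\<close> become admissible coordinates of the curve.\<close>
  define h where "h x = 1/2 + arctan x / pi" for x
  have h: "h x \<in> {0..1}" for x
  proof -
    have "arctan x / pi \<le> 1/2" "arctan x / pi \<ge> -(1/2)"
      using arctan_lbound[of x] arctan_ubound[of x] by (simp_all add: pos_divide_le_eq pos_le_divide_eq)
    then show ?thesis unfolding h_def atLeastAtMost_iff by linarith
  qed
  have ex: "\<exists>s. s \<in> {0..1} \<and> (\<forall>j. g j s = h (X k j \<omega>))" for k \<omega>
    by (rule g3[where y="\<lambda>j. h (X k j \<omega>)", unfolded Bex_def]) (rule h)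
  \<comment> \<open>An arbitrary choice of a curve parameter for each outcome; measurability is
    automatic because every set is measurable for \<open>measure_pmf\<close>.\<close>
  define enc where "enc k \<omega> = (SOME s. s \<in> {0..1} \<and> (\<forall>j. g j s = h (X k j \<omega>)))" for k \<omega>
  have enc0: "enc k \<omega> \<in> {0..1} \<and> (\<forall>j. g j (enc k \<omega>) = h (X k j \<omega>))" for k \<omega>
    unfolding enc_def by (rule someI_ex[OF ex])
  note enc = enc0[THEN conjunct1] enc0[THEN conjunct2, rule_format]
  define \<nu>s where "\<nu>s k = distr (p k) borel (enc k)" for k
  have rd: "real_distribution (\<nu>s k)" for k unfolding \<nu>s_def by (rule real_distribution_distr_pmf)
  have "tight \<nu>s"
    unfolding tight_def
  proof (intro conjI allI impI rd)
    fix \<epsilon> :: real assume "\<epsilon> > 0"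
    have "measure (\<nu>s k) {-1<..1} = 1" for k
    proof -
      have "enc k -` {-1<..1} = UNIV"
      proof -
        have "enc k \<omega> \<in> {-1<..1}" for \<omega> using enc(1)[of k \<omega>] by simp
        then show ?thesis by blast
      qed
      then show ?thesis unfolding \<nu>s_def by (subst measure_distr) simp_all
    qed
    then show "\<exists>a b. a < b \<and> (\<forall>n. 1 - \<epsilon> < measure (\<nu>s n) {a<..b})"
      using \<open>\<epsilon> > 0\<close> by (intro exI[of _ "-1"] exI[of _ 1] conjI allI) simp_all
  qed
  from tight_imp_convergent_subsubsequence[OF this strict_mono_id]
  obtain r \<nu> where r: "strict_mono r" and \<nu>: "real_distribution \<nu>" and "weak_conv_m (\<nu>s \<circ> id \<circ> r) \<nu>"
    by blast
  then have wc: "weak_conv_m (\<lambda>k. \<nu>s (r k)) \<nu>" by (simp add: comp_def)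
  interpret \<nu>: real_distribution \<nu> by (rule \<nu>)
  have conv: "(\<lambda>k. \<integral>\<omega>. F (enc (r k) \<omega>) \<partial>p (r k)) \<longlonglongrightarrow> (\<integral>s. F s \<partial>\<nu>)"
    if F: "continuous_on UNIV F" "\<And>s. norm (F s) \<le> B" for F :: "real \<Rightarrow> 'b::{banach, second_countable_topology}" and B
  proof -
    have "(\<lambda>k. integral\<^sup>L (\<nu>s (r k)) F) \<longlonglongrightarrow> integral\<^sup>L \<nu> F"
    proof (rule weak_conv_imp_integral_bdd_continuous_conv[OF rd \<nu> wc])
      show "isCont F x" for x using F(1) by (simp add: continuous_on_eq_continuous_at)
    qed (rule F(2))
    moreover have "F \<in> borel_measurable borel" using F(1) by (rule borel_measurable_continuous_onI)
    then have "integral\<^sup>L (\<nu>s k) F = (\<integral>\<omega>. F (enc k \<omega>) \<partial>p k)" for k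
      unfolding \<nu>s_def by (subst integral_distr) simp_all
    ultimately show ?thesis by simp
  qed
  \<comment> \<open>The decoding \<open>Z j = tan (\<theta> j)\<close> inverts \<open>h\<close>
    along the curve. It may be discontinuous where \<open>g j\<close> is 0 or 1, that is, where mass
    would have escaped to infinity, so weak convergence cannot be applied to it directly.\<close>
  define \<theta> where "\<theta> j s = pi * (g j s - 1/2)" for j s
  have \<theta>_enc: "\<theta> j (enc k \<omega>) = arctan (X k j \<omega>)" for j k \<omega>
    by (simp add: \<theta>_def enc h_def)
  have \<theta>_cont: "continuous_on UNIV (\<theta> j)" for j
    unfolding \<theta>_def using g(1) by (intro continuous_intros)
  define Z where "Z j s = tan (\<theta> j s)" for j s
  \<comment> \<open>Clipping the angle keeps \<open>tan\<close> away from its poles, which makes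
    \<open>F\<close> below continuous.\<close>
  define cl where "cl R x = max (- arctan R) (min (arctan R) x)" for R x
  have cl: "\<bar>cl R x\<bar> < pi / 2" if "R > 0" for R x
  proof -
    have "0 < arctan R" "arctan R < pi / 2" using that arctan_ubound by simp_all
    then show ?thesis unfolding cl_def abs_less_iff by linarith
  qed
  have cl_id: "cl R x = x" if "\<bar>x\<bar> \<le> arctan R" for R x
    using that unfolding cl_def by linarith
  have [measurable]: "\<theta> j \<in> borel_measurable borel" for j
    using \<theta>_cont by (rule borel_measurable_continuous_onI)
  have Zm[measurable]: "Z j \<in> borel_measurable borel" for j
    unfolding Z_def tan_def by (intro borel_measurable_divide measurable_compose[OF _ borel_measurable_sin] measurable_compose[OF _ borel_measurable_cos]) simp_all
  have main: "(\<lambda>k. \<integral>\<omega>. cis (\<Sum>j<n. t j * X (r k) j \<omega>) \<partial>p (r k)) \<longlonglongrightarrow> (\<integral>s. cis (\<Sum>j<n. t j * Z j s) \<partial>\<nu>)" for n t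
  proof (rule LIMSEQ_I)
    fix e :: real assume e: "e > 0"
    \<comment> \<open>Five equal shares: each of the two cutoff errors is at most
      \<open>2 * n * \<epsilon>\<close>, below two fifths of \<open>e\<close>, and the last fifth is
      left to weak convergence.\<close>
    define \<epsilon> where "\<epsilon> = e / (5 * (real n + 1))"
    have \<epsilon>: "\<epsilon> > 0" using e by (simp add: \<epsilon>_def)
    have ex: "\<exists>R. R > 0 \<and> (\<forall>\<^sub>F k in sequentially. measure (p k) {\<omega>. \<bar>X k j \<omega>\<bar> \<ge> R} \<le> \<epsilon>)" for j
      by (rule tight[OF \<epsilon>])
    define R where "R j = (SOME R. R > 0 \<and> (\<forall>\<^sub>F k in sequentially. measure (p k) {\<omega>. \<bar>X k j \<omega>\<bar> \<ge> R} \<le> \<epsilon>))" for j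
    have R0: "R j > 0 \<and> (\<forall>\<^sub>F k in sequentially. measure (p k) {\<omega>. \<bar>X k j \<omega>\<bar> \<ge> R j} \<le> \<epsilon>)" for j
      unfolding R_def by (rule someI_ex[OF ex])
    note R = R0[THEN conjunct1] R0[THEN conjunct2]
    define S where "S j = R j + 1" for j
    have RS: "0 < arctan (R j)" "arctan (R j) < arctan (S j)" "S j > 0" for j
      using R(1)[of j] by (auto simp: S_def arctan_less_iff)
    \<comment> \<open>A continuous stand-in for the indicator of large angles: 0 up to
      \<open>arctan (R j)\<close> and 1 beyond \<open>arctan (S j)\<close>. Continuity lets the tail
      bounds for the \<open>p k\<close> pass to \<nu>.\<close>
    define \<kappa> where "\<kappa> j s = max 0 (min 1 ((\<bar>\<theta> j s\<bar> - arctan (R j)) / (arctan (S j) - arctan (R j))))" for j s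
    have \<kappa>01: "0 \<le> \<kappa> j s" "\<kappa> j s \<le> 1" for j s by (auto simp: \<kappa>_def)
    have \<kappa>1: "\<kappa> j s = 1" if "\<bar>\<theta> j s\<bar> > arctan (S j)" for j s
      using that RS[of j] by (auto simp: \<kappa>_def field_simps)
    have \<kappa>0: "\<kappa> j s = 0" if "\<bar>\<theta> j s\<bar> \<le> arctan (R j)" for j s
      using that RS[of j] by (auto simp: \<kappa>_def divide_nonpos_pos)
    have \<kappa>c: "continuous_on UNIV (\<kappa> j)" for j
      unfolding \<kappa>_def using RS[of j] by (intro continuous_intros \<theta>_cont) auto
    have [measurable]: "\<kappa> j \<in> borel_measurable borel" for j
      using \<kappa>c by (rule borel_measurable_continuous_onI)
    have arctan_abs: "\<bar>arctan x\<bar> = arctan \<bar>x\<bar>" for x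
      by (auto simp: abs_if arctan_minus)
    have Xk: "(\<integral>\<omega>. \<kappa> j (enc k \<omega>) \<partial>p k) \<le> measure (p k) {\<omega>. \<bar>X k j \<omega>\<bar> \<ge> R j}" for k j
    proof -
      have "(\<integral>\<omega>. \<kappa> j (enc k \<omega>) \<partial>p k) \<le> (\<integral>\<omega>. indicator {\<omega>. \<bar>X k j \<omega>\<bar> \<ge> R j} \<omega> \<partial>p k)"
      proof (rule integral_mono)
        show "integrable (p k) (\<lambda>\<omega>. \<kappa> j (enc k \<omega>))"
          by (rule measure_pmf.integrable_const_bound[where B=1]) (use \<kappa>01 in auto)
        show "\<kappa> j (enc k \<omega>) \<le> indicator {\<omega>. \<bar>X k j \<omega>\<bar> \<ge> R j} \<omega>" for \<omega>
          using \<kappa>0[of j "enc k \<omega>"] \<kappa>01[of j] by (auto simp: indicator_def \<theta>_enc arctan_abs arctan_le_iff)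
      qed (auto intro: measure_pmf.integrable_const_bound[where B=1])
      then show ?thesis by simp
    qed
    define K where "K s = (\<Sum>j<n. \<kappa> j s)" for s
    have Kc: "continuous_on UNIV K" unfolding K_def by (intro continuous_intros \<kappa>c)
    have K0: "0 \<le> K s" "K s \<le> real n" for s
      using \<kappa>01 sum_mono[of "{..<n}" "\<lambda>j. \<kappa> j s" "\<lambda>_. 1"] by (auto simp: K_def intro: sum_nonneg)
    have K1: "K s \<ge> 1" if "j < n" "\<bar>\<theta> j s\<bar> > arctan (S j)" for s j
      using \<kappa>1[OF that(2)] member_le_sum[of j "{..<n}" "\<lambda>j. \<kappa> j s"] \<kappa>01 that(1) by (auto simp: K_def)
    have Kint: "integrable (p k) (\<lambda>\<omega>. K (enc k \<omega>))" for k
      by (rule measure_pmf.integrable_const_bound[where B="real n"]) (use K0 in auto)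
    have [measurable]: "K \<in> borel_measurable borel" using Kc by (rule borel_measurable_continuous_onI)
    have Kint\<nu>: "integrable \<nu> K"
      by (rule \<nu>.integrable_const_bound[where B="real n"]) (use K0 in auto)
    define F where "F s = cis (\<Sum>j<n. t j * tan (cl (S j) (\<theta> j s)))" for s
    have Fc: "continuous_on UNIV F"
    proof -
      have c: "cos (cl (S j) x) \<noteq> 0" for j x
      proof -
        have "- (pi / 2) < cl (S j) x" "cl (S j) x < pi / 2" using cl[OF RS(3)[of j], of x] unfolding abs_less_iff by linarith+
        then show ?thesis using cos_gt_zero_pi[of "cl (S j) x"] by simp
      qed
      have "continuous_on UNIV (\<lambda>s. cl (S j) (\<theta> j s))" for j
        unfolding cl_def by (intro continuous_intros \<theta>_cont)
      then have tc: "continuous_on UNIV (\<lambda>s. tan (cl (S j) (\<theta> j s)))" for j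
        unfolding continuous_on_def using c by (intro ballI tendsto_tan) (auto simp: continuous_on_def)
      show ?thesis unfolding F_def cis_conv_exp
        by (intro continuous_on_exp continuous_on_mult continuous_on_of_real continuous_on_sum continuous_on_const tc)
    qed
    have [measurable]: "F \<in> borel_measurable borel" using Fc by (rule borel_measurable_continuous_onI)
    have Fint: "integrable (p k) (\<lambda>\<omega>. F (enc k \<omega>))" for k
      by (rule measure_pmf.integrable_const_bound[where B=1]) (auto simp: F_def)
    \<comment> \<open>Both exponentials have modulus 1, and they differ only if some angle exceeds
      its clipping level, where \<open>K\<close> is at least 1.\<close>
    have cut: "cmod (cis (\<Sum>j<n. t j * Z j s) - F s) \<le> 2 * K s" for s
    proof (cases "\<exists>j<n. \<bar>\<theta> j s\<bar> > arctan (S j)")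
      case True
      then have "2 * K s \<ge> 2" using K1[of _ s] by (elim exE conjE) simp
      moreover have "cmod (cis (\<Sum>j<n. t j * Z j s) - F s) \<le> 2"
        using norm_triangle_ineq4[of "cis (\<Sum>j<n. t j * Z j s)" "F s"] by (simp add: F_def)
      ultimately show ?thesis by linarith
    next
      case False
      have "cl (S j) (\<theta> j s) = \<theta> j s" if "j < n" for j
        by (rule cl_id, rule leI) (use False that in blast)
      then have "F s = cis (\<Sum>j<n. t j * Z j s)"
        unfolding F_def Z_def by (intro arg_cong[where f=cis] sum.cong) simp_all
      then show ?thesis using K0 by simp
    qed
    have d1: "cmod ((\<integral>\<omega>. cis (\<Sum>j<n. t j * X k j \<omega>) \<partial>p k) - (\<integral>\<omega>. F (enc k \<omega>) \<partial>p k)) \<le> 2 * (\<integral>\<omega>. K (enc k \<omega>) \<partial>p k)" for k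
    proof -
      have X: "cis (\<Sum>j<n. t j * X k j \<omega>) = cis (\<Sum>j<n. t j * Z j (enc k \<omega>))" for \<omega>
        by (simp add: Z_def \<theta>_enc tan_arctan)
      have i: "integrable (p k) (\<lambda>\<omega>. cis (\<Sum>j<n. t j * X k j \<omega>))"
        by (rule measure_pmf.integrable_const_bound[where B=1]) auto
      have "cmod ((\<integral>\<omega>. cis (\<Sum>j<n. t j * X k j \<omega>) \<partial>p k) - (\<integral>\<omega>. F (enc k \<omega>) \<partial>p k))
        = cmod (\<integral>\<omega>. cis (\<Sum>j<n. t j * X k j \<omega>) - F (enc k \<omega>) \<partial>p k)"
        by (subst Bochner_Integration.integral_diff[OF i Fint]) simp
      also have "\<dots> \<le> (\<integral>\<omega>. 2 * K (enc k \<omega>) \<partial>p k)"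
        by (rule order_trans[OF integral_norm_bound integral_mono]) (use Kint i Fint in \<open>simp_all add: X cut\<close>)
      finally show ?thesis by simp
    qed
    have d2: "cmod ((\<integral>s. cis (\<Sum>j<n. t j * Z j s) \<partial>\<nu>) - (\<integral>s. F s \<partial>\<nu>)) \<le> 2 * (\<integral>s. K s \<partial>\<nu>)"
    proof -
      have i: "integrable \<nu> (\<lambda>s. cis (\<Sum>j<n. t j * Z j s))"
        by (rule \<nu>.integrable_const_bound[where B=1]) (auto simp: cis_conv_exp)
      have i2: "integrable \<nu> F"
        by (rule \<nu>.integrable_const_bound[where B=1]) (auto simp: F_def)
      have "cmod ((\<integral>s. cis (\<Sum>j<n. t j * Z j s) \<partial>\<nu>) - (\<integral>s. F s \<partial>\<nu>)) = cmod (\<integral>s. cis (\<Sum>j<n. t j * Z j s) - F s \<partial>\<nu>)"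
        by (subst Bochner_Integration.integral_diff[OF i i2]) simp
      also have "\<dots> \<le> (\<integral>s. 2 * K s \<partial>\<nu>)"
        by (rule order_trans[OF integral_norm_bound integral_mono]) (use Kint\<nu> i i2 in \<open>simp_all add: cut\<close>)
      finally show ?thesis by simp
    qed
    have evK: "\<forall>\<^sub>F k in sequentially. (\<integral>\<omega>. K (enc k \<omega>) \<partial>p k) \<le> real n * \<epsilon>"
    proof -
      have "\<forall>\<^sub>F k in sequentially. \<forall>j\<in>{..<n}. measure (p k) {\<omega>. \<bar>X k j \<omega>\<bar> \<ge> R j} \<le> \<epsilon>"
        by (intro eventually_ball_finite) (use R(2) in auto)
      then show ?thesis
      proof eventually_elim
        case (elim k)
        have "(\<integral>\<omega>. K (enc k \<omega>) \<partial>p k) = (\<Sum>j<n. \<integral>\<omega>. \<kappa> j (enc k \<omega>) \<partial>p k)"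
          unfolding K_def
          by (intro Bochner_Integration.integral_sum measure_pmf.integrable_const_bound[where B=1]) (use \<kappa>01 in auto)
        also have "\<dots> \<le> (\<Sum>j<n. \<epsilon>)"
          by (intro sum_mono order_trans[OF Xk]) (use elim in auto)
        finally show ?case by simp
      qed
    qed
    have n\<epsilon>: "real n * \<epsilon> < e / 5"
      using e by (simp add: \<epsilon>_def field_simps)
    have evKr: "\<forall>\<^sub>F k in sequentially. (\<integral>\<omega>. K (enc (r k) \<omega>) \<partial>p (r k)) \<le> real n * \<epsilon>"
      by (rule eventually_compose_filterlim[OF evK filterlim_subseq[OF r]])
    have K\<nu>: "(\<integral>s. K s \<partial>\<nu>) \<le> real n * \<epsilon>"
      by (rule tendsto_upperbound[OF conv[OF Kc, of "real n"] evKr]) (use K0 in auto)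
    have "(\<lambda>k. \<integral>\<omega>. F (enc (r k) \<omega>) \<partial>p (r k)) \<longlonglongrightarrow> (\<integral>s. F s \<partial>\<nu>)"
      by (rule conv[OF Fc, of 1]) (auto simp: F_def)
    then have "\<forall>\<^sub>F k in sequentially. dist (\<integral>\<omega>. F (enc (r k) \<omega>) \<partial>p (r k)) (\<integral>s. F s \<partial>\<nu>) < e / 5"
      by (rule tendstoD) (use e in auto)
    with evKr have "\<forall>\<^sub>F k in sequentially. norm ((\<integral>\<omega>. cis (\<Sum>j<n. t j * X (r k) j \<omega>) \<partial>p (r k)) - (\<integral>s. cis (\<Sum>j<n. t j * Z j s) \<partial>\<nu>)) < e"
    proof eventually_elim
      case (elim k)
      let ?a = "\<integral>\<omega>. cis (\<Sum>j<n. t j * X (r k) j \<omega>) \<partial>p (r k)"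
      let ?b = "\<integral>\<omega>. F (enc (r k) \<omega>) \<partial>p (r k)"
      let ?c = "\<integral>s. F s \<partial>\<nu>"
      let ?d = "\<integral>s. cis (\<Sum>j<n. t j * Z j s) \<partial>\<nu>"
      have "cmod (?a - ?b) < 2 * (e/5)" using d1[of "r k"] elim n\<epsilon> by linarith
      moreover have "cmod (?b - ?c) < e / 5" using elim by (simp add: dist_norm)
      moreover have "cmod (?c - ?d) < 2 * (e/5)" using d2 K\<nu> n\<epsilon> by (simp add: norm_minus_commute)
      moreover have "cmod (?a - ?d) \<le> cmod (?a - ?b) + cmod (?b - ?c) + cmod (?c - ?d)"
        using norm_triangle_ineq[of "?a - ?b" "?b - ?c"] norm_triangle_ineq[of "?a - ?c" "?c - ?d"] by simp
      ultimately show ?case by linarith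
    qed
    then show "\<exists>no. \<forall>k\<ge>no. norm ((\<integral>\<omega>. cis (\<Sum>j<n. t j * X (r k) j \<omega>) \<partial>p (r k)) - (\<integral>s. cis (\<Sum>j<n. t j * Z j s) \<partial>\<nu>)) < e"
      by (simp add: eventually_sequentially)
  qed
  show ?thesis by (rule that[OF \<nu> r Zm main])
qed

section \<open>Bochner's theorem for countably many variables\<close>

lemma sum_cis_roots:
  fixes d :: int and L :: nat
  assumes L: "L > 0" and d: "\<bar>d\<bar> < int L"
  shows "(\<Sum>y<L. cis (2 * pi * of_int d * real y / real L)) = (if d = 0 then of_nat L else 0)"
proof (cases "d = 0")
  case False
  define z where "z = cis (2 * pi * of_int d / real L)"
  have "z \<noteq> 1"
  proof
    assume "z = 1"
    then have "cos (2 * pi * of_int d / real L) = 1" by (simp add: z_def complex_eq_iff)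
    then obtain n :: int where n: "2 * pi * of_int d / real L = of_int n * 2 * pi"
      unfolding cos_one_2pi_int by blast
    have "2 * pi * of_int d = (2 * pi) * (of_int n * real L)"
      using n L by (simp add: field_simps)
    then have "real_of_int d = of_int n * real L" using pi_gt_zero by simp
    then have dn: "d = n * int L" by (metis of_int_eq_iff of_int_mult of_int_of_nat_eq)
    then have "n \<noteq> 0" using False by auto
    then have "\<bar>n\<bar> * int L \<ge> 1 * int L" by (intro mult_right_mono) auto
    then show False using d dn by (simp add: abs_mult)
  qed
  moreover have "z ^ L = 1"
  proof -
    have "z ^ L = cis (real L * (2 * pi * of_int d / real L))" unfolding z_def by (rule Complex.DeMoivre)
    also have "real L * (2 * pi * of_int d / real L) = 2 * pi * of_int d" using L by simp
    also have "cis (2 * pi * of_int d) = 1" by (rule cis_multiple_2pi) auto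
    finally show ?thesis .
  qed
  ultimately have "(\<Sum>y<L. z ^ y) = 0" by (simp add: geometric_sum)
  moreover have "z ^ y = cis (2 * pi * of_int d * real y / real L)" for y
    by (simp add: z_def Complex.DeMoivre algebra_simps)
  ultimately show ?thesis using False by simp
qed simp

text \<open>Divided by \<open>N\<close>, the number of pairs with difference \<open>m\<close> is the
  Fejer factor \<open>1 - |m| / N\<close>.\<close>

lemma count_differences:
  fixes m :: int and N :: nat
  assumes "\<bar>m\<bar> < int N"
  shows "(\<Sum>u<N. \<Sum>v<N. if m - int u + int v = 0 then (1::real) else 0) = real N - \<bar>of_int m\<bar>"
proof -
  have 1: "(\<Sum>v<N. if m - int u + int v = 0 then (1::real) else 0) = (if m \<le> int u \<and> int u < int N + m then 1 else 0)" for u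
  proof -
    have "{v. v < N \<and> m - int u + int v = 0} = (if m \<le> int u \<and> int u < int N + m then {nat (int u - m)} else {})"
      by auto
    then have "card {v. v < N \<and> m - int u + int v = 0} = (if m \<le> int u \<and> int u < int N + m then 1 else 0)" by simp
    then show ?thesis by (simp add: sum.If_cases Int_def lessThan_def)
  qed
  have "{u. u < N \<and> m \<le> int u \<and> int u < int N + m} = {nat m..<nat (min (int N) (int N + m))}"
    by auto
  then have "real (card {u. u < N \<and> m \<le> int u \<and> int u < int N + m}) = real N - \<bar>of_int m\<bar>"
    using assms by (auto simp: of_nat_diff min_def nat_le_iff)
  then show ?thesis unfolding 1 by (simp add: sum.If_cases Int_def lessThan_def)
qed

text \<open>Positive definiteness, applied to a box of grid points with values of a character as
  coefficients, says that the Fejer means \<open>S x\<close> are nonnegative. Normalised, they are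
  the weights of a finitely supported law, and orthogonality of characters returns \<psi> on the
  grid, damped by the Fejer factors.\<close>

lemma fejer_pmf:
  fixes \<psi> :: "(nat \<Rightarrow> real) \<Rightarrow> complex" and k N :: nat and M :: real
  assumes pd: "\<And>(I :: (nat \<Rightarrow> nat) set) a c. finite I \<Longrightarrow> (\<And>i j. i \<in> I \<Longrightarrow> j \<ge> k \<Longrightarrow> a i j = 0) \<Longrightarrow>
      Im (\<Sum>i\<in>I. \<Sum>l\<in>I. cnj (c i) * \<psi> (\<lambda>j. a i j - a l j) * c l) = 0 \<and>
      Re (\<Sum>i\<in>I. \<Sum>l\<in>I. cnj (c i) * \<psi> (\<lambda>j. a i j - a l j) * c l) \<ge> 0"
    and one: "\<psi> (\<lambda>_. 0) = 1" and N: "N > 0" and M: "M > 0"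
  shows "\<exists>(p :: (nat \<Rightarrow> nat) pmf) (X :: nat \<Rightarrow> (nat \<Rightarrow> nat) \<Rightarrow> real).
    (\<forall>j x. \<bar>X j x\<bar> \<le> pi * M) \<and>
    (\<forall>m :: nat \<Rightarrow> int. (\<forall>j<k. \<bar>m j\<bar> < int N) \<longrightarrow> (\<forall>j\<ge>k. m j = 0) \<longrightarrow>
      (\<integral>x. cis (\<Sum>j<k. (of_int (m j) / M) * X j x) \<partial>p) =
        \<psi> (\<lambda>j. of_int (m j) / M) * (\<Prod>j<k. of_real (1 - \<bar>of_int (m j)\<bar> / real N)))"
proof -
  \<comment> \<open>With \<open>|m j| < N\<close> and \<open>a j, b j < N\<close>, all frequencies
    \<open>m j - a j + b j\<close> lie strictly between \<open>-L\<close> and \<open>L\<close>, so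
    only the zero frequency survives the sum over \<open>L\<close> points.\<close>
  define L where "L = 2 * N"
  have L: "L > 0" using N by (simp add: L_def)
  define T where "T = PiE {..<k} (\<lambda>_. {..<N})"
  define \<Omega> where "\<Omega> = PiE {..<k} (\<lambda>_. {..<L})"
  have fin: "finite T" "finite \<Omega>" by (auto simp: T_def \<Omega>_def intro!: finite_PiE)
  define e :: "(nat \<Rightarrow> int) \<Rightarrow> (nat \<Rightarrow> nat) \<Rightarrow> complex"
    where "e d x = (\<Prod>j<k. cis (2 * pi * of_int (d j) * real (x j) / real L))" for d x
  define \<iota> where "\<iota> a j = (if j < k then real (a j) / M else 0)" for a :: "nat \<Rightarrow> nat" and j
  define S where "S x = (\<Sum>a\<in>T. \<Sum>b\<in>T. cnj (e (\<lambda>j. int (a j)) x) * \<psi> (\<lambda>j. \<iota> a j - \<iota> b j) * e (\<lambda>j. int (b j)) x)" for x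
  have S: "Im (S x) = 0" "Re (S x) \<ge> 0" for x
    using pd[OF fin(1), of \<iota> "\<lambda>a. e (\<lambda>j. int (a j)) x"] by (simp_all add: S_def \<iota>_def)
  have e_mult: "cnj (e (\<lambda>j. int (a j)) x) * z * e (\<lambda>j. int (b j)) x * e m x = z * e (\<lambda>j. m j - int (a j) + int (b j)) x" for a b m x z
  proof -
    have "cnj (cis (2 * pi * of_int (int (a j)) * real (x j) / real L)) * cis (2 * pi * of_int (int (b j)) * real (x j) / real L)
        * cis (2 * pi * of_int (m j) * real (x j) / real L) = cis (2 * pi * of_int (m j - int (a j) + int (b j)) * real (x j) / real L)" for j
      by (simp add: cis_cnj cis_mult algebra_simps diff_divide_distrib add_divide_distrib)
    then have "cnj (e (\<lambda>j. int (a j)) x) * e (\<lambda>j. int (b j)) x * e m x = e (\<lambda>j. m j - int (a j) + int (b j)) x"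
      unfolding e_def cnj_prod prod.distrib[symmetric] by simp
    then show ?thesis by (simp add: mult_ac)
  qed
  have key: "(\<Sum>x\<in>\<Omega>. S x * e m x) = of_real ((real L * real N) ^ k) * (\<psi> (\<lambda>j. of_int (m j) / M) * (\<Prod>j<k. of_real (1 - \<bar>of_int (m j)\<bar> / real N)))"
    if m: "\<And>j. j < k \<Longrightarrow> \<bar>m j\<bar> < int N" "\<And>j. j \<ge> k \<Longrightarrow> m j = 0" for m
  proof -
    define D where "D u v j = (if m j - int u + int v = 0 then 1 else 0 :: real)" for u v j
    have inner: "(\<Sum>x\<in>\<Omega>. e (\<lambda>j. m j - int (a j) + int (b j)) x) = of_real (\<Prod>j<k. real L * D (a j) (b j) j)"
      if ab: "a \<in> T" "b \<in> T" for a b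
    proof -
      have "(\<Sum>x\<in>\<Omega>. e (\<lambda>j. m j - int (a j) + int (b j)) x)
        = (\<Prod>j<k. \<Sum>y<L. cis (2 * pi * of_int (m j - int (a j) + int (b j)) * real y / real L))"
        unfolding e_def \<Omega>_def by (subst prod_sum_PiE) auto
      also have "\<dots> = (\<Prod>j<k. of_real (real L * D (a j) (b j) j))"
      proof (rule prod.cong[OF refl])
        fix j assume "j \<in> {..<k}"
        then have j: "j < k" by simp
        have "a j < N" "b j < N" using ab j by (auto simp: T_def PiE_def Pi_def)
        then have "\<bar>m j - int (a j) + int (b j)\<bar> < int L" using m(1)[OF j] by (simp add: L_def)
        from sum_cis_roots[OF L this]
        show "(\<Sum>y<L. cis (2 * pi * of_int (m j - int (a j) + int (b j)) * real y / real L)) = of_real (real L * D (a j) (b j) j)"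
          unfolding D_def by simp
      qed
      finally show ?thesis by simp
    qed
    \<comment> \<open>The product of the \<open>D\<close> vanishes unless the difference of
      \<open>a\<close> and \<open>b\<close> is \<open>m\<close>, and then the argument of \<psi> is
      the grid point of \<open>m\<close>; so \<psi> can be taken out of the double sum.\<close>
    have repl: "\<psi> (\<lambda>j. \<iota> a j - \<iota> b j) * of_real (\<Prod>j<k. real L * D (a j) (b j) j) = \<psi> (\<lambda>j. of_int (m j) / M) * of_real (\<Prod>j<k. real L * D (a j) (b j) j)" for a b
    proof (cases "\<forall>j<k. m j - int (a j) + int (b j) = 0")
      case True
      have "(\<lambda>j. \<iota> a j - \<iota> b j) = (\<lambda>j. of_int (m j) / M)"
      proof
        fix j
        show "\<iota> a j - \<iota> b j = of_int (m j) / M"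
        proof (cases "j < k")
          case j: True
          then have "m j = int (a j) - int (b j)" using True by auto
          then show ?thesis using j by (simp add: \<iota>_def diff_divide_distrib)
        qed (simp add: \<iota>_def m)
      qed
      then show ?thesis by simp
    next
      case False
      then obtain j where "j < k" "D (a j) (b j) j = 0" by (auto simp: D_def)
      then have "(\<Prod>j<k. real L * D (a j) (b j) j) = 0" by (intro prod_zero) auto
      then show ?thesis by simp
    qed
    have cnt: "(\<Sum>a\<in>T. \<Sum>b\<in>T. \<Prod>j<k. real L * D (a j) (b j) j) = (\<Prod>j<k. real L * (real N - \<bar>of_int (m j)\<bar>))"
    proof -
      have "(\<Sum>a\<in>T. \<Sum>b\<in>T. \<Prod>j<k. real L * D (a j) (b j) j) = (\<Sum>a\<in>T. \<Prod>j<k. \<Sum>v<N. real L * D (a j) v j)"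
        unfolding T_def by (subst prod_sum_PiE) auto
      also have "\<dots> = (\<Prod>j<k. \<Sum>u<N. \<Sum>v<N. real L * D u v j)"
        unfolding T_def by (subst prod_sum_PiE) auto
      also have "\<dots> = (\<Prod>j<k. real L * (real N - \<bar>of_int (m j)\<bar>))"
      proof (rule prod.cong[OF refl])
        fix j assume "j \<in> {..<k}"
        then have "(\<Sum>u<N. \<Sum>v<N. D u v j) = real N - \<bar>of_int (m j)\<bar>"
          unfolding D_def by (intro count_differences m) auto
        then show "(\<Sum>u<N. \<Sum>v<N. real L * D u v j) = real L * (real N - \<bar>of_int (m j)\<bar>)"
          by (simp flip: sum_distrib_left)
      qed
      finally show ?thesis .
    qed
    have "(\<Sum>x\<in>\<Omega>. S x * e m x) = (\<Sum>x\<in>\<Omega>. \<Sum>a\<in>T. \<Sum>b\<in>T. \<psi> (\<lambda>j. \<iota> a j - \<iota> b j) * e (\<lambda>j. m j - int (a j) + int (b j)) x)"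
      unfolding S_def sum_distrib_right e_mult ..
    also have "\<dots> = (\<Sum>a\<in>T. \<Sum>b\<in>T. \<Sum>x\<in>\<Omega>. \<psi> (\<lambda>j. \<iota> a j - \<iota> b j) * e (\<lambda>j. m j - int (a j) + int (b j)) x)"
      by (subst sum.swap) (intro sum.cong refl sum.swap)
    also have "\<dots> = (\<Sum>a\<in>T. \<Sum>b\<in>T. \<psi> (\<lambda>j. of_int (m j) / M) * of_real (\<Prod>j<k. real L * D (a j) (b j) j))"
      by (intro sum.cong refl) (simp only: sum_distrib_left[symmetric] inner repl)
    also have "\<dots> = \<psi> (\<lambda>j. of_int (m j) / M) * of_real (\<Prod>j<k. real L * (real N - \<bar>of_int (m j)\<bar>))"
      by (simp only: sum_distrib_left[symmetric] of_real_sum[symmetric] cnt)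
    also have "(\<Prod>j<k. real L * (real N - \<bar>of_int (m j)\<bar>)) = (\<Prod>j<k. (real L * real N) * (1 - \<bar>of_int (m j)\<bar> / real N))"
      using N by (intro prod.cong refl) (simp add: field_simps)
    also have "\<dots> = (real L * real N) ^ k * (\<Prod>j<k. (1 - \<bar>of_int (m j)\<bar> / real N))"
      by (simp only: prod.distrib prod_constant card_lessThan power_mult_distrib)
    finally show ?thesis by (simp add: mult_ac)
  qed
  define c where "c = (real L * real N) ^ k"
  have c: "c > 0" using L N by (simp add: c_def)
  define w where "w x = (if x \<in> \<Omega> then Re (S x) / c else 0)" for x
  have w0: "w x \<ge> 0" for x using S c by (simp add: w_def)
  have cw: "complex_of_real (w x) = S x / of_real c" if "x \<in> \<Omega>" for x
    using that S[of x] by (simp add: w_def complex_eq_iff)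
  have sumw: "(\<Sum>x\<in>\<Omega>. of_real (w x) * e m x) = \<psi> (\<lambda>j. of_int (m j) / M) * (\<Prod>j<k. of_real (1 - \<bar>of_int (m j)\<bar> / real N))"
    if m: "\<And>j. j < k \<Longrightarrow> \<bar>m j\<bar> < int N" "\<And>j. j \<ge> k \<Longrightarrow> m j = 0" for m
  proof -
    have "(\<Sum>x\<in>\<Omega>. of_real (w x) * e m x) = (\<Sum>x\<in>\<Omega>. S x * e m x) / of_real c"
      unfolding sum_divide_distrib by (intro sum.cong refl) (simp add: cw)
    then show ?thesis using c L N by (simp add: key[OF m] c_def)
  qed
  have "(\<Sum>x\<in>\<Omega>. complex_of_real (w x) * e (\<lambda>_. 0) x) = 1"
    using sumw[of "\<lambda>_. 0"] N one by simp
  then have "complex_of_real (\<Sum>x\<in>\<Omega>. w x) = 1" by (simp add: e_def)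
  then have w1: "(\<Sum>x\<in>\<Omega>. w x) = 1" by (simp only: of_real_eq_1_iff)
  have nn: "(\<integral>\<^sup>+x. ennreal (w x) \<partial>count_space UNIV) = 1"
  proof -
    have "(\<integral>\<^sup>+x. ennreal (w x) \<partial>count_space UNIV) = (\<Sum>x\<in>\<Omega>. ennreal (w x))"
      by (rule nn_integral_count_space'[OF fin(2)]) (auto simp: w_def)
    then show ?thesis by (simp add: sum_ennreal w0 w1)
  qed
  define p where "p = embed_pmf w"
  have pmf: "pmf p x = w x" for x unfolding p_def by (rule pmf_embed_pmf[OF w0 nn])
  \<comment> \<open>The point \<open>x j\<close> of the cyclic group is represented by an angle in
    \<open>(-pi, pi]\<close>, scaled by \<open>M\<close>. Reducing modulo \<open>L\<close> first
    makes the bound \<open>pi * M\<close> hold for every \<open>x\<close>, including those outside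
    \<open>\<Omega>\<close>.\<close>
  define X where "X j x = (if x j mod L \<le> N then pi * M * real (x j mod L) / real N else pi * M * (real (x j mod L) / real N - 2))"
    for j :: nat and x :: "nat \<Rightarrow> nat"
  have Xb: "\<bar>X j x\<bar> \<le> pi * M" for j x
  proof -
    have "x j mod L < 2 * N" using mod_less_divisor[OF L, of "x j"] by (simp add: L_def)
    then have "real (x j mod L) < real (2 * N)" by (simp only: of_nat_less_iff)
    then have q: "0 \<le> real (x j mod L) / real N" "real (x j mod L) / real N < 2"
      using N by (simp_all add: pos_divide_less_eq)
    have "\<bar>if x j mod L \<le> N then real (x j mod L) / real N else real (x j mod L) / real N - 2\<bar> \<le> 1"
      using q N by (auto simp: field_simps)
    then have "pi * M * \<bar>if x j mod L \<le> N then real (x j mod L) / real N else real (x j mod L) / real N - 2\<bar> \<le> pi * M * 1"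
      using M pi_gt_zero by (intro mult_left_mono) auto
    moreover have "\<bar>X j x\<bar> = pi * M * \<bar>if x j mod L \<le> N then real (x j mod L) / real N else real (x j mod L) / real N - 2\<bar>"
      using M pi_gt_zero by (simp add: X_def abs_mult)
    ultimately show ?thesis by simp
  qed
  have Xe: "cis (\<Sum>j<k. (of_int (m j) / M) * X j x) = e m x" if x: "x \<in> \<Omega>" for m x
  proof -
    have "cis ((of_int (m j) / M) * X j x) = cis (2 * pi * of_int (m j) * real (x j) / real L)" if j: "j < k" for j
    proof -
      have "x j < L" using x j by (auto simp: \<Omega>_def PiE_def Pi_def)
      then have xj: "x j mod L = x j" by simp
      show ?thesis
      proof (cases "x j \<le> N")
        case True
        then have "X j x = pi * M * real (x j) / real N" by (simp add: X_def xj)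
        then show ?thesis using M by (simp add: L_def mult_ac)
      next
        case False
        then have xe: "X j x = pi * M * (real (x j) / real N - 2)" by (simp add: X_def xj)
        have "(of_int (m j) / M) * X j x = 2 * pi * of_int (m j) * real (x j) / real L - 2 * pi * of_int (m j)"
          unfolding xe L_def using M N by (simp add: field_simps)
        then have "cis ((of_int (m j) / M) * X j x) = cis (2 * pi * of_int (m j) * real (x j) / real L) / cis (2 * pi * of_int (m j))"
          by (simp only: cis_divide)
        also have "cis (2 * pi * of_int (m j)) = 1" by (rule cis_multiple_2pi) auto
        finally show ?thesis by simp
      qed
    qed
    moreover have "cis (\<Sum>j\<in>A. f j) = (\<Prod>j\<in>A. cis (f j))" for A :: "nat set" and f
      by (induction A rule: infinite_finite_induct) (auto simp: cis_mult[symmetric])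
    ultimately show ?thesis by (simp add: e_def)
  qed
  have "(\<integral>x. cis (\<Sum>j<k. (of_int (m j) / M) * X j x) \<partial>p) = \<psi> (\<lambda>j. of_int (m j) / M) * (\<Prod>j<k. of_real (1 - \<bar>of_int (m j)\<bar> / real N))"
    if m: "\<And>j. j < k \<Longrightarrow> \<bar>m j\<bar> < int N" "\<And>j. j \<ge> k \<Longrightarrow> m j = 0" for m
  proof -
    have "(\<integral>x. cis (\<Sum>j<k. (of_int (m j) / M) * X j x) \<partial>p) = (\<Sum>x\<in>\<Omega>. pmf p x *\<^sub>R cis (\<Sum>j<k. (of_int (m j) / M) * X j x))"
    proof (rule integral_measure_pmf[OF fin(2)])
      fix x assume "x \<in> set_pmf p"
      then show "x \<in> \<Omega>" by (auto simp: set_pmf_eq pmf w_def split: if_splits)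
    qed
    also have "\<dots> = (\<Sum>x\<in>\<Omega>. of_real (w x) * e m x)"
      by (intro sum.cong refl) (simp only: Xe pmf scaleR_conv_of_real)
    finally show ?thesis using sumw[OF m] by simp
  qed
  then show ?thesis using Xb by (intro exI[of _ p] exI[of _ X]) blast
qed

section \<open>Tail bounds from values of a characteristic function near 0\<close>

lemma sin_abs_lower_bound:
  fixes x :: real
  assumes "\<bar>x\<bar> \<le> pi / 2"
  shows "\<bar>x\<bar> / 2 \<le> \<bar>sin x\<bar>"
proof -
  have *: "x / 2 \<le> sin x" if "0 \<le> x" "x \<le> pi / 2" for x :: real
  proof (cases "x \<le> pi / 3")
    case True
    show ?thesis
    proof (cases "x = 0")
      case False
      then have "0 < x" using that by simp
      then obtain z where z: "0 < z" "z < x" "sin x - sin 0 = (x - 0) * cos z"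
        using MVT2[of 0 x sin cos] by (auto intro: DERIV_sin)
      have "cos z \<ge> cos (pi / 3)" using z True pi_gt_zero by (intro cos_monotone_0_pi_le) auto
      then have "x * cos z \<ge> x * (1/2)" using \<open>0 < x\<close> by (intro mult_left_mono) (auto simp: cos_60)
      then show ?thesis using z by simp
    qed simp
  next
    case False
    have "sin (pi / 3) \<le> sin x" using False that by (intro sin_monotone_2pi_le) auto
    moreover have "pi / 4 \<le> sqrt 3 / 2"
    proof -
      have "pi / 2 \<le> 1.6" using pi_approx by simp
      also have "1.6 \<le> sqrt 3" by (rule real_le_rsqrt) (simp add: power2_eq_square)
      finally show ?thesis by simp
    qed
    ultimately show ?thesis using that by (simp add: sin_60)
  qed
  show ?thesis
    using *[of x] *[of "-x"] assms by (auto simp: abs_if)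
qed


text \<open>Multiplication by \<open>2 * sin (\<theta> / 2)\<close> telescopes the Dirichlet sum to
  a difference of two sines.\<close>

lemma dirichlet_sum_bound:
  fixes \<theta> :: real
  assumes "\<bar>\<theta>\<bar> \<le> pi" "\<theta> \<noteq> 0"
  shows "(\<Sum>m=1..n. cos (real m * \<theta>)) \<le> 4 / \<bar>\<theta>\<bar>"
proof -
  have id: "2 * sin (\<theta> / 2) * (\<Sum>m=1..n. cos (real m * \<theta>)) = sin ((real n + 1/2) * \<theta>) - sin (\<theta> / 2)"
  proof (induction n)
    case (Suc n)
    have "sin ((real (Suc n) + 1/2) * \<theta>) - sin ((real n + 1/2) * \<theta>) = 2 * sin (\<theta> / 2) * cos (real (Suc n) * \<theta>)"
    proof -
      have a: "(real (Suc n) + 1/2) * \<theta> = real (Suc n) * \<theta> + \<theta> / 2" by (simp add: algebra_simps)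
      have b: "(real n + 1/2) * \<theta> = real (Suc n) * \<theta> - \<theta> / 2" by (simp add: field_simps)
      show ?thesis unfolding a b sin_add sin_diff by (simp add: algebra_simps)
    qed
    then show ?case using Suc.IH by (simp add: algebra_simps)
  qed (simp add: algebra_simps)
  have lb: "\<bar>\<theta>\<bar> / 4 \<le> \<bar>sin (\<theta> / 2)\<bar>" using sin_abs_lower_bound[of "\<theta> / 2"] assms by simp
  let ?S = "\<Sum>m=1..n. cos (real m * \<theta>)"
  have "(\<bar>\<theta>\<bar> / 2) * \<bar>?S\<bar> \<le> \<bar>2 * sin (\<theta> / 2) * ?S\<bar>"
    using mult_right_mono[OF lb, of "2 * \<bar>?S\<bar>"] by (simp add: abs_mult mult_ac)
  also have "\<dots> \<le> 2"
    unfolding id using abs_sin_le_one[of "(real n + 1/2) * \<theta>"] abs_sin_le_one[of "\<theta> / 2"] by linarith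
  finally have "\<bar>?S\<bar> \<le> 4 / \<bar>\<theta>\<bar>" using assms by (simp add: field_simps)
  then show ?thesis by linarith
qed

text \<open>A discrete truncation inequality. For \<open>\<theta> = X / M\<close> with
  \<open>8 / n \<le> |\<theta>| \<le> pi\<close> the cosine sum is at most \<open>n / 2\<close>, so
  the mean of \<open>1 - cos (m * \<theta>)\<close> over \<open>m\<close> is at least 1/2, and twice
  this mean dominates the indicator. The bound on \<open>X\<close> keeps \<theta> within one
  period.\<close>

lemma pmf_tail_bound:
  fixes p :: "'a pmf" and X :: "'a \<Rightarrow> real"
  assumes X: "\<And>x. \<bar>X x\<bar> \<le> pi * M" and M: "M > 0" and n: "n > 0"
  shows "measure p {x. \<bar>X x\<bar> \<ge> 8 * M / real n} \<le> 2 / real n * (\<Sum>m=1..n. 1 - Re (\<integral>x. cis (real m / M * X x) \<partial>p))"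
proof -
  have i: "integrable p (\<lambda>x. cis (real m / M * X x))" for m
    by (rule measure_pmf.integrable_const_bound[where B=1]) auto
  have ic: "integrable p (\<lambda>x. cos (real m / M * X x))" for m
    by (rule measure_pmf.integrable_const_bound[where B=1]) auto
  have Re: "Re (\<integral>x. cis (real m / M * X x) \<partial>p) = (\<integral>x. cos (real m / M * X x) \<partial>p)" for m
    using integral_Re[OF i[of m]] by simp
  have pt: "indicator {x. \<bar>X x\<bar> \<ge> 8 * M / real n} x \<le> 2 / real n * (\<Sum>m=1..n. 1 - cos (real m / M * X x))" for x
  proof (cases "\<bar>X x\<bar> \<ge> 8 * M / real n")
    case True
    define \<theta> where "\<theta> = X x / M"
    have a\<theta>: "\<bar>\<theta>\<bar> = \<bar>X x\<bar> / M" using M by (simp add: \<theta>_def)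
    have "8 / real n \<le> \<bar>\<theta>\<bar>" using True M n unfolding a\<theta> by (simp add: field_simps)
    moreover have "0 < 8 / real n" using n by simp
    ultimately have \<theta>: "8 / real n \<le> \<bar>\<theta>\<bar>" "0 < \<bar>\<theta>\<bar>" by linarith+
    have "\<bar>\<theta>\<bar> \<le> pi" using X[of x] M unfolding a\<theta> by (simp add: field_simps)
    then have "(\<Sum>m=1..n. cos (real m * \<theta>)) \<le> 4 / \<bar>\<theta>\<bar>"
      using \<theta> by (intro dirichlet_sum_bound) auto
    also have "4 / \<bar>\<theta>\<bar> \<le> real n / 2" using \<theta> n by (simp add: field_simps)
    finally have "(\<Sum>m=1..n. 1 - cos (real m / M * X x)) \<ge> real n / 2"
      by (simp add: sum_subtractf \<theta>_def)
    then have "2 / real n * (\<Sum>m=1..n. 1 - cos (real m / M * X x)) \<ge> 2 / real n * (real n / 2)"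
      by (intro mult_left_mono) auto
    then show ?thesis using True n by simp
  next
    case False
    have "0 \<le> (\<Sum>m=1..n. 1 - cos (real m / M * X x))" by (intro sum_nonneg) simp
    then show ?thesis using False by (simp add: zero_le_divide_iff)
  qed
  have "measure p {x. \<bar>X x\<bar> \<ge> 8 * M / real n} = (\<integral>x. indicator {x. \<bar>X x\<bar> \<ge> 8 * M / real n} x \<partial>p)" by simp
  also have "\<dots> \<le> (\<integral>x. 2 / real n * (\<Sum>m=1..n. 1 - cos (real m / M * X x)) \<partial>p)"
  proof (rule integral_mono[OF _ _ pt])
    show "integrable p (\<lambda>x. 2 / real n * (\<Sum>m=1..n. 1 - cos (real m / M * X x)))"
      using ic by (intro integrable_mult_right Bochner_Integration.integrable_sum Bochner_Integration.integrable_diff) simp_all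
  qed (rule measure_pmf.integrable_const_bound[where B=1], auto)
  also have "\<dots> = 2 / real n * (\<Sum>m=1..n. 1 - Re (\<integral>x. cis (real m / M * X x) \<partial>p))"
  proof -
    have "(\<integral>x. (\<Sum>m=1..n. 1 - cos (real m / M * X x)) \<partial>p) = (\<Sum>m=1..n. \<integral>x. 1 - cos (real m / M * X x) \<partial>p)"
      using ic by (intro Bochner_Integration.integral_sum Bochner_Integration.integrable_diff) simp_all
    also have "\<dots> = (\<Sum>m=1..n. 1 - Re (\<integral>x. cis (real m / M * X x) \<partial>p))"
      unfolding Re using ic by (intro sum.cong refl) (simp add: Bochner_Integration.integral_diff)
    finally show ?thesis by simp
  qed
  finally show ?thesis .
qed

text \<open>The k-th law resolves k coordinates at the frequencies \<open>m / 2^k\<close> with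
  \<open>|m| < 4^k\<close>: the mesh tends to 0 and the range to infinity. At a fixed dyadic point t
  the Fejer factors are \<open>1 - |t j| / 2^k\<close>, which tend to 1. Continuity then leads from
  dyadic to real arguments.\<close>

lemma countable_bochner:
  fixes \<psi> :: "(nat \<Rightarrow> real) \<Rightarrow> complex"
  assumes pd: "\<And>k (I :: (nat \<Rightarrow> nat) set) a c. finite I \<Longrightarrow> (\<And>i j. i \<in> I \<Longrightarrow> j \<ge> k \<Longrightarrow> a i j = 0) \<Longrightarrow>
      Im (\<Sum>i\<in>I. \<Sum>l\<in>I. cnj (c i) * \<psi> (\<lambda>j. a i j - a l j) * c l) = 0 \<and>
      Re (\<Sum>i\<in>I. \<Sum>l\<in>I. cnj (c i) * \<psi> (\<lambda>j. a i j - a l j) * c l) \<ge> 0"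
    and one: "\<psi> (\<lambda>_. 0) = 1"
    and cont: "\<And>k (\<tau> :: nat \<Rightarrow> nat \<Rightarrow> real) t. (\<And>j. (\<lambda>r. \<tau> r j) \<longlonglongrightarrow> t j) \<Longrightarrow> (\<And>r j. j \<ge> k \<Longrightarrow> \<tau> r j = 0) \<Longrightarrow>
      (\<lambda>r. \<psi> (\<tau> r)) \<longlonglongrightarrow> \<psi> t"
  obtains \<nu> :: "real measure" and Z :: "nat \<Rightarrow> real \<Rightarrow> real"
  where "real_distribution \<nu>" "\<And>j. Z j \<in> borel_measurable borel"
    "\<And>n t. (\<And>j. j \<ge> n \<Longrightarrow> t j = 0) \<Longrightarrow> (\<integral>s. cis (\<Sum>j<n. t j * Z j s) \<partial>\<nu>) = \<psi> t"
proof -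
  define P where "P k p X \<longleftrightarrow> (\<forall>j x. \<bar>X j x\<bar> \<le> pi * 2 ^ k) \<and>
    (\<forall>m :: nat \<Rightarrow> int. (\<forall>j<k. \<bar>m j\<bar> < int (4 ^ k)) \<longrightarrow> (\<forall>j\<ge>k. m j = 0) \<longrightarrow>
      (\<integral>x. cis (\<Sum>j<k. (of_int (m j) / 2 ^ k) * X j x) \<partial>measure_pmf p) =
        \<psi> (\<lambda>j. of_int (m j) / 2 ^ k) * (\<Prod>j<k. of_real (1 - \<bar>of_int (m j)\<bar> / real (4 ^ k))))"
    for k :: nat and p :: "(nat \<Rightarrow> nat) pmf" and X :: "nat \<Rightarrow> (nat \<Rightarrow> nat) \<Rightarrow> real"
  have "\<forall>k. \<exists>p X. P k p X"
    unfolding P_def by (intro allI fejer_pmf pd one) auto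
  from choice[OF this] obtain p where "\<forall>k. \<exists>X. P k (p k) X" ..
  from choice[OF this] obtain X where PX: "\<forall>k. P k (p k) (X k)" ..
  have Xb: "\<bar>X k j x\<bar> \<le> pi * 2 ^ k" for k j x using PX unfolding P_def by simp
  have EX: "(\<integral>x. cis (\<Sum>j<k. (of_int (m j) / 2 ^ k) * X k j x) \<partial>measure_pmf (p k)) =
        \<psi> (\<lambda>j. of_int (m j) / 2 ^ k) * (\<Prod>j<k. of_real (1 - \<bar>of_int (m j)\<bar> / 4 ^ k))"
    if "\<And>j. j < k \<Longrightarrow> \<bar>m j\<bar> < 4 ^ k" "\<And>j. j \<ge> k \<Longrightarrow> m j = 0" for k m
  proof -
    have "P k (p k) (X k)" using PX by simp
    then show ?thesis using that unfolding P_def by simp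
  qed
  have tight: "\<exists>R>0. \<forall>\<^sub>F k in sequentially. measure (p k) {\<omega>. \<bar>X k j \<omega>\<bar> \<ge> R} \<le> \<epsilon>" if \<epsilon>: "\<epsilon> > 0" for j \<epsilon>
  proof -
    define \<delta> where "\<delta> t = (\<lambda>i. if i = j then t else 0 :: real)" for t
    \<comment> \<open>Continuity is available only along sequences, so the neighbourhood of 0 is
      found by contradiction, from a sequence with \<open>|t q| \<le> 1 / 2^q\<close>.\<close>
    have "\<exists>q::nat. \<forall>t. \<bar>t\<bar> \<le> 1 / 2 ^ q \<longrightarrow> cmod (\<psi> (\<delta> t) - 1) \<le> \<epsilon> / 8"
    proof (rule ccontr)
      assume "\<not> ?thesis"
      then have "\<forall>q::nat. \<exists>t. \<bar>t\<bar> \<le> 1 / 2 ^ q \<and> cmod (\<psi> (\<delta> t) - 1) > \<epsilon> / 8" by (simp add: not_le)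
      from choice[OF this] obtain t where t: "\<forall>q::nat. \<bar>t q\<bar> \<le> 1 / 2 ^ q \<and> cmod (\<psi> (\<delta> (t q)) - 1) > \<epsilon> / 8" ..
      have "t \<longlonglongrightarrow> 0"
      proof (rule Lim_null_comparison)
        show "\<forall>\<^sub>F q in sequentially. norm (t q) \<le> (1/2) ^ q"
          using t by (intro always_eventually allI) (simp add: power_one_over)
        show "(\<lambda>q. (1/2::real) ^ q) \<longlonglongrightarrow> 0" by (rule LIMSEQ_realpow_zero) auto
      qed
      then have "(\<lambda>q. \<delta> (t q) i) \<longlonglongrightarrow> 0" for i by (cases "i = j") (simp_all add: \<delta>_def)
      then have "(\<lambda>q. \<psi> (\<delta> (t q))) \<longlonglongrightarrow> \<psi> (\<lambda>_. 0)"
        by (rule cont[where k="Suc j"]) (simp add: \<delta>_def)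
      then have "\<forall>\<^sub>F q in sequentially. dist (\<psi> (\<delta> (t q))) 1 < \<epsilon> / 8"
        unfolding one by (rule tendstoD) (use \<epsilon> in simp)
      then obtain q where "dist (\<psi> (\<delta> (t q))) 1 < \<epsilon> / 8"
        unfolding eventually_sequentially by blast
      moreover have "cmod (\<psi> (\<delta> (t q)) - 1) > \<epsilon> / 8" using t by simp
      ultimately show False by (simp add: dist_norm)
    qed
    then obtain q :: nat where q: "\<And>t. \<bar>t\<bar> \<le> 1 / 2 ^ q \<Longrightarrow> cmod (\<psi> (\<delta> t) - 1) \<le> \<epsilon> / 8" by blast
    have "(\<lambda>k. (1 + \<epsilon> / 8) * (1/2) ^ k) \<longlonglongrightarrow> (1 + \<epsilon> / 8) * 0"
      by (intro tendsto_intros LIMSEQ_realpow_zero) auto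
    then have "\<forall>\<^sub>F k in sequentially. (1 + \<epsilon> / 8) * (1/2) ^ k < \<epsilon> / 8"
      by (rule order_tendstoD) (use \<epsilon> in simp)
    moreover have "\<forall>\<^sub>F k in sequentially. k \<ge> q + j + 1" by (rule eventually_ge_at_top)
    ultimately have "\<forall>\<^sub>F k in sequentially. measure (p k) {\<omega>. \<bar>X k j \<omega>\<bar> \<ge> 8 * 2 ^ q} \<le> \<epsilon>"
    proof eventually_elim
      case (elim k)
      \<comment> \<open>With this many frequencies, \<open>m / 2^k\<close> is at most
        \<open>1 / 2^q\<close> for all \<open>m \<le> n\<close>, and the radius
        \<open>8 * 2^k / n\<close> equals \<open>8 * 2^q\<close>, independent of
        \<open>k\<close>.\<close>
      define n where "n = (2::nat) ^ (k - q)"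
      have n: "n > 0" "real n = 2 ^ k / 2 ^ q" "real n \<le> 2 ^ k"
        using elim power_diff[of "2::real" q k] power_increasing[of "k - q" k "2::real"] by (simp_all add: n_def)
      have le: "1 - Re (\<integral>x. cis (real m / 2 ^ k * X k j x) \<partial>p k) \<le> \<epsilon> / 4" if m: "m \<in> {1..n}" for m
      proof -
        define mm where "mm i = (if i = j then int m else 0)" for i
        have mr: "real m \<le> real n" using m by simp
        have m4: "real m \<le> 2 ^ k" using mr n by linarith
        have lt: "(2::real) ^ k < 4 ^ k" using elim by (intro power_strict_mono) auto
        then have "real m < 4 ^ k" using m4 by linarith
        then have "int m < 4 ^ k" by (metis of_int_less_iff of_int_of_nat_eq of_int_numeral of_int_power)
        then have "(\<integral>x. cis (\<Sum>i<k. (of_int (mm i) / 2 ^ k) * X k i x) \<partial>measure_pmf (p k)) =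
          \<psi> (\<lambda>i. of_int (mm i) / 2 ^ k) * (\<Prod>i<k. of_real (1 - \<bar>of_int (mm i)\<bar> / 4 ^ k))"
          by (intro EX) (use elim in \<open>auto simp: mm_def\<close>)
        moreover have "(\<Sum>i<k. (of_int (mm i) / 2 ^ k) * X k i x) = real m / 2 ^ k * X k j x" for x
        proof -
          have "(\<Sum>i<k. (of_int (mm i) / 2 ^ k) * X k i x) = (\<Sum>i<k. if i = j then real m / 2 ^ k * X k i x else 0)"
            by (intro sum.cong) (auto simp: mm_def)
          then show ?thesis using elim by simp
        qed
        moreover have "(\<Prod>i<k. of_real (1 - \<bar>of_int (mm i)\<bar> / 4 ^ k)) = complex_of_real (1 - real m / 4 ^ k)"
        proof -
          have "(\<Prod>i<k. of_real (1 - \<bar>of_int (mm i)\<bar> / 4 ^ k)) = (\<Prod>i<k. if i = j then complex_of_real (1 - real m / 4 ^ k) else 1)"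
            by (intro prod.cong) (auto simp: mm_def)
          then show ?thesis using elim by simp
        qed
        moreover have "(\<lambda>i. of_int (mm i) / 2 ^ k) = \<delta> (real m / 2 ^ k)"
          by (auto simp: mm_def \<delta>_def)
        ultimately have E: "(\<integral>x. cis (real m / 2 ^ k * X k j x) \<partial>p k) = \<psi> (\<delta> (real m / 2 ^ k)) * complex_of_real (1 - real m / 4 ^ k)"
          by simp
        let ?z = "\<psi> (\<delta> (real m / 2 ^ k))"
        have "real m / 2 ^ k \<le> 1 / 2 ^ q" using mr n(2) by (simp add: field_simps)
        then have z1: "cmod (?z - 1) \<le> \<epsilon> / 8" by (intro q) simp
        have "cmod ?z \<le> 1 + cmod (?z - 1)" using norm_triangle_ineq[of 1 "?z - 1"] by simp
        then have z2: "cmod ?z \<le> 1 + \<epsilon> / 8" using z1 by linarith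
        have "real m / 4 ^ k \<le> 2 ^ k / 4 ^ k" using m4 by (intro divide_right_mono) auto
        also have "2 ^ k / 4 ^ k = (1/2::real) ^ k" by (simp add: power_divide[symmetric])
        finally have m5: "real m / 4 ^ k \<le> (1/2) ^ k" .
        have "1 - Re (?z * complex_of_real (1 - real m / 4 ^ k)) = Re (1 - ?z) + real m / 4 ^ k * Re ?z"
          by (simp add: algebra_simps)
        also have "\<dots> \<le> \<epsilon> / 8 + (1/2) ^ k * (1 + \<epsilon> / 8)"
        proof (rule add_mono)
          show "Re (1 - ?z) \<le> \<epsilon> / 8" using z1 complex_Re_le_cmod[of "1 - ?z"] by (simp add: norm_minus_commute)
          have "real m / 4 ^ k * Re ?z \<le> real m / 4 ^ k * cmod ?z"
            by (intro mult_left_mono complex_Re_le_cmod) simp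
          also have "\<dots> \<le> (1/2) ^ k * (1 + \<epsilon> / 8)" by (intro mult_mono m5 z2) auto
          finally show "real m / 4 ^ k * Re ?z \<le> (1/2) ^ k * (1 + \<epsilon> / 8)" .
        qed
        also have "\<dots> \<le> \<epsilon> / 4" using elim(1) by (simp add: mult.commute)
        finally show ?thesis unfolding E .
      qed
      have "measure (p k) {x. \<bar>X k j x\<bar> \<ge> 8 * 2 ^ k / real n} \<le> 2 / real n * (\<Sum>m=1..n. 1 - Re (\<integral>x. cis (real m / 2 ^ k * X k j x) \<partial>p k))"
        by (rule pmf_tail_bound[OF Xb _ n(1)]) simp
      also have "\<dots> \<le> 2 / real n * (\<Sum>m=1..n. \<epsilon> / 4)"
        by (intro mult_left_mono sum_mono le) auto
      also have "\<dots> \<le> \<epsilon>" using n(1) \<epsilon> by simp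
      also have "8 * 2 ^ k / real n = 8 * 2 ^ q" by (simp add: n(2))
      finally show ?case .
    qed
    then show ?thesis by (intro exI[of _ "8 * 2 ^ q"]) simp
  qed
  obtain \<nu> Z r where \<nu>: "real_distribution \<nu>" and r: "strict_mono (r :: nat \<Rightarrow> nat)"
    and Z: "\<And>j. Z j \<in> borel_measurable borel"
    and lim: "\<And>n t. (\<lambda>k. \<integral>\<omega>. cis (\<Sum>j<n. t j * X (r k) j \<omega>) \<partial>p (r k)) \<longlonglongrightarrow> (\<integral>s. cis (\<Sum>j<n::nat. t j * Z j s) \<partial>\<nu>)"
    by (rule pmf_subseq_limit[OF tight], assumption) (rule that, assumption+)
  interpret \<nu>: real_distribution \<nu> by (rule \<nu>)
  have dyadic: "(\<integral>s. cis (\<Sum>j<n. (of_int (m j) / 2 ^ q) * Z j s) \<partial>\<nu>) = \<psi> (\<lambda>j. of_int (m j) / 2 ^ q)"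
    if m: "\<And>j. j \<ge> n \<Longrightarrow> m j = (0::int)" for n q m
  proof -
    define t where "t j = real_of_int (m j) / 2 ^ q" for j
    obtain B :: nat where B: "\<And>j. j < n \<Longrightarrow> \<bar>m j\<bar> < int B"
    proof
      fix j assume "j < n"
      then have "nat \<bar>m j\<bar> \<le> (\<Sum>j<n. nat \<bar>m j\<bar>)" by (intro member_le_sum) auto
      then show "\<bar>m j\<bar> < int (Suc (\<Sum>j<n. nat \<bar>m j\<bar>))" by linarith
    qed
    have "\<forall>\<^sub>F k in sequentially. k \<ge> n + q + B" by (rule eventually_ge_at_top)
    then have ev: "\<forall>\<^sub>F k in sequentially. \<psi> t * (\<Prod>j<n. of_real (1 - \<bar>t j\<bar> * (1/2) ^ k)) = (\<integral>x. cis (\<Sum>j<n. t j * X k j x) \<partial>p k)"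
    proof eventually_elim
      case (elim k)
      \<comment> \<open>The same dyadic point over the finer denominator \<open>2^k\<close>, where
        the k-th law reproduces \<psi> exactly up to the Fejer factors.\<close>
      define m' where "m' j = m j * 2 ^ (k - q)" for j
      have m't: "real_of_int (m' j) / 2 ^ k = t j" for j

      proof -
        have "(2::real) ^ (k - q) = 2 ^ k / 2 ^ q" using elim by (intro power_diff) auto
        then show ?thesis by (simp add: m'_def t_def)
      qed
      have m'4: "\<bar>real_of_int (m' j)\<bar> / 4 ^ k = \<bar>t j\<bar> * (1/2) ^ k" for j
      proof -
        have "\<bar>real_of_int (m' j)\<bar> = \<bar>t j\<bar> * 2 ^ k" by (simp add: m't[symmetric])
        moreover have "2 ^ k / 4 ^ k = (1/2::real) ^ k" by (simp add: power_divide[symmetric])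
        ultimately show ?thesis by (metis times_divide_eq_right)
      qed
      have b: "\<bar>m' j\<bar> < 4 ^ k" for j
      proof (cases "j < n")
        case True
        have "B < 2 ^ k" using elim less_exp[of B] power_increasing[of B k "2::nat"] by linarith
        then have "int B < 2 ^ k" by (metis of_nat_less_iff of_nat_numeral of_nat_power)
        then have "\<bar>m j\<bar> < 2 ^ k" using B[OF True] by linarith
        then have "\<bar>m j\<bar> * 2 ^ (k - q) < 2 ^ k * 2 ^ (k - q)" by simp
        also have "\<dots> \<le> 2 ^ k * (2 ^ k :: int)" by (intro mult_left_mono power_increasing) auto
        finally show ?thesis by (simp add: m'_def abs_mult power_mult_distrib[symmetric])
      qed (use m in \<open>simp add: m'_def\<close>)
      have "(\<integral>x. cis (\<Sum>j<k. (of_int (m' j) / 2 ^ k) * X k j x) \<partial>measure_pmf (p k)) =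
        \<psi> (\<lambda>j. of_int (m' j) / 2 ^ k) * (\<Prod>j<k. of_real (1 - \<bar>of_int (m' j)\<bar> / 4 ^ k))"
        by (rule EX[OF b]) (use elim m in \<open>simp add: m'_def\<close>)
      then have E: "(\<integral>x. cis (\<Sum>j<k. t j * X k j x) \<partial>measure_pmf (p k)) = \<psi> t * (\<Prod>j<k. of_real (1 - \<bar>t j\<bar> * (1/2) ^ k))"
        unfolding m't m'4 by simp
      have t0: "t j = 0" if "j \<ge> n" for j using m[OF that] by (simp add: t_def)
      have sub: "{..<n} \<subseteq> {..<k}" using elim by auto
      have "(\<Sum>j<k. t j * X k j x) = (\<Sum>j<n. t j * X k j x)" for x
        by (rule sum.mono_neutral_right[OF _ sub]) (auto simp: t0)
      moreover have "(\<Prod>j<k. complex_of_real (1 - \<bar>t j\<bar> * (1/2) ^ k)) = (\<Prod>j<n. of_real (1 - \<bar>t j\<bar> * (1/2) ^ k))"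
        by (rule prod.mono_neutral_right[OF _ sub]) (auto simp: t0)
      ultimately show ?case using E by simp
    qed
    have "(\<lambda>k. \<psi> t * (\<Prod>j<n. complex_of_real (1 - \<bar>t j\<bar> * (1/2) ^ k))) \<longlonglongrightarrow> \<psi> t * (\<Prod>j<n. of_real (1 - \<bar>t j\<bar> * 0))"
      by (intro tendsto_intros LIMSEQ_realpow_zero) auto
    then have "(\<lambda>k. \<integral>x. cis (\<Sum>j<n. t j * X k j x) \<partial>p k) \<longlonglongrightarrow> \<psi> t"
      using Lim_transform_eventually[OF _ ev] by simp
    then have "(\<lambda>k. \<integral>x. cis (\<Sum>j<n. t j * X (r k) j x) \<partial>p (r k)) \<longlonglongrightarrow> \<psi> t"
      by (rule LIMSEQ_subseq_LIMSEQ[OF _ r, unfolded comp_def])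
    from LIMSEQ_unique[OF lim this] show ?thesis unfolding t_def .
  qed
  show ?thesis
  proof (rule that[OF \<nu> Z])
    fix n and t :: "nat \<Rightarrow> real" assume t: "\<And>j. j \<ge> n \<Longrightarrow> t j = 0"
    \<comment> \<open>Rounding down to the dyadic grid sends 0 to 0, so the number of active
      coordinates does not grow along the approximation.\<close>
    define m where "m q j = \<lfloor>2 ^ q * t j\<rfloor>" for q j
    define \<tau> where "\<tau> q j = real_of_int (m q j) / 2 ^ q" for q j
    have m0: "m q j = 0" if "j \<ge> n" for q j using t[OF that] by (simp add: m_def)
    have \<tau>: "(\<lambda>q. \<tau> q j) \<longlonglongrightarrow> t j" for j
    proof -
      have "(\<lambda>q. \<tau> q j - t j) \<longlonglongrightarrow> 0"
      proof (rule Lim_null_comparison)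
        have "\<bar>\<tau> q j - t j\<bar> \<le> (1/2) ^ q" for q
        proof -
          have "\<bar>of_int (m q j) - 2 ^ q * t j\<bar> \<le> 1" unfolding m_def by linarith
          moreover have e: "\<tau> q j - t j = (of_int (m q j) - 2 ^ q * t j) / 2 ^ q" by (simp add: \<tau>_def field_simps)
          ultimately show ?thesis unfolding e power_one_over abs_divide by (simp add: divide_right_mono)
        qed
        then show "\<forall>\<^sub>F q in sequentially. norm (\<tau> q j - t j) \<le> (1/2) ^ q" by simp
        show "(\<lambda>q. (1/2::real) ^ q) \<longlonglongrightarrow> 0" by (rule LIMSEQ_realpow_zero) auto
      qed
      then show ?thesis by (simp add: LIM_zero_iff)
    qed
    have l1: "(\<lambda>q. \<psi> (\<tau> q)) \<longlonglongrightarrow> \<psi> t"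
      by (rule cont[OF \<tau>, of n]) (simp add: \<tau>_def m0)
    have l2: "(\<lambda>q. \<integral>s. cis (\<Sum>j<n. \<tau> q j * Z j s) \<partial>\<nu>) \<longlonglongrightarrow> (\<integral>s. cis (\<Sum>j<n. t j * Z j s) \<partial>\<nu>)"
    proof (rule integral_dominated_convergence[where w="\<lambda>_. 1"])
      have cm: "cis \<in> borel_measurable borel"
        by (intro borel_measurable_continuous_onI continuous_on_cis continuous_on_id)
      have sm: "(\<lambda>s. \<Sum>j<n. u j * Z j s) \<in> borel_measurable \<nu>" for u
        using Z by (intro borel_measurable_sum borel_measurable_times) simp_all
      show "(\<lambda>s. cis (\<Sum>j<n. t j * Z j s)) \<in> borel_measurable \<nu>"
        by (rule measurable_compose[OF sm cm])
      show "(\<lambda>s. cis (\<Sum>j<n. \<tau> q j * Z j s)) \<in> borel_measurable \<nu>" for q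
        by (rule measurable_compose[OF sm cm])
      show "AE s in \<nu>. (\<lambda>q. cis (\<Sum>j<n. \<tau> q j * Z j s)) \<longlonglongrightarrow> cis (\<Sum>j<n. t j * Z j s)"
        by (intro AE_I2 tendsto_cis tendsto_sum tendsto_mult \<tau> tendsto_const)
    qed simp_all
    have "(\<integral>s. cis (\<Sum>j<n. \<tau> q j * Z j s) \<partial>\<nu>) = \<psi> (\<tau> q)" for q
      unfolding \<tau>_def by (rule dyadic) (rule m0)
    from LIMSEQ_unique[OF l2[unfolded this] l1]
    show "(\<integral>s. cis (\<Sum>j<n. t j * Z j s) \<partial>\<nu>) = \<psi> t" .
  qed
qed

section \<open>Hermite functions on the line\<close>

lemma power_exp_bound: "y ^ k / fact k \<le> exp y" if "y \<ge> 0" for y :: real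
proof -
  have s: "(\<lambda>n. y ^ n /\<^sub>R fact n) sums exp y" by (rule exp_converges)
  have "(\<Sum>n\<in>{k}. y ^ n /\<^sub>R fact n) \<le> (\<Sum>n. y ^ n /\<^sub>R fact n)"
    by (rule sum_le_suminf[OF sums_summable[OF s]]) (use that in auto)
  then show ?thesis using sums_unique[OF s] by (simp add: divide_inverse mult.commute)
qed

text \<open>Only continuity and decay are recorded: derivatives of Hermite functions are obtained
  algebraically from the ladder relations and are rapid for the same reason.\<close>

definition rapid :: "(real \<Rightarrow> real) \<Rightarrow> bool" where
  "rapid f \<longleftrightarrow> continuous_on UNIV f \<and> (\<forall>k. \<exists>C. \<forall>x. \<bar>x\<bar> ^ k * \<bar>f x\<bar> \<le> C)"

lemma rapidE:
  assumes "rapid f"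
  obtains C where "\<And>x. \<bar>x\<bar> ^ k * \<bar>f x\<bar> \<le> C" "C \<ge> 0"
proof -
  obtain C where C: "\<forall>x. \<bar>x\<bar> ^ k * \<bar>f x\<bar> \<le> C" using assms unfolding rapid_def by blast
  have "0 \<le> \<bar>0::real\<bar> ^ k * \<bar>f 0\<bar>" by simp
  then have "C \<ge> 0" using C[rule_format, of 0] by linarith
  then show ?thesis using that C by blast
qed

lemma rapid_add:
  assumes "rapid f" "rapid g" shows "rapid (\<lambda>x. a * f x + b * g x)"
  unfolding rapid_def
proof (intro conjI allI)
  show "continuous_on UNIV (\<lambda>x. a * f x + b * g x)"
    using assms unfolding rapid_def by (intro continuous_intros) auto
  fix k
  obtain C where C: "\<And>x. \<bar>x\<bar> ^ k * \<bar>f x\<bar> \<le> C" using rapidE[OF assms(1)] by metis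
  obtain D where D: "\<And>x. \<bar>x\<bar> ^ k * \<bar>g x\<bar> \<le> D" using rapidE[OF assms(2)] by metis
  have "\<bar>x\<bar> ^ k * \<bar>a * f x + b * g x\<bar> \<le> \<bar>a\<bar> * C + \<bar>b\<bar> * D" for x
  proof -
    have "\<bar>x\<bar> ^ k * \<bar>a * f x + b * g x\<bar> \<le> \<bar>x\<bar> ^ k * (\<bar>a\<bar> * \<bar>f x\<bar> + \<bar>b\<bar> * \<bar>g x\<bar>)"
      by (intro mult_left_mono order_trans[OF abs_triangle_ineq]) (simp_all add: abs_mult)
    also have "\<dots> = \<bar>a\<bar> * (\<bar>x\<bar> ^ k * \<bar>f x\<bar>) + \<bar>b\<bar> * (\<bar>x\<bar> ^ k * \<bar>g x\<bar>)" by (simp add: algebra_simps)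
    also have "\<dots> \<le> \<bar>a\<bar> * C + \<bar>b\<bar> * D" by (intro add_mono mult_left_mono C D) auto
    finally show ?thesis .
  qed
  then show "\<exists>C. \<forall>x. \<bar>x\<bar> ^ k * \<bar>a * f x + b * g x\<bar> \<le> C" by blast
qed

lemma rapid_mult:
  assumes "rapid f" "rapid g" shows "rapid (\<lambda>x. f x * g x)"
  unfolding rapid_def
proof (intro conjI allI)
  show "continuous_on UNIV (\<lambda>x. f x * g x)"
    using assms unfolding rapid_def by (intro continuous_intros) auto
  fix k
  obtain C where C: "\<And>x. \<bar>x\<bar> ^ k * \<bar>f x\<bar> \<le> C" "C \<ge> 0" using rapidE[OF assms(1)] by metis
  obtain D where D: "\<And>x. \<bar>x\<bar> ^ 0 * \<bar>g x\<bar> \<le> D" using rapidE[OF assms(2)] by metis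
  have "\<bar>x\<bar> ^ k * \<bar>f x * g x\<bar> \<le> C * D" for x
    using mult_mono[OF C(1)[of x] D[of x]] C(2) by (simp add: abs_mult mult_ac)
  then show "\<exists>C. \<forall>x. \<bar>x\<bar> ^ k * \<bar>f x * g x\<bar> \<le> C" by blast
qed

lemma rapid_times_x:
  assumes "rapid f" shows "rapid (\<lambda>x. x * f x)"
  unfolding rapid_def
proof (intro conjI allI)
  show "continuous_on UNIV (\<lambda>x. x * f x)"
    using assms unfolding rapid_def by (intro continuous_intros) auto
  fix k
  obtain C where C: "\<And>x. \<bar>x\<bar> ^ Suc k * \<bar>f x\<bar> \<le> C" using rapidE[OF assms] by metis
  then have "\<bar>x\<bar> ^ k * \<bar>x * f x\<bar> \<le> C" for x using C[of x] by (simp add: abs_mult mult_ac)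
  then show "\<exists>C. \<forall>x. \<bar>x\<bar> ^ k * \<bar>x * f x\<bar> \<le> C" by blast
qed

lemma rapid_decay:
  assumes "rapid f" obtains C where "\<And>x. \<bar>f x\<bar> \<le> C * inverse (1 + x\<^sup>2)" "C \<ge> 0"
proof -
  obtain C where C: "\<And>x. \<bar>x\<bar> ^ 0 * \<bar>f x\<bar> \<le> C" "C \<ge> 0" using rapidE[OF assms] by metis
  obtain D where D: "\<And>x. \<bar>x\<bar> ^ 2 * \<bar>f x\<bar> \<le> D" "D \<ge> 0" using rapidE[OF assms] by metis
  have "\<bar>f x\<bar> \<le> (C + D) * inverse (1 + x\<^sup>2)" for x
  proof -
    have "(1 + x\<^sup>2) * \<bar>f x\<bar> \<le> C + D" using C(1)[of x] D(1)[of x] by (simp add: algebra_simps)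
    moreover have "1 + x\<^sup>2 > 0" by (simp add: add_pos_nonneg)
    ultimately show ?thesis by (simp add: field_simps)
  qed
  then show ?thesis using that[of "C + D"] C D by auto
qed

lemma integrable_inverse_square: "integrable lborel (\<lambda>x::real. inverse (1 + x\<^sup>2))"
  using integrable_inverse_1_plus_square by (simp add: set_integrable_def einterval_def)

lemma rapid_integrable:
  assumes "rapid f" shows "integrable lborel f"
proof -
  obtain C where C: "\<And>x. \<bar>f x\<bar> \<le> C * inverse (1 + x\<^sup>2)" "C \<ge> 0" using rapid_decay[OF assms] by metis
  show ?thesis
  proof (rule Bochner_Integration.integrable_bound)
    show "integrable lborel (\<lambda>x. C * inverse (1 + x\<^sup>2))"
      by (rule integrable_mult_right[OF integrable_inverse_square])
    show "f \<in> borel_measurable lborel"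
      using assms by (simp add: rapid_def borel_measurable_continuous_onI)
    show "AE x in lborel. norm (f x) \<le> norm (C * inverse (1 + x\<^sup>2))"
      using C by (intro AE_I2) (auto intro: order_trans[OF C(1) abs_ge_self])
  qed
qed

text \<open>By translation invariance each difference quotient of \<open>F\<close> along
  \<open>b\<close> has integral 0. The majorant \<open>w\<close>, valid for all shifts up to 1,
  dominates the quotients through the mean value theorem, so the limit has integral 0 as
  well.\<close>

lemma integral_derivative_zero:
  fixes F F' :: "'a::euclidean_space \<Rightarrow> real" and b :: 'a
  assumes deriv: "\<And>x. ((\<lambda>t. F (x + t *\<^sub>R b)) has_real_derivative F' x) (at 0)"
    and F: "integrable lborel F" and F': "F' \<in> borel_measurable borel"
    and dom: "\<And>x t. \<bar>t\<bar> \<le> 1 \<Longrightarrow> \<bar>F' (x + t *\<^sub>R b)\<bar> \<le> w x" and w: "integrable lborel w"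
  shows "(\<integral>x. F' x \<partial>lborel) = 0"
proof -
  have der: "((\<lambda>t. F (x + t *\<^sub>R b)) has_real_derivative F' (x + t *\<^sub>R b)) (at t)" for x t
  proof -
    have "((\<lambda>s. F ((x + t *\<^sub>R b) + s *\<^sub>R b)) has_real_derivative F' (x + t *\<^sub>R b)) (at 0)" by (rule deriv)
    then have "((\<lambda>s. F (x + (s + t) *\<^sub>R b)) has_real_derivative F' (x + t *\<^sub>R b)) (at 0)"
      by (simp add: algebra_simps)
    then show ?thesis
      using DERIV_shift[of "\<lambda>s. F (x + s *\<^sub>R b)" "F' (x + t *\<^sub>R b)" 0 t] by simp
  qed
  define t where "t k = 1 / real (Suc k)" for k
  have t: "0 < t k" "t k \<le> 1" for k by (auto simp: t_def)
  have t0: "t \<longlonglongrightarrow> 0" unfolding t_def by (rule LIMSEQ_Suc[OF lim_1_over_n])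
  define q where "q k x = (F (x + t k *\<^sub>R b) - F x) / t k" for k x
  have sh: "integrable lborel (\<lambda>x. F (x + c))" "(\<integral>x. F (x + c) \<partial>lborel) = (\<integral>x. F x \<partial>lborel)" for c
  proof -
    have m: "F \<in> borel_measurable borel" using F by auto
    have d: "distr lborel borel ((+) c) = (lborel :: 'a measure)" by (rule lborel_distr_plus)
    have "integrable (distr lborel borel ((+) c)) F" unfolding d by (rule F)
    then show "integrable lborel (\<lambda>x. F (x + c))"
      by (subst (asm) integrable_distr_eq) (use m in \<open>simp_all add: add.commute\<close>)
    have "(\<integral>x. F x \<partial>distr lborel borel ((+) c)) = (\<integral>x. F (c + x) \<partial>lborel)"
      by (rule integral_distr) (use m in simp_all)
    then show "(\<integral>x. F (x + c) \<partial>lborel) = (\<integral>x. F x \<partial>lborel)" unfolding d by (simp add: add.commute)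
  qed
  have q0: "(\<integral>x. q k x \<partial>lborel) = 0" for k
    unfolding q_def using sh F by (simp add: Bochner_Integration.integral_diff)
  have "(\<lambda>k. \<integral>x. q k x \<partial>lborel) \<longlonglongrightarrow> (\<integral>x. F' x \<partial>lborel)"
  proof (rule integral_dominated_convergence[where w=w])
    show "F' \<in> borel_measurable lborel" using F' by simp
    show "q k \<in> borel_measurable lborel" for k
      unfolding q_def using borel_measurable_integrable[OF sh(1)[of "t k *\<^sub>R b"]] borel_measurable_integrable[OF F] by simp
    show "AE x in lborel. (\<lambda>k. q k x) \<longlonglongrightarrow> F' x"
    proof (rule AE_I2)
      fix x
      have "((\<lambda>h. (F (x + h *\<^sub>R b) - F x) / h) \<longlongrightarrow> F' x) (at 0)"
        using deriv[of x] by (simp add: DERIV_def)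
      moreover have "filterlim t (at 0) sequentially"
      proof (rule filterlim_atI[OF t0])
        show "\<forall>\<^sub>F k in sequentially. t k \<noteq> 0" using t(1) by (intro always_eventually allI) (metis less_irrefl)
      qed
      ultimately show "(\<lambda>k. q k x) \<longlonglongrightarrow> F' x" unfolding q_def by (rule filterlim_compose)
    qed
    show "AE x in lborel. norm (q k x) \<le> w x" for k
    proof (rule AE_I2)
      fix x
      obtain s where s: "0 < s" "s < t k" "F (x + t k *\<^sub>R b) - F (x + 0 *\<^sub>R b) = (t k - 0) * F' (x + s *\<^sub>R b)"
        using MVT2[of 0 "t k" "\<lambda>t. F (x + t *\<^sub>R b)" "\<lambda>s. F' (x + s *\<^sub>R b)"] der t(1) by blast
      then have "q k x = F' (x + s *\<^sub>R b)" using t(1)[of k] by (simp add: q_def)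
      moreover have "\<bar>s\<bar> \<le> 1" using s t(2)[of k] by simp
      ultimately show "norm (q k x) \<le> w x" using dom[of s x] by simp
    qed
  qed (rule w)
  then show ?thesis unfolding q0 by (simp add: LIMSEQ_const_iff)
qed

text \<open>Supplies a majorant that is uniform in shifts of size at most 1, as
  \<open>integral_derivative_zero\<close> demands.\<close>

lemma inverse_square_shift: "inverse (1 + (x + t)\<^sup>2) \<le> 3 * inverse (1 + x\<^sup>2)" if "\<bar>t\<bar> \<le> 1" for x t :: real
proof -
  have "t\<^sup>2 \<le> 1" using that by (simp add: abs_square_le_1)
  moreover have "x\<^sup>2 \<le> 2 * (x + t)\<^sup>2 + 2 * t\<^sup>2"
    using zero_le_power2[of "x + 2 * t"] by (simp add: power2_eq_square algebra_simps)
  moreover have "1 + b \<le> 3 * (1 + c)" if "a \<le> 1" "b \<le> 2 * c + 2 * a" "0 \<le> c" for a b c :: real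
    using that by simp
  ultimately have "1 + x\<^sup>2 \<le> 3 * (1 + (x + t)\<^sup>2)" using zero_le_power2[of "x + t"] by blast
  moreover have "1 + x\<^sup>2 > 0" "1 + (x + t)\<^sup>2 > 0" by (simp_all add: add_pos_nonneg)
  ultimately show ?thesis by (simp add: field_simps)
qed

lemma rapid_integral_deriv_zero:
  assumes "rapid F" "rapid F'" "\<And>x. (F has_real_derivative F' x) (at x)"
  shows "(\<integral>x. F' x \<partial>lborel) = 0"
proof -
  obtain C where C: "\<And>x. \<bar>F' x\<bar> \<le> C * inverse (1 + x\<^sup>2)" "C \<ge> 0" using rapid_decay[OF assms(2)] by metis
  show ?thesis
  proof (rule integral_derivative_zero[where F=F and b=1 and w="\<lambda>x. C * (3 * inverse (1 + x\<^sup>2))"])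
    show "((\<lambda>t. F (x + t *\<^sub>R 1)) has_real_derivative F' x) (at 0)" for x
      using DERIV_shift[of F "F' x" 0 x] assms(3)[of x] by (simp add: add.commute)
    show "\<bar>F' (x + t *\<^sub>R 1)\<bar> \<le> C * (3 * inverse (1 + x\<^sup>2))" if "\<bar>t\<bar> \<le> 1" for x t
      using order_trans[OF C(1) mult_left_mono[OF inverse_square_shift[OF that] C(2)]] by simp
    show "F' \<in> borel_measurable borel" using assms(2) by (simp add: rapid_def borel_measurable_continuous_onI)
  qed (intro integrable_mult_right integrable_inverse_square rapid_integrable assms)+
qed

section \<open>Ladder relations, orthonormality and second moments\<close>

lemma hermite_poly_rec:
  "hermite_poly (Suc n) x = 2 * x * hermite_poly n x - 2 * real n * hermite_poly (n - 1) x"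
  by (cases n) simp_all

lemma hermite_poly_deriv:
  "(hermite_poly n has_real_derivative 2 * real n * hermite_poly (n - 1) x) (at x)"
proof (induction n x rule: hermite_poly.induct)
  case (1 x)
  show ?case by (simp add: fun_eq_iff[of "hermite_poly 0"] ext[of "hermite_poly 0" "\<lambda>_. 1"])
next
  case (2 x)
  have "hermite_poly (Suc 0) = (\<lambda>x. 2 * x)" by auto
  then show ?case by (auto intro!: derivative_eq_intros)
next
  case (3 n x)
  have "((\<lambda>x. 2 * x * hermite_poly (Suc n) x - 2 * real (Suc n) * hermite_poly n x) has_real_derivative
      2 * hermite_poly (Suc n) x + 2 * x * (2 * real (Suc n) * hermite_poly n x) - 2 * real (Suc n) * (2 * real n * hermite_poly (n - 1) x)) (at x)"
    using 3 by (auto intro!: derivative_eq_intros)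
  moreover have "2 * hermite_poly (Suc n) x + 2 * x * (2 * real (Suc n) * hermite_poly n x) - 2 * real (Suc n) * (2 * real n * hermite_poly (n - 1) x)
      = 2 * real (Suc (Suc n)) * hermite_poly (Suc n) x"
    unfolding hermite_poly_rec[of n] by (simp add: algebra_simps)
  ultimately show ?case by (simp only: hermite_poly.simps diff_Suc_1 ext[of "hermite_poly (Suc (Suc n))", OF hermite_poly.simps(3)])
qed

definition hermite_const :: "nat \<Rightarrow> real" where
  "hermite_const n = sqrt (2 ^ n * fact n * sqrt pi)"

lemma hermite_const_pos: "hermite_const n > 0" by (simp add: hermite_const_def)

lemma hermite_const_neq_0 [simp]: "hermite_const n \<noteq> 0"
  using hermite_const_pos[of n] by simp

lemma hermite_const_Suc: "hermite_const (Suc n) = sqrt (2 * (real n + 1)) * hermite_const n"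
  by (simp add: hermite_const_def real_sqrt_mult[symmetric] algebra_simps)

lemma hermite_fun_alt: "hermite_fun n x = hermite_poly n x * exp (- (x\<^sup>2) / 2) / hermite_const n"
  by (simp add: hermite_fun_def hermite_const_def)

text \<open>Normalisation turns the factor \<open>2 * n\<close> of the derivative of the polynomial
  into \<open>sqrt (2 * n)\<close>. At \<open>n = 0\<close> the truncated index \<open>n - 1\<close>
  carries the coefficient 0, a convention on which all ladder relations below rely.\<close>

lemma hermite_lower: "2 * real n * hermite_poly (n - 1) x * exp (- (x\<^sup>2) / 2) / hermite_const n = sqrt (2 * real n) * hermite_fun (n - 1) x"
proof (cases n)
  case (Suc m)
  have "2 * real n = sqrt (2 * (real m + 1)) * sqrt (2 * (real m + 1))" using Suc by simp
  then show ?thesis using Suc hermite_const_pos[of m]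
    by (simp add: hermite_fun_alt hermite_const_Suc del: real_sqrt_mult_self)
qed simp

lemma hermite_raise: "sqrt (2 * (real n + 1)) * hermite_fun (Suc n) x = 2 * x * hermite_fun n x - sqrt (2 * real n) * hermite_fun (n - 1) x"
proof -
  have "sqrt (2 * (real n + 1)) * hermite_fun (Suc n) x = hermite_poly (Suc n) x * exp (- (x\<^sup>2) / 2) / hermite_const n"
    using less_imp_neq[OF hermite_const_pos[of n], symmetric] by (simp add: hermite_fun_alt hermite_const_Suc)
  also have "\<dots> = 2 * x * hermite_fun n x - 2 * real n * hermite_poly (n - 1) x * exp (- (x\<^sup>2) / 2) / hermite_const n"
    unfolding hermite_poly_rec by (simp add: hermite_fun_alt algebra_simps diff_divide_distrib)
  finally show ?thesis unfolding hermite_lower .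
qed

lemma hermite_fun_deriv:
  "(hermite_fun n has_real_derivative sqrt (2 * real n) * hermite_fun (n - 1) x - x * hermite_fun n x) (at x)"
proof -
  have "((\<lambda>x. hermite_poly n x * exp (- (x\<^sup>2) / 2) / hermite_const n) has_real_derivative
     (2 * real n * hermite_poly (n - 1) x * exp (- (x\<^sup>2) / 2) + hermite_poly n x * (exp (- (x\<^sup>2) / 2) * (- x))) / hermite_const n) (at x)"
    by (auto intro!: derivative_eq_intros hermite_poly_deriv)
  moreover have "(2 * real n * hermite_poly (n - 1) x * exp (- (x\<^sup>2) / 2) + hermite_poly n x * (exp (- (x\<^sup>2) / 2) * (- x))) / hermite_const n
     = sqrt (2 * real n) * hermite_fun (n - 1) x - x * hermite_fun n x"
    unfolding hermite_lower[symmetric] by (simp add: hermite_fun_alt add_divide_distrib diff_divide_distrib algebra_simps)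
  ultimately show ?thesis by (simp only: ext[of "hermite_fun n", OF hermite_fun_alt])
qed

lemma sqrt_half: "sqrt (2 * a) = 2 * sqrt (a / 2)"
proof -
  have "sqrt (2 * a) = sqrt (4 * (a / 2))" by simp
  also have "\<dots> = 2 * sqrt (a / 2)" by (subst real_sqrt_mult) simp
  finally show ?thesis .
qed

text \<open>The position operator as a sum of raising and lowering. Together with the formula for
  the derivative it reduces powers of \<open>x\<close> and derivatives to shifts of the
  index.\<close>

lemma hermite_times_x:
  "x * hermite_fun n x = sqrt ((real n + 1) / 2) * hermite_fun (Suc n) x + sqrt (real n / 2) * hermite_fun (n - 1) x"
  using hermite_raise[of n x] unfolding sqrt_half by simp

lemma hermite_fun_deriv':
  "(hermite_fun n has_real_derivative sqrt (real n / 2) * hermite_fun (n - 1) x - sqrt ((real n + 1) / 2) * hermite_fun (Suc n) x) (at x)"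
  using hermite_fun_deriv[of n x] unfolding sqrt_half hermite_times_x by (simp add: algebra_simps)

lemma hermite_rapid: "rapid (hermite_fun n)"
proof -
  have h0: "rapid (hermite_fun 0)"
    unfolding rapid_def
  proof (intro conjI allI)
    show "continuous_on UNIV (hermite_fun 0)"
      by (intro continuous_at_imp_continuous_on ballI DERIV_isCont[OF hermite_fun_deriv])
    fix k
    have "\<bar>x\<bar> ^ k * \<bar>hermite_fun 0 x\<bar> \<le> (1 + 2 ^ k * fact k) / hermite_const 0" for x
    proof -
      have "(x\<^sup>2 / 2) ^ k / fact k \<le> exp (x\<^sup>2 / 2)" by (rule power_exp_bound) simp
      then have "(x\<^sup>2) ^ k \<le> 2 ^ k * fact k * exp (x\<^sup>2 / 2)" by (simp add: power_divide field_simps)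
      then have 1: "(x\<^sup>2) ^ k * exp (- (x\<^sup>2) / 2) \<le> 2 ^ k * fact k"
        by (simp add: exp_minus field_simps)
      have "\<bar>x\<bar> ^ k \<le> 1 + (x\<^sup>2) ^ k"
      proof (cases "\<bar>x\<bar> \<le> 1")
        case True
        then show ?thesis using power_le_one[of "\<bar>x\<bar>" k] zero_le_power[OF zero_le_power2[of x], of k] by linarith
      next
        case False
        then have "\<bar>x\<bar> ^ k \<le> \<bar>x\<bar> ^ (2 * k)" by (intro power_increasing) auto
        then show ?thesis by (simp add: power_mult)
      qed
      then have "\<bar>x\<bar> ^ k * exp (- (x\<^sup>2) / 2) \<le> (1 + (x\<^sup>2) ^ k) * exp (- (x\<^sup>2) / 2)"
        by (intro mult_right_mono) auto
      also have "\<dots> \<le> 1 + 2 ^ k * fact k"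
        using 1 by (simp add: algebra_simps) (smt (verit) exp_le_one_iff zero_le_power2 divide_nonneg_pos)
      finally have "\<bar>x\<bar> ^ k * exp (- (x\<^sup>2) / 2) \<le> 1 + 2 ^ k * fact k" .
      then show ?thesis using hermite_const_pos[of 0] by (simp add: hermite_fun_alt abs_mult divide_right_mono)
    qed
    then show "\<exists>C. \<forall>x. \<bar>x\<bar> ^ k * \<bar>hermite_fun 0 x\<bar> \<le> C" by blast
  qed
  have eq: "hermite_fun (Suc n) = (\<lambda>x. 2 / sqrt (2 * (real n + 1)) * (x * hermite_fun n x) + (- sqrt (2 * real n) / sqrt (2 * (real n + 1))) * hermite_fun (n - 1) x)" for n
  proof
    fix x
    have "hermite_fun (Suc n) x = (2 * x * hermite_fun n x - sqrt (2 * real n) * hermite_fun (n - 1) x) / sqrt (2 * (real n + 1))"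
      unfolding hermite_raise[symmetric] by simp
    then show "hermite_fun (Suc n) x = 2 / sqrt (2 * (real n + 1)) * (x * hermite_fun n x) + (- sqrt (2 * real n) / sqrt (2 * (real n + 1))) * hermite_fun (n - 1) x"
      by (simp add: diff_divide_distrib)
  qed
  show ?thesis
  proof (induction n rule: less_induct)
    case (less n)
    show ?case
    proof (cases n)
      case (Suc m)
      then have "rapid (hermite_fun m)" "rapid (hermite_fun (m - 1))" using less by auto
      then show ?thesis unfolding Suc eq by (intro rapid_add rapid_times_x)
    qed (use h0 in simp)
  qed
qed

text \<open>In the derivative of \<open>h_n * h_m\<close> the terms with \<open>x\<close> cancel,
  and its integral 0 relates \<open>I (n - 1) m\<close> to \<open>I n (m + 1)\<close>. This
  recursion reduces every inner product to the Gaussian integral or to 0.\<close>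

lemma hermite_orthonormal: "(\<integral>x. hermite_fun n x * hermite_fun m x \<partial>lborel) = (if n = m then 1 else 0)"
proof -
  define I where "I n m = (\<integral>x. hermite_fun n x * hermite_fun m x \<partial>lborel)" for n m
  have int: "integrable lborel (\<lambda>x. hermite_fun n x * hermite_fun m x)" for n m
    by (intro rapid_integrable rapid_mult hermite_rapid)
  have step: "sqrt (2 * real n) * I (n - 1) m = sqrt (2 * (real m + 1)) * I n (Suc m)" for n m
  proof -
    define G where "G x = sqrt (2 * real n) * (hermite_fun (n - 1) x * hermite_fun m x) + (- sqrt (2 * (real m + 1))) * (hermite_fun n x * hermite_fun (Suc m) x)" for x
    have "(\<integral>x. G x \<partial>lborel) = 0"
    proof (rule rapid_integral_deriv_zero[where F="\<lambda>x. hermite_fun n x * hermite_fun m x"])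
      show "rapid G" unfolding G_def by (intro rapid_add rapid_mult hermite_rapid)
      show "rapid (\<lambda>x. hermite_fun n x * hermite_fun m x)" by (intro rapid_mult hermite_rapid)
      fix x
      have "((\<lambda>x. hermite_fun n x * hermite_fun m x) has_real_derivative
        (sqrt (2 * real n) * hermite_fun (n - 1) x - x * hermite_fun n x) * hermite_fun m x +
        (sqrt (2 * real m) * hermite_fun (m - 1) x - x * hermite_fun m x) * hermite_fun n x) (at x)"
        by (intro DERIV_mult hermite_fun_deriv)
      moreover have e: "sqrt (2 * real m) * hermite_fun (m - 1) x = 2 * x * hermite_fun m x - sqrt (2 * (real m + 1)) * hermite_fun (Suc m) x"
        using hermite_raise[of m x] by simp
      moreover have "(sqrt (2 * real n) * hermite_fun (n - 1) x - x * hermite_fun n x) * hermite_fun m x +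
        (sqrt (2 * real m) * hermite_fun (m - 1) x - x * hermite_fun m x) * hermite_fun n x = G x"
        unfolding e G_def by (simp add: algebra_simps)
      ultimately show "((\<lambda>x. hermite_fun n x * hermite_fun m x) has_real_derivative G x) (at x)" by simp
    qed
    then show ?thesis unfolding G_def I_def using int by simp
  qed
  have sym: "I n m = I m n" for n m unfolding I_def by (simp add: mult.commute)
  have I0: "I 0 (Suc m) = 0" for m
  proof -
    have "sqrt (2 * (real m + 1)) * I 0 (Suc m) = 0" using step[of 0 m] by simp
    then show ?thesis by (simp add: add_eq_0_iff)
  qed
  have I00: "I 0 0 = 1"
  proof -
    have "(\<lambda>x. hermite_fun 0 x * hermite_fun 0 x) = normal_density 0 (1 / sqrt 2)"
    proof
      fix x :: real
      have "hermite_fun 0 x * hermite_fun 0 x = exp (- (x\<^sup>2) / 2) * exp (- (x\<^sup>2) / 2) / (sqrt (sqrt pi) * sqrt (sqrt pi))"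
        by (simp add: hermite_fun_def)
      also have "\<dots> = exp (- (x\<^sup>2)) / sqrt pi" by (simp add: exp_add[symmetric])
      also have "\<dots> = normal_density 0 (1 / sqrt 2) x" by (simp add: normal_density_def power_divide)
      finally show "hermite_fun 0 x * hermite_fun 0 x = normal_density 0 (1 / sqrt 2) x" .
    qed
    then show ?thesis unfolding I_def by (simp add: integral_normal_density)
  qed
  have "I n m = (if n = m then 1 else 0)"
  proof (induction m arbitrary: n)
    case 0
    show ?case using I0 I00 sym by (cases n) auto
  next
    case (Suc m)
    show ?case
    proof (cases n)
      case (Suc n')
      have "sqrt (2 * (real m + 1)) * I n (Suc m) = sqrt (2 * real n) * (if n' = m then 1 else 0)"
        using step[of n m] Suc.IH[of n'] Suc by simp
      then have "sqrt (2 * (real m + 1)) * I n (Suc m) = sqrt (2 * (real m + 1)) * (if n' = m then 1 else 0)"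
        using Suc by (simp add: add.commute split: if_splits)
      then have "I n (Suc m) = (if n' = m then 1 else 0)"
        by (simp add: add_eq_0_iff split: if_splits)
      then show ?thesis using Suc by simp
    qed (simp add: I0)
  qed
  then show ?thesis unfolding I_def .
qed

text \<open>Squaring the ladder form of \<open>x * h_n\<close> and integrating leaves only the
  diagonal coefficients \<open>(n + 1) / 2\<close> and \<open>n / 2\<close>.\<close>

lemma hermite_second_moment: "(\<integral>x. x\<^sup>2 * (hermite_fun n x)\<^sup>2 \<partial>lborel) = real n + 1 / 2"
proof -
  have int: "integrable lborel (\<lambda>x. hermite_fun n x * hermite_fun m x)" for n m
    by (intro rapid_integrable rapid_mult hermite_rapid)
  have e: "x\<^sup>2 * (hermite_fun n x)\<^sup>2 = (real n + 1) / 2 * (hermite_fun (Suc n) x * hermite_fun (Suc n) x)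
     + (2 * (sqrt ((real n + 1) / 2) * sqrt (real n / 2)) * (hermite_fun (Suc n) x * hermite_fun (n - 1) x)
     + real n / 2 * (hermite_fun (n - 1) x * hermite_fun (n - 1) x))" for x
  proof -
    have "x\<^sup>2 * (hermite_fun n x)\<^sup>2 = (x * hermite_fun n x)\<^sup>2" by (simp add: power_mult_distrib)
    also have "\<dots> = (sqrt ((real n + 1) / 2))\<^sup>2 * (hermite_fun (Suc n) x * hermite_fun (Suc n) x)
     + (2 * (sqrt ((real n + 1) / 2) * sqrt (real n / 2)) * (hermite_fun (Suc n) x * hermite_fun (n - 1) x)
     + (sqrt (real n / 2))\<^sup>2 * (hermite_fun (n - 1) x * hermite_fun (n - 1) x))"
      unfolding hermite_times_x by (simp only: power2_eq_square) (simp only: algebra_simps)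
    finally show ?thesis by (simp only: real_sqrt_pow2_iff[THEN iffD2] of_nat_0_le_iff divide_nonneg_nonneg add_nonneg_nonneg zero_le_one zero_le_numeral)
  qed
  show ?thesis unfolding e using int by (simp add: hermite_orthonormal) (auto simp: field_simps)
qed

section \<open>Derivatives of Hermite functions and bounds polynomial in the index\<close>

fun hermite_diff :: "nat \<Rightarrow> nat \<Rightarrow> real \<Rightarrow> real" where
  "hermite_diff 0 n x = hermite_fun n x"
| "hermite_diff (Suc j) n x = sqrt (real n / 2) * hermite_diff j (n - 1) x - sqrt ((real n + 1) / 2) * hermite_diff j (Suc n) x"

lemma hermite_diff_deriv: "(hermite_diff j n has_real_derivative hermite_diff (Suc j) n x) (at x)"
proof (induction j arbitrary: n)
  case 0
  have "hermite_diff 0 n = hermite_fun n" by auto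
  then show ?case using hermite_fun_deriv'[of n x] by simp
next
  case (Suc j)
  have "hermite_diff (Suc j) n = (\<lambda>x. sqrt (real n / 2) * hermite_diff j (n - 1) x - sqrt ((real n + 1) / 2) * hermite_diff j (Suc n) x)"
    by auto
  then show ?case
    by (simp only: hermite_diff.simps(2)[of "Suc j"]) (intro DERIV_diff DERIV_cmult Suc.IH)
qed

text \<open>Hermite's differential equation, from the two ladder expressions of the first
  derivative; the oscillator eigenvalues \<open>2 * n + 1\<close> originate here.\<close>

lemma hermite_diff_2: "hermite_diff 2 n x = (x\<^sup>2 - (2 * real n + 1)) * hermite_fun n x"
proof -
  have d1: "hermite_diff 1 k x = 2 * (sqrt (real k / 2) * hermite_fun (k - 1) x) - x * hermite_fun k x"
    "hermite_diff 1 k x = x * hermite_fun k x - 2 * (sqrt ((real k + 1) / 2) * hermite_fun (Suc k) x)" for k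
    using hermite_times_x[of x k] by simp_all
  have a: "sqrt (real n / 2) * hermite_diff 1 (n - 1) x = x * (sqrt (real n / 2) * hermite_fun (n - 1) x) - real n * hermite_fun n x"
  proof (cases n)
    case (Suc m)
    have "sqrt (real n / 2) * hermite_diff 1 m x = x * (sqrt (real n / 2) * hermite_fun m x) - 2 * (sqrt (real n / 2) * sqrt (real n / 2)) * hermite_fun n x"
      unfolding d1(2)[of m] using Suc by (simp add: algebra_simps)
    then show ?thesis using Suc by simp
  qed simp
  have b: "sqrt ((real n + 1) / 2) * hermite_diff 1 (Suc n) x = (real n + 1) * hermite_fun n x - x * (sqrt ((real n + 1) / 2) * hermite_fun (Suc n) x)"
  proof -
    have "sqrt ((real n + 1) / 2) * hermite_diff 1 (Suc n) x = 2 * (sqrt ((real n + 1) / 2) * sqrt ((real n + 1) / 2)) * hermite_fun n x - x * (sqrt ((real n + 1) / 2) * hermite_fun (Suc n) x)"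
      unfolding d1(1)[of "Suc n"] by (simp add: algebra_simps)
    then show ?thesis by (simp add: add_nonneg_nonneg)
  qed
  have "hermite_diff 2 n x = sqrt (real n / 2) * hermite_diff 1 (n - 1) x - sqrt ((real n + 1) / 2) * hermite_diff 1 (Suc n) x"
    by (simp add: numeral_2_eq_2)
  also have "\<dots> = x * (x * hermite_fun n x) - (2 * real n + 1) * hermite_fun n x"
    unfolding a b hermite_times_x by (simp add: algebra_simps)
  finally show ?thesis by (simp add: power2_eq_square algebra_simps)
qed


lemma rapid_sup_bound:
  assumes F: "rapid F" "rapid F'" "\<And>x. (F has_real_derivative F' x) (at x)"
  shows "\<bar>F x\<bar> \<le> (\<integral>x. \<bar>F' x\<bar> \<partial>lborel)"
proof (rule field_le_epsilon)
  fix e :: real assume e: "e > 0"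
  obtain C where C: "\<And>x. \<bar>x\<bar> ^ 1 * \<bar>F x\<bar> \<le> C" "C \<ge> 0" using rapidE[OF F(1)] by metis
  \<comment> \<open>Far enough to the left for decay to force \<open>|F y| \<le> e\<close>; the rest
    is the fundamental theorem of calculus on \<open>[y, x]\<close>.\<close>
  define y where "y = min x (- (C / e) - 1)"
  have y: "y \<le> x" "\<bar>y\<bar> \<ge> C / e" "\<bar>y\<bar> > 0"
    using divide_nonneg_pos[OF C(2) e] unfolding y_def by linarith+
  have "C \<le> \<bar>y\<bar> * e" using y(2) e by (simp add: field_simps)
  then have "\<bar>y\<bar> * \<bar>F y\<bar> \<le> \<bar>y\<bar> * e" using C(1)[of y] by simp
  then have Fy: "\<bar>F y\<bar> \<le> e" using y(3) by simp
  have "(\<integral>z. F' z * indicator {y..x} z \<partial>lborel) = F x - F y"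
    using F(2) by (intro integral_FTC_Icc_real[OF y(1) F(3)]) (simp add: rapid_def continuous_on_eq_continuous_at)
  moreover have "\<bar>\<integral>z. F' z * indicator {y..x} z \<partial>lborel\<bar> \<le> (\<integral>z. \<bar>F' z\<bar> \<partial>lborel)"
  proof -
    have i: "integrable lborel (\<lambda>z. F' z * indicator {y..x} z)"
      by (rule Bochner_Integration.integrable_bound[OF rapid_integrable[OF F(2)]])
         (use rapid_integrable[OF F(2)] in \<open>auto simp: indicator_def\<close>)
    have "\<bar>\<integral>z. F' z * indicator {y..x} z \<partial>lborel\<bar> \<le> (\<integral>z. \<bar>F' z * indicator {y..x} z\<bar> \<partial>lborel)"
      using integral_norm_bound[of lborel "\<lambda>z. F' z * indicator {y..x} z"] by simp
    also have "\<dots> \<le> (\<integral>z. \<bar>F' z\<bar> \<partial>lborel)"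
      using i rapid_integrable[OF F(2)] by (intro integral_mono) (auto simp: indicator_def)
    finally show ?thesis .
  qed
  ultimately show "\<bar>F x\<bar> \<le> (\<integral>x. \<bar>F' x\<bar> \<partial>lborel) + e" using Fy by linarith
qed

lemma hermite_diff_rapid: "rapid (hermite_diff j n)"
proof (induction j arbitrary: n)
  case 0
  have "hermite_diff 0 n = hermite_fun n" by auto
  then show ?case using hermite_rapid by simp
next
  case (Suc j)
  have "hermite_diff (Suc j) n = (\<lambda>x. sqrt (real n / 2) * hermite_diff j (n - 1) x + (- sqrt ((real n + 1) / 2)) * hermite_diff j (Suc n) x)"
    by auto
  then show ?case by (simp only: rapid_add Suc.IH)
qed

text \<open>The square of \<open>h\<close> is at most the integral of \<open>|2 * h * h'|\<close>,
  hence of \<open>h^2 + h'^2\<close>, which the ladder relation bounds through second moments. The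
  constant 7 is crude; only polynomial growth in \<open>n\<close> matters.\<close>

lemma hermite_sup_bound: "\<bar>hermite_fun n x\<bar> \<le> 7 * (real n + 1)"
proof -
  let ?h = "hermite_fun n" and ?k = "hermite_fun (Suc n)" and ?d = "hermite_diff 1 n"
  have int: "integrable lborel (\<lambda>x. hermite_fun n x * hermite_fun n x)" for n
    by (intro rapid_integrable rapid_mult hermite_rapid)
  have int2: "integrable lborel (\<lambda>x. x\<^sup>2 * (?h x)\<^sup>2)"
  proof -
    have "rapid (\<lambda>x. x * (x * (?h x * ?h x)))" by (intro rapid_times_x rapid_mult hermite_rapid)
    then show ?thesis using rapid_integrable by (simp add: power2_eq_square mult_ac)
  qed
  have D: "rapid (\<lambda>x. ?d x * ?h x + ?d x * ?h x)"
    using rapid_add[OF rapid_mult[OF hermite_diff_rapid hermite_rapid] rapid_mult[OF hermite_diff_rapid hermite_rapid], where a=1 and b=1]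
    by (simp only: mult_1)
  have "\<bar>?h x * ?h x\<bar> \<le> (\<integral>x. \<bar>?d x * ?h x + ?d x * ?h x\<bar> \<partial>lborel)"
  proof (rule rapid_sup_bound[OF rapid_mult[OF hermite_rapid hermite_rapid] D])
    have "hermite_diff 0 n = ?h" by auto
    then have "(?h has_real_derivative ?d x) (at x)" for x using hermite_diff_deriv[of 0 n x] by simp
    then show "((\<lambda>x. ?h x * ?h x) has_real_derivative ?d x * ?h x + ?d x * ?h x) (at x)" for x
      by (intro DERIV_mult)
  qed
  also have "\<dots> \<le> (\<integral>x. ?h x * ?h x + (2 * (x\<^sup>2 * (?h x)\<^sup>2) + 4 * (real n + 1) * (?k x * ?k x)) \<partial>lborel)"
  proof (rule integral_mono)
    show "integrable lborel (\<lambda>x. \<bar>?d x * ?h x + ?d x * ?h x\<bar>)"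
      using rapid_integrable[OF D] by (rule integrable_abs)
    show "integrable lborel (\<lambda>x. ?h x * ?h x + (2 * (x\<^sup>2 * (?h x)\<^sup>2) + 4 * (real n + 1) * (?k x * ?k x)))"
      by (intro Bochner_Integration.integrable_add integrable_mult_right int int2)
    fix x :: real
    have d: "?d x = x * ?h x - 2 * (sqrt ((real n + 1) / 2) * ?k x)"
      using hermite_times_x[of x n] by simp
    have sq: "(2 * (sqrt ((real n + 1) / 2) * ?k x))\<^sup>2 = 2 * (real n + 1) * (?k x * ?k x)"
      by (simp add: power_mult_distrib power2_eq_square[of "?k x"])
    have "(a - b)\<^sup>2 \<le> 2 * a\<^sup>2 + 2 * b\<^sup>2" for a b :: real
      using zero_le_power2[of "a + b"] by (simp add: power2_eq_square algebra_simps)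
    from this[of "x * ?h x" "2 * (sqrt ((real n + 1) / 2) * ?k x)"]
    have "(?d x)\<^sup>2 \<le> 2 * (x * ?h x)\<^sup>2 + 2 * (2 * (real n + 1) * (?k x * ?k x))"
      unfolding d sq .
    moreover have "\<bar>a * b + a * b\<bar> \<le> b * b + a\<^sup>2" for a b :: real
      using zero_le_power2[of "a + b"] zero_le_power2[of "a - b"] by (simp add: power2_eq_square algebra_simps abs_le_iff)
    then have "\<bar>?d x * ?h x + ?d x * ?h x\<bar> \<le> ?h x * ?h x + (?d x)\<^sup>2" .
    moreover have "2 * (x * ?h x)\<^sup>2 + 2 * (2 * (real n + 1) * (?k x * ?k x)) = 2 * (x\<^sup>2 * (?h x)\<^sup>2) + 4 * (real n + 1) * (?k x * ?k x)"
      by (simp add: power_mult_distrib)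
    ultimately show "\<bar>?d x * ?h x + ?d x * ?h x\<bar> \<le> ?h x * ?h x + (2 * (x\<^sup>2 * (?h x)\<^sup>2) + 4 * (real n + 1) * (?k x * ?k x))"
      by linarith
  qed
  also have "\<dots> = 1 + (2 * (real n + 1 / 2) + 4 * (real n + 1))"
    using int int2 by (simp add: hermite_orthonormal hermite_second_moment)
  also have "\<dots> \<le> 7 * (real n + 1)" by simp
  finally have "\<bar>?h x\<bar> * \<bar>?h x\<bar> \<le> 7 * (real n + 1)" by (simp add: abs_mult)
  also have "\<dots> \<le> (7 * (real n + 1)) * (7 * (real n + 1))"
    using mult_left_mono[of 1 "7 * (real n + 1)" "7 * (real n + 1)"] by simp
  finally have "(\<bar>?h x\<bar>)\<^sup>2 \<le> (7 * (real n + 1))\<^sup>2" by (simp only: power2_eq_square)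
  then show ?thesis by (rule power2_le_imp_le) simp
qed

definition poly_bounded :: "(nat \<Rightarrow> real \<Rightarrow> real) \<Rightarrow> bool" where
  "poly_bounded g \<longleftrightarrow> (\<exists>C m. C \<ge> 0 \<and> (\<forall>n x. \<bar>g n x\<bar> \<le> C * (real n + 1) ^ m))"

lemma poly_bounded_raise:
  assumes "poly_bounded g" shows "poly_bounded (\<lambda>n x. sqrt ((real n + 1) / 2) * g (Suc n) x)"
proof -
  obtain C m where C: "C \<ge> 0" "\<And>n x. \<bar>g n x\<bar> \<le> C * (real n + 1) ^ m"
    using assms unfolding poly_bounded_def by blast
  have "\<bar>sqrt ((real n + 1) / 2) * g (Suc n) x\<bar> \<le> (C * 2 ^ m) * (real n + 1) ^ Suc m" for n x
  proof -
    have "sqrt ((real n + 1) / 2) \<le> real n + 1"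
      by (rule real_le_lsqrt) (simp_all add: power2_eq_square algebra_simps)
    moreover have "\<bar>g (Suc n) x\<bar> \<le> C * (2 * (real n + 1)) ^ m"
      using C(2)[of "Suc n" x] by (rule order_trans) (intro mult_left_mono power_mono C(1), auto)
    ultimately have "sqrt ((real n + 1) / 2) * \<bar>g (Suc n) x\<bar> \<le> (real n + 1) * (C * (2 * (real n + 1)) ^ m)"
      by (intro mult_mono) auto
    then show ?thesis unfolding power_mult_distrib by (simp add: abs_mult mult_ac)
  qed
  then show ?thesis unfolding poly_bounded_def using C(1) by (intro exI[of _ "C * 2 ^ m"] exI[of _ "Suc m"]) simp
qed

lemma poly_bounded_lower:
  assumes "poly_bounded g" shows "poly_bounded (\<lambda>n x. sqrt (real n / 2) * g (n - 1) x)"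
proof -
  obtain C m where C: "C \<ge> 0" "\<And>n x. \<bar>g n x\<bar> \<le> C * (real n + 1) ^ m"
    using assms unfolding poly_bounded_def by blast
  have "\<bar>sqrt (real n / 2) * g (n - 1) x\<bar> \<le> C * (real n + 1) ^ Suc m" for n x
  proof -
    have "sqrt (real n / 2) \<le> real n + 1"
      by (rule real_le_lsqrt) (simp_all add: power2_eq_square algebra_simps)
    moreover have "\<bar>g (n - 1) x\<bar> \<le> C * (real n + 1) ^ m"
      using C(2)[of "n - 1" x] by (rule order_trans) (intro mult_left_mono power_mono C(1), auto)
    ultimately have "sqrt (real n / 2) * \<bar>g (n - 1) x\<bar> \<le> (real n + 1) * (C * (real n + 1) ^ m)"
      by (intro mult_mono) auto
    then show ?thesis by (simp add: abs_mult mult_ac)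
  qed
  then show ?thesis unfolding poly_bounded_def using C(1) by blast
qed

lemma poly_bounded_add:
  assumes "poly_bounded f" "poly_bounded g" "\<And>n x. \<bar>k n x\<bar> \<le> \<bar>f n x\<bar> + \<bar>g n x\<bar>"
  shows "poly_bounded k"
proof -
  obtain C m where C: "C \<ge> 0" "\<And>n x. \<bar>f n x\<bar> \<le> C * (real n + 1) ^ m"
    using assms(1) unfolding poly_bounded_def by blast
  obtain D l where D: "D \<ge> 0" "\<And>n x. \<bar>g n x\<bar> \<le> D * (real n + 1) ^ l"
    using assms(2) unfolding poly_bounded_def by blast
  have "\<bar>k n x\<bar> \<le> (C + D) * (real n + 1) ^ (m + l)" for n x
  proof -
    have "\<bar>f n x\<bar> \<le> C * (real n + 1) ^ (m + l)"
      using C(2) by (rule order_trans) (intro mult_left_mono power_increasing C(1), auto)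
    moreover have "\<bar>g n x\<bar> \<le> D * (real n + 1) ^ (m + l)"
      using D(2) by (rule order_trans) (intro mult_left_mono power_increasing D(1), auto)
    ultimately show ?thesis using assms(3)[of n x] by (simp add: distrib_right)
  qed
  then show ?thesis unfolding poly_bounded_def using C(1) D(1) by (intro exI[of _ "C + D"] exI[of _ "m + l"]) simp
qed

text \<open>Multiplication by \<open>x\<close> and differentiation both act as index shifts with
  coefficients of order \<open>sqrt n\<close>, so each preserves bounds that are uniform in
  \<open>x\<close> and polynomial in \<open>n\<close>.\<close>

lemma hermite_diff_power_poly_bounded: "poly_bounded (\<lambda>n x. x ^ k * hermite_diff j n x)"
proof (induction j)
  case 0
  show ?case
  proof (induction k)
    case 0
    show ?case unfolding poly_bounded_def using hermite_sup_bound
      by (intro exI[of _ 7] exI[of _ 1]) simp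
  next
    case (Suc k)
    show ?case
    proof (rule poly_bounded_add[OF poly_bounded_raise[OF Suc.IH] poly_bounded_lower[OF Suc.IH]])
      fix n and x :: real
      have "x ^ Suc k * hermite_diff 0 n x = x ^ k * (x * hermite_fun n x)" by simp
      also have "\<dots> = sqrt ((real n + 1) / 2) * (x ^ k * hermite_diff 0 (Suc n) x) + sqrt (real n / 2) * (x ^ k * hermite_diff 0 (n - 1) x)"
        unfolding hermite_times_x by (simp add: algebra_simps)
      finally show "\<bar>x ^ Suc k * hermite_diff 0 n x\<bar> \<le> \<bar>sqrt ((real n + 1) / 2) * (x ^ k * hermite_diff 0 (Suc n) x)\<bar> + \<bar>sqrt (real n / 2) * (x ^ k * hermite_diff 0 (n - 1) x)\<bar>"
        using abs_triangle_ineq by simp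
    qed
  qed
next
  case (Suc j)
  show ?case
  proof (rule poly_bounded_add[OF poly_bounded_raise[OF Suc.IH] poly_bounded_lower[OF Suc.IH]])
    fix n and x :: real
    have "x ^ k * hermite_diff (Suc j) n x = sqrt (real n / 2) * (x ^ k * hermite_diff j (n - 1) x) - sqrt ((real n + 1) / 2) * (x ^ k * hermite_diff j (Suc n) x)"
      by (simp add: algebra_simps)
    then show "\<bar>x ^ k * hermite_diff (Suc j) n x\<bar> \<le> \<bar>sqrt ((real n + 1) / 2) * (x ^ k * hermite_diff j (Suc n) x)\<bar> + \<bar>sqrt (real n / 2) * (x ^ k * hermite_diff j (n - 1) x)\<bar>"
      by linarith
  qed
qed

lemma hermite_diff_weighted_bound:
  "\<exists>C m. C \<ge> 0 \<and> (\<forall>n x. (1 + \<bar>x\<bar>) ^ k * \<bar>hermite_diff j n x\<bar> \<le> C * (real n + 1) ^ m)"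
proof -
  have "poly_bounded (\<lambda>n x. (1 + \<bar>x\<bar>) ^ k * hermite_diff j n x / 2 ^ k)"
  proof (rule poly_bounded_add[OF hermite_diff_power_poly_bounded[of 0 j] hermite_diff_power_poly_bounded[of k j]])
    fix n and x :: real
    have "(1 + \<bar>x\<bar>) ^ k \<le> (2 * max 1 \<bar>x\<bar>) ^ k" by (intro power_mono) auto
    also have "\<dots> = 2 ^ k * max 1 \<bar>x\<bar> ^ k" by (simp add: power_mult_distrib)
    also have "max 1 \<bar>x\<bar> ^ k \<le> 1 + \<bar>x\<bar> ^ k" by (auto simp: max_def)
    finally have "(1 + \<bar>x\<bar>) ^ k / 2 ^ k \<le> 1 + \<bar>x\<bar> ^ k" by (simp add: pos_divide_le_eq mult.commute)
    then have "(1 + \<bar>x\<bar>) ^ k / 2 ^ k * \<bar>hermite_diff j n x\<bar> \<le> (1 + \<bar>x\<bar> ^ k) * \<bar>hermite_diff j n x\<bar>"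
      by (rule mult_right_mono) simp
    then show "\<bar>(1 + \<bar>x\<bar>) ^ k * hermite_diff j n x / 2 ^ k\<bar> \<le> \<bar>x ^ 0 * hermite_diff j n x\<bar> + \<bar>x ^ k * hermite_diff j n x\<bar>"
      by (simp add: abs_mult power_abs algebra_simps)
  qed
  then obtain C m where C: "C \<ge> 0" "\<And>n x. \<bar>(1 + \<bar>x\<bar>) ^ k * hermite_diff j n x / 2 ^ k\<bar> \<le> C * (real n + 1) ^ m"
    unfolding poly_bounded_def by blast
  have "(1 + \<bar>x\<bar>) ^ k * \<bar>hermite_diff j n x\<bar> \<le> (2 ^ k * C) * (real n + 1) ^ m" for n x
    using C(2)[of x n] by (simp add: abs_mult field_simps)
  then show ?thesis using C(1) by (intro exI[of _ "2 ^ k * C"] exI[of _ m]) simp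
qed

section \<open>Indicators as bounded limits of Hermite functions\<close>

definition hermite_base :: "(real \<Rightarrow> complex) set" where
  "hermite_base = range (\<lambda>n x. complex_of_real (hermite_fun n x))"

lemma hermite_base_measurable: "u \<in> hermite_base \<Longrightarrow> u \<in> borel_measurable borel"
  and hermite_base_bounded: "u \<in> hermite_base \<Longrightarrow> \<exists>C. \<forall>x. cmod (u x) \<le> C"
proof -
  assume "u \<in> hermite_base"
  then obtain n where u: "u = (\<lambda>x. complex_of_real (hermite_fun n x))" by (auto simp: hermite_base_def)
  have "continuous_on UNIV (hermite_fun n)" using hermite_rapid by (simp add: rapid_def)
  then have "hermite_fun n \<in> borel_measurable borel" by (rule borel_measurable_continuous_onI)
  then show "u \<in> borel_measurable borel" unfolding u by simp
  show "\<exists>C. \<forall>x. cmod (u x) \<le> C" unfolding u using hermite_sup_bound by auto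
qed

lemma hermite_closure_power:
  "bp_closure hermite_base (\<lambda>x. of_real (x ^ k * hermite_fun n x))"
proof (induction k arbitrary: n)
  case 0
  show ?case by (auto intro!: bp_closure.base simp: hermite_base_def)
next
  case (Suc k)
  have "x ^ Suc k * hermite_fun n x = sqrt ((real n + 1) / 2) * (x ^ k * hermite_fun (Suc n) x) + sqrt (real n / 2) * (x ^ k * hermite_fun (n - 1) x)" for x
  proof -
    have "x ^ Suc k * hermite_fun n x = x ^ k * (x * hermite_fun n x)" by simp
    then show ?thesis unfolding hermite_times_x by (simp add: algebra_simps)
  qed
  then show ?case
    using bp_closure.lincomb[OF Suc.IH[of "Suc n"] Suc.IH[of "n - 1"], of "of_real (sqrt ((real n + 1) / 2))" "of_real (sqrt (real n / 2))"]
    by simp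
qed

text \<open>The exponential series is multiplied by the Gaussian \<open>hermite_fun 0\<close>. Since
  \<open>|t * x| - x^2 / 2 \<le> t^2 / 2\<close>, the partial sums are bounded uniformly in
  \<open>x\<close>, which the closure requires.\<close>

lemma hermite_closure_cis: "bp_closure hermite_base (\<lambda>x. of_real (hermite_fun 0 x) * cis (t * x))"
proof (rule bp_closure.lim[where U="\<lambda>N x. \<Sum>k<N. ((\<i> * of_real t) ^ k / fact k) * of_real (x ^ k * hermite_fun 0 x)"])
  show "bp_closure hermite_base (\<lambda>x. \<Sum>k<N. ((\<i> * of_real t) ^ k / fact k) * of_real (x ^ k * hermite_fun 0 x))" for N
    by (rule bp_closure_sum[OF _ bp_closure_scale[OF hermite_closure_power] hermite_closure_power]) simp
  have eq: "(\<Sum>k<N. ((\<i> * of_real t) ^ k / fact k) * of_real (x ^ k * hermite_fun 0 x))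
     = of_real (hermite_fun 0 x) * (\<Sum>k<N. (\<i> * of_real (t * x)) ^ k /\<^sub>R fact k)" for N x
    by (simp add: sum_distrib_left scaleR_conv_of_real divide_inverse power_mult_distrib mult_ac)
  show "cmod (\<Sum>k<N. ((\<i> * of_real t) ^ k / fact k) * of_real (x ^ k * hermite_fun 0 x)) \<le> exp (t\<^sup>2 / 2) / hermite_const 0" for N x
  proof -
    have "cmod (\<Sum>k<N. (\<i> * of_real (t * x)) ^ k /\<^sub>R fact k) \<le> (\<Sum>k<N. \<bar>t * x\<bar> ^ k /\<^sub>R fact k)"
      by (rule sum_norm_le) (simp add: norm_power norm_mult abs_mult)
    also have "\<dots> \<le> exp \<bar>t * x\<bar>"
    proof -
      have s: "(\<lambda>k. \<bar>t * x\<bar> ^ k /\<^sub>R fact k) sums exp \<bar>t * x\<bar>" by (rule exp_converges)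
      have "(\<Sum>k<N. \<bar>t * x\<bar> ^ k /\<^sub>R fact k) \<le> (\<Sum>k. \<bar>t * x\<bar> ^ k /\<^sub>R fact k)"
        by (rule sum_le_suminf[OF sums_summable[OF s]]) auto
      then show ?thesis using sums_unique[OF s] by simp
    qed
    finally have "cmod (\<Sum>k<N. (\<i> * of_real (t * x)) ^ k /\<^sub>R fact k) \<le> exp \<bar>t * x\<bar>" .
    then have "cmod (of_real (hermite_fun 0 x) * (\<Sum>k<N. (\<i> * of_real (t * x)) ^ k /\<^sub>R fact k)) \<le> \<bar>hermite_fun 0 x\<bar> * exp \<bar>t * x\<bar>"
      unfolding norm_mult by (intro mult_mono) auto
    also have "\<dots> = exp (\<bar>t * x\<bar> - x\<^sup>2 / 2) / hermite_const 0"
    proof -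
      have "exp (\<bar>t * x\<bar> - x\<^sup>2 / 2) = exp (- (x\<^sup>2) / 2) * exp \<bar>t * x\<bar>"
        unfolding exp_add[symmetric] by simp
      then show ?thesis using hermite_const_pos[of 0] by (simp add: hermite_fun_alt)
    qed
    also have "\<dots> \<le> exp (t\<^sup>2 / 2) / hermite_const 0"
    proof -
      have "\<bar>t * x\<bar> - x\<^sup>2 / 2 \<le> t\<^sup>2 / 2"
        using zero_le_power2[of "\<bar>t\<bar> - \<bar>x\<bar>"] by (simp add: abs_mult power2_diff)
      then show ?thesis using hermite_const_pos[of 0] by (intro divide_right_mono) auto
    qed
    finally show ?thesis unfolding eq .
  qed
  show "(\<lambda>N. \<Sum>k<N. ((\<i> * of_real t) ^ k / fact k) * of_real (x ^ k * hermite_fun 0 x)) \<longlonglongrightarrow> of_real (hermite_fun 0 x) * cis (t * x)" for x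
  proof -
    have "(\<lambda>k. (\<i> * of_real (t * x)) ^ k /\<^sub>R fact k) sums exp (\<i> * of_real (t * x))" by (rule exp_converges)
    then show ?thesis unfolding eq sums_def cis_conv_exp by (intro tendsto_intros)
  qed
qed

text \<open>Chains the two closures: indicators lie in the closure of the exponentials, and
  multiplication by the Gaussian sends exponentials into the Hermite closure.\<close>

lemma hermite_closure_indicator:
  assumes "A \<in> sets borel"
  shows "bp_closure hermite_base (\<lambda>x. of_real (hermite_fun 0 x) * indicator A x)"
proof (rule bp_closure_mult_right[OF trig_indicator[OF assms]])
  show "bp_closure hermite_base (\<lambda>x. of_real (hermite_fun 0 x) * v x)" if "v \<in> trig" for v
    using that hermite_closure_cis by (auto simp: trig_def)
  show "cmod (of_real (hermite_fun 0 x)) \<le> 7 * (real 0 + 1)" for x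
    using hermite_sup_bound[of 0 x] by simp
qed

section \<open>Schwartz functions\<close>

lemma bij_axis_Basis: "bij_betw (\<lambda>i. axis i (1::real)) (UNIV :: 'n::finite set) (Basis :: (real^'n) set)"
  by (auto simp: bij_betw_def inj_on_def axis_eq_axis Basis_vec_def)

text \<open>Lebesgue measure on the vector type is the image of a product measure over
  \<open>Basis\<close>, so the index type is transported to the axis vectors before Fubini is
  applied.\<close>

lemma vec_integral_prod:
  fixes u :: "'n::finite \<Rightarrow> real \<Rightarrow> real"
  assumes int: "\<And>i. integrable lborel (u i)"
  shows "integrable lborel (\<lambda>x::real^'n. \<Prod>i\<in>UNIV. u i (x $ i))" (is ?i)
    and "(\<integral>x. (\<Prod>i\<in>UNIV. u i ((x::real^'n) $ i)) \<partial>lborel) = (\<Prod>i\<in>UNIV. \<integral>x. u i x \<partial>lborel)" (is ?e)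
proof -
  define idx :: "real^'n \<Rightarrow> 'n" where "idx = the_inv_into UNIV (\<lambda>i. axis i 1)"
  have idx: "idx (axis i 1) = i" for i
    unfolding idx_def by (rule the_inv_into_f_f) (auto simp: inj_on_def axis_eq_axis)
  define f where "f b = u (idx b)" for b
  have reindex: "(\<Prod>i\<in>UNIV. c i) = (\<Prod>b\<in>Basis. c (idx b))" for c :: "'n \<Rightarrow> real"
    using prod.reindex_bij_betw[OF bij_axis_Basis, of "\<lambda>b. c (idx b)"] by (simp add: idx)
  have prod_eq: "(\<Prod>i\<in>UNIV. u i (x $ i)) = (\<Prod>b\<in>Basis. f b (x \<bullet> b))" for x :: "real^'n"
    using prod.reindex_bij_betw[OF bij_axis_Basis, of "\<lambda>b. f b (x \<bullet> b)"] by (simp add: idx f_def inner_axis)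
  interpret product_sigma_finite "\<lambda>_::real^'n. lborel :: real measure" ..
  let ?P = "Pi\<^sub>M (Basis :: (real^'n) set) (\<lambda>_. lborel :: real measure)"
  have T: "(\<lambda>f. \<Sum>b\<in>Basis. f b *\<^sub>R b) \<in> measurable ?P (borel :: (real^'n) measure)" by simp
  have fm: "f b \<in> borel_measurable borel" for b using borel_measurable_integrable[OF int] by (simp add: f_def)
  have pm: "(\<lambda>x. \<Prod>b\<in>Basis. f b (x \<bullet> b)) \<in> borel_measurable (borel :: (real^'n) measure)"
    using fm by (intro borel_measurable_prod measurable_compose[OF _ fm]) simp
  have comp: "(\<Prod>b\<in>Basis. f b ((\<Sum>b\<in>Basis. g b *\<^sub>R b) \<bullet> b)) = (\<Prod>b\<in>Basis. f b (g b))" for g :: "real^'n \<Rightarrow> real"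
    by (intro prod.cong refl) simp
  have "integrable ?P (\<lambda>g. \<Prod>b\<in>Basis. f b (g b))"
    by (rule product_integrable_prod) (simp_all add: f_def int)
  then show ?i unfolding prod_eq lborel_eq[where 'a="real^'n"]
    by (subst integrable_distr_eq[OF T pm]) (simp add: comp)
  have "(\<integral>g. (\<Prod>b\<in>Basis. f b (g b)) \<partial>?P) = (\<Prod>b\<in>Basis. \<integral>x. f b x \<partial>lborel)"
    by (rule product_integral_prod) (simp_all add: f_def int)
  then show ?e unfolding prod_eq lborel_eq[where 'a="real^'n"] reindex
    by (subst integral_distr[OF T pm]) (simp add: comp f_def)
qed

text \<open>One integrable majorant for all decay estimates; the product form makes its
  integrability and its behaviour under shifts one-dimensional questions.\<close>

definition vec_weight :: "real^'n::finite \<Rightarrow> real" where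
  "vec_weight x = (\<Prod>i\<in>UNIV. inverse (1 + (x $ i)\<^sup>2))"

lemma vec_weight_pos: "0 < vec_weight x"
  unfolding vec_weight_def by (intro prod_pos) (simp add: add_pos_nonneg)

lemma vec_weight_le_1: "vec_weight x \<le> 1"
  unfolding vec_weight_def by (intro prod_le_1) (simp add: add_pos_nonneg inverse_le_1_iff)

lemma integrable_vec_weight: "integrable lborel (vec_weight :: real^'n::finite \<Rightarrow> real)"
  unfolding vec_weight_def[abs_def] by (rule vec_integral_prod) (rule integrable_inverse_square)

lemma vec_weight_shift:
  assumes "\<bar>t\<bar> \<le> 1" shows "vec_weight (x + t *\<^sub>R axis k 1) \<le> 3 * vec_weight x"
proof -
  have "vec_weight (x + t *\<^sub>R axis k 1) \<le> (\<Prod>i\<in>UNIV. (if i = k then 3 else 1) * inverse (1 + (x $ i)\<^sup>2))"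
    unfolding vec_weight_def
  proof (intro prod_mono conjI)
    fix i
    show "0 \<le> inverse (1 + ((x + t *\<^sub>R axis k 1) $ i)\<^sup>2)" by (simp add: add_nonneg_nonneg)
    show "inverse (1 + ((x + t *\<^sub>R axis k 1) $ i)\<^sup>2) \<le> (if i = k then 3 else 1) * inverse (1 + (x $ i)\<^sup>2)"
      using inverse_square_shift[OF assms, of "x $ i"] by (auto simp: axis_def)
  qed
  also have "\<dots> = 3 * vec_weight x"
    unfolding prod.distrib vec_weight_def by simp
  finally show ?thesis .
qed

text \<open>Origin of the exponent \<open>2 * CARD('n)\<close> in later estimates: each factor
  \<open>1 + (x $ i)^2\<close> costs two powers of \<open>1 + norm x\<close>.\<close>

lemma vec_weight_lower: "1 \<le> (1 + norm x) ^ (2 * CARD('n)) * vec_weight (x :: real^'n::finite)"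
proof -
  have "(\<Prod>i\<in>(UNIV::'n set). 1 + (x $ i)\<^sup>2) \<le> (\<Prod>i\<in>(UNIV::'n set). (1 + norm x)\<^sup>2)"
  proof (intro prod_mono conjI)
    fix i
    have "\<bar>x $ i\<bar> \<le> norm x" by (rule component_le_norm_cart)
    then have "(x $ i)\<^sup>2 \<le> (norm x)\<^sup>2" by (rule abs_le_square_iff[THEN iffD1, of "x $ i" "norm x", simplified])
    then show "1 + (x $ i)\<^sup>2 \<le> (1 + norm x)\<^sup>2" using norm_ge_zero[of x] by (simp add: power2_sum del: norm_ge_zero)
  qed simp
  also have "\<dots> = (1 + norm x) ^ (2 * CARD('n))" by (simp add: power_mult)
  finally have le: "(\<Prod>i\<in>(UNIV::'n set). 1 + (x $ i)\<^sup>2) \<le> (1 + norm x) ^ (2 * CARD('n))" .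
  have "(\<Prod>i\<in>(UNIV::'n set). 1 + (x $ i)\<^sup>2) * vec_weight x = 1"
    unfolding vec_weight_def prod.distrib[symmetric]
  proof (rule prod.neutral, rule ballI)
    fix i
    have "1 + (x $ i)\<^sup>2 \<noteq> 0" using zero_le_power2[of "x $ i"] by linarith
    then show "(1 + (x $ i)\<^sup>2) * inverse (1 + (x $ i)\<^sup>2) = 1" by simp
  qed
  then show ?thesis using mult_right_mono[OF le less_imp_le[OF vec_weight_pos[of x]]] by simp
qed

section \<open>Partial derivatives and seminorms of Schwartz functions\<close>

lemma pd_append: "pd (is @ js) f = pd is (pd js f)"
  by (induction "is") simp_all

lemma schwartz_differentiable: "f \<in> schwartz \<Longrightarrow> pd is f differentiable (at x)"
  by (simp add: schwartz_def)

lemma schwartz_pd: "f \<in> schwartz \<Longrightarrow> pd js f \<in> schwartz"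
  by (simp add: schwartz_def pd_append[symmetric])

lemma schwartz_seminorm_ge:
  assumes "f \<in> schwartz" shows "(1 + norm x) ^ k * \<bar>pd is f x\<bar> \<le> schwartz_seminorm k is f"
  unfolding schwartz_seminorm_def
proof (rule cSUP_upper)
  have "bounded (range (\<lambda>x. (1 + norm x) ^ k * pd is f x))" using assms by (simp add: schwartz_def)
  then obtain C where "\<And>x. norm ((1 + norm x) ^ k * pd is f x) \<le> C" unfolding bounded_iff by blast
  then have "(1 + norm x) ^ k * \<bar>pd is f x\<bar> \<le> C" for x by (simp add: abs_mult)
  then show "bdd_above (range (\<lambda>x. (1 + norm x) ^ k * \<bar>pd is f x\<bar>))" by (intro bdd_aboveI[of _ C]) auto
qed simp

lemma schwartz_seminorm_le:
  assumes "\<And>x. (1 + norm x) ^ k * \<bar>pd is f x\<bar> \<le> C" shows "schwartz_seminorm k is f \<le> C"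
  unfolding schwartz_seminorm_def by (rule cSUP_least) (use assms in auto)

lemma schwartz_seminorm_nonneg: "f \<in> schwartz \<Longrightarrow> 0 \<le> schwartz_seminorm k is f"
  by (rule order_trans[OF _ schwartz_seminorm_ge[where x=0]]) simp_all

lemma pd_Cons_eqI: "(pd is f has_derivative D) (at x) \<Longrightarrow> pd (i # is) f x = D (axis i 1)"
  by (simp add: frechet_derivative_at[symmetric])

lemma has_derivative_pd:
  "f \<in> schwartz \<Longrightarrow> (pd is f has_derivative frechet_derivative (pd is f) (at x)) (at x)"
  using schwartz_differentiable frechet_derivative_works by blast

lemma pd_line_derivative:
  assumes "f \<in> schwartz"
  shows "((\<lambda>t. pd is f (x + t *\<^sub>R axis i 1)) has_real_derivative pd (i # is) f x) (at 0)"
proof -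
  let ?D = "frechet_derivative (pd is f) (at x)"
  have "((\<lambda>t. x + t *\<^sub>R axis i 1) has_derivative (\<lambda>t. t *\<^sub>R axis i 1)) (at (0::real))"
    by (auto intro!: derivative_eq_intros)
  moreover have "(pd is f has_derivative ?D) (at (x + 0 *\<^sub>R axis i 1))" using has_derivative_pd[OF assms] by simp
  ultimately have "((\<lambda>t. pd is f (x + t *\<^sub>R axis i 1)) has_derivative (\<lambda>t. ?D (t *\<^sub>R axis i 1))) (at 0)"
    by (rule has_derivative_compose)
  moreover have "?D (t *\<^sub>R axis i 1) = t * ?D (axis i 1)" for t
    using linear_scale[OF has_derivative_linear[OF has_derivative_pd[OF assms, of "is" x]], of t "axis i 1"] by simp
  then have "(\<lambda>t. ?D (t *\<^sub>R axis i 1)) = (*) (?D (axis i 1))" by (simp add: fun_eq_iff mult.commute)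
  ultimately show ?thesis unfolding has_field_derivative_def by simp
qed

lemma schwartz_continuous: "f \<in> schwartz \<Longrightarrow> continuous_on UNIV (pd is f)"
  using schwartz_differentiable
  by (auto intro!: continuous_at_imp_continuous_on differentiable_imp_continuous_within)

lemma schwartz_measurable: "f \<in> schwartz \<Longrightarrow> pd is f \<in> borel_measurable borel"
  using schwartz_continuous by (rule borel_measurable_continuous_onI)

text \<open>A whole family \<open>G\<close> of iterated partial derivatives is proposed at once, and
  the total derivatives \<open>D\<close> are compared with it only on axis vectors. Membership and
  the formula for \<open>pd\<close> come from the same data.\<close>

lemma schwartzI:
  assumes G0: "G [] = f"
    and der: "\<And>is x. (G is has_derivative D is x) (at x)" "\<And>is i x. D is x (axis i 1) = G (i # is) x"
    and bound: "\<And>is k. \<exists>C. \<forall>x. (1 + norm x) ^ k * \<bar>G is x\<bar> \<le> C"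
  shows "f \<in> schwartz" and "pd is f = G is"
proof -
  have pdG: "pd is f = G is" for "is"
  proof (induction "is")
    case (Cons i "is")
    show ?case
    proof
      fix x
      have "(pd is f has_derivative D is x) (at x)" using Cons der(1) by simp
      from pd_Cons_eqI[OF this] show "pd (i # is) f x = G (i # is) x" using der(2) by simp
    qed
  qed (simp add: G0)
  then show "pd is f = G is" .
  show "f \<in> schwartz"
    unfolding schwartz_def
  proof (intro CollectI allI conjI)
    show "pd is f differentiable (at x)" for "is" x
      unfolding pdG using der(1) by (rule differentiableI)
    fix "is" k
    obtain C where "\<forall>x. (1 + norm x) ^ k * \<bar>G is x\<bar> \<le> C" using bound by blast
    then show "bounded (range (\<lambda>x. (1 + norm x) ^ k * pd is f x))"
      unfolding bounded_iff pdG by (intro exI[of _ C]) (simp add: abs_mult)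
  qed
qed

lemma
  assumes f: "f \<in> schwartz" and g: "g \<in> schwartz"
  shows schwartz_lincomb: "(\<lambda>x. a * f x + b * g x) \<in> schwartz"
    and pd_lincomb: "pd is (\<lambda>x. a * f x + b * g x) = (\<lambda>x. a * pd is f x + b * pd is g x)"
    and schwartz_seminorm_lincomb:
      "schwartz_seminorm k is (\<lambda>x. a * f x + b * g x) \<le> \<bar>a\<bar> * schwartz_seminorm k is f + \<bar>b\<bar> * schwartz_seminorm k is g"
proof -
  define G where "G is x = a * pd is f x + b * pd is g x" for "is" x
  define D where "D is x h = a * frechet_derivative (pd is f) (at x) h + b * frechet_derivative (pd is g) (at x) h" for "is" x h
  have G0: "G [] = (\<lambda>x. a * f x + b * g x)" by (simp add: G_def fun_eq_iff)
  have d1: "(G is has_derivative D is x) (at x)" for "is" x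
    unfolding G_def[abs_def] D_def[abs_def]
    by (intro has_derivative_add has_derivative_mult_right has_derivative_pd f g)
  have d2: "D is x (axis i 1) = G (i # is) x" for "is" i x by (simp add: D_def G_def)
  have b: "(1 + norm x) ^ k * \<bar>G is x\<bar> \<le> \<bar>a\<bar> * schwartz_seminorm k is f + \<bar>b\<bar> * schwartz_seminorm k is g" for k "is" x
  proof -
    have "(1 + norm x) ^ k * \<bar>G is x\<bar> \<le> (1 + norm x) ^ k * (\<bar>a\<bar> * \<bar>pd is f x\<bar> + \<bar>b\<bar> * \<bar>pd is g x\<bar>)"
      unfolding G_def by (intro mult_left_mono order_trans[OF abs_triangle_ineq]) (simp_all add: abs_mult)
    also have "\<dots> = \<bar>a\<bar> * ((1 + norm x) ^ k * \<bar>pd is f x\<bar>) + \<bar>b\<bar> * ((1 + norm x) ^ k * \<bar>pd is g x\<bar>)"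
      by (simp add: algebra_simps)
    also have "\<dots> \<le> \<bar>a\<bar> * schwartz_seminorm k is f + \<bar>b\<bar> * schwartz_seminorm k is g"
      by (intro add_mono mult_left_mono schwartz_seminorm_ge f g) auto
    finally show ?thesis .
  qed
  then have b': "\<exists>C. \<forall>x. (1 + norm x) ^ k * \<bar>G is x\<bar> \<le> C" for "is" k by blast
  show "(\<lambda>x. a * f x + b * g x) \<in> schwartz" by (rule schwartzI(1)[OF G0 d1 d2 b'])
  have eq: "pd is (\<lambda>x. a * f x + b * g x) = G is" for "is" by (rule schwartzI(2)[OF G0 d1 d2 b'])
  show "pd is (\<lambda>x. a * f x + b * g x) = (\<lambda>x. a * pd is f x + b * pd is g x)"
    unfolding eq by (simp add: G_def fun_eq_iff)
  show "schwartz_seminorm k is (\<lambda>x. a * f x + b * g x) \<le> \<bar>a\<bar> * schwartz_seminorm k is f + \<bar>b\<bar> * schwartz_seminorm k is g"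
    by (rule schwartz_seminorm_le) (simp only: eq b)
qed

lemma schwartz_zero: "(\<lambda>x. 0) \<in> schwartz"
  by (rule schwartzI(1)[where G="\<lambda>_ _. 0" and D="\<lambda>_ _ _. 0"]) (auto intro!: exI[of _ 0])

lemma schwartz_sum:
  assumes "finite I" "\<And>i. i \<in> I \<Longrightarrow> f i \<in> schwartz"
  shows "(\<lambda>x. \<Sum>i\<in>I. c i * f i x) \<in> schwartz"
    and "pd is (\<lambda>x. \<Sum>i\<in>I. c i * f i x) = (\<lambda>x. \<Sum>i\<in>I. c i * pd is (f i) x)"
proof -
  have "(\<lambda>x. \<Sum>i\<in>I. c i * f i x) \<in> schwartz \<and> pd is (\<lambda>x. \<Sum>i\<in>I. c i * f i x) = (\<lambda>x. \<Sum>i\<in>I. c i * pd is (f i) x)"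
    using assms
  proof (induction I rule: finite_induct)
    case empty
    have "pd is (\<lambda>x::real^'b. 0) = (\<lambda>x. 0)"
      by (induction "is") simp_all
    then show ?case by (simp add: schwartz_zero)
  next
    case (insert i I)
    have fi: "f i \<in> schwartz" and IH: "(\<lambda>x. \<Sum>i\<in>I. c i * f i x) \<in> schwartz"
      "pd is (\<lambda>x. \<Sum>i\<in>I. c i * f i x) = (\<lambda>x. \<Sum>i\<in>I. c i * pd is (f i) x)"
      using insert by auto
    show ?case
      using schwartz_lincomb[OF fi IH(1), of "c i" 1] pd_lincomb[OF fi IH(1), of "is" "c i" 1] insert(1,2)
      by (simp add: IH(2))
  qed
  then show "(\<lambda>x. \<Sum>i\<in>I. c i * f i x) \<in> schwartz"
    and "pd is (\<lambda>x. \<Sum>i\<in>I. c i * f i x) = (\<lambda>x. \<Sum>i\<in>I. c i * pd is (f i) x)" by auto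
qed

text \<open>The sum that bounds the functional in \<open>tempered\<close>. On Schwartz functions it
  increases with \<open>N\<close>, so a single one of these norms replaces any finite collection of
  seminorms.\<close>

definition schwartz_norm :: "nat \<Rightarrow> (real^'n::finite \<Rightarrow> real) \<Rightarrow> real" where
  "schwartz_norm N f = (\<Sum>k\<le>N. \<Sum>is\<in>{is::'n list. length is \<le> N}. schwartz_seminorm k is f)"

lemma finite_lists_le: "finite {is::'n::finite list. length is \<le> N}"
  using finite_lists_length_le[of "UNIV::'n set" N] by simp

lemma schwartz_seminorm_le_norm:
  assumes "f \<in> schwartz" "k \<le> N" "length is \<le> N"
  shows "schwartz_seminorm k is f \<le> schwartz_norm N f"
proof -
  have "schwartz_seminorm k is f \<le> (\<Sum>is\<in>{is. length is \<le> N}. schwartz_seminorm k is f)"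
    by (rule member_le_sum) (use assms finite_lists_le schwartz_seminorm_nonneg in auto)
  also have "\<dots> \<le> schwartz_norm N f"
    unfolding schwartz_norm_def
    by (rule member_le_sum[of k "{..N}"]) (use assms schwartz_seminorm_nonneg in \<open>auto intro!: sum_nonneg\<close>)
  finally show ?thesis .
qed

lemma schwartz_norm_nonneg: "f \<in> schwartz \<Longrightarrow> 0 \<le> schwartz_norm N f"
  unfolding schwartz_norm_def by (intro sum_nonneg schwartz_seminorm_nonneg)

lemma schwartz_norm_mono:
  assumes "f \<in> schwartz" "N \<le> M" shows "schwartz_norm N f \<le> schwartz_norm M f"
proof -
  have "schwartz_norm N f \<le> (\<Sum>k\<le>N. \<Sum>is\<in>{is. length is \<le> M}. schwartz_seminorm k is f)"
    unfolding schwartz_norm_def using assms finite_lists_le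
    by (intro sum_mono sum_mono2) (auto intro: schwartz_seminorm_nonneg)
  also have "\<dots> \<le> schwartz_norm M f"
    unfolding schwartz_norm_def using assms
    by (intro sum_mono2) (auto intro!: sum_nonneg schwartz_seminorm_nonneg)
  finally show ?thesis .
qed

lemma schwartz_pointwise:
  assumes "f \<in> schwartz" "k \<le> N" "length is \<le> N"
  shows "(1 + norm x) ^ k * \<bar>pd is f x\<bar> \<le> schwartz_norm N f"
  by (rule order_trans[OF schwartz_seminorm_ge schwartz_seminorm_le_norm]) (use assms in auto)

lemma schwartz_weight_bound:
  fixes f :: "real^'n::finite \<Rightarrow> real"
  assumes "f \<in> schwartz" "2 * CARD('n) \<le> N" "length is \<le> N"
  shows "\<bar>pd is f x\<bar> \<le> schwartz_norm N f * vec_weight x"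
proof -
  let ?a = "(1 + norm x) ^ (2 * CARD('n))"
  have "\<bar>pd is f x\<bar> \<le> (?a * vec_weight x) * \<bar>pd is f x\<bar>"
    using mult_right_mono[OF vec_weight_lower[of x], of "\<bar>pd is f x\<bar>"] by simp
  also have "\<dots> = (?a * \<bar>pd is f x\<bar>) * vec_weight x" by simp
  also have "\<dots> \<le> schwartz_norm N f * vec_weight x"
    by (intro mult_right_mono schwartz_pointwise less_imp_le[OF vec_weight_pos] assms)
  finally show ?thesis .
qed

text \<open>For a seminorm \<open>p\<close> this is continuity in the Frechet topology, expressed by
  one norm of the increasing family.\<close>

definition dominated :: "((real^'n::finite \<Rightarrow> real) \<Rightarrow> real) \<Rightarrow> bool" where
  "dominated p \<longleftrightarrow> (\<exists>C M. C \<ge> 0 \<and> (\<forall>f\<in>schwartz. p f \<le> C * schwartz_norm M f))"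

lemma dominatedI:
  assumes "C \<ge> 0" "\<And>f. f \<in> schwartz \<Longrightarrow> p f \<le> C * schwartz_norm M f"
  shows "dominated p"
  using assms unfolding dominated_def by blast

lemma dominated_add:
  assumes "dominated p" "dominated q" "\<And>f. f \<in> schwartz \<Longrightarrow> r f \<le> \<bar>a\<bar> * p f + \<bar>b\<bar> * q f"
  shows "dominated r"
proof -
  obtain C M where C: "C \<ge> 0" "\<And>f. f \<in> schwartz \<Longrightarrow> p f \<le> C * schwartz_norm M f"
    using assms(1) unfolding dominated_def by blast
  obtain D N where D: "D \<ge> 0" "\<And>f. f \<in> schwartz \<Longrightarrow> q f \<le> D * schwartz_norm N f"
    using assms(2) unfolding dominated_def by blast
  show ?thesis
  proof (rule dominatedI[of "\<bar>a\<bar> * C + \<bar>b\<bar> * D"])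
    fix f :: "real^'a \<Rightarrow> real" assume f: "f \<in> schwartz"
    have "p f \<le> C * schwartz_norm (max M N) f"
      by (rule order_trans[OF C(2)[OF f] mult_left_mono[OF schwartz_norm_mono[OF f] C(1)]]) simp
    moreover have "q f \<le> D * schwartz_norm (max M N) f"
      by (rule order_trans[OF D(2)[OF f] mult_left_mono[OF schwartz_norm_mono[OF f] D(1)]]) simp
    ultimately have "\<bar>a\<bar> * p f + \<bar>b\<bar> * q f \<le> \<bar>a\<bar> * (C * schwartz_norm (max M N) f) + \<bar>b\<bar> * (D * schwartz_norm (max M N) f)"
      by (intro add_mono mult_left_mono) auto
    then show "r f \<le> (\<bar>a\<bar> * C + \<bar>b\<bar> * D) * schwartz_norm (max M N) f"
      using assms(3)[OF f] by (simp add: algebra_simps)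
  qed (use C D in simp)
qed

lemma dominated_sum:
  assumes "finite I" "\<And>i. i \<in> I \<Longrightarrow> dominated (p i)"
  shows "dominated (\<lambda>f. \<Sum>i\<in>I. p i f)"
  using assms
proof (induction I rule: finite_induct)
  case empty
  show ?case by (rule dominatedI[of 0]) simp_all
next
  case (insert i I)
  have "dominated (p i)" "dominated (\<lambda>f. \<Sum>i\<in>I. p i f)" using insert by auto
  then show ?case
    by (rule dominated_add[where a=1 and b=1]) (use insert in simp)
qed

lemma dominated_seminorm: "dominated (schwartz_seminorm k is)"
  by (rule dominatedI[of 1 _ "max k (length is)"]) (simp_all add: schwartz_seminorm_le_norm)

definition continuous_op :: "((real^'n::finite \<Rightarrow> real) \<Rightarrow> (real^'n \<Rightarrow> real)) \<Rightarrow> bool" where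
  "continuous_op A \<longleftrightarrow> (\<forall>f\<in>schwartz. A f \<in> schwartz) \<and> (\<forall>k is. dominated (\<lambda>f. schwartz_seminorm k is (A f)))"

lemma continuous_op_norm: "continuous_op A \<Longrightarrow> dominated (\<lambda>f. schwartz_norm N (A f))"
  unfolding schwartz_norm_def continuous_op_def by (intro dominated_sum finite_lists_le) auto

lemma dominated_comp:
  assumes "dominated p" "continuous_op A" shows "dominated (\<lambda>f. p (A f))"
proof -
  obtain C M where C: "C \<ge> 0" "\<And>f. f \<in> schwartz \<Longrightarrow> p f \<le> C * schwartz_norm M f"
    using assms(1) unfolding dominated_def by blast
  obtain D N where D: "D \<ge> 0" "\<And>f. f \<in> schwartz \<Longrightarrow> schwartz_norm M (A f) \<le> D * schwartz_norm N f"
    using continuous_op_norm[OF assms(2), of M] unfolding dominated_def by blast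
  show ?thesis
  proof (rule dominatedI[of "C * D"])
    fix f :: "real^'a \<Rightarrow> real" assume f: "f \<in> schwartz"
    then have "A f \<in> schwartz" using assms(2) by (simp add: continuous_op_def)
    then have "p (A f) \<le> C * schwartz_norm M (A f)" by (rule C(2))
    also have "\<dots> \<le> C * (D * schwartz_norm N f)" by (intro mult_left_mono D f C)
    finally show "p (A f) \<le> C * D * schwartz_norm N f" by simp
  qed (use C D in simp)
qed

lemma continuous_op_comp:
  assumes "continuous_op A" "continuous_op B" shows "continuous_op (\<lambda>f. A (B f))"
proof -
  have "dominated (\<lambda>f. schwartz_seminorm k is (A (B f)))" for k "is"
    using assms(1) by (intro dominated_comp[OF _ assms(2)]) (auto simp: continuous_op_def)
  then show ?thesis using assms by (auto simp: continuous_op_def)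
qed

lemma continuous_op_pd: "continuous_op (pd js)"
proof -
  have "schwartz_seminorm k is (pd js f) = schwartz_seminorm k (is @ js) f" for k "is" and f :: "real^'a \<Rightarrow> real"
    by (simp add: schwartz_seminorm_def pd_append)
  moreover have "dominated (\<lambda>f. schwartz_seminorm k is f)" for k and "is" :: "'a list"
    using dominated_seminorm[of k "is"] by simp
  ultimately show ?thesis unfolding continuous_op_def by (simp add: schwartz_pd)
qed

lemma continuous_op_lincomb:
  assumes "continuous_op A" "continuous_op B"
  shows "continuous_op (\<lambda>f x. a * A f x + b * B f x)"
  unfolding continuous_op_def
proof (intro conjI ballI allI)
  show "(\<lambda>x. a * A f x + b * B f x) \<in> schwartz" if "f \<in> schwartz" for f
    using assms that by (intro schwartz_lincomb) (auto simp: continuous_op_def)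
  fix k "is"
  have "dominated (\<lambda>f. schwartz_seminorm k is (A f))" "dominated (\<lambda>f. schwartz_seminorm k is (B f))"
    using assms by (auto simp: continuous_op_def)
  then show "dominated (\<lambda>f. schwartz_seminorm k is (\<lambda>x. a * A f x + b * B f x))"
    by (rule dominated_add[where a=a and b=b])
       (rule schwartz_seminorm_lincomb, use assms in \<open>auto simp: continuous_op_def\<close>)
qed

lemma continuous_op_sum:
  fixes A :: "'i \<Rightarrow> (real^'n::finite \<Rightarrow> real) \<Rightarrow> real^'n \<Rightarrow> real"
  assumes "finite I" "\<And>i. i \<in> I \<Longrightarrow> continuous_op (A i)"
  shows "continuous_op (\<lambda>f x. \<Sum>i\<in>I. A i f x)"
  using assms
proof (induction I rule: finite_induct)
  case empty
  have "pd is (\<lambda>x::real^'n. 0) = (\<lambda>x. 0)" for "is" by (induction "is") simp_all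
  then have "schwartz_seminorm k is (\<lambda>x::real^'n. 0) = 0" for k "is" by (simp add: schwartz_seminorm_def)
  then show ?case by (auto simp: continuous_op_def schwartz_zero intro!: dominatedI[of 0])
next
  case (insert i I)
  then show ?case using continuous_op_lincomb[of "A i" "\<lambda>f x. \<Sum>i\<in>I. A i f x" 1 1] by simp
qed

text \<open>The partial derivatives of \<open>x\<^sub>i f\<close>: by Leibniz, \<open>x\<^sub>i \<partial>f\<close> plus one term for each
  occurrence of \<open>i\<close> in the list of indices.\<close>

fun removals :: "'n \<Rightarrow> 'n list \<Rightarrow> 'n list list" where
  "removals i [] = []"
| "removals i (j # is) = (if i = j then [is] else []) @ map ((#) j) (removals i is)"

lemma removals_length: "l \<in> set (removals i is) \<Longrightarrow> length l \<le> length is"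
  by (induction "is" arbitrary: l) (auto split: if_splits)

lemma has_derivative_sum_list:
  assumes "\<And>l. l \<in> set ls \<Longrightarrow> (u l has_derivative u' l) (at x)"
  shows "((\<lambda>x. \<Sum>l\<leftarrow>ls. u l x) has_derivative (\<lambda>h. \<Sum>l\<leftarrow>ls. u' l h)) (at x)"
  using assms by (induction ls) (auto intro!: derivative_eq_intros)

lemma continuous_op_coord: "continuous_op (\<lambda>f x. x $ i * f x)"
proof -
  define G where "G f is x = x $ i * pd is f x + (\<Sum>l\<leftarrow>removals i is. pd l f x)" for f :: "real^'a \<Rightarrow> real" and "is" x
  define D where "D f is x h = (x $ i * frechet_derivative (pd is f) (at x) h + h $ i * pd is f x)
     + (\<Sum>l\<leftarrow>removals i is. frechet_derivative (pd l f) (at x) h)" for f :: "real^'a \<Rightarrow> real" and "is" x h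
  have G0: "G f [] = (\<lambda>x. x $ i * f x)" for f by (simp add: G_def fun_eq_iff)
  have d1: "(G f is has_derivative D f is x) (at x)" if "f \<in> schwartz" for f "is" x
  proof -
    have "((\<lambda>x. x $ i) has_derivative (\<lambda>h. h $ i)) (at x)"
      by (rule bounded_linear.has_derivative[OF bounded_linear_vec_nth]) simp
    then show ?thesis
      unfolding G_def[abs_def] D_def[abs_def]
      by (intro has_derivative_add has_derivative_mult has_derivative_sum_list has_derivative_pd that)
  qed
  have d2: "D f is x (axis j 1) = G f (j # is) x" for f "is" j x
    by (auto simp: D_def G_def comp_def axis_def)
  have b: "(1 + norm x) ^ k * \<bar>G f is x\<bar> \<le> (1 + real (length (removals i is))) * schwartz_norm (Suc k + length is) f"
    if f: "f \<in> schwartz" for f k "is" x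
  proof -
    let ?S = "schwartz_norm (Suc k + length is) f"
    have "(1 + norm x) ^ k * \<bar>x $ i * pd is f x\<bar> \<le> (1 + norm x) ^ Suc k * \<bar>pd is f x\<bar>"
    proof -
      have "\<bar>x $ i\<bar> \<le> 1 + norm x" using component_le_norm_cart[of x i] by linarith
      then have "\<bar>x $ i\<bar> * ((1 + norm x) ^ k * \<bar>pd is f x\<bar>) \<le> (1 + norm x) * ((1 + norm x) ^ k * \<bar>pd is f x\<bar>)"
        by (rule mult_right_mono) simp
      then show ?thesis by (simp add: abs_mult mult_ac)
    qed
    also have "\<dots> \<le> ?S" by (rule schwartz_pointwise) (use f in auto)
    finally have 1: "(1 + norm x) ^ k * \<bar>x $ i * pd is f x\<bar> \<le> ?S" .
    have "(1 + norm x) ^ k * \<bar>\<Sum>l\<leftarrow>ls. pd l f x\<bar> \<le> real (length ls) * ?S" if "\<And>l. l \<in> set ls \<Longrightarrow> length l \<le> length is" for ls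
      using that
    proof (induction ls)
      case (Cons l ls)
      have "(1 + norm x) ^ k * \<bar>\<Sum>l\<leftarrow>l # ls. pd l f x\<bar> \<le> (1 + norm x) ^ k * \<bar>pd l f x\<bar> + (1 + norm x) ^ k * \<bar>\<Sum>l\<leftarrow>ls. pd l f x\<bar>"
        unfolding distrib_left[symmetric] by (intro mult_left_mono) (auto intro: abs_triangle_ineq)
      also have "\<dots> \<le> ?S + real (length ls) * ?S"
        using Cons.prems[of l] by (intro add_mono Cons.IH Cons.prems schwartz_pointwise f) auto
      finally show ?case by (simp add: algebra_simps)
    qed simp
    from this[OF removals_length] have 2: "(1 + norm x) ^ k * \<bar>\<Sum>l\<leftarrow>removals i is. pd l f x\<bar> \<le> real (length (removals i is)) * ?S" .
    have "(1 + norm x) ^ k * \<bar>G f is x\<bar> \<le> (1 + norm x) ^ k * \<bar>x $ i * pd is f x\<bar> + (1 + norm x) ^ k * \<bar>\<Sum>l\<leftarrow>removals i is. pd l f x\<bar>"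
      unfolding distrib_left[symmetric] G_def by (intro mult_left_mono) (auto intro: abs_triangle_ineq)
    then show ?thesis using 1 2 by (simp add: algebra_simps)
  qed
  have b': "\<exists>C. \<forall>x. (1 + norm x) ^ k * \<bar>G f is x\<bar> \<le> C" if "f \<in> schwartz" for f "is" k using b[OF that] by blast
  show ?thesis
    unfolding continuous_op_def
  proof (intro conjI ballI allI)
    show "(\<lambda>x. x $ i * f x) \<in> schwartz" if "f \<in> schwartz" for f :: "real^'a \<Rightarrow> real"
      by (rule schwartzI(1)[OF G0 d1[OF that] d2 b'[OF that]])
    fix k and "is" :: "'a list"
    show "dominated (\<lambda>f. schwartz_seminorm k is (\<lambda>x. x $ i * f x))"
    proof (rule dominatedI[of "1 + real (length (removals i is))"])
      fix f :: "real^'a \<Rightarrow> real" assume f: "f \<in> schwartz"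
      have eq: "pd is (\<lambda>x. x $ i * f x) = G f is" by (rule schwartzI(2)[OF G0 d1[OF f] d2 b'[OF f]])
      show "schwartz_seminorm k is (\<lambda>x. x $ i * f x) \<le> (1 + real (length (removals i is))) * schwartz_norm (Suc k + length is) f"
        by (rule schwartz_seminorm_le) (simp only: eq b[OF f])
    qed simp
  qed
qed

section \<open>Tensor products of one-dimensional functions\<close>

lemma one_plus_norm_le_prod: "1 + norm (x :: real^'n::finite) \<le> (\<Prod>i\<in>UNIV. 1 + \<bar>x $ i\<bar>)"
proof -
  have "1 + (\<Sum>i\<in>I. \<bar>x $ i\<bar>) \<le> (\<Prod>i\<in>I. 1 + \<bar>x $ i\<bar>)" if "finite I" for I
    using that
  proof (induction I rule: finite_induct)
    case (insert i I)
    have "1 \<le> (\<Prod>i\<in>I. 1 + \<bar>x $ i\<bar>)" by (rule prod_ge_1) simp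
    then have "\<bar>x $ i\<bar> * 1 \<le> \<bar>x $ i\<bar> * (\<Prod>i\<in>I. 1 + \<bar>x $ i\<bar>)" by (intro mult_left_mono) auto
    then show ?case using insert by (simp add: algebra_simps)
  qed simp
  from this[of UNIV] show ?thesis using norm_le_l1_cart[of x] by simp
qed

text \<open>Here \<open>u i j\<close> is the j-th derivative of the i-th factor. Only the
  multiplicity of \<open>i\<close> in the list of directions matters, hence
  \<open>count_list\<close>.\<close>

lemma
  fixes u :: "'n::finite \<Rightarrow> nat \<Rightarrow> real \<Rightarrow> real"
  assumes der: "\<And>i j x. (u i j has_real_derivative u i (Suc j) x) (at x)"
    and bnd: "\<And>i j k. \<exists>C. \<forall>x. (1 + \<bar>x\<bar>) ^ k * \<bar>u i j x\<bar> \<le> C"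
  shows schwartz_tensor: "(\<lambda>x::real^'n. \<Prod>i\<in>UNIV. u i 0 (x $ i)) \<in> schwartz"
    and pd_tensor: "pd is (\<lambda>x::real^'n. \<Prod>i\<in>UNIV. u i 0 (x $ i)) = (\<lambda>x. \<Prod>i\<in>UNIV. u i (count_list is i) (x $ i))"
    and tensor_bound: "(\<And>i x. (1 + \<bar>x\<bar>) ^ k * \<bar>u i (count_list is i) x\<bar> \<le> B i) \<Longrightarrow>
      schwartz_seminorm k is (\<lambda>x::real^'n. \<Prod>i\<in>UNIV. u i 0 (x $ i)) \<le> (\<Prod>i\<in>UNIV. B i)"
proof -
  let ?f = "\<lambda>x::real^'n. \<Prod>i\<in>UNIV. u i 0 (x $ i)"
  define G where "G is x = (\<Prod>i\<in>UNIV. u i (count_list is i) (x $ i))" for "is" and x :: "real^'n"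
  define D where "D is x h = (\<Sum>i\<in>UNIV. (u i (Suc (count_list is i)) (x $ i) * h $ i) * (\<Prod>j\<in>UNIV - {i}. u j (count_list is j) (x $ j)))" for "is" and x h :: "real^'n"
  have G0: "G [] = ?f" by (simp add: G_def fun_eq_iff)
  have d1: "(G is has_derivative D is x) (at x)" for "is" x
  proof -
    have "((\<lambda>x. u i j (x $ i)) has_derivative (\<lambda>h. u i (Suc j) (x $ i) * h $ i)) (at x)" for i j
    proof -
      have "((\<lambda>x. x $ i) has_derivative (\<lambda>h. h $ i)) (at x)"
        by (rule bounded_linear.has_derivative[OF bounded_linear_vec_nth]) simp
      moreover have "(u i j has_derivative (*) (u i (Suc j) (x $ i))) (at (x $ i))"
        using der by (simp add: has_field_derivative_def)
      ultimately show ?thesis by (rule has_derivative_compose)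
    qed
    then show ?thesis
      unfolding G_def[abs_def] D_def[abs_def] by (intro has_derivative_prod)
  qed
  have d2: "D is x (axis k 1) = G (k # is) x" for "is" k x
  proof -
    have "D is x (axis k 1) = (\<Sum>i\<in>UNIV. if i = k then u k (Suc (count_list is k)) (x $ k) * (\<Prod>j\<in>UNIV - {k}. u j (count_list is j) (x $ j)) else 0)"
      unfolding D_def by (intro sum.cong refl) (simp add: axis_def)
    also have "\<dots> = u k (Suc (count_list is k)) (x $ k) * (\<Prod>j\<in>UNIV - {k}. u j (count_list is j) (x $ j))" by simp
    also have "(\<Prod>j\<in>UNIV - {k}. u j (count_list is j) (x $ j)) = (\<Prod>j\<in>UNIV - {k}. u j (count_list (k # is) j) (x $ j))"
      by (intro prod.cong refl) auto
    also have "u k (Suc (count_list is k)) (x $ k) * \<dots> = G (k # is) x"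
      unfolding G_def by (subst prod.remove[of UNIV k]) simp_all
    finally show ?thesis .
  qed
  have b: "(1 + norm x) ^ k * \<bar>G is x\<bar> \<le> (\<Prod>i\<in>UNIV. B i)"
    if B: "\<And>i x. (1 + \<bar>x\<bar>) ^ k * \<bar>u i (count_list is i) x\<bar> \<le> B i" for k "is" x B
  proof -
    have "(1 + norm x) ^ k \<le> (\<Prod>i\<in>UNIV. 1 + \<bar>x $ i\<bar>) ^ k" by (intro power_mono one_plus_norm_le_prod) simp
    then have "(1 + norm x) ^ k * \<bar>G is x\<bar> \<le> (\<Prod>i\<in>UNIV. (1 + \<bar>x $ i\<bar>) ^ k) * \<bar>G is x\<bar>"
      by (intro mult_right_mono) (simp_all add: prod_power_distrib)
    also have "\<dots> = (\<Prod>i\<in>UNIV. (1 + \<bar>x $ i\<bar>) ^ k * \<bar>u i (count_list is i) (x $ i)\<bar>)"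
      by (simp add: G_def abs_prod prod.distrib)
    also have "\<dots> \<le> (\<Prod>i\<in>UNIV. B i)" by (intro prod_mono conjI B) simp
    finally show ?thesis .
  qed
  have b': "\<exists>C. \<forall>x. (1 + norm x) ^ k * \<bar>G is x\<bar> \<le> C" for "is" k
  proof -
    have "\<forall>i. \<exists>C. \<forall>x. (1 + \<bar>x\<bar>) ^ k * \<bar>u i (count_list is i) x\<bar> \<le> C" using bnd by blast
    from choice[OF this] obtain B where "\<forall>i. \<forall>x. (1 + \<bar>x\<bar>) ^ k * \<bar>u i (count_list is i) x\<bar> \<le> B i" ..
    then show ?thesis using b[of k "is" B] by blast
  qed
  show "?f \<in> schwartz" by (rule schwartzI(1)[OF G0 d1 d2 b'])
  have eq: "pd is ?f = G is" for "is" by (rule schwartzI(2)[OF G0 d1 d2 b'])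
  show "pd is ?f = (\<lambda>x. \<Prod>i\<in>UNIV. u i (count_list is i) (x $ i))" unfolding eq by (simp add: G_def fun_eq_iff)
  show "schwartz_seminorm k is ?f \<le> (\<Prod>i\<in>UNIV. B i)" if "\<And>i x. (1 + \<bar>x\<bar>) ^ k * \<bar>u i (count_list is i) x\<bar> \<le> B i"
    by (rule schwartz_seminorm_le) (simp only: eq b[OF that])
qed

text \<open>The product of the one-dimensional eigenvalues. Unlike their sum
  \<open>hermite_eigenvalue\<close> it makes series over multi-indices factorise; it is at most the
  d-th power of the sum, and the sum is at most d times the product.\<close>

definition hermite_index :: "('n::finite \<Rightarrow> nat) \<Rightarrow> real" where
  "hermite_index \<alpha> = (\<Prod>i\<in>UNIV. 2 * real (\<alpha> i) + 1)"

lemma hermite_index_ge_1: "1 \<le> hermite_index \<alpha>"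
  unfolding hermite_index_def by (rule prod_ge_1) simp

lemma
  shows hermite_tensor_schwartz: "hermite_tensor \<alpha> \<in> schwartz"
    and pd_hermite_tensor: "pd is (hermite_tensor \<alpha>) = (\<lambda>x. \<Prod>i\<in>UNIV. hermite_diff (count_list is i) (\<alpha> i) (x $ i))"
    and hermite_tensor_seminorm: "\<exists>C m. C \<ge> 0 \<and> (\<forall>\<alpha> :: 'n::finite \<Rightarrow> nat. schwartz_seminorm k is (hermite_tensor \<alpha>) \<le> C * hermite_index \<alpha> ^ m)"
proof -
  have eq: "hermite_tensor \<alpha> = (\<lambda>x. \<Prod>i\<in>UNIV. hermite_diff 0 (\<alpha> i) (x $ i))" for \<alpha> :: "'m::finite \<Rightarrow> nat"
    by (simp add: hermite_tensor_def fun_eq_iff)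
  have der: "(hermite_diff j n has_real_derivative hermite_diff (Suc j) n x) (at x)" for j n x
    by (rule hermite_diff_deriv)
  have bnd: "\<exists>C. \<forall>x. (1 + \<bar>x\<bar>) ^ k * \<bar>hermite_diff j n x\<bar> \<le> C" for k j n
    using hermite_diff_weighted_bound[of k j] by blast
  show "hermite_tensor \<alpha> \<in> schwartz" unfolding eq
    by (rule schwartz_tensor[where u="\<lambda>i j. hermite_diff j (\<alpha> i)", OF der bnd])
  show "pd is (hermite_tensor \<alpha>) = (\<lambda>x. \<Prod>i\<in>UNIV. hermite_diff (count_list is i) (\<alpha> i) (x $ i))" unfolding eq
    by (rule pd_tensor[where u="\<lambda>i j. hermite_diff j (\<alpha> i)", OF der bnd])
  have "\<forall>i. \<exists>C m. C \<ge> 0 \<and> (\<forall>n x. (1 + \<bar>x\<bar>) ^ k * \<bar>hermite_diff (count_list is i) n x\<bar> \<le> C * (real n + 1) ^ m)"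
    using hermite_diff_weighted_bound by blast
  from choice[OF this] obtain C where "\<forall>i::'n. \<exists>m. C i \<ge> 0 \<and> (\<forall>n x. (1 + \<bar>x\<bar>) ^ k * \<bar>hermite_diff (count_list is i) n x\<bar> \<le> C i * (real n + 1) ^ m)" ..
  from choice[OF this] obtain m where Cm: "\<forall>i::'n. C i \<ge> 0 \<and> (\<forall>n x. (1 + \<bar>x\<bar>) ^ k * \<bar>hermite_diff (count_list is i) n x\<bar> \<le> C i * (real n + 1) ^ m i)" ..
  \<comment> \<open>A common exponent above all \<open>m i\<close>; enlarging exponents is harmless
    because \<open>2 * \<alpha> i + 1\<close> is at least 1.\<close>
  define l where "l = (\<Sum>i\<in>UNIV. m i)"
  have "schwartz_seminorm k is (hermite_tensor \<alpha>) \<le> (\<Prod>i\<in>UNIV. C i) * hermite_index \<alpha> ^ l" for \<alpha> :: "'n \<Rightarrow> nat"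
  proof -
    have "schwartz_seminorm k is (hermite_tensor \<alpha>) \<le> (\<Prod>i\<in>UNIV. C i * (2 * real (\<alpha> i) + 1) ^ l)"
      unfolding eq
    proof (rule tensor_bound[where u="\<lambda>i j. hermite_diff j (\<alpha> i)", OF der bnd])
      fix i x
      have "(real (\<alpha> i) + 1) ^ m i \<le> (2 * real (\<alpha> i) + 1) ^ m i" by (intro power_mono) auto
      also have "\<dots> \<le> (2 * real (\<alpha> i) + 1) ^ l"
        unfolding l_def by (intro power_increasing member_le_sum) auto
      finally have "C i * (real (\<alpha> i) + 1) ^ m i \<le> C i * (2 * real (\<alpha> i) + 1) ^ l"
        using Cm by (intro mult_left_mono) auto
      then show "(1 + \<bar>x\<bar>) ^ k * \<bar>hermite_diff (count_list is i) (\<alpha> i) x\<bar> \<le> C i * (2 * real (\<alpha> i) + 1) ^ l"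
        using Cm order_trans by blast
    qed
    also have "\<dots> = (\<Prod>i\<in>UNIV. C i) * hermite_index \<alpha> ^ l"
      by (simp add: prod.distrib hermite_index_def prod_power_distrib)
    finally show ?thesis .
  qed
  moreover have "(\<Prod>i\<in>UNIV. C i) \<ge> 0" using Cm by (intro prod_nonneg) auto
  ultimately show "\<exists>C m. C \<ge> 0 \<and> (\<forall>\<alpha> :: 'n::finite \<Rightarrow> nat. schwartz_seminorm k is (hermite_tensor \<alpha>) \<le> C * hermite_index \<alpha> ^ m)" by blast
qed

section \<open>Hermite expansions\<close>

lemma integrable_weight_bound:
  fixes f :: "real^'n::finite \<Rightarrow> 'b::{banach, second_countable_topology}"
  assumes "f \<in> borel_measurable borel" "\<And>x. norm (f x) \<le> C * vec_weight x"
  shows "integrable lborel f"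
proof (rule Bochner_Integration.integrable_bound)
  show "integrable lborel (\<lambda>x. C * vec_weight x)" by (rule integrable_mult_right[OF integrable_vec_weight])
  show "AE x in lborel. norm (f x) \<le> norm (C * vec_weight x)"
    using assms(2) by (intro AE_I2) (simp, meson abs_ge_self order_trans)
qed (use assms in simp)

lemma schwartz_bounded_by_norm:
  fixes f :: "real^'n::finite \<Rightarrow> real"
  assumes "f \<in> schwartz" "2 * CARD('n) \<le> N" "length is \<le> N"
  shows "\<bar>pd is f x\<bar> \<le> schwartz_norm N f"
proof -
  have "\<bar>pd is f x\<bar> \<le> schwartz_norm N f * vec_weight x" by (rule schwartz_weight_bound[OF assms])
  also have "\<dots> \<le> schwartz_norm N f * 1"
    by (intro mult_left_mono vec_weight_le_1 schwartz_norm_nonneg assms)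
  finally show ?thesis by simp
qed

lemma schwartz_pd_prod_bound:
  fixes f g :: "real^'n::finite \<Rightarrow> real"
  assumes f: "f \<in> schwartz" and g: "g \<in> schwartz" and N: "2 * CARD('n) \<le> N" "length is \<le> N" "length js \<le> N"
  shows "\<bar>pd is f x * pd js g x\<bar> \<le> (schwartz_norm N f * schwartz_norm N g) * vec_weight x"
proof -
  have "\<bar>pd is f x\<bar> * \<bar>pd js g x\<bar> \<le> (schwartz_norm N f * vec_weight x) * schwartz_norm N g"
    by (intro mult_mono schwartz_weight_bound schwartz_bounded_by_norm f g N)
       (auto intro!: mult_nonneg_nonneg schwartz_norm_nonneg f less_imp_le[OF vec_weight_pos])
  then show ?thesis by (simp add: abs_mult mult_ac)
qed

lemma schwartz_integrable_mult:
  fixes f g :: "real^'n::finite \<Rightarrow> real"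
  assumes f: "f \<in> schwartz" and g: "g \<in> schwartz"
  shows "integrable lborel (\<lambda>x. f x * g x)"
proof (rule integrable_weight_bound)
  show "(\<lambda>x. f x * g x) \<in> borel_measurable borel"
    using schwartz_measurable[OF f, of "[]"] schwartz_measurable[OF g, of "[]"] by simp
  show "norm (f x * g x) \<le> (schwartz_norm (2 * CARD('n)) f * schwartz_norm (2 * CARD('n)) g) * vec_weight x" for x
    using schwartz_pd_prod_bound[OF f g, of "2 * CARD('n)" "[]" "[]" x] by simp
qed

lemma integration_by_parts:
  fixes f g :: "real^'n::finite \<Rightarrow> real"
  assumes f: "f \<in> schwartz" and g: "g \<in> schwartz"
  shows "(\<integral>x. pd [i] f x * g x \<partial>lborel) = - (\<integral>x. f x * pd [i] g x \<partial>lborel)"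
proof -
  let ?N = "2 * CARD('n)"
  have N: "1 \<le> ?N" by (simp add: Suc_le_eq)
  let ?C = "schwartz_norm ?N f * schwartz_norm ?N g"
  define F' where "F' x = pd [i] f x * g x + f x * pd [i] g x" for x
  have F'b: "\<bar>F' x\<bar> \<le> (2 * ?C) * vec_weight x" for x
  proof -
    have "\<bar>F' x\<bar> \<le> \<bar>pd [i] f x * g x\<bar> + \<bar>f x * pd [i] g x\<bar>" unfolding F'_def by (rule abs_triangle_ineq)
    also have "\<dots> \<le> ?C * vec_weight x + ?C * vec_weight x"
      using schwartz_pd_prod_bound[OF f g, of ?N "[i]" "[]" x] schwartz_pd_prod_bound[OF f g, of ?N "[]" "[i]" x] N
      by (intro add_mono) auto
    finally show ?thesis by (simp add: mult_ac)
  qed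
  have "(\<integral>x. F' x \<partial>lborel) = 0"
  proof (rule integral_derivative_zero[where F="\<lambda>x. f x * g x" and b="axis i 1" and w="\<lambda>x. (2 * ?C) * (3 * vec_weight x)"])
    fix x
    have "((\<lambda>t. f (x + t *\<^sub>R axis i 1)) has_real_derivative pd [i] f x) (at 0)"
      using pd_line_derivative[OF f, of "[]" x i] by simp
    moreover have "((\<lambda>t. g (x + t *\<^sub>R axis i 1)) has_real_derivative pd [i] g x) (at 0)"
      using pd_line_derivative[OF g, of "[]" x i] by simp
    ultimately have "((\<lambda>t. f (x + t *\<^sub>R axis i 1) * g (x + t *\<^sub>R axis i 1)) has_real_derivative
      pd [i] f x * g (x + 0 *\<^sub>R axis i 1) + pd [i] g x * f (x + 0 *\<^sub>R axis i 1)) (at 0)"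
      by (rule DERIV_mult)
    then show "((\<lambda>t. f (x + t *\<^sub>R axis i 1) * g (x + t *\<^sub>R axis i 1)) has_real_derivative F' x) (at 0)"
      by (simp add: F'_def mult.commute)
  next
    show "F' \<in> borel_measurable borel"
      unfolding F'_def[abs_def]
      using schwartz_measurable[OF f, of "[]"] schwartz_measurable[OF g, of "[]"]
        schwartz_measurable[OF f, of "[i]"] schwartz_measurable[OF g, of "[i]"]
      by (intro borel_measurable_add borel_measurable_times) (simp_all only: pd.simps)
    fix x :: "real^'n" and t :: real assume t: "\<bar>t\<bar> \<le> 1"
    have "\<bar>F' (x + t *\<^sub>R axis i 1)\<bar> \<le> (2 * ?C) * vec_weight (x + t *\<^sub>R axis i 1)" by (rule F'b)
    also have "\<dots> \<le> (2 * ?C) * (3 * vec_weight x)"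
      by (intro mult_left_mono vec_weight_shift t mult_nonneg_nonneg schwartz_norm_nonneg f g) simp
    finally show "\<bar>F' (x + t *\<^sub>R axis i 1)\<bar> \<le> (2 * ?C) * (3 * vec_weight x)" .
  qed (intro schwartz_integrable_mult f g integrable_mult_right integrable_vec_weight)+
  moreover have "integrable lborel (\<lambda>x. pd [i] f x * g x)" "integrable lborel (\<lambda>x. f x * pd [i] g x)"
    by (intro schwartz_integrable_mult f g schwartz_pd)+
  ultimately show ?thesis unfolding F'_def by simp
qed

section \<open>The harmonic oscillator and the decay of Hermite coefficients\<close>

definition hermite_coef :: "(real^'n::finite \<Rightarrow> real) \<Rightarrow> ('n \<Rightarrow> nat) \<Rightarrow> real" where
  "hermite_coef f \<alpha> = (\<integral>x. f x * hermite_tensor \<alpha> x \<partial>lborel)"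

text \<open>The one-dimensional harmonic oscillator in coordinate \<open>i\<close>, position squared
  minus second derivative; the factors 1 and -1 give it the shape of
  \<open>continuous_op_lincomb\<close>.\<close>

definition oscillator_part :: "'n \<Rightarrow> (real^'n::finite \<Rightarrow> real) \<Rightarrow> real^'n \<Rightarrow> real" where
  "oscillator_part i f x = 1 * (x $ i * (x $ i * f x)) + (- 1) * pd [i, i] f x"

definition oscillator :: "(real^'n::finite \<Rightarrow> real) \<Rightarrow> real^'n \<Rightarrow> real" where
  "oscillator f x = (\<Sum>i\<in>UNIV. oscillator_part i f x)"

definition hermite_eigenvalue :: "('n::finite \<Rightarrow> nat) \<Rightarrow> real" where
  "hermite_eigenvalue \<alpha> = 2 * real (sum \<alpha> UNIV) + real CARD('n)"

lemma hermite_eigenvalue_sum: "hermite_eigenvalue (\<alpha> :: 'n::finite \<Rightarrow> nat) = (\<Sum>i\<in>UNIV. 2 * real (\<alpha> i) + 1)"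
  by (simp add: hermite_eigenvalue_def sum.distrib sum_distrib_left)

lemma continuous_op_oscillator_part: "continuous_op (oscillator_part i)"
  unfolding oscillator_part_def[abs_def]
  by (intro continuous_op_lincomb continuous_op_pd continuous_op_comp[OF continuous_op_coord continuous_op_coord])

lemma continuous_op_oscillator: "continuous_op oscillator"
  unfolding oscillator_def[abs_def] by (intro continuous_op_sum continuous_op_oscillator_part) simp

lemma schwartz_coord: "f \<in> schwartz \<Longrightarrow> (\<lambda>x. x $ i * f x) \<in> schwartz"
  using continuous_op_coord[of i] by (simp add: continuous_op_def)

lemma pd2_hermite_tensor:
  "pd [i, i] (hermite_tensor \<alpha>) x = ((x $ i)\<^sup>2 - (2 * real (\<alpha> i) + 1)) * hermite_tensor \<alpha> x"
proof -
  have "pd [i, i] (hermite_tensor \<alpha>) x = hermite_diff 2 (\<alpha> i) (x $ i) * (\<Prod>j\<in>UNIV - {i}. hermite_diff (count_list [i, i] j) (\<alpha> j) (x $ j))"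
    unfolding pd_hermite_tensor by (subst prod.remove[of UNIV i]) (simp_all add: numeral_2_eq_2)
  also have "(\<Prod>j\<in>UNIV - {i}. hermite_diff (count_list [i, i] j) (\<alpha> j) (x $ j)) = (\<Prod>j\<in>UNIV - {i}. hermite_fun (\<alpha> j) (x $ j))"
    by (intro prod.cong refl) auto
  also have "hermite_diff 2 (\<alpha> i) (x $ i) * \<dots> = ((x $ i)\<^sup>2 - (2 * real (\<alpha> i) + 1)) * (hermite_fun (\<alpha> i) (x $ i) * (\<Prod>j\<in>UNIV - {i}. hermite_fun (\<alpha> j) (x $ j)))"
    unfolding hermite_diff_2 by simp
  also have "hermite_fun (\<alpha> i) (x $ i) * (\<Prod>j\<in>UNIV - {i}. hermite_fun (\<alpha> j) (x $ j)) = hermite_tensor \<alpha> x"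
    unfolding hermite_tensor_def by (subst prod.remove[of UNIV i]) simp_all
  finally show ?thesis .
qed

text \<open>Two integrations by parts move the second derivative to the Hermite tensor, where the
  differential equation turns the operator into its eigenvalue.\<close>

lemma hermite_coef_oscillator_part:
  fixes f :: "real^'n::finite \<Rightarrow> real"
  assumes f: "f \<in> schwartz"
  shows "hermite_coef (oscillator_part i f) \<alpha> = (2 * real (\<alpha> i) + 1) * hermite_coef f \<alpha>"
proof -
  let ?h = "hermite_tensor \<alpha>"
  have h: "?h \<in> schwartz" by (rule hermite_tensor_schwartz)
  have xf: "(\<lambda>x. x $ i * (x $ i * f x)) \<in> schwartz" by (intro schwartz_coord f)
  have i1: "integrable lborel (\<lambda>x. (x $ i * (x $ i * f x)) * ?h x)" by (rule schwartz_integrable_mult[OF xf h])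
  have i2: "integrable lborel (\<lambda>x. pd [i, i] f x * ?h x)" by (rule schwartz_integrable_mult[OF schwartz_pd[OF f] h])
  have i3: "integrable lborel (\<lambda>x. f x * ?h x)" by (rule schwartz_integrable_mult[OF f h])
  have "(\<integral>x. pd [i, i] f x * ?h x \<partial>lborel) = (\<integral>x. pd [i] (pd [i] f) x * ?h x \<partial>lborel)" by simp
  also have "\<dots> = - (\<integral>x. pd [i] f x * pd [i] ?h x \<partial>lborel)" by (rule integration_by_parts[OF schwartz_pd[OF f] h])
  also have "\<dots> = (\<integral>x. f x * pd [i] (pd [i] ?h) x \<partial>lborel)"
    using integration_by_parts[OF f schwartz_pd[OF h], of i "[i]"] by simp
  also have "\<dots> = (\<integral>x. f x * pd [i, i] ?h x \<partial>lborel)" by simp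
  also have "\<dots> = (\<integral>x. (x $ i * (x $ i * f x)) * ?h x - (2 * real (\<alpha> i) + 1) * (f x * ?h x) \<partial>lborel)"
    unfolding pd2_hermite_tensor by (simp add: algebra_simps power2_eq_square)
  also have "\<dots> = (\<integral>x. (x $ i * (x $ i * f x)) * ?h x \<partial>lborel) - (2 * real (\<alpha> i) + 1) * (\<integral>x. f x * ?h x \<partial>lborel)"
    using i1 i3 by (subst Bochner_Integration.integral_diff) simp_all
  finally have e: "(\<integral>x. pd [i, i] f x * ?h x \<partial>lborel) = \<dots>" .
  have "hermite_coef (oscillator_part i f) \<alpha> = (\<integral>x. (x $ i * (x $ i * f x)) * ?h x - pd [i, i] f x * ?h x \<partial>lborel)"
    unfolding hermite_coef_def oscillator_part_def by (rule Bochner_Integration.integral_cong[OF refl]) (simp only: left_diff_distrib mult_1 mult_minus1 diff_conv_add_uminus distrib_right mult_minus_left)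
  also have "\<dots> = (\<integral>x. (x $ i * (x $ i * f x)) * ?h x \<partial>lborel) - (\<integral>x. pd [i, i] f x * ?h x \<partial>lborel)"
    by (rule Bochner_Integration.integral_diff[OF i1 i2])
  finally show ?thesis unfolding e by (simp add: hermite_coef_def)
qed

lemma hermite_coef_oscillator:
  fixes f :: "real^'n::finite \<Rightarrow> real"
  assumes f: "f \<in> schwartz"
  shows "hermite_coef (oscillator f) \<alpha> = hermite_eigenvalue \<alpha> * hermite_coef f \<alpha>"
proof -
  have o: "oscillator_part i f \<in> schwartz" for i
    using continuous_op_oscillator_part[of i] f by (simp add: continuous_op_def)
  have "hermite_coef (oscillator f) \<alpha> = (\<Sum>i\<in>UNIV. hermite_coef (oscillator_part i f) \<alpha>)"
    unfolding hermite_coef_def oscillator_def sum_distrib_right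
    by (rule Bochner_Integration.integral_sum) (intro schwartz_integrable_mult o hermite_tensor_schwartz)
  then show ?thesis
    by (simp add: hermite_coef_oscillator_part[OF f] hermite_eigenvalue_sum sum_distrib_right)
qed

lemma continuous_op_oscillator_funpow:
  "continuous_op (oscillator ^^ m :: (real^'n::finite \<Rightarrow> real) \<Rightarrow> real^'n \<Rightarrow> real)"
proof (induction m)
  case 0
  have "pd [] = (oscillator ^^ 0 :: (real^'n \<Rightarrow> real) \<Rightarrow> real^'n \<Rightarrow> real)" by (simp add: fun_eq_iff)
  then show ?case using continuous_op_pd[of "[] :: 'n list"] by (simp add: id_def)
next
  case (Suc m)
  have "continuous_op (\<lambda>f :: real^'n \<Rightarrow> real. oscillator ((oscillator ^^ m) f))"
    by (rule continuous_op_comp[OF continuous_op_oscillator Suc])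
  then show ?case by (simp add: comp_def)
qed

lemma schwartz_oscillator_funpow:
  fixes f :: "real^'n::finite \<Rightarrow> real"
  assumes "f \<in> schwartz" shows "(oscillator ^^ m) f \<in> schwartz"
  using continuous_op_oscillator_funpow[of m, where 'n='n] assms by (simp add: continuous_op_def)

lemma hermite_coef_oscillator_funpow:
  fixes f :: "real^'n::finite \<Rightarrow> real"
  assumes f: "f \<in> schwartz"
  shows "hermite_coef ((oscillator ^^ m) f) \<alpha> = hermite_eigenvalue \<alpha> ^ m * hermite_coef f \<alpha>"
  by (induction m) (simp_all add: hermite_coef_oscillator schwartz_oscillator_funpow f)

lemma hermite_index_le_eigenvalue: "hermite_index (\<alpha> :: 'n::finite \<Rightarrow> nat) \<le> hermite_eigenvalue \<alpha> ^ CARD('n)"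
proof -
  have "hermite_index \<alpha> \<le> (\<Prod>i\<in>(UNIV::'n set). hermite_eigenvalue \<alpha>)"
    unfolding hermite_index_def
  proof (intro prod_mono conjI)
    fix i
    show "2 * real (\<alpha> i) + 1 \<le> hermite_eigenvalue \<alpha>"
      unfolding hermite_eigenvalue_sum by (rule member_le_sum) auto
  qed simp
  then show ?thesis by simp
qed

lemma hermite_eigenvalue_ge_1: "1 \<le> hermite_eigenvalue (\<alpha> :: 'n::finite \<Rightarrow> nat)"
proof -
  have "2 * real (\<alpha> undefined) + 1 \<le> hermite_eigenvalue \<alpha>"
    unfolding hermite_eigenvalue_sum by (rule member_le_sum) auto
  then show ?thesis by linarith
qed

lemma hermite_eigenvalue_le_index: "hermite_eigenvalue (\<alpha> :: 'n::finite \<Rightarrow> nat) \<le> real CARD('n) * hermite_index \<alpha>"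
proof -
  have "2 * real (\<alpha> i) + 1 \<le> hermite_index \<alpha>" for i
  proof -
    have "1 \<le> (\<Prod>j\<in>UNIV - {i}. 2 * real (\<alpha> j) + 1)" by (rule prod_ge_1) simp
    then have "(2 * real (\<alpha> i) + 1) * 1 \<le> (2 * real (\<alpha> i) + 1) * (\<Prod>j\<in>UNIV - {i}. 2 * real (\<alpha> j) + 1)"
      by (rule mult_left_mono) simp
    then show ?thesis unfolding hermite_index_def by (subst prod.remove[of UNIV i]) simp_all
  qed
  then have "hermite_eigenvalue \<alpha> \<le> (\<Sum>i\<in>(UNIV::'n set). hermite_index \<alpha>)"
    unfolding hermite_eigenvalue_sum by (intro sum_mono)
  then show ?thesis by simp
qed

text \<open>Smoothness and decay of \<open>f\<close> become decay of its coefficients: the k-th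
  power of the oscillator multiplies them by the k-th power of the eigenvalue, while the direct
  estimate \<open>b\<close> of any coefficient loses only a fixed power of
  \<open>hermite_index\<close>.\<close>

lemma hermite_coef_decay:
  "\<exists>C M. C \<ge> 0 \<and> (\<forall>f\<in>schwartz. \<forall>\<alpha>::'n::finite \<Rightarrow> nat. \<bar>hermite_coef f \<alpha>\<bar> * hermite_index \<alpha> ^ r \<le> C * schwartz_norm M f)"
proof -
  obtain C0 m0 where C0: "C0 \<ge> 0" "\<And>\<alpha> :: 'n \<Rightarrow> nat. schwartz_seminorm 0 [] (hermite_tensor \<alpha>) \<le> C0 * hermite_index \<alpha> ^ m0"
    using hermite_tensor_seminorm[of 0 "[]"] by blast
  let ?N = "2 * CARD('n)"
  define I where "I = (\<integral>x. vec_weight (x :: real^'n) \<partial>lborel)"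
  have I: "I \<ge> 0" unfolding I_def by (rule integral_nonneg_AE) (simp add: less_imp_le vec_weight_pos)
  have b: "\<bar>hermite_coef f \<alpha>\<bar> \<le> (C0 * I) * schwartz_norm ?N f * hermite_index \<alpha> ^ m0" if f: "f \<in> schwartz" for f :: "real^'n \<Rightarrow> real" and \<alpha>
  proof -
    have "\<bar>hermite_coef f \<alpha>\<bar> \<le> (\<integral>x. \<bar>f x * hermite_tensor \<alpha> x\<bar> \<partial>lborel)"
      unfolding hermite_coef_def using integral_norm_bound[of lborel "\<lambda>x. f x * hermite_tensor \<alpha> x"] by simp
    also have "\<dots> \<le> (\<integral>x. schwartz_norm ?N f * (C0 * hermite_index \<alpha> ^ m0) * vec_weight (x :: real^'n) \<partial>lborel)"
    proof (rule integral_mono)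
      show "integrable lborel (\<lambda>x. \<bar>f x * hermite_tensor \<alpha> x\<bar>)"
        by (intro integrable_abs schwartz_integrable_mult f hermite_tensor_schwartz)
      show "integrable lborel (\<lambda>x::real^'n. schwartz_norm ?N f * (C0 * hermite_index \<alpha> ^ m0) * vec_weight x)"
        by (intro integrable_mult_right integrable_vec_weight)
      fix x
      have "\<bar>hermite_tensor \<alpha> x\<bar> \<le> C0 * hermite_index \<alpha> ^ m0"
        using schwartz_seminorm_ge[OF hermite_tensor_schwartz[of \<alpha>], of x 0 "[]"] C0(2)[of \<alpha>] by simp
      moreover have "\<bar>f x\<bar> \<le> schwartz_norm ?N f * vec_weight x"
        using schwartz_weight_bound[OF f, of ?N "[]" x] by simp
      ultimately have "\<bar>f x\<bar> * \<bar>hermite_tensor \<alpha> x\<bar> \<le> (schwartz_norm ?N f * vec_weight x) * (C0 * hermite_index \<alpha> ^ m0)"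
        by (intro mult_mono) (auto intro!: mult_nonneg_nonneg schwartz_norm_nonneg f less_imp_le[OF vec_weight_pos])
      then show "\<bar>f x * hermite_tensor \<alpha> x\<bar> \<le> schwartz_norm ?N f * (C0 * hermite_index \<alpha> ^ m0) * vec_weight x"
        by (simp add: abs_mult mult_ac)
    qed
    also have "\<dots> = (C0 * I) * schwartz_norm ?N f * hermite_index \<alpha> ^ m0" by (simp add: I_def)
    finally show ?thesis .
  qed
  define k where "k = CARD('n) * (r + m0)"
  obtain D M where D: "D \<ge> 0" "\<And>f :: real^'n \<Rightarrow> real. f \<in> schwartz \<Longrightarrow> schwartz_norm ?N ((oscillator ^^ k) f) \<le> D * schwartz_norm M f"
    using continuous_op_norm[OF continuous_op_oscillator_funpow[of k], of ?N] unfolding dominated_def by blast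
  show ?thesis
  proof (intro exI[of _ "(C0 * I) * D"] exI[of _ M] conjI ballI allI)
    show "0 \<le> C0 * I * D" using C0(1) I D(1) by simp
    fix f :: "real^'n \<Rightarrow> real" and \<alpha> :: "'n \<Rightarrow> nat" assume f: "f \<in> schwartz"
    have Hf: "(oscillator ^^ k) f \<in> schwartz" by (rule schwartz_oscillator_funpow[OF f])
    have "hermite_index \<alpha> ^ (r + m0) \<le> (hermite_eigenvalue \<alpha> ^ CARD('n)) ^ (r + m0)"
      by (intro power_mono hermite_index_le_eigenvalue order_trans[OF zero_le_one hermite_index_ge_1])
    then have "\<bar>hermite_coef f \<alpha>\<bar> * hermite_index \<alpha> ^ (r + m0) \<le> \<bar>hermite_coef f \<alpha>\<bar> * hermite_eigenvalue \<alpha> ^ k"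
      unfolding k_def power_mult by (intro mult_left_mono) auto
    also have "\<dots> = \<bar>hermite_coef ((oscillator ^^ k) f) \<alpha>\<bar>"
      using hermite_coef_oscillator_funpow[OF f, of k \<alpha>] hermite_eigenvalue_ge_1[of \<alpha>] by (simp add: abs_mult mult.commute)
    also have "\<dots> \<le> (C0 * I) * schwartz_norm ?N ((oscillator ^^ k) f) * hermite_index \<alpha> ^ m0" by (rule b[OF Hf])
    also have "\<dots> \<le> (C0 * I) * (D * schwartz_norm M f) * hermite_index \<alpha> ^ m0"
      using hermite_index_ge_1[of \<alpha>] C0(1) I by (intro mult_right_mono mult_left_mono D(2)[OF f]) auto
    finally have "(\<bar>hermite_coef f \<alpha>\<bar> * hermite_index \<alpha> ^ r) * hermite_index \<alpha> ^ m0 \<le> (C0 * I * D * schwartz_norm M f) * hermite_index \<alpha> ^ m0"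
      by (simp add: power_add mult_ac)
    then show "\<bar>hermite_coef f \<alpha>\<bar> * hermite_index \<alpha> ^ r \<le> C0 * I * D * schwartz_norm M f"
      by (rule mult_right_le_imp_le) (use hermite_index_ge_1[of \<alpha>] in simp)
  qed
qed

section \<open>Enumeration of multi-indices and summability\<close>

lemma infinite_multi_indices: "infinite (UNIV :: ('n::finite \<Rightarrow> nat) set)"
proof -
  have "inj (\<lambda>k::nat. (\<lambda>_::'n. k))" by (auto simp: inj_def fun_eq_iff)
  then have "infinite (range (\<lambda>k::nat. (\<lambda>_::'n. k)))" by (rule range_inj_infinite)
  then show ?thesis using finite_subset[OF subset_UNIV] by blast
qed

text \<open>The enumeration is arbitrary; later bounds are expressed through
  \<open>hermite_index (multi_index n)\<close> and do not depend on the order.\<close>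

definition multi_index :: "nat \<Rightarrow> ('n::finite \<Rightarrow> nat)" where
  "multi_index = from_nat_into UNIV"

lemma bij_multi_index: "bij_betw multi_index UNIV (UNIV :: ('n::finite \<Rightarrow> nat) set)"
  unfolding multi_index_def by (rule bij_betw_from_nat_into) (auto simp: infinite_multi_indices)

text \<open>The terms factorise over the coordinates. A finite set of multi-indices lies in a cube,
  and over a cube the sum is a product of d partial sums of a convergent one-dimensional
  series.\<close>

lemma summable_on_hermite_index:
  assumes s: "s > 1"
  shows "(\<lambda>\<alpha> :: 'n::finite \<Rightarrow> nat. hermite_index \<alpha> powr (- s)) summable_on UNIV"
proof -
  define a where "a n = (2 * real n + 1) powr (- s)" for n
  have a0: "a n \<ge> 0" for n by (simp add: a_def)
  have sa: "summable a"
  proof (rule summable_comparison_test_ev)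
    show "summable (\<lambda>n. real n powr (- s))" using s by (simp add: summable_real_powr_iff)
    have "norm (a n) \<le> real n powr (- s)" if "n \<ge> 1" for n
      using that s unfolding a_def by (simp add: powr_mono2')
    then show "\<forall>\<^sub>F n in sequentially. norm (a n) \<le> real n powr (- s)"
      unfolding eventually_sequentially by blast
  qed
  have eq: "hermite_index \<alpha> powr (- s) = (\<Prod>i\<in>UNIV. a (\<alpha> i))" for \<alpha> :: "'n \<Rightarrow> nat"
    unfolding hermite_index_def a_def by (rule prod_powr_distrib)
  show ?thesis
  proof (rule nonneg_bdd_above_summable_on)
    show "0 \<le> hermite_index \<alpha> powr (- s)" for \<alpha> :: "'n \<Rightarrow> nat" by simp
    show "bdd_above (sum (\<lambda>\<alpha> :: 'n \<Rightarrow> nat. hermite_index \<alpha> powr (- s)) ` {F. F \<subseteq> UNIV \<and> finite F})"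
    proof (rule bdd_aboveI2)
      fix F :: "('n \<Rightarrow> nat) set" assume "F \<in> {F. F \<subseteq> UNIV \<and> finite F}"
      then have F: "finite F" by simp
      define N where "N = Max ((\<lambda>(\<alpha>, i). \<alpha> i) ` (F \<times> UNIV))"
      have N: "\<alpha> i \<le> N" if "\<alpha> \<in> F" for \<alpha> i
        unfolding N_def using F that by (intro Max_ge) (auto intro!: image_eqI[of _ _ "(\<alpha>, i)"])
      have "sum (\<lambda>\<alpha>. hermite_index \<alpha> powr (- s)) F \<le> sum (\<lambda>\<alpha>. \<Prod>i\<in>UNIV. a (\<alpha> i)) (PiE UNIV (\<lambda>_::'n. {..N}))"
        unfolding eq by (intro sum_mono2 finite_PiE) (use N in \<open>auto intro!: prod_nonneg a0\<close>)
      also have "\<dots> = (\<Prod>i\<in>(UNIV::'n set). \<Sum>n\<le>N. a n)" by (subst prod_sum_PiE) auto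
      also have "\<dots> \<le> (\<Prod>i\<in>(UNIV::'n set). suminf a)"
        by (intro prod_mono conjI sum_nonneg a0 sum_le_suminf sa) auto
      finally show "sum (\<lambda>\<alpha>. hermite_index \<alpha> powr (- s)) F \<le> (\<Prod>i\<in>(UNIV::'n set). suminf a)" .
    qed
  qed
qed

lemma summable_hermite_index:
  assumes "s > 1"
  shows "summable (\<lambda>n. hermite_index (multi_index n :: 'n::finite \<Rightarrow> nat) powr (- s))"
proof -
  have "(\<lambda>n. hermite_index (multi_index n :: 'n \<Rightarrow> nat) powr (- s)) summable_on UNIV"
    by (subst summable_on_reindex_bij_betw[OF bij_multi_index]) (rule summable_on_hermite_index[OF assms])
  then show ?thesis by (subst (asm) summable_on_UNIV_nonneg_real_iff) simp_all
qed

lemma summable_hermite_index_square: "summable (\<lambda>n. inverse (hermite_index (multi_index n :: 'n::finite \<Rightarrow> nat)) ^ 2)"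
proof -
  have "hermite_index \<alpha> powr (- 2) = inverse (hermite_index \<alpha>) ^ 2" for \<alpha> :: "'n \<Rightarrow> nat"
    using hermite_index_ge_1[of \<alpha>] by (simp add: powr_minus power_inverse)
  then show ?thesis using summable_hermite_index[of 2, where 'n='n] by simp
qed

section \<open>Completeness and convergence of Hermite series\<close>

lemma hermite_coef_tensor: "hermite_coef (hermite_tensor \<beta>) \<alpha> = (if \<alpha> = \<beta> then 1 else 0)"
proof -
  have "hermite_coef (hermite_tensor \<beta>) \<alpha> = (\<integral>x. (\<Prod>i\<in>UNIV. hermite_fun (\<beta> i) (x $ i) * hermite_fun (\<alpha> i) (x $ i)) \<partial>lborel)"
    by (simp add: hermite_coef_def hermite_tensor_def prod.distrib)
  also have "\<dots> = (\<Prod>i\<in>UNIV. \<integral>x. hermite_fun (\<beta> i) x * hermite_fun (\<alpha> i) x \<partial>lborel)"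
    by (rule vec_integral_prod(2)[where u="\<lambda>i x. hermite_fun (\<beta> i) x * hermite_fun (\<alpha> i) x"])
       (intro rapid_integrable rapid_mult hermite_rapid)
  also have "\<dots> = (\<Prod>i\<in>UNIV. if \<beta> i = \<alpha> i then 1 else 0)" by (simp only: hermite_orthonormal)
  also have "\<dots> = (if \<alpha> = \<beta> then 1 else 0)"
  proof (cases "\<alpha> = \<beta>")
    case False
    then obtain i where "\<alpha> i \<noteq> \<beta> i" by (auto simp: fun_eq_iff)
    then have "(if \<beta> i = \<alpha> i then 1 else 0 :: real) = 0" by simp
    then have "(\<Prod>i\<in>UNIV. if \<beta> i = \<alpha> i then 1 else 0 :: real) = 0" by (intro prod_zero bexI[of _ i]) simp_all
    then show ?thesis using False by simp
  qed simp
  finally show ?thesis .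
qed

text \<open>If \<open>g\<close> were positive at \<open>a\<close>, it would be positive on a box.
  Vanishing of all coefficients passes through the Hermite closure to the test function that is a
  positive Gaussian on the box and 0 outside, whose pairing with \<open>g\<close> would be strictly
  positive.\<close>

lemma hermite_complete:
  fixes g :: "real^'n::finite \<Rightarrow> real"
  assumes g: "continuous_on UNIV g" "integrable lborel g" and zero: "\<And>\<alpha>. hermite_coef g \<alpha> = 0"
  shows "g a = 0"
proof -
  have main: "\<not> g a > 0" if g: "continuous_on UNIV g" "integrable lborel g" and zero: "\<And>\<alpha>. hermite_coef g \<alpha> = 0" for g :: "real^'n \<Rightarrow> real"
  proof
    assume pos: "g a > 0"
    have "open {x. 0 < g x}" by (rule open_Collect_less[OF continuous_on_const g(1)])
    moreover have "a \<in> {x. 0 < g x}" using pos by simp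
    ultimately obtain d where d0: "d > 0" "ball a d \<subseteq> {x. 0 < g x}" by (rule openE)
    have d: "g x > 0" if "dist x a < d" for x
      using d0(2) that by (auto simp: dist_commute)
    \<comment> \<open>Half of the radius is shared among the coordinates, so the l1 norm bounds the
      distance to \<open>a\<close> by \<open>d / 2\<close>.\<close>
    define \<delta> where "\<delta> = d / (2 * real CARD('n))"
    have \<delta>: "\<delta> > 0" using d0(1) by (simp add: \<delta>_def)
    define l u where "l = (\<chi> i. a $ i - \<delta>)" and "u = (\<chi> i. a $ i + \<delta>)"
    have gpos: "g x > 0" if "x \<in> box l u" for x
    proof (rule d)
      have x: "\<bar>(x - a) $ i\<bar> \<le> \<delta>" for i
        using that by (auto simp: mem_box_cart l_def u_def abs_le_iff dest!: spec[of _ i])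
      have "norm (x - a) \<le> (\<Sum>i\<in>UNIV. \<bar>(x - a) $ i\<bar>)" by (rule norm_le_l1_cart)
      also have "\<dots> \<le> (\<Sum>i\<in>(UNIV::'n set). \<delta>)" by (intro sum_mono x)
      also have "\<dots> = d / 2" by (simp add: \<delta>_def)
      also have "\<dots> < d" using d0(1) by simp
      finally show "dist x a < d" by (simp add: dist_norm)
    qed
    define A where "A i = {l $ i<..<u $ i}" for i
    define w where "w i y = complex_of_real (hermite_fun 0 y) * indicator (A i) y" for i y
    have gm: "g \<in> borel_measurable borel" using g(1) by (rule borel_measurable_continuous_onI)
    \<comment> \<open>The weight 0 on the right-hand side turns the comparison of integrals into a
      statement about vanishing.\<close>
    have "(\<integral>x. complex_of_real (g x) * (\<Prod>i\<in>UNIV. w i (x $ i)) \<partial>lborel) = (\<integral>x. 0 * (\<Prod>i\<in>UNIV. w i (x $ i)) \<partial>(lborel :: (real^'n) measure))"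
    proof (rule bp_integral_prod_eq[OF hermite_base_measurable hermite_base_bounded])
      show "integrable lborel (\<lambda>x. complex_of_real (g x))" using g(2) by simp
      show "bp_closure hermite_base (w i)" for i unfolding w_def[abs_def] by (rule hermite_closure_indicator) (simp add: A_def)
      fix v :: "'n \<Rightarrow> real \<Rightarrow> complex" assume "\<And>i. i \<in> UNIV \<Longrightarrow> v i \<in> hermite_base"
      then have "\<forall>i. \<exists>n. v i = (\<lambda>x. complex_of_real (hermite_fun n x))" by (auto simp: hermite_base_def)
      from choice[OF this] obtain \<alpha> where \<alpha>: "\<forall>i. v i = (\<lambda>x. complex_of_real (hermite_fun (\<alpha> i) x))" ..
      have "(\<integral>x. complex_of_real (g x) * (\<Prod>i\<in>UNIV. v i (x $ i)) \<partial>lborel) = (\<integral>x. complex_of_real (g x * hermite_tensor \<alpha> x) \<partial>lborel)"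
        using \<alpha> by (simp add: hermite_tensor_def)
      also have "\<dots> = complex_of_real (hermite_coef g \<alpha>)"
        unfolding hermite_coef_def by (rule integral_complex_of_real)
      finally show "(\<integral>x. complex_of_real (g x) * (\<Prod>i\<in>UNIV. v i (x $ i)) \<partial>lborel) = (\<integral>x. 0 * (\<Prod>i\<in>UNIV. v i (x $ i)) \<partial>(lborel :: (real^'n) measure))"
        by (simp add: zero)
    qed simp_all
    moreover define k where "k x = g x * (\<Prod>i\<in>UNIV. hermite_fun 0 (x $ i)) * indicator (box l u) x" for x
    have ind: "(\<Prod>i\<in>UNIV. indicator (A i) (x $ i)) = (indicator (box l u) x :: real)" for x :: "real^'n"
      by (auto simp: A_def indicator_def mem_box_cart prod_zero_iff intro!: prod.neutral)
    have keq: "complex_of_real (g x) * (\<Prod>i\<in>UNIV. w i (x $ i)) = complex_of_real (k x)" for x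
    proof -
      have "(\<Prod>i\<in>UNIV. w i (x $ i)) = complex_of_real ((\<Prod>i\<in>UNIV. hermite_fun 0 (x $ i)) * (\<Prod>i\<in>UNIV. indicator (A i) (x $ i)))"
      proof -
        have "w i y = complex_of_real (hermite_fun 0 y * indicator (A i) y)" for i y
          by (auto simp: w_def indicator_def)
        then show ?thesis by (simp only: of_real_prod[symmetric] prod.distrib)
      qed
      then show ?thesis unfolding ind k_def by simp
    qed
    ultimately have k0: "(\<integral>x. k x \<partial>lborel) = 0" unfolding keq by (simp add: integral_complex_of_real)
    have h0: "hermite_fun 0 y > 0" for y using hermite_const_pos[of 0] by (simp add: hermite_fun_alt)
    have knn: "k x \<ge> 0" for x
      using gpos[of x] by (auto simp: k_def indicator_def intro!: mult_nonneg_nonneg prod_nonneg less_imp_le[OF h0])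
    have hb: "hermite_fun 0 y \<le> 7" for y using hermite_sup_bound[of 0 y] by simp
    have hm: "hermite_fun 0 \<in> borel_measurable borel" using hermite_rapid[of 0] by (simp add: rapid_def borel_measurable_continuous_onI)
    have km: "k \<in> borel_measurable borel"
      unfolding k_def[abs_def] using gm
      by (intro borel_measurable_times borel_measurable_prod measurable_compose[OF _ hm]) simp_all
    have ki: "integrable lborel k"
    proof (rule Bochner_Integration.integrable_bound)
      show "integrable lborel (\<lambda>x. g x * 7 ^ CARD('n))" using g(2) by simp
      have "\<bar>\<Prod>i\<in>UNIV. hermite_fun 0 (x $ i)\<bar> \<le> 7 ^ CARD('n)" for x :: "real^'n"
        unfolding abs_prod using prod_mono[of UNIV "\<lambda>i. \<bar>hermite_fun 0 (x $ i)\<bar>" "\<lambda>_. 7"] h0 hb by (simp add: less_imp_le)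
      then show "AE x in lborel. norm (k x) \<le> norm (g x * 7 ^ CARD('n))"
        by (intro AE_I2) (auto simp: k_def abs_mult indicator_def intro!: mult_left_mono)
    qed (use km in simp)
    have "AE x in lborel. k x = 0"
      using integral_nonneg_eq_0_iff_AE[OF ki] knn k0 by simp
    then obtain Z where Z: "{x. k x \<noteq> 0} \<subseteq> Z" "emeasure lborel Z = 0" "Z \<in> sets lborel"
      by (auto elim!: AE_E)
    have "box l u \<subseteq> {x. k x \<noteq> 0}"
    proof
      fix x assume x: "x \<in> box l u"
      have "(\<Prod>i\<in>UNIV. hermite_fun 0 (x $ i)) > 0" by (intro prod_pos h0)
      then have "g x * (\<Prod>i\<in>UNIV. hermite_fun 0 (x $ i)) > 0" using gpos[OF x] by (rule mult_pos_pos[rotated])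
      moreover have "k x = g x * (\<Prod>i\<in>UNIV. hermite_fun 0 (x $ i))" using x by (simp add: k_def)
      ultimately have "k x > 0" by (simp only:)
      then show "x \<in> {x. k x \<noteq> 0}" by simp
    qed
    then have "emeasure lborel (box l u) \<le> 0" using Z emeasure_mono[of "box l u" Z lborel] by auto
    moreover have "emeasure lborel (box l u) > 0"
    proof -
      have lu: "l \<bullet> b \<le> u \<bullet> b" if "b \<in> Basis" for b
        using that \<delta> by (auto simp: Basis_vec_def l_def u_def inner_axis)
      have "(\<Prod>b\<in>Basis. (u - l) \<bullet> b) > 0"
        using \<delta> by (intro prod_pos) (auto simp: Basis_vec_def l_def u_def inner_axis)
      then show ?thesis by (subst emeasure_lborel_box[OF lu]) auto
    qed
    ultimately show False by simp
  qed
  have "hermite_coef (\<lambda>x. - g x) \<alpha> = 0" for \<alpha> using zero[of \<alpha>] by (simp add: hermite_coef_def)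
  then have "\<not> - g a > 0" using main[of "\<lambda>x. - g x"] g by (simp add: continuous_on_minus)
  then show ?thesis using main[OF g zero] by simp
qed


definition hermite_seq :: "nat \<Rightarrow> real^'n::finite \<Rightarrow> real" where
  "hermite_seq n = hermite_tensor (multi_index n)"

definition coef_seq :: "(real^'n::finite \<Rightarrow> real) \<Rightarrow> nat \<Rightarrow> real" where
  "coef_seq f n = hermite_coef f (multi_index n)"

lemma hermite_seq_schwartz: "hermite_seq n \<in> schwartz"
  by (simp add: hermite_seq_def hermite_tensor_schwartz)

lemma hermite_coef_bound_index:
  obtains C M where "C \<ge> 0" "\<And>f (\<alpha>::'n::finite \<Rightarrow> nat). f \<in> schwartz \<Longrightarrow> \<bar>hermite_coef f \<alpha>\<bar> * hermite_index \<alpha> ^ r \<le> C * schwartz_norm M f"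
  using hermite_coef_decay[of r, where 'n='n] by blast

text \<open>The decay of coefficients is taken with exponent \<open>m + 2\<close>: \<open>m\<close>
  powers absorb the growth of the seminorms of Hermite tensors, and two remain for
  summability.\<close>

lemma expansion_majorant:
  fixes f :: "real^'n::finite \<Rightarrow> real"
  assumes f: "f \<in> schwartz"
  shows "\<exists>b. summable b \<and> (\<forall>n (x::real^'n). (1 + norm x) ^ k * \<bar>coef_seq f n * pd is (hermite_seq n) x\<bar> \<le> b n)"
proof -
  obtain C m where C: "C \<ge> 0" "\<And>\<alpha> :: 'n \<Rightarrow> nat. schwartz_seminorm k is (hermite_tensor \<alpha>) \<le> C * hermite_index \<alpha> ^ m"
    using hermite_tensor_seminorm[of k "is"] by blast
  obtain D M where D: "D \<ge> 0" "\<And>f (\<alpha> :: 'n \<Rightarrow> nat). f \<in> schwartz \<Longrightarrow> \<bar>hermite_coef f \<alpha>\<bar> * hermite_index \<alpha> ^ (m + 2) \<le> D * schwartz_norm M f"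
    by (rule hermite_coef_bound_index[of "m + 2", where 'n='n]) blast
  define b where "b n = (C * (D * schwartz_norm M f)) * inverse (hermite_index (multi_index n :: 'n \<Rightarrow> nat)) ^ 2" for n
  have "summable b" unfolding b_def by (intro summable_mult summable_hermite_index_square)
  moreover have "(1 + norm x) ^ k * \<bar>coef_seq f n * pd is (hermite_seq n) x\<bar> \<le> b n" for n x
  proof -
    let ?i = "hermite_index (multi_index n :: 'n \<Rightarrow> nat)"
    have i: "?i > 0" using hermite_index_ge_1[of "multi_index n :: 'n \<Rightarrow> nat"] by linarith
    have "(1 + norm x) ^ k * \<bar>pd is (hermite_seq n) x\<bar> \<le> C * ?i ^ m"
      unfolding hermite_seq_def by (rule order_trans[OF schwartz_seminorm_ge[OF hermite_tensor_schwartz] C(2)])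
    then have "\<bar>coef_seq f n\<bar> * ((1 + norm x) ^ k * \<bar>pd is (hermite_seq n) x\<bar>) \<le> \<bar>coef_seq f n\<bar> * (C * ?i ^ m)"
      by (rule mult_left_mono) simp
    also have "\<dots> = C * (\<bar>coef_seq f n\<bar> * ?i ^ (m + 2)) * inverse ?i ^ 2"
      using i by (simp add: power_add power2_eq_square field_simps)
    also have "\<dots> \<le> C * (D * schwartz_norm M f) * inverse ?i ^ 2"
      unfolding coef_seq_def using i by (intro mult_right_mono mult_left_mono D(2) f C(1)) simp
    finally show ?thesis by (simp add: b_def abs_mult mult_ac)
  qed
  ultimately show ?thesis by blast
qed

text \<open>Without derivatives, the series defines a continuous integrable function with the same
  coefficients as \<open>f\<close>, and completeness identifies the two. Each further derivative is
  one termwise differentiation along an axis.\<close>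

lemma hermite_expansion:
  fixes f :: "real^'n::finite \<Rightarrow> real"
  assumes f: "f \<in> schwartz"
  shows "(\<lambda>n. coef_seq f n * pd is (hermite_seq n) x) sums pd is f x"
proof (induction "is" arbitrary: x)
  case Nil
  \<comment> \<open>This exponent converts the majorant into a multiple of
    \<open>vec_weight\<close>, which permits termwise integration.\<close>
  let ?N = "2 * CARD('n)"
  from expansion_majorant[OF f, of ?N "[]"] obtain b
    where bs: "summable b \<and> (\<forall>n (x::real^'n). (1 + norm x) ^ ?N * \<bar>coef_seq f n * pd [] (hermite_seq n) x\<bar> \<le> b n)" ..
  have b: "summable b" "(1 + norm x) ^ ?N * \<bar>coef_seq f n * hermite_seq n x\<bar> \<le> b n" for n and x :: "real^'n"
    using bs[THEN conjunct1] bs[THEN conjunct2, rule_format, of x n] by (simp_all only: pd.simps)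
  have bw: "\<bar>coef_seq f n * hermite_seq n x\<bar> \<le> b n * vec_weight x" for n and x :: "real^'n"
  proof -
    let ?t = "\<bar>coef_seq f n * hermite_seq n x\<bar>"
    have "?t \<le> ((1 + norm x) ^ ?N * vec_weight x) * ?t"
      using mult_right_mono[OF vec_weight_lower[of x], of ?t] by simp
    also have "\<dots> = ((1 + norm x) ^ ?N * ?t) * vec_weight x" by simp
    also have "\<dots> \<le> b n * vec_weight x" by (intro mult_right_mono b less_imp_le[OF vec_weight_pos])
    finally show ?thesis .
  qed
  have b0: "b n \<ge> 0" for n using order_trans[OF _ b(2)[of 0 n]] by simp
  have bb: "norm (coef_seq f n * hermite_seq n x) \<le> b n" for n and x :: "real^'n"
    using order_trans[OF bw mult_left_mono[OF vec_weight_le_1 b0]] by simp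
  have sm: "summable (\<lambda>n. coef_seq f n * hermite_seq n x)" for x :: "real^'n"
    by (rule summable_comparison_test'[OF b(1) bb])
  define g where "g x = (\<Sum>n. coef_seq f n * hermite_seq n x)" for x :: "real^'n"
  have hc: "continuous_on UNIV (hermite_seq n :: real^'n \<Rightarrow> real)" for n
    using schwartz_continuous[OF hermite_seq_schwartz, of "[]"] by simp
  have fc: "continuous_on UNIV f" using schwartz_continuous[OF f, of "[]"] by simp
  have gc: "continuous_on UNIV g"
  proof -
    have ul: "uniform_limit UNIV (\<lambda>m x. \<Sum>n<m. coef_seq f n * hermite_seq n x) g sequentially"
      unfolding g_def[abs_def] by (rule Weierstrass_m_test[OF bb b(1)])
    have "continuous_on UNIV (\<lambda>x. \<Sum>n<m. coef_seq f n * hermite_seq n (x :: real^'n))" for m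
      by (intro continuous_on_sum continuous_on_mult continuous_on_const hc)
    then show ?thesis by (intro uniform_limit_theorem[OF always_eventually ul] allI) simp_all
  qed
  have gw: "\<bar>g x\<bar> \<le> suminf b * vec_weight x" for x
  proof -
    have "\<bar>g x\<bar> \<le> (\<Sum>n. b n * vec_weight x)"
      unfolding g_def real_norm_def[symmetric]
      by (rule norm_suminf_le) (use bw summable_mult2[OF b(1)] in simp_all)
    then show ?thesis by (simp add: suminf_mult2[OF b(1)])
  qed
  have fi: "integrable lborel f"
    by (rule integrable_weight_bound[where C="schwartz_norm ?N f"])
       (use schwartz_measurable[OF f, of "[]"] schwartz_weight_bound[OF f, of ?N "[]"] in simp_all)
  have gi: "integrable lborel g"
    by (rule integrable_weight_bound[OF borel_measurable_continuous_onI[OF gc], where C="suminf b"]) (simp add: gw)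
  have gcoef: "hermite_coef g \<beta> = hermite_coef f \<beta>" for \<beta>
  proof -
    obtain m where m: "multi_index m = \<beta>" using bij_multi_index by (metis UNIV_I bij_betw_imp_surj_on imageE)
    have ml: "multi_index n = \<beta> \<longleftrightarrow> n = m" for n
      using bij_multi_index m by (metis bij_betw_imp_inj_on injD)
    have hs: "hermite_tensor \<beta> \<in> schwartz" by (rule hermite_tensor_schwartz)
    define K where "K = schwartz_norm ?N (hermite_tensor \<beta>)"
    have K: "\<bar>hermite_tensor \<beta> x\<bar> \<le> K" for x unfolding K_def using schwartz_bounded_by_norm[OF hs, of ?N "[]" x] by simp
    have K0: "K \<ge> 0" unfolding K_def by (rule schwartz_norm_nonneg[OF hs])
    define t where "t n x = coef_seq f n * (hermite_seq n x * hermite_tensor \<beta> x)" for n x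
    have ti: "integrable lborel (t n)" for n
      unfolding t_def[abs_def] by (intro integrable_mult_right schwartz_integrable_mult hermite_seq_schwartz hs)
    have tb: "norm (t n x) \<le> (b n * K) * vec_weight x" for n x
    proof -
      have "\<bar>coef_seq f n * hermite_seq n x\<bar> * \<bar>hermite_tensor \<beta> x\<bar> \<le> (b n * vec_weight x) * K"
        by (intro mult_mono bw K mult_nonneg_nonneg b0 less_imp_le[OF vec_weight_pos]) simp
      then show ?thesis by (simp add: t_def abs_mult mult_ac)
    qed
    have ts: "summable (\<lambda>n. norm (t n x))" for x
      by (rule summable_comparison_test'[where g="\<lambda>n. (b n * K) * vec_weight x" and N=0])
         (use tb in \<open>auto intro!: summable_mult2 b(1)\<close>)
    have tis: "summable (\<lambda>n. \<integral>x. norm (t n x) \<partial>lborel)"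
    proof (rule summable_comparison_test'[where N=0])
      show "summable (\<lambda>n. (b n * K) * (\<integral>x. vec_weight (x :: real^'n) \<partial>lborel))"
        by (intro summable_mult2 b(1))
      fix n
      have "(\<integral>x. norm (t n x) \<partial>lborel) \<le> (\<integral>x. (b n * K) * vec_weight (x :: real^'n) \<partial>lborel)"
        by (intro integral_mono integrable_norm ti integrable_mult_right integrable_vec_weight tb)
      then show "norm (\<integral>x. norm (t n x) \<partial>lborel) \<le> (b n * K) * (\<integral>x. vec_weight (x :: real^'n) \<partial>lborel)"
        by (simp add: integral_nonneg_AE)
    qed
    have "hermite_coef g \<beta> = (\<integral>x. (\<Sum>n. t n x) \<partial>lborel)"
    proof -
      have "g x * hermite_tensor \<beta> x = (\<Sum>n. t n x)" for x
        unfolding g_def t_def using suminf_mult2[OF sm[of x], of "hermite_tensor \<beta> x"] by (simp add: mult.assoc)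
      then show ?thesis by (simp add: hermite_coef_def)
    qed
    also have "\<dots> = (\<Sum>n. \<integral>x. t n x \<partial>lborel)"
      by (rule integral_suminf[OF ti AE_I2[OF ts] tis])
    also have "\<dots> = (\<Sum>n. coef_seq f n * hermite_coef (hermite_tensor (multi_index n)) \<beta>)"
      unfolding t_def hermite_seq_def hermite_coef_def by simp
    also have "\<dots> = (\<Sum>n. if n = m then hermite_coef f \<beta> else 0)"
    proof (rule suminf_cong)
      fix n
      show "coef_seq f n * hermite_coef (hermite_tensor (multi_index n)) \<beta> = (if n = m then hermite_coef f \<beta> else 0)"
      proof (cases "n = m")
        case True
        then show ?thesis by (simp add: hermite_coef_tensor coef_seq_def m)
      next
        case False
        then have "\<beta> \<noteq> multi_index n" using ml[of n] by metis
        then show ?thesis using False by (simp add: hermite_coef_tensor)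
      qed
    qed
    also have "\<dots> = hermite_coef f \<beta>"
      using sums_single[of m "\<lambda>_. hermite_coef f \<beta>"] by (simp add: sums_iff)
    finally show ?thesis .
  qed
  have "f x - g x = 0"
  proof (rule hermite_complete)
    show "continuous_on UNIV (\<lambda>x. f x - g x)" by (intro continuous_on_diff fc gc)
    show "integrable lborel (\<lambda>x. f x - g x)" by (intro Bochner_Integration.integrable_diff fi gi)
    fix \<alpha> :: "'n \<Rightarrow> nat"
    have hs: "hermite_tensor \<alpha> \<in> schwartz" by (rule hermite_tensor_schwartz)
    have m: "(\<lambda>x. g x * hermite_tensor \<alpha> x) \<in> borel_measurable borel"
      using borel_measurable_continuous_onI[OF gc] schwartz_measurable[OF hs, of "[]"] by simp
    have gi': "integrable lborel (\<lambda>x. g x * hermite_tensor \<alpha> x)"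
    proof (rule integrable_weight_bound[OF m])
      fix x
      have "\<bar>g x\<bar> * \<bar>hermite_tensor \<alpha> x\<bar> \<le> (suminf b * vec_weight x) * schwartz_norm ?N (hermite_tensor \<alpha>)"
        using schwartz_bounded_by_norm[OF hs, of ?N "[]" x] suminf_nonneg[OF b(1) b0]
        by (intro mult_mono gw) (simp_all add: less_imp_le[OF vec_weight_pos])
      then show "norm (g x * hermite_tensor \<alpha> x) \<le> (suminf b * schwartz_norm ?N (hermite_tensor \<alpha>)) * vec_weight x"
        by (simp add: abs_mult mult_ac)
    qed
    have "hermite_coef (\<lambda>x. f x - g x) \<alpha> = hermite_coef f \<alpha> - hermite_coef g \<alpha>"
      unfolding hermite_coef_def left_diff_distrib
      by (rule Bochner_Integration.integral_diff[OF schwartz_integrable_mult[OF f hs] gi'])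
    then show "hermite_coef (\<lambda>x. f x - g x) \<alpha> = 0" by (simp add: gcoef)
  qed
  then have "f x = (\<Sum>n. coef_seq f n * hermite_seq n x)" by (simp add: g_def)
  then show ?case using summable_sums[OF sm[of x]] by simp
next
  case (Cons i "is")
  define F where "F n t = coef_seq f n * pd is (hermite_seq n) (x + t *\<^sub>R axis i 1)" for n t
  define F' where "F' n t = coef_seq f n * pd (i # is) (hermite_seq n) (x + t *\<^sub>R axis i 1)" for n t
  obtain b where b: "summable b" "\<And>n x. (1 + norm x) ^ 0 * \<bar>coef_seq f n * pd (i # is) (hermite_seq n) x\<bar> \<le> b n"
    using expansion_majorant[OF f, of 0 "i # is"] by blast
  have F'b: "norm (F' n t) \<le> b n" for n t using b(2)[of "x + t *\<^sub>R axis i 1" n] by (simp add: F'_def)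
  have der: "(F n has_field_derivative F' n t) (at t)" for n t
  proof -
    let ?h = "hermite_seq n :: real^'n \<Rightarrow> real"
    have "((\<lambda>s. pd is ?h ((x + t *\<^sub>R axis i 1) + s *\<^sub>R axis i 1)) has_real_derivative pd (i # is) ?h (x + t *\<^sub>R axis i 1)) (at 0)"
      by (rule pd_line_derivative[OF hermite_seq_schwartz])
    then have "((\<lambda>s. pd is ?h (x + (s + t) *\<^sub>R axis i 1)) has_real_derivative pd (i # is) ?h (x + t *\<^sub>R axis i 1)) (at 0)"
      by (simp add: algebra_simps)
    then have "((\<lambda>s. pd is ?h (x + s *\<^sub>R axis i 1)) has_real_derivative pd (i # is) ?h (x + t *\<^sub>R axis i 1)) (at t)"
      using DERIV_shift[of "\<lambda>s. pd is ?h (x + s *\<^sub>R axis i 1)" "pd (i # is) ?h (x + t *\<^sub>R axis i 1)" 0 t] by simp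
    then show ?thesis unfolding F_def[abs_def] F'_def by (rule DERIV_cmult)
  qed
  have uc: "uniformly_convergent_on UNIV (\<lambda>n t. \<Sum>k<n. F' k t)"
    by (rule Weierstrass_m_test'[OF F'b b(1)])
  have s0: "summable (\<lambda>n. F n 0)" unfolding F_def using sums_summable[OF Cons.IH[of x]] by simp
  have "((\<lambda>t. \<Sum>n. F n t) has_field_derivative (\<Sum>n. F' n 0)) (at 0)"
    by (rule has_field_derivative_series'(2)[OF convex_UNIV der uc UNIV_I s0]) simp
  moreover have "(\<Sum>n. F n t) = pd is f (x + t *\<^sub>R axis i 1)" for t
    unfolding F_def using sums_unique[OF Cons.IH] by simp
  ultimately have "((\<lambda>t. pd is f (x + t *\<^sub>R axis i 1)) has_field_derivative (\<Sum>n. F' n 0)) (at 0)" by simp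
  then have "(\<Sum>n. F' n 0) = pd (i # is) f x"
    by (rule DERIV_unique) (rule pd_line_derivative[OF f])
  moreover have "summable (\<lambda>n. F' n 0)" by (rule summable_comparison_test'[OF b(1) F'b])
  ultimately have "(\<lambda>n. F' n 0) sums pd (i # is) f x" by (simp add: sums_iff)
  then show ?case by (simp only: F'_def scaleR_zero_left add_0_right)
qed

text \<open>In every seminorm the remainder is controlled, uniformly in \<open>x\<close>, by the
  tail of the majorant series.\<close>

lemma hermite_partial_sums_tendsto:
  fixes f :: "real^'n::finite \<Rightarrow> real"
  assumes f: "f \<in> schwartz"
  shows "(\<lambda>m. schwartz_norm N (\<lambda>x. f x - (\<Sum>n<m. coef_seq f n * hermite_seq n x))) \<longlonglongrightarrow> 0"
proof -
  have "(\<lambda>m. schwartz_seminorm k is (\<lambda>x. f x - (\<Sum>n<m. coef_seq f n * hermite_seq n x))) \<longlonglongrightarrow> 0" for k "is"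
  proof -
    obtain b where b: "summable b" "\<And>n x. (1 + norm x) ^ k * \<bar>coef_seq f n * pd is (hermite_seq n) x\<bar> \<le> b n"
      using expansion_majorant[OF f, of k "is"] by blast
    have le: "schwartz_seminorm k is (\<lambda>x. f x - (\<Sum>n<m. coef_seq f n * hermite_seq n x)) \<le> suminf b - (\<Sum>n<m. b n)" for m
    proof (rule schwartz_seminorm_le)
      fix x :: "real^'n"
      define c where "c n = coef_seq f n * pd is (hermite_seq n) x" for n
      let ?s = "\<lambda>x. \<Sum>n<m. coef_seq f n * hermite_seq n x"
      have s: "?s \<in> schwartz" "pd is ?s = (\<lambda>x. \<Sum>n<m. coef_seq f n * pd is (hermite_seq n) x)"
        by (intro schwartz_sum hermite_seq_schwartz finite_lessThan)+
      have "pd is (\<lambda>x. f x - ?s x) x = pd is f x - (\<Sum>n<m. c n)"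
        using pd_lincomb[OF f s(1), of "is" 1 "-1"] by (simp add: s(2) c_def)
      moreover have "(\<lambda>n. c (n + m)) sums (pd is f x - (\<Sum>n<m. c n))"
        unfolding c_def by (rule sums_split_initial_segment[OF hermite_expansion[OF f]])
      ultimately have sm: "(\<lambda>n. (1 + norm x) ^ k * c (n + m)) sums ((1 + norm x) ^ k * pd is (\<lambda>x. f x - ?s x) x)"
        by (simp add: sums_mult)
      have cb: "norm ((1 + norm x) ^ k * c (n + m)) \<le> b (n + m)" for n
        using b(2)[of x "n + m"] by (simp add: c_def abs_mult)
      have bs: "summable (\<lambda>n. b (n + m))" using b(1) by (simp add: summable_iff_shift)
      have "norm (\<Sum>n. (1 + norm x) ^ k * c (n + m)) \<le> (\<Sum>n. b (n + m))"
        by (rule norm_suminf_le[OF cb bs])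
      then show "(1 + norm x) ^ k * \<bar>pd is (\<lambda>x. f x - ?s x) x\<bar> \<le> suminf b - (\<Sum>n<m. b n)"
        using sums_unique[OF sm] suminf_minus_initial_segment[OF b(1), of m] by (simp add: abs_mult)
    qed
    have "(\<lambda>m. suminf b - (\<Sum>n<m. b n)) \<longlonglongrightarrow> suminf b - suminf b"
      by (intro tendsto_intros summable_LIMSEQ b(1))
    then have lim: "(\<lambda>m. suminf b - (\<Sum>n<m. b n)) \<longlonglongrightarrow> 0" by simp
    have "0 \<le> schwartz_seminorm k is (\<lambda>x. f x - (\<Sum>n<m. coef_seq f n * hermite_seq n x))" for m
    proof (rule schwartz_seminorm_nonneg)
      have "(\<lambda>x. \<Sum>n<m. coef_seq f n * hermite_seq n x) \<in> schwartz"
        by (intro schwartz_sum hermite_seq_schwartz finite_lessThan)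
      from schwartz_lincomb[OF f this, of 1 "-1"]
      show "(\<lambda>x. f x - (\<Sum>n<m. coef_seq f n * hermite_seq n x)) \<in> schwartz" by simp
    qed
    note nn = this
    show ?thesis
    proof (rule tendsto_sandwich)
      show "\<forall>\<^sub>F m in sequentially. 0 \<le> schwartz_seminorm k is (\<lambda>x. f x - (\<Sum>n<m. coef_seq f n * hermite_seq n x))"
        using nn by (intro always_eventually allI)
      show "\<forall>\<^sub>F m in sequentially. schwartz_seminorm k is (\<lambda>x. f x - (\<Sum>n<m. coef_seq f n * hermite_seq n x)) \<le> suminf b - (\<Sum>n<m. b n)"
        using le by (intro always_eventually allI)
      show "(\<lambda>m. suminf b - (\<Sum>n<m. b n)) \<longlonglongrightarrow> 0" by (rule lim)
    qed (rule tendsto_const)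
  qed
  then have "(\<lambda>m. schwartz_norm N (\<lambda>x. f x - (\<Sum>n<m. coef_seq f n * hermite_seq n x))) \<longlonglongrightarrow> (\<Sum>k\<le>N. \<Sum>is\<in>{is::'n list. length is \<le> N}. 0)"
    unfolding schwartz_norm_def by (intro tendsto_sum)
  then show ?thesis by simp
qed

section \<open>The space of tempered distributions\<close>

lemma schwartz_norm_lincomb:
  assumes f: "f \<in> schwartz" and g: "g \<in> schwartz"
  shows "schwartz_norm N (\<lambda>x. a * f x + b * g x) \<le> \<bar>a\<bar> * schwartz_norm N f + \<bar>b\<bar> * schwartz_norm N g"
proof -
  have "schwartz_norm N (\<lambda>x. a * f x + b * g x) \<le>
      (\<Sum>k\<le>N. \<Sum>is\<in>{is. length is \<le> N}. \<bar>a\<bar> * schwartz_seminorm k is f + \<bar>b\<bar> * schwartz_seminorm k is g)"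
    unfolding schwartz_norm_def by (intro sum_mono schwartz_seminorm_lincomb f g)
  then show ?thesis by (simp add: schwartz_norm_def sum.distrib sum_distrib_left)
qed

lemma schwartz_norm_zero: "schwartz_norm N (\<lambda>x::real^'n::finite. 0) = 0"
proof -
  define z where "z = (\<lambda>x::real^'n. 0::real)"
  have z: "z \<in> schwartz" unfolding z_def by (rule schwartz_zero)
  have "(\<lambda>x. 0 * z x + 0 * z x) = z" by (simp add: z_def)
  then have "schwartz_norm N z \<le> 0" using schwartz_norm_lincomb[OF z z, of N 0 0] by simp
  then show ?thesis using schwartz_norm_nonneg[OF z, of N] by (simp add: z_def)
qed

lemma schwartz_norm_sum:
  assumes "finite I" "\<And>i. i \<in> I \<Longrightarrow> f i \<in> schwartz"
  shows "schwartz_norm N (\<lambda>x. \<Sum>i\<in>I. c i * f i x) \<le> (\<Sum>i\<in>I. \<bar>c i\<bar> * schwartz_norm N (f i))"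
  using assms
proof (induction I rule: finite_induct)
  case empty
  show ?case by (simp add: schwartz_norm_zero)
next
  case (insert i I)
  have "schwartz_norm N (\<lambda>x. c i * f i x + 1 * (\<Sum>i\<in>I. c i * f i x)) \<le> \<bar>c i\<bar> * schwartz_norm N (f i) + \<bar>1\<bar> * schwartz_norm N (\<lambda>x. \<Sum>i\<in>I. c i * f i x)"
    by (rule schwartz_norm_lincomb) (use insert in \<open>auto intro: schwartz_sum\<close>)
  then show ?case using insert by simp
qed

text \<open>Makes a functional that is continuous for \<open>trip_norm\<close> continuous along
  every sequence converging in the Schwartz space, Hermite partial sums in particular.\<close>

lemma dominated_trip_norm: "dominated (trip_norm :: (real^'n::finite \<Rightarrow> real) \<Rightarrow> real)"
proof -
  let ?N = "2 * CARD('n)"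
  define I where "I = (\<integral>x. vec_weight (x :: real^'n) \<partial>lborel)"
  have I: "I \<ge> 0" unfolding I_def by (rule integral_nonneg_AE) (simp add: less_imp_le vec_weight_pos)
  show ?thesis
  proof (rule dominatedI[of "I + sqrt I"])
    fix f :: "real^'n \<Rightarrow> real" assume f: "f \<in> schwartz"
    define P where "P = schwartz_norm ?N f"
    have P: "P \<ge> 0" unfolding P_def by (rule schwartz_norm_nonneg[OF f])
    have b: "\<bar>f x\<bar> \<le> P * vec_weight x" for x unfolding P_def using schwartz_weight_bound[OF f, of ?N "[]" x] by simp
    have fi: "integrable lborel f"
      by (rule integrable_weight_bound[where C=P]) (use schwartz_measurable[OF f, of "[]"] b in simp_all)
    have L1: "L1_norm f \<le> P * I"
    proof -
      have "L1_norm f \<le> (\<integral>x. P * vec_weight (x :: real^'n) \<partial>lborel)"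
        unfolding L1_norm_def by (intro integral_mono integrable_abs fi integrable_mult_right integrable_vec_weight b)
      then show ?thesis by (simp add: I_def)
    qed
    have L1': "0 \<le> L1_norm f" unfolding L1_norm_def by (rule integral_nonneg_AE) simp
    have "(\<integral>x. (f x)\<^sup>2 \<partial>lborel) \<le> (\<integral>x. P\<^sup>2 * vec_weight (x :: real^'n) \<partial>lborel)"
    proof (rule integral_mono)
      show "integrable lborel (\<lambda>x. (f x)\<^sup>2)" using schwartz_integrable_mult[OF f f] by (simp add: power2_eq_square)
      show "integrable lborel (\<lambda>x. P\<^sup>2 * vec_weight (x :: real^'n))" by (intro integrable_mult_right integrable_vec_weight)
      fix x
      have "\<bar>f x\<bar> * \<bar>f x\<bar> \<le> (P * vec_weight x) * (P * 1)"
        by (intro mult_mono b order_trans[OF b] mult_left_mono vec_weight_le_1 P mult_nonneg_nonneg less_imp_le[OF vec_weight_pos]) simp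
      then show "(f x)\<^sup>2 \<le> P\<^sup>2 * vec_weight x" by (simp add: power2_eq_square mult_ac)
    qed
    then have "(\<integral>x. (f x)\<^sup>2 \<partial>lborel) \<le> P\<^sup>2 * I" by (simp add: I_def)
    then have "L2_norm f \<le> sqrt (P\<^sup>2 * I)" unfolding L2_norm_def by (rule real_sqrt_le_mono)
    then have L2: "L2_norm f \<le> P * sqrt I" using P by (simp add: real_sqrt_mult)
    have L2': "0 \<le> L2_norm f" unfolding L2_norm_def by (intro real_sqrt_ge_zero integral_nonneg_AE) simp
    have "trip_norm f \<le> L1_norm f + L2_norm f"
      unfolding trip_norm_def using sqrt_sum_squares_le_sum[OF L1' L2'] .
    then show "trip_norm f \<le> (I + sqrt I) * schwartz_norm ?N f"
      using L1 L2 by (simp add: P_def algebra_simps)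
  qed (use I in simp)
qed

text \<open>Nonnegativity of the terms allows the sum over multi-indices to be read as a series
  along \<open>multi_index\<close>, the form in which duality with sequences is carried out
  later.\<close>

lemma hermite_norm_summable:
  fixes f :: "real^'n::finite \<Rightarrow> real"
  assumes "q \<ge> 0"
  shows "f \<in> schwartz \<Longrightarrow> summable (\<lambda>n. hermite_eigenvalue (multi_index n :: 'n \<Rightarrow> nat) powr (2 * q) * (coef_seq f n)\<^sup>2)" (is "_ \<Longrightarrow> ?s")
    and "f \<in> schwartz \<Longrightarrow> hermite_norm q f = sqrt (\<Sum>n. hermite_eigenvalue (multi_index n :: 'n \<Rightarrow> nat) powr (2 * q) * (coef_seq f n)\<^sup>2)" (is "_ \<Longrightarrow> ?e")
    and "dominated (hermite_norm q :: (real^'n \<Rightarrow> real) \<Rightarrow> real)"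
proof -
  \<comment> \<open>An integer above \<open>2 * q\<close>, replacing the real power of the
    eigenvalue by a natural one. The square of \<open>r + 1\<close> powers of decay covers
    \<open>r\<close> of them and leaves at least two for summability.\<close>
  define r where "r = nat \<lceil>2 * q\<rceil>"
  obtain C M where C: "C \<ge> 0" "\<And>f (\<alpha> :: 'n \<Rightarrow> nat). f \<in> schwartz \<Longrightarrow> \<bar>hermite_coef f \<alpha>\<bar> * hermite_index \<alpha> ^ (r + 1) \<le> C * schwartz_norm M f"
    by (rule hermite_coef_bound_index[of "r + 1", where 'n='n]) blast
  define T where "T f n = hermite_eigenvalue (multi_index n :: 'n \<Rightarrow> nat) powr (2 * q) * (coef_seq f n)\<^sup>2" for f :: "real^'n \<Rightarrow> real" and n
  define i where "i n = inverse (hermite_index (multi_index n :: 'n \<Rightarrow> nat)) ^ 2" for n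
  have i: "summable i" unfolding i_def by (rule summable_hermite_index_square)
  have T0: "T f n \<ge> 0" for f n by (simp add: T_def)
  have Tb: "T f n \<le> (real CARD('n) ^ r * (C * schwartz_norm M f)\<^sup>2) * i n" if f: "f \<in> schwartz" for f n
  proof -
    let ?h = "hermite_index (multi_index n :: 'n \<Rightarrow> nat)" and ?e = "hermite_eigenvalue (multi_index n :: 'n \<Rightarrow> nat)"
    have h: "?h \<ge> 1" by (rule hermite_index_ge_1)
    have e: "?e \<ge> 1" by (rule hermite_eigenvalue_ge_1)
    have "?e powr (2 * q) \<le> ?e powr real r" using e by (intro powr_mono) (simp_all add: r_def, linarith)
    also have "\<dots> = ?e ^ r" using e by (intro powr_realpow) simp
    also have "\<dots> \<le> (real CARD('n) * ?h) ^ r" using e by (intro power_mono hermite_eigenvalue_le_index) simp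
    finally have e2: "?e powr (2 * q) \<le> real CARD('n) ^ r * ?h ^ r" by (simp add: power_mult_distrib)
    have "(\<bar>coef_seq f n\<bar> * ?h ^ (r + 1))\<^sup>2 \<le> (C * schwartz_norm M f)\<^sup>2"
      unfolding coef_seq_def by (intro power_mono C(2) f) (use h in simp)
    moreover have "(coef_seq f n)\<^sup>2 * ?h ^ r * ?h ^ 2 \<le> (\<bar>coef_seq f n\<bar> * ?h ^ (r + 1))\<^sup>2"
    proof -
      have "?h ^ r * ?h ^ 2 \<le> ?h ^ (2 * (r + 1))" unfolding power_add[symmetric] using h by (intro power_increasing) auto
      then have "(coef_seq f n)\<^sup>2 * (?h ^ r * ?h ^ 2) \<le> (coef_seq f n)\<^sup>2 * ?h ^ (2 * (r + 1))" by (rule mult_left_mono) simp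
      then show ?thesis by (simp only: power_mult_distrib power2_abs power_mult[symmetric] mult.commute[of 2] mult.assoc)
    qed
    ultimately have "(coef_seq f n)\<^sup>2 * ?h ^ r * ?h ^ 2 \<le> (C * schwartz_norm M f)\<^sup>2" by (rule order_trans[rotated])
    then have c: "(coef_seq f n)\<^sup>2 * ?h ^ r \<le> (C * schwartz_norm M f)\<^sup>2 * i n"
      using h by (simp add: i_def power_inverse pos_le_divide_eq[symmetric] divide_inverse)
    have "T f n \<le> (real CARD('n) ^ r * ?h ^ r) * (coef_seq f n)\<^sup>2" unfolding T_def by (intro mult_right_mono e2) simp
    also have "\<dots> = real CARD('n) ^ r * ((coef_seq f n)\<^sup>2 * ?h ^ r)" by (simp add: mult_ac)
    also have "\<dots> \<le> real CARD('n) ^ r * ((C * schwartz_norm M f)\<^sup>2 * i n)" by (intro mult_left_mono c) simp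
    finally show ?thesis by (simp add: mult_ac)
  qed
  have s: "summable (T f)" if f: "f \<in> schwartz" for f
    by (rule summable_comparison_test'[OF summable_mult[OF i]]) (use Tb[OF f] T0 in simp)
  have e: "hermite_norm q f = sqrt (suminf (T f))" if f: "f \<in> schwartz" for f
  proof -
    have "hermite_norm q f = sqrt (\<Sum>\<^sub>\<infinity>\<alpha>\<in>UNIV. hermite_eigenvalue \<alpha> powr (2 * q) * (hermite_coef f \<alpha>)\<^sup>2)"
      unfolding hermite_norm_def hermite_eigenvalue_def hermite_coef_def ..
    also have "(\<Sum>\<^sub>\<infinity>\<alpha>\<in>UNIV. hermite_eigenvalue \<alpha> powr (2 * q) * (hermite_coef f \<alpha>)\<^sup>2) = (\<Sum>\<^sub>\<infinity>n\<in>UNIV. T f n)"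
      unfolding T_def coef_seq_def
      by (rule infsum_reindex_bij_betw[OF bij_multi_index, symmetric])
    also have "\<dots> = suminf (T f)"
    proof -
      have "T f summable_on UNIV" by (subst summable_on_UNIV_nonneg_real_iff) (use T0 s[OF f] in auto)
      then have "(T f has_sum (\<Sum>\<^sub>\<infinity>n\<in>UNIV. T f n)) UNIV" by simp
      then have "T f sums (\<Sum>\<^sub>\<infinity>n\<in>UNIV. T f n)" by (rule has_sum_imp_sums)
      then show ?thesis by (rule sums_unique)
    qed
    finally show ?thesis .
  qed
  show "f \<in> schwartz \<Longrightarrow> ?s" using s[of f] by (simp add: T_def[abs_def])
  show "f \<in> schwartz \<Longrightarrow> ?e" using e[of f] by (simp add: T_def[abs_def])
  show "dominated (hermite_norm q :: (real^'n \<Rightarrow> real) \<Rightarrow> real)"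
  proof (rule dominatedI[of "sqrt (real CARD('n) ^ r * suminf i) * C"])
    have i0: "suminf i \<ge> 0" by (rule suminf_nonneg[OF i]) (simp add: i_def)
    then show "0 \<le> sqrt (real CARD('n) ^ r * suminf i) * C" using C(1) by simp
    fix f :: "real^'n \<Rightarrow> real" assume f: "f \<in> schwartz"
    have "suminf (T f) \<le> (\<Sum>n. (real CARD('n) ^ r * (C * schwartz_norm M f)\<^sup>2) * i n)"
      by (rule suminf_le[OF Tb[OF f] s[OF f] summable_mult[OF i]])
    also have "\<dots> = (real CARD('n) ^ r * suminf i) * (C * schwartz_norm M f)\<^sup>2"
      by (simp add: suminf_mult[OF i])
    finally have "sqrt (suminf (T f)) \<le> sqrt ((real CARD('n) ^ r * suminf i) * (C * schwartz_norm M f)\<^sup>2)"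
      by (rule real_sqrt_le_mono)
    also have "\<dots> = sqrt (real CARD('n) ^ r * suminf i) * (C * schwartz_norm M f)"
      using C(1) schwartz_norm_nonneg[OF f, of M] by (simp add: real_sqrt_mult)
    finally show "hermite_norm q f \<le> sqrt (real CARD('n) ^ r * suminf i) * C * schwartz_norm M f"
      by (simp add: e[OF f])
  qed
qed

lemma hermite_seq_norm_bound:
  obtains C m where "C \<ge> 0" "\<And>n. schwartz_norm N (hermite_seq n :: real^'n::finite \<Rightarrow> real) \<le> C * hermite_index (multi_index n :: 'n \<Rightarrow> nat) ^ m"
proof -
  have "\<forall>p :: nat \<times> 'n list. \<exists>C m. C \<ge> 0 \<and> (\<forall>\<alpha> :: 'n \<Rightarrow> nat. schwartz_seminorm (fst p) (snd p) (hermite_tensor \<alpha>) \<le> C * hermite_index \<alpha> ^ m)"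
    using hermite_tensor_seminorm by blast
  from choice[OF this] obtain C where "\<forall>p :: nat \<times> 'n list. \<exists>m. C p \<ge> 0 \<and> (\<forall>\<alpha> :: 'n \<Rightarrow> nat. schwartz_seminorm (fst p) (snd p) (hermite_tensor \<alpha>) \<le> C p * hermite_index \<alpha> ^ m)" ..
  from choice[OF this] obtain m where Cm: "\<forall>p :: nat \<times> 'n list. C p \<ge> 0 \<and> (\<forall>\<alpha> :: 'n \<Rightarrow> nat. schwartz_seminorm (fst p) (snd p) (hermite_tensor \<alpha>) \<le> C p * hermite_index \<alpha> ^ m p)" ..
  let ?P = "{..N} \<times> {is :: 'n list. length is \<le> N}"
  have fin: "finite ?P" by (simp add: finite_lists_le)
  define l where "l = (\<Sum>p\<in>?P. m p)"
  show ?thesis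
  proof (rule that[of "\<Sum>p\<in>?P. C p" l])
    show "0 \<le> (\<Sum>p\<in>?P. C p)" using Cm by (intro sum_nonneg) auto
    fix n
    let ?h = "hermite_index (multi_index n :: 'n \<Rightarrow> nat)"
    have "schwartz_norm N (hermite_seq n :: real^'n \<Rightarrow> real) = (\<Sum>p\<in>?P. schwartz_seminorm (fst p) (snd p) (hermite_tensor (multi_index n :: 'n \<Rightarrow> nat)))"
      unfolding schwartz_norm_def hermite_seq_def by (simp add: sum.cartesian_product case_prod_beta)
    also have "\<dots> \<le> (\<Sum>p\<in>?P. C p * ?h ^ l)"
    proof (rule sum_mono)
      fix p assume p: "p \<in> ?P"
      have "schwartz_seminorm (fst p) (snd p) (hermite_tensor (multi_index n :: 'n \<Rightarrow> nat)) \<le> C p * ?h ^ m p" using Cm by blast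
      also have "\<dots> \<le> C p * ?h ^ l"
        using member_le_sum[OF p _ fin, of m] conjunct1[OF Cm[rule_format, of p]] unfolding l_def
        by (intro mult_left_mono power_increasing hermite_index_ge_1) simp_all
      finally show "schwartz_seminorm (fst p) (snd p) (hermite_tensor (multi_index n :: 'n \<Rightarrow> nat)) \<le> C p * ?h ^ l" .
    qed
    finally show "schwartz_norm N (hermite_seq n :: real^'n \<Rightarrow> real) \<le> (\<Sum>p\<in>?P. C p) * ?h ^ l"
      by (simp add: sum_distrib_right)
  qed
qed

section \<open>Tempered distributions and their Hermite values\<close>

lemma temperedE:
  fixes \<omega> :: "(real^'n::finite \<Rightarrow> real) \<Rightarrow> real"
  assumes "\<omega> \<in> tempered"
  obtains C N where "C \<ge> 0" "\<And>f. f \<in> schwartz \<Longrightarrow> \<bar>\<omega> f\<bar> \<le> C * schwartz_norm N f"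
proof -
  obtain C N where C: "\<forall>f\<in>schwartz. \<bar>\<omega> f\<bar> \<le> C * schwartz_norm N f"
    using assms unfolding tempered_def schwartz_norm_def by blast
  have "\<bar>\<omega> f\<bar> \<le> \<bar>C\<bar> * schwartz_norm N f" if f: "f \<in> schwartz" for f
  proof -
    have "C * schwartz_norm N f \<le> \<bar>C\<bar> * schwartz_norm N f"
      by (intro mult_right_mono schwartz_norm_nonneg f) simp
    then show ?thesis using C f by fastforce
  qed
  then show ?thesis using that[of "\<bar>C\<bar>" N] by simp
qed

lemma tempered_linear:
  assumes "\<omega> \<in> tempered" "f \<in> schwartz" "g \<in> schwartz"
  shows "\<omega> (\<lambda>x. a * f x + b * g x) = a * \<omega> f + b * \<omega> g"
  using assms unfolding tempered_def by blast

lemma tempered_sum: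
  assumes \<omega>: "\<omega> \<in> tempered" and "finite I" "\<And>i. i \<in> I \<Longrightarrow> f i \<in> schwartz"
  shows "\<omega> (\<lambda>x. \<Sum>i\<in>I. c i * f i x) = (\<Sum>i\<in>I. c i * \<omega> (f i))"
  using assms(2,3)
proof (induction I rule: finite_induct)
  case empty
  show ?case using tempered_linear[OF \<omega> schwartz_zero schwartz_zero, of 0 0] by simp
next
  case (insert i I)
  have "\<omega> (\<lambda>x. c i * f i x + 1 * (\<Sum>i\<in>I. c i * f i x)) = c i * \<omega> (f i) + 1 * \<omega> (\<lambda>x. \<Sum>i\<in>I. c i * f i x)"
    by (rule tempered_linear[OF \<omega>]) (use insert in \<open>auto intro: schwartz_sum\<close>)
  then show ?case using insert by simp
qed

text \<open>Continuity along the Hermite partial sums; hence a tempered distribution is determined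
  by its values on Hermite functions.\<close>

lemma tempered_expansion:
  fixes \<omega> :: "(real^'n::finite \<Rightarrow> real) \<Rightarrow> real"
  assumes \<omega>: "\<omega> \<in> tempered" and f: "f \<in> schwartz"
  shows "(\<lambda>n. coef_seq f n * \<omega> (hermite_seq n)) sums \<omega> f"
proof -
  obtain C N where C: "C \<ge> 0" "\<And>f. f \<in> schwartz \<Longrightarrow> \<bar>\<omega> f\<bar> \<le> C * schwartz_norm N f" using temperedE[OF \<omega>] by blast
  define s where "s m x = (\<Sum>n<m. coef_seq f n * hermite_seq n x)" for m and x :: "real^'n"
  have s: "s m \<in> schwartz" for m unfolding s_def[abs_def] by (intro schwartz_sum hermite_seq_schwartz finite_lessThan)
  have \<omega>s: "\<omega> (s m) = (\<Sum>n<m. coef_seq f n * \<omega> (hermite_seq n))" for m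
    unfolding s_def[abs_def] by (rule tempered_sum[OF \<omega>]) (auto intro: hermite_seq_schwartz)
  have d: "(\<lambda>x. f x - s m x) \<in> schwartz" for m using schwartz_lincomb[OF f s, of 1 "-1"] by simp
  have \<omega>d: "\<omega> (\<lambda>x. f x - s m x) = \<omega> f - \<omega> (s m)" for m using tempered_linear[OF \<omega> f s, of 1 "-1"] by simp
  have "(\<lambda>m. C * schwartz_norm N (\<lambda>x. f x - s m x)) \<longlonglongrightarrow> C * 0"
    unfolding s_def by (intro tendsto_mult tendsto_const hermite_partial_sums_tendsto f)
  then have l: "(\<lambda>m. C * schwartz_norm N (\<lambda>x. f x - s m x)) \<longlonglongrightarrow> 0" by simp
  have "(\<lambda>m. \<omega> (s m) - \<omega> f) \<longlonglongrightarrow> 0"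
  proof (rule Lim_null_comparison[OF _ l])
    show "\<forall>\<^sub>F m in sequentially. norm (\<omega> (s m) - \<omega> f) \<le> C * schwartz_norm N (\<lambda>x. f x - s m x)"
      using C(2)[OF d] unfolding \<omega>d by (intro always_eventually allI) (simp add: abs_minus_commute)
  qed
  then have "(\<lambda>m. \<omega> (s m)) \<longlonglongrightarrow> \<omega> f" by (simp add: LIM_zero_iff)
  then show ?thesis unfolding sums_def \<omega>s .
qed

definition hermite_values :: "((real^'n::finite \<Rightarrow> real) \<Rightarrow> real) \<Rightarrow> nat \<Rightarrow> real" where
  "hermite_values \<omega> n = \<omega> (hermite_seq n)"

lemma openin_weak_star_subset: "openin weak_star U \<Longrightarrow> U \<subseteq> tempered"
  unfolding weak_star_def using openin_subset by fastforce

lemma space_tempered_borel: "space tempered_borel = (tempered :: ((real^'n::finite \<Rightarrow> real) \<Rightarrow> real) set)"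
  and sets_tempered_borel: "sets tempered_borel = sigma_sets (tempered :: ((real^'n \<Rightarrow> real) \<Rightarrow> real) set) {U. openin weak_star U}"
proof -
  have "{U. openin weak_star U} \<subseteq> Pow (tempered :: ((real^'n \<Rightarrow> real) \<Rightarrow> real) set)" using openin_weak_star_subset by blast
  then show "space tempered_borel = (tempered :: ((real^'n \<Rightarrow> real) \<Rightarrow> real) set)"
    "sets tempered_borel = sigma_sets (tempered :: ((real^'n \<Rightarrow> real) \<Rightarrow> real) set) {U. openin weak_star U}"
    unfolding tempered_borel_def by (simp_all add: space_measure_of sets_measure_of)
qed

lemma evaluation_open:
  assumes f: "f \<in> schwartz" and A: "open A"
  shows "openin weak_star {\<omega> \<in> tempered. \<omega> f \<in> A}"
proof -
  let ?P = "product_topology (\<lambda>_. euclideanreal) (schwartz :: (real^'a \<Rightarrow> real) set)"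
  have "continuous_map ?P euclideanreal (\<lambda>\<omega>. \<omega> f)"
    by (rule continuous_map_product_projection[OF f])
  then have o: "openin ?P {\<omega> \<in> topspace ?P. \<omega> f \<in> A}"
    using A by (auto simp: continuous_map_def)
  have "tempered \<subseteq> topspace ?P" by (auto simp: tempered_def PiE_def)
  then have "{\<omega> \<in> tempered. \<omega> f \<in> A} = {\<omega> \<in> topspace ?P. \<omega> f \<in> A} \<inter> tempered" by blast
  then show ?thesis unfolding weak_star_def openin_subtopology using o by blast
qed

lemma measurable_evaluation:
  assumes f: "f \<in> schwartz" and \<mu>: "sets \<mu> = sets tempered_borel"
  shows "(\<lambda>\<omega>. \<omega> f) \<in> borel_measurable \<mu>"
proof (rule borel_measurableI)
  fix S :: "real set" assume S: "open S"
  have sp: "space \<mu> = tempered" using sets_eq_imp_space_eq[OF \<mu>] by (simp add: space_tempered_borel)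
  have "(\<lambda>\<omega>. \<omega> f) -` S \<inter> space \<mu> = {\<omega> \<in> tempered. \<omega> f \<in> S}" unfolding sp by blast
  moreover have "{\<omega> \<in> tempered. \<omega> f \<in> S} \<in> sets \<mu>"
    unfolding \<mu> sets_tempered_borel using evaluation_open[OF f S] by (intro sigma_sets.Basic) simp
  ultimately show "(\<lambda>\<omega>. \<omega> f) -` S \<inter> space \<mu> \<in> sets \<mu>" by simp
qed

lemma measurable_hermite_values:
  assumes \<mu>: "sets \<mu> = sets (tempered_borel :: ((real^'n::finite \<Rightarrow> real) \<Rightarrow> real) measure)"
  shows "hermite_values \<in> borel_measurable \<mu>"
  by (rule measurable_coordinatewise_then_product)
     (simp add: hermite_values_def measurable_evaluation[OF hermite_seq_schwartz \<mu>])

text \<open>The tempered distributions are exhausted by countably many sets on which evaluation at any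
  Schwartz function is a uniform limit of finite combinations of the Hermite evaluations; on each of
  them the weak-* topology is induced by \<^const>\<open>hermite_values\<close>.\<close>

definition hermite_growth :: "'n::finite itself \<Rightarrow> nat \<Rightarrow> (nat \<Rightarrow> real) set" where
  "hermite_growth _ m = {x. \<forall>n. \<bar>x n\<bar> \<le> real m * hermite_index (multi_index n :: 'n \<Rightarrow> nat) ^ m}"

lemma hermite_growth_exhausts:
  fixes \<omega> :: "(real^'n::finite \<Rightarrow> real) \<Rightarrow> real"
  assumes "\<omega> \<in> tempered"
  shows "\<exists>m. hermite_values \<omega> \<in> hermite_growth TYPE('n) m"
proof -
  obtain C N where C: "C \<ge> 0" "\<And>f. f \<in> schwartz \<Longrightarrow> \<bar>\<omega> f\<bar> \<le> C * schwartz_norm N f" using temperedE[OF assms] by blast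
  obtain D l where D: "D \<ge> 0" "\<And>n. schwartz_norm N (hermite_seq n :: real^'n \<Rightarrow> real) \<le> D * hermite_index (multi_index n :: 'n \<Rightarrow> nat) ^ l"
    using hermite_seq_norm_bound[of N, where 'n='n] by blast
  define m where "m = nat \<lceil>C * D\<rceil> + l"
  have m: "C * D \<le> real m" "l \<le> m" unfolding m_def by linarith+
  have "\<bar>hermite_values \<omega> n\<bar> \<le> real m * hermite_index (multi_index n :: 'n \<Rightarrow> nat) ^ m" for n
  proof -
    let ?h = "hermite_index (multi_index n :: 'n \<Rightarrow> nat)"
    have "\<bar>hermite_values \<omega> n\<bar> \<le> C * schwartz_norm N (hermite_seq n :: real^'n \<Rightarrow> real)"
      unfolding hermite_values_def by (rule C(2)[OF hermite_seq_schwartz])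
    also have "\<dots> \<le> C * (D * ?h ^ l)" by (intro mult_left_mono D C)
    also have "\<dots> = (C * D) * ?h ^ l" by simp
    also have "\<dots> \<le> real m * ?h ^ m"
      using C(1) D(1) m hermite_index_ge_1[of "multi_index n :: 'n \<Rightarrow> nat"] by (intro mult_mono power_increasing) auto
    finally show ?thesis .
  qed
  then show ?thesis unfolding hermite_growth_def by blast
qed

lemma closed_hermite_growth: "closed (hermite_growth TYPE('n::finite) m)"
proof -
  have "hermite_growth TYPE('n) m = (\<Inter>n. {x. \<bar>x n\<bar> \<le> real m * hermite_index (multi_index n :: 'n \<Rightarrow> nat) ^ m})"
    by (auto simp: hermite_growth_def)
  also have "closed \<dots>"
  proof (intro closed_INT ballI)
    fix n
    have "continuous_on UNIV (\<lambda>x :: nat \<Rightarrow> real. \<bar>x n\<bar>)" by (intro continuous_on_rabs continuous_on_product_coordinates)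
    then show "closed {x :: nat \<Rightarrow> real. \<bar>x n\<bar> \<le> real m * hermite_index (multi_index n :: 'n \<Rightarrow> nat) ^ m}"
      by (rule closed_Collect_le[OF _ continuous_on_const])
  qed
  finally show ?thesis .
qed

lemma weak_star_open_on_growth:
  fixes U :: "((real^'n::finite \<Rightarrow> real) \<Rightarrow> real) set"
  assumes U: "openin weak_star U"
  shows "\<exists>V. open V \<and> (\<forall>\<omega>\<in>tempered. hermite_values \<omega> \<in> hermite_growth TYPE('n) m \<longrightarrow> (\<omega> \<in> U \<longleftrightarrow> hermite_values \<omega> \<in> V))"
proof -
  let ?B = "hermite_growth TYPE('n) m"
  let ?P = "product_topology (\<lambda>_. euclideanreal) (schwartz :: (real^'n \<Rightarrow> real) set)"
  obtain W where W: "openin ?P W" "U = W \<inter> tempered" using U unfolding weak_star_def openin_subtopology by blast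
  define e where "e f x = (\<Sum>n. coef_seq f n * x n)" for f :: "real^'n \<Rightarrow> real" and x :: "nat \<Rightarrow> real"
  have ec: "continuous_on ?B (e f)" if f: "f \<in> schwartz" for f
  proof -
    obtain C M where C: "C \<ge> 0" "\<And>f (\<alpha> :: 'n \<Rightarrow> nat). f \<in> schwartz \<Longrightarrow> \<bar>hermite_coef f \<alpha>\<bar> * hermite_index \<alpha> ^ (m + 2) \<le> C * schwartz_norm M f"
      by (rule hermite_coef_bound_index[of "m + 2", where 'n='n]) blast
    define b where "b n = (real m * (C * schwartz_norm M f)) * inverse (hermite_index (multi_index n :: 'n \<Rightarrow> nat)) ^ 2" for n
    have bs: "summable b" unfolding b_def by (intro summable_mult summable_hermite_index_square)
    have bb: "norm (coef_seq f n * x n) \<le> b n" if "x \<in> ?B" for n x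
    proof -
      let ?h = "hermite_index (multi_index n :: 'n \<Rightarrow> nat)"
      have h: "?h > 0" using hermite_index_ge_1[of "multi_index n :: 'n \<Rightarrow> nat"] by linarith
      have "\<bar>x n\<bar> \<le> real m * ?h ^ m" using that by (simp add: hermite_growth_def)
      then have "\<bar>coef_seq f n\<bar> * \<bar>x n\<bar> \<le> \<bar>coef_seq f n\<bar> * (real m * ?h ^ m)" by (rule mult_left_mono) simp
      also have "\<dots> = real m * (\<bar>coef_seq f n\<bar> * ?h ^ (m + 2)) * inverse ?h ^ 2"
        using h by (simp add: power_add power2_eq_square field_simps)
      also have "\<dots> \<le> b n" unfolding b_def coef_seq_def using h by (intro mult_right_mono mult_left_mono C(2) f) simp_all
      finally show ?thesis by (simp add: abs_mult)
    qed
    have ul: "uniform_limit ?B (\<lambda>k x. \<Sum>n<k. coef_seq f n * x n) (e f) sequentially"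
      unfolding e_def[abs_def] by (rule Weierstrass_m_test[OF bb bs])
    have "continuous_on ?B (\<lambda>x. \<Sum>n<k. coef_seq f n * x n)" for k
      by (intro continuous_on_sum continuous_on_mult continuous_on_const continuous_on_subset[OF continuous_on_product_coordinates subset_UNIV])
    then show ?thesis by (intro uniform_limit_theorem[OF always_eventually ul] allI) simp_all
  qed
  \<comment> \<open>\<open>E\<close> recovers a tempered distribution from its Hermite values. The
    target is the full product space, so the question whether \<open>E x\<close> is tempered for a
    general sequence does not arise.\<close>
  define E where "E x = restrict (\<lambda>f. e f x) schwartz" for x
  have "continuous_map (top_of_set ?B) ?P E"
    unfolding continuous_map_componentwise
  proof (intro conjI ballI)
    show "E ` topspace (top_of_set ?B) \<subseteq> extensional schwartz" by (auto simp: E_def)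
    fix f :: "real^'n \<Rightarrow> real" assume "f \<in> schwartz"
    then show "continuous_map (top_of_set ?B) euclideanreal (\<lambda>x. E x f)"
      using ec[of f] by (simp add: E_def)
  qed
  then have "openin (top_of_set ?B) {x \<in> topspace (top_of_set ?B). E x \<in> W}"
    using W(1) by (auto simp: continuous_map_def)
  then have "openin (top_of_set ?B) {x \<in> ?B. E x \<in> W}" by simp
  then obtain V where V: "open V" "{x \<in> ?B. E x \<in> W} = ?B \<inter> V" unfolding openin_open by blast
  have "\<omega> \<in> U \<longleftrightarrow> hermite_values \<omega> \<in> V" if \<omega>: "\<omega> \<in> tempered" "hermite_values \<omega> \<in> ?B" for \<omega>
  proof -
    have "E (hermite_values \<omega>) = \<omega>"
    proof
      fix f
      show "E (hermite_values \<omega>) f = \<omega> f"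
      proof (cases "f \<in> schwartz")
        case True
        then show ?thesis using sums_unique[OF tempered_expansion[OF \<omega>(1) True]] by (simp add: E_def e_def hermite_values_def)
      next
        case False
        then show ?thesis using \<omega>(1) by (simp add: E_def tempered_def extensional_def)
      qed
    qed
    then have "\<omega> \<in> W \<longleftrightarrow> hermite_values \<omega> \<in> {x \<in> ?B. E x \<in> W}" using \<omega>(2) by simp
    then show ?thesis using V(2) W(2) \<omega> by blast
  qed
  then show ?thesis using V(1) by blast
qed

text \<open>On each growth set, membership in a weak-* open set is an open condition on the Hermite
  values, and countably many growth sets exhaust the space. Open sets are thus pulled back from
  Borel sets of sequences even when they are uncountable unions of cylinders.\<close>

lemma sets_tempered_borel_vimage:
  fixes A :: "((real^'n::finite \<Rightarrow> real) \<Rightarrow> real) set"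
  assumes "A \<in> sets tempered_borel"
  shows "\<exists>V\<in>sets (borel :: (nat \<Rightarrow> real) measure). A = hermite_values -` V \<inter> tempered"
proof -
  let ?vA = "vimage_algebra (tempered :: ((real^'n \<Rightarrow> real) \<Rightarrow> real) set) hermite_values (borel :: (nat \<Rightarrow> real) measure)"
  have vA: "sets ?vA = {hermite_values -` V \<inter> tempered | V. V \<in> sets borel}"
    by (rule sets_vimage_algebra2) simp
  have "U \<in> sets ?vA" if U: "openin weak_star U" for U :: "((real^'n \<Rightarrow> real) \<Rightarrow> real) set"
  proof -
    have "\<forall>m. \<exists>V. open V \<and> (\<forall>\<omega>\<in>tempered. hermite_values \<omega> \<in> hermite_growth TYPE('n) m \<longrightarrow> (\<omega> \<in> U \<longleftrightarrow> hermite_values \<omega> \<in> V))"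
      using weak_star_open_on_growth[OF U] by blast
    from choice[OF this] obtain V where V: "\<forall>m. open (V m) \<and> (\<forall>\<omega>\<in>tempered. hermite_values \<omega> \<in> hermite_growth TYPE('n) m \<longrightarrow> (\<omega> \<in> U \<longleftrightarrow> hermite_values \<omega> \<in> V m))" ..
    define W where "W = (\<Union>m. hermite_growth TYPE('n) m \<inter> V m)"
    have "W \<in> sets borel"
    proof -
      have "hermite_growth TYPE('n) m \<inter> V m \<in> sets borel" for m
        by (intro sets.Int borel_closed[OF closed_hermite_growth] borel_open) (use V in blast)
      then show ?thesis unfolding W_def by (intro sets.countable_UN) auto
    qed
    moreover have "U = hermite_values -` W \<inter> tempered"
    proof (intro equalityI subsetI)
      fix \<omega> assume \<omega>: "\<omega> \<in> U"
      then have t: "\<omega> \<in> tempered" using openin_weak_star_subset[OF U] by blast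
      obtain m where "hermite_values \<omega> \<in> hermite_growth TYPE('n) m" using hermite_growth_exhausts[OF t] by blast
      then show "\<omega> \<in> hermite_values -` W \<inter> tempered" using V t \<omega> by (auto simp: W_def)
    next
      fix \<omega> :: "(real^'n \<Rightarrow> real) \<Rightarrow> real" assume "\<omega> \<in> hermite_values -` W \<inter> tempered"
      then show "\<omega> \<in> U" using V by (auto simp: W_def)
    qed
    ultimately show ?thesis unfolding vA by blast
  qed
  then have "sigma_sets tempered {U. openin weak_star U} \<subseteq> sets ?vA"
    using sets.sigma_sets_subset[of "{U. openin weak_star U}" ?vA] by auto
  then have "A \<in> sets ?vA" using assms unfolding sets_tempered_borel by blast
  then show ?thesis unfolding vA by blast
qed

lemma measurable_into_tempered:
  fixes F :: "'a \<Rightarrow> (real^'n::finite \<Rightarrow> real) \<Rightarrow> real"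
  assumes F: "\<And>s. s \<in> space M \<Longrightarrow> F s \<in> tempered" and m: "\<And>n. (\<lambda>s. F s (hermite_seq n)) \<in> borel_measurable M"
  shows "F \<in> measurable M tempered_borel"
proof (rule measurableI)
  show "F s \<in> space tempered_borel" if "s \<in> space M" for s using F[OF that] by (simp add: space_tempered_borel)
  fix A :: "((real^'n \<Rightarrow> real) \<Rightarrow> real) set" assume "A \<in> sets tempered_borel"
  then obtain V where V: "V \<in> sets borel" "A = hermite_values -` V \<inter> tempered" using sets_tempered_borel_vimage by blast
  have "(\<lambda>s. hermite_values (F s)) \<in> borel_measurable M"
    by (rule measurable_coordinatewise_then_product) (simp add: hermite_values_def m)
  from measurable_sets[OF this V(1)] have "(\<lambda>s. hermite_values (F s)) -` V \<inter> space M \<in> sets M" .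
  moreover have "F -` A \<inter> space M = (\<lambda>s. hermite_values (F s)) -` V \<inter> space M" unfolding V(2) using F by blast
  ultimately show "F -` A \<inter> space M \<in> sets M" by simp
qed

text \<open>A finite combination of Hermite functions is again a test function, so the
  characteristic functional contains the integrals of all products of exponentials of Hermite
  evaluations. The closure argument upgrades these to indicators, and the resulting boxes determine
  a law on sequences.\<close>

lemma char_fun_determines_measure:
  fixes \<mu> \<mu>' :: "((real^'n::finite \<Rightarrow> real) \<Rightarrow> real) measure"
  assumes \<mu>: "prob_space \<mu>" "sets \<mu> = sets tempered_borel" and \<mu>': "prob_space \<mu>'" "sets \<mu>' = sets tempered_borel"
    and eq: "\<And>f. f \<in> schwartz \<Longrightarrow> char_fun \<mu> f = char_fun \<mu>' f"
  shows "\<mu> = \<mu>'"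
proof -
  interpret \<mu>: prob_space \<mu> by (rule \<mu>(1))
  interpret \<mu>': prob_space \<mu>' by (rule \<mu>'(1))
  note m = measurable_hermite_values[OF \<mu>(2)] and m' = measurable_hermite_values[OF \<mu>'(2)]
  have sp: "space \<mu> = tempered" "space \<mu>' = tempered"
    using sets_eq_imp_space_eq[OF \<mu>(2)] sets_eq_imp_space_eq[OF \<mu>'(2)] by (simp_all add: space_tempered_borel)
  have ev: "(\<lambda>\<omega>. \<omega> (hermite_seq j)) \<in> borel_measurable \<mu>" "(\<lambda>\<omega>. \<omega> (hermite_seq j)) \<in> borel_measurable \<mu>'" for j
    by (rule measurable_evaluation[OF hermite_seq_schwartz \<mu>(2)], rule measurable_evaluation[OF hermite_seq_schwartz \<mu>'(2)])
  have cis_sum: "cis (\<Sum>j\<in>J. u j) = (\<Prod>j\<in>J. cis (u j))" for J :: "nat set" and u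
    by (induction J rule: infinite_finite_induct) (auto simp: cis_mult[symmetric])
  have box: "emeasure \<mu> {\<omega> \<in> tempered. \<forall>j\<in>J. \<omega> (hermite_seq j) \<in> A j} = emeasure \<mu>' {\<omega> \<in> tempered. \<forall>j\<in>J. \<omega> (hermite_seq j) \<in> A j}"
    if J: "finite J" and A: "\<And>j. j \<in> J \<Longrightarrow> A j \<in> sets borel" for J and A :: "nat \<Rightarrow> real set"
  proof -
    define S where "S = {\<omega> \<in> (tempered :: ((real^'n \<Rightarrow> real) \<Rightarrow> real) set). \<forall>j\<in>J. \<omega> (hermite_seq j) \<in> A j}"
    have S: "S \<in> sets \<mu>" "S \<in> sets \<mu>'"
    proof -
      have "{\<omega> \<in> space K. \<forall>j\<in>J. \<omega> (hermite_seq j) \<in> A j} \<in> sets K"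
        if "\<And>j. (\<lambda>\<omega>. \<omega> (hermite_seq j)) \<in> borel_measurable K" for K :: "((real^'n \<Rightarrow> real) \<Rightarrow> real) measure"
      proof (rule sets.sets_Collect_finite_All[OF _ J])
        fix j assume "j \<in> J"
        have "(\<lambda>\<omega>. \<omega> (hermite_seq j)) -` A j \<inter> space K \<in> sets K" by (rule measurable_sets[OF that A[OF \<open>j \<in> J\<close>]])
        moreover have "(\<lambda>\<omega>. \<omega> (hermite_seq j)) -` A j \<inter> space K = {\<omega> \<in> space K. \<omega> (hermite_seq j) \<in> A j}" by blast
        ultimately show "{\<omega> \<in> space K. \<omega> (hermite_seq j) \<in> A j} \<in> sets K" by simp
      qed
      from this[OF ev(1)] this[OF ev(2)] show "S \<in> sets \<mu>" "S \<in> sets \<mu>'" unfolding S_def sp by simp_all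
    qed
    have "(\<integral>\<omega>. 1 * (\<Prod>j\<in>J. indicator (A j) (\<omega> (hermite_seq j))) \<partial>\<mu>) = (\<integral>\<omega>. 1 * (\<Prod>j\<in>J. indicator (A j) (\<omega> (hermite_seq j))) \<partial>\<mu>' :: complex)"
    proof (rule bp_integral_prod_eq[where B=trig and u="\<lambda>j x. indicator (A j) x"])
      show "u \<in> borel_measurable borel" if "u \<in> trig" for u by (rule trig_measurable[OF bp_closure.base[OF that]])
      show "\<exists>C. \<forall>x. cmod (u x) \<le> C" if "u \<in> trig" for u by (rule trig_bounded[OF bp_closure.base[OF that]])
      show "bp_closure trig (\<lambda>x. indicator (A j) x)" if "j \<in> J" for j by (rule trig_indicator[OF A[OF that]])
      fix u :: "nat \<Rightarrow> real \<Rightarrow> complex" assume "\<And>j. j \<in> J \<Longrightarrow> u j \<in> trig"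
      then have "\<forall>j. \<exists>t. j \<in> J \<longrightarrow> u j = (\<lambda>x. cis (t * x))" by (auto simp: trig_def)
      from choice[OF this] obtain t where t: "\<forall>j. j \<in> J \<longrightarrow> u j = (\<lambda>x. cis (t j * x))" ..
      define f where "f x = (\<Sum>j\<in>J. t j * hermite_seq j x)" for x :: "real^'n"
      have f: "f \<in> schwartz" unfolding f_def[abs_def] by (intro schwartz_sum hermite_seq_schwartz J)
      have "1 * (\<Prod>j\<in>J. u j (\<omega> (hermite_seq j))) = cis (\<omega> f)" if "\<omega> \<in> tempered" for \<omega>
      proof -
        have "\<omega> f = (\<Sum>j\<in>J. t j * \<omega> (hermite_seq j))"
          unfolding f_def[abs_def] by (rule tempered_sum[OF that J]) (rule hermite_seq_schwartz)
        then show ?thesis using t by (simp add: cis_sum)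
      qed
      then have "(\<integral>\<omega>. 1 * (\<Prod>j\<in>J. u j (\<omega> (hermite_seq j))) \<partial>\<mu>) = char_fun \<mu> f" "(\<integral>\<omega>. 1 * (\<Prod>j\<in>J. u j (\<omega> (hermite_seq j))) \<partial>\<mu>') = char_fun \<mu>' f"
        unfolding char_fun_def by (intro Bochner_Integration.integral_cong refl; simp only: sp)+
      then show "(\<integral>\<omega>. 1 * (\<Prod>j\<in>J. u j (\<omega> (hermite_seq j))) \<partial>\<mu>) = (\<integral>\<omega>. 1 * (\<Prod>j\<in>J. u j (\<omega> (hermite_seq j))) \<partial>\<mu>')"
        using eq[OF f] by simp
    qed (use J ev in auto)
    moreover have "(\<integral>\<omega>. 1 * (\<Prod>j\<in>J. indicator (A j) (\<omega> (hermite_seq j))) \<partial>K) = complex_of_real (measure K S)"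
      if "S \<in> sets K" "space K = tempered" for K :: "((real^'n \<Rightarrow> real) \<Rightarrow> real) measure"
    proof -
      have "(\<integral>\<omega>. 1 * (\<Prod>j\<in>J. indicator (A j) (\<omega> (hermite_seq j))) \<partial>K) = (\<integral>\<omega>. complex_of_real (indicator S \<omega>) \<partial>K)"
      proof (rule Bochner_Integration.integral_cong[OF refl])
        fix \<omega> assume "\<omega> \<in> space K"
        then have \<omega>: "\<omega> \<in> tempered" using that by simp
        show "1 * (\<Prod>j\<in>J. indicator (A j) (\<omega> (hermite_seq j))) = complex_of_real (indicator S \<omega>)"
        proof (cases "\<omega> \<in> S")
          case True
          then show ?thesis by (simp add: S_def)
        next
          case False
          then obtain j where "j \<in> J" "\<omega> (hermite_seq j) \<notin> A j" using \<omega> by (auto simp: S_def)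
          then have "(\<Prod>j\<in>J. indicator (A j) (\<omega> (hermite_seq j))) = (0::complex)" using J by (intro prod_zero bexI[of _ j]) simp_all
          then show ?thesis using False by simp
        qed
      qed
      also have "\<dots> = complex_of_real (\<integral>\<omega>. indicator S \<omega> \<partial>K)" by (rule integral_complex_of_real)
      also have "(\<integral>\<omega>. indicator S \<omega> \<partial>K) = measure K S" using that(1) by simp
      finally show ?thesis .
    qed
    ultimately have "measure \<mu> S = measure \<mu>' S" using S sp by simp
    then show ?thesis unfolding S_def[symmetric] by (simp add: \<mu>.emeasure_eq_measure \<mu>'.emeasure_eq_measure)
  qed
  \<comment> \<open>Boxes in finitely many coordinates are a generator stable under intersection, so
    the box identity settles the law of the whole sequence.\<close>
  have distr: "distr \<mu> (borel :: (nat \<Rightarrow> real) measure) hermite_values = distr \<mu>' borel hermite_values"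
  proof (rule measure_eqI_PiM_infinite[where I=UNIV and M="\<lambda>_. borel"])
    show "sets (distr \<mu> (borel :: (nat \<Rightarrow> real) measure) hermite_values) = sets (Pi\<^sub>M UNIV (\<lambda>_. borel))"
      "sets (distr \<mu>' (borel :: (nat \<Rightarrow> real) measure) hermite_values) = sets (Pi\<^sub>M UNIV (\<lambda>_. borel))"
      by (simp_all add: sets_PiM_equal_borel)
    show "finite_measure (distr \<mu> (borel :: (nat \<Rightarrow> real) measure) hermite_values)"
      using \<mu>.prob_space_distr[OF m] by (simp add: prob_space_def)
    fix A :: "nat \<Rightarrow> real set" and J :: "nat set"
    assume J: "finite J" and A: "\<And>i. i \<in> J \<Longrightarrow> A i \<in> sets borel"
    have e: "prod_emb UNIV (\<lambda>_. borel) J (Pi\<^sub>E J A) = {x :: nat \<Rightarrow> real. \<forall>j\<in>J. x j \<in> A j}"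
      by (auto simp: prod_emb_def PiE_iff)
    have "prod_emb UNIV (\<lambda>_. borel) J (Pi\<^sub>E J A) \<in> sets (Pi\<^sub>M UNIV (\<lambda>_. borel :: real measure))"
      using J A by (intro sets_PiM_I) auto
    then have b: "{x :: nat \<Rightarrow> real. \<forall>j\<in>J. x j \<in> A j} \<in> sets borel" unfolding e by (simp add: sets_PiM_equal_borel)
    have v: "hermite_values -` {x. \<forall>j\<in>J. x j \<in> A j} \<inter> tempered = {\<omega> \<in> tempered. \<forall>j\<in>J. \<omega> (hermite_seq j) \<in> A j}"
      by (auto simp: hermite_values_def)
    show "emeasure (distr \<mu> borel hermite_values) (prod_emb UNIV (\<lambda>_. borel) J (Pi\<^sub>E J A)) = emeasure (distr \<mu>' borel hermite_values) (prod_emb UNIV (\<lambda>_. borel) J (Pi\<^sub>E J A))"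
      unfolding e emeasure_distr[OF m b] emeasure_distr[OF m' b] sp v by (rule box[OF J A])
  qed
  show ?thesis
  proof (rule measure_eqI)
    show "sets \<mu> = sets \<mu>'" by (simp add: \<mu> \<mu>')
    fix A assume "A \<in> sets \<mu>"
    then have "A \<in> sets tempered_borel" by (simp add: \<mu>)
    then obtain V where V: "V \<in> sets borel" "A = hermite_values -` V \<inter> tempered" using sets_tempered_borel_vimage by blast
    have "emeasure \<mu> A = emeasure (distr \<mu> borel hermite_values) V" by (simp only: emeasure_distr[OF m V(1)] V(2) sp)
    also have "\<dots> = emeasure (distr \<mu>' borel hermite_values) V" by (simp only: distr)
    also have "\<dots> = emeasure \<mu>' A" by (simp only: emeasure_distr[OF m' V(1)] V(2) sp)
    finally show "emeasure \<mu> A = emeasure \<mu>' A" .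
  qed
qed

text \<open>For a fixed constant the condition ranges over uncountably many \<open>f\<close>, but
  its negation is a union of weak-* open sets and hence open. Integer constants then suffice for a
  countable union.\<close>

lemma tempered_q_measurable: "tempered_q q \<in> sets (tempered_borel :: ((real^'n::finite \<Rightarrow> real) \<Rightarrow> real) measure)"
proof -
  define T where "T = (tempered :: ((real^'n \<Rightarrow> real) \<Rightarrow> real) set)"
  define K where "K C = {\<omega> \<in> T. \<forall>f\<in>schwartz. \<bar>\<omega> f\<bar> \<le> C * hermite_norm q f}" for C
  have hn: "hermite_norm q f \<ge> 0" for f :: "real^'n \<Rightarrow> real"
    unfolding hermite_norm_def by (intro real_sqrt_ge_zero infsum_nonneg) simp
  have eq: "tempered_q q = (\<Union>k::nat. K (real (Suc k)))"
  proof (intro equalityI subsetI)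
    fix \<omega> :: "(real^'n \<Rightarrow> real) \<Rightarrow> real" assume "\<omega> \<in> tempered_q q"
    then obtain C where C: "\<omega> \<in> tempered" "C > 0" "\<forall>f\<in>schwartz. \<bar>\<omega> f\<bar> \<le> C * hermite_norm q f" by (auto simp: tempered_q_def)
    have "\<bar>\<omega> f\<bar> \<le> real (Suc (nat \<lceil>C\<rceil>)) * hermite_norm q f" if "f \<in> schwartz" for f
    proof -
      have "C * hermite_norm q f \<le> real (Suc (nat \<lceil>C\<rceil>)) * hermite_norm q f"
        by (intro mult_right_mono hn) linarith
      then show ?thesis using C(3) that by fastforce
    qed
    then show "\<omega> \<in> (\<Union>k::nat. K (real (Suc k)))" using C(1) by (auto simp: K_def T_def)
  next
    fix \<omega> assume "\<omega> \<in> (\<Union>k::nat. K (real (Suc k)))"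
    then obtain k :: nat where "\<omega> \<in> K (real (Suc k))" by blast
    then show "\<omega> \<in> tempered_q q" unfolding tempered_q_def K_def T_def by (auto intro!: exI[of _ "real (Suc k)"] simp del: of_nat_Suc)
  qed
  have "K C \<in> sets tempered_borel" for C
  proof -
    have "T - K C = (\<Union>f\<in>schwartz. {\<omega> \<in> T. \<omega> f \<in> {y. \<bar>y\<bar> > C * hermite_norm q f}})"
      by (auto simp: K_def not_le)
    also have "openin weak_star \<dots>"
    proof (intro openin_Union ballI)
      fix U assume "U \<in> (\<lambda>f. {\<omega> \<in> T. \<omega> f \<in> {y. \<bar>y\<bar> > C * hermite_norm q f}}) ` schwartz"
      then obtain f where f: "f \<in> schwartz" "U = {\<omega> \<in> T. \<omega> f \<in> {y. \<bar>y\<bar> > C * hermite_norm q f}}" by blast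
      have "open {y :: real. \<bar>y\<bar> > C * hermite_norm q f}" by (intro open_Collect_less continuous_intros)
      then show "openin weak_star U" unfolding f(2) T_def by (rule evaluation_open[OF f(1)])
    qed
    finally have "T - K C \<in> sets tempered_borel" unfolding sets_tempered_borel by (intro sigma_sets.Basic) simp
    then have "space tempered_borel - (T - K C) \<in> sets tempered_borel" by (rule sets.compl_sets)
    moreover have "space tempered_borel - (T - K C) = K C" by (auto simp: space_tempered_borel T_def K_def)
    ultimately show ?thesis by simp
  qed
  then show ?thesis unfolding eq by (intro sets.countable_UN) auto
qed

section \<open>Gaussian averaging\<close>

lemma integrable_one_plus_square_powr:
  assumes s: "s > 1 / 2"
  shows "integrable lborel (\<lambda>x::real. (1 + x\<^sup>2) powr (- s))"
proof -
  define g where "g x = (1 + x) powr (- (2 * s)) * indicator {0..} x" for x :: real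
  have g0: "g x \<ge> 0" for x by (simp add: g_def)
  have gm[measurable]: "g \<in> borel_measurable borel" unfolding g_def[abs_def] by measurable
  \<comment> \<open>The antiderivative of the comparison function; it vanishes at infinity precisely
    because \<open>2 * s > 1\<close>.\<close>
  define F where "F x = (1 + x) powr (1 - 2 * s) / (1 - 2 * s)" for x :: real
  have F: "(F \<longlongrightarrow> 0) at_top"
  proof -
    have "((\<lambda>x::real. (1 + x) powr (1 - 2 * s)) \<longlongrightarrow> 0) at_top"
      by (rule tendsto_neg_powr) (use s in \<open>auto intro!: filterlim_tendsto_add_at_top[OF tendsto_const] filterlim_ident\<close>)
    then have "((\<lambda>x::real. (1 + x) powr (1 - 2 * s) / (1 - 2 * s)) \<longlongrightarrow> 0 / (1 - 2 * s)) at_top"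
      by (rule tendsto_divide[OF _ tendsto_const]) (use s in simp)
    then show ?thesis unfolding F_def[abs_def] by simp
  qed
  have "(\<integral>\<^sup>+x. ennreal ((1 + x) powr (- (2 * s))) * indicator {0..} x \<partial>lborel) = 0 - F 0"
  proof (rule nn_integral_FTC_atLeast[OF _ _ _ F])
    fix x :: real assume "0 \<le> x"
    then show "DERIV F x :> (1 + x) powr (- (2 * s))"
      unfolding F_def using s by (auto intro!: derivative_eq_intros)
  qed simp_all
  moreover have "ennreal (g x) = ennreal ((1 + x) powr (- (2 * s))) * indicator {0..} x" for x
    by (simp add: g_def indicator_def)
  ultimately have "(\<integral>\<^sup>+x. ennreal (g x) \<partial>lborel) < \<infinity>" by simp
  then have gi: "integrable lborel g" using g0 by (intro integrableI_nonneg) simp_all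
  have "integrable lborel (\<lambda>x. g (0 + (-1) * x))" by (rule lborel_integrable_real_affine[OF gi]) simp
  then have gi2: "integrable lborel (\<lambda>x. 2 powr s * (g x + g (- x)))"
    by (intro integrable_mult_right Bochner_Integration.integrable_add gi) simp
  show ?thesis
  proof (rule Bochner_Integration.integrable_bound[OF gi2])
    show "AE x in lborel. norm ((1 + x\<^sup>2) powr (- s)) \<le> norm (2 powr s * (g x + g (- x)))"
    proof (rule AE_I2)
      fix x :: real
      have "(1 + \<bar>x\<bar>)\<^sup>2 / 2 \<le> 1 + x\<^sup>2"
        using zero_le_power2[of "1 - \<bar>x\<bar>"] by (simp add: power2_eq_square algebra_simps)
      then have "(1 + x\<^sup>2) powr (- s) \<le> ((1 + \<bar>x\<bar>)\<^sup>2 / 2) powr (- s)"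
        using s by (intro powr_mono2') auto
      also have "\<dots> = 2 powr s * (1 + \<bar>x\<bar>) powr (- (2 * s))"
      proof -
        have "(1 + \<bar>x\<bar>)\<^sup>2 = (1 + \<bar>x\<bar>) powr 2" by (simp add: powr_numeral)
        then have "((1 + \<bar>x\<bar>)\<^sup>2) powr (- s) = (1 + \<bar>x\<bar>) powr (- (2 * s))" by (simp only: powr_powr mult_minus_right)
        moreover have "((1 + \<bar>x\<bar>)\<^sup>2 / 2) powr (- s) = ((1 + \<bar>x\<bar>)\<^sup>2) powr (- s) / 2 powr (- s)"
          by (rule powr_divide)
        moreover have "(2::real) powr (- s) = inverse (2 powr s)" by (rule powr_minus)
        ultimately have "((1 + \<bar>x\<bar>)\<^sup>2 / 2) powr (- s) = (1 + \<bar>x\<bar>) powr (- (2 * s)) / inverse (2 powr s)" by (simp only:)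
        also have "\<dots> = 2 powr s * (1 + \<bar>x\<bar>) powr (- (2 * s))"
          by (simp only: divide_inverse inverse_inverse_eq mult.commute)
        finally show ?thesis .
      qed
      also have "(1 + \<bar>x\<bar>) powr (- (2 * s)) \<le> g x + g (- x)"
        by (cases "x \<ge> 0") (simp_all add: g_def indicator_def)
      finally have "(1 + x\<^sup>2) powr (- s) \<le> 2 powr s * (g x + g (- x))" by simp
      then show "norm ((1 + x\<^sup>2) powr (- s)) \<le> norm (2 powr s * (g x + g (- x)))" using g0[of x] g0[of "- x"] by simp
    qed
  qed simp
qed

definition power_weight :: "real \<Rightarrow> real^'n::finite \<Rightarrow> real" where
  "power_weight s x = (\<Prod>i\<in>UNIV. (1 + (x $ i)\<^sup>2) powr s)"

lemma power_weight_ge_1: "0 \<le> s \<Longrightarrow> 1 \<le> power_weight s x"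
  unfolding power_weight_def by (intro prod_ge_1 ge_one_powr_ge_zero) simp_all

text \<open>In the range \<open>s \<le> 1\<close> one factor \<open>vec_weight\<close> absorbs the
  growing weight, so that of the two factors coming from a product of Schwartz functions one remains
  for integrability.\<close>

lemma power_weight_vec_weight: "s \<le> 1 \<Longrightarrow> power_weight s x * vec_weight x \<le> 1"
proof -
  assume s: "s \<le> 1"
  have "(\<Prod>i\<in>UNIV. (1 + (x $ i)\<^sup>2) powr s * inverse (1 + (x $ i)\<^sup>2)) \<le> 1"
  proof (intro prod_le_1 conjI)
    fix i
    have p: "1 + (x $ i)\<^sup>2 > 0" by (simp add: add_pos_nonneg)
    have "(1 + (x $ i)\<^sup>2) powr s \<le> (1 + (x $ i)\<^sup>2) powr 1" by (rule powr_mono[OF s]) simp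
    then show "(1 + (x $ i)\<^sup>2) powr s * inverse (1 + (x $ i)\<^sup>2) \<le> 1" using p by (simp add: field_simps)
    show "0 \<le> (1 + (x $ i)\<^sup>2) powr s * inverse (1 + (x $ i)\<^sup>2)" using p by simp
  qed
  then show ?thesis unfolding power_weight_def vec_weight_def prod.distrib .
qed

lemma power_weight_measurable: "power_weight s \<in> borel_measurable (borel :: (real^'n::finite) measure)"
proof -
  have [measurable]: "(\<lambda>x::real^'n. x $ i) \<in> borel_measurable borel" for i
    by (intro borel_measurable_continuous_onI continuous_on_component continuous_on_id)
  show ?thesis unfolding power_weight_def[abs_def] by measurable
qed

lemma power_weight_integrable:
  fixes f g :: "real^'n::finite \<Rightarrow> real"
  assumes s: "0 \<le> s" "s \<le> 1" and f: "f \<in> schwartz" and g: "g \<in> schwartz"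
  shows "integrable lborel (\<lambda>x. f x * g x * power_weight s x)"
proof (rule integrable_weight_bound)
  let ?N = "2 * CARD('n)"
  show "(\<lambda>x. f x * g x * power_weight s x) \<in> borel_measurable borel"
    using schwartz_measurable[OF f, of "[]"] schwartz_measurable[OF g, of "[]"]
    by (intro borel_measurable_times power_weight_measurable) simp_all
  fix x :: "real^'n"
  have pw: "0 \<le> power_weight s x" using power_weight_ge_1[OF s(1), of x] by linarith
  have fb: "\<bar>f x\<bar> \<le> schwartz_norm ?N f * vec_weight x" "\<bar>g x\<bar> \<le> schwartz_norm ?N g * vec_weight x"
    using schwartz_weight_bound[OF f, of ?N "[]" x] schwartz_weight_bound[OF g, of ?N "[]" x] by simp_all
  have "\<bar>f x\<bar> * \<bar>g x\<bar> * power_weight s x \<le> (schwartz_norm ?N f * vec_weight x) * (schwartz_norm ?N g * vec_weight x) * power_weight s x"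
    by (intro mult_right_mono mult_mono fb pw mult_nonneg_nonneg schwartz_norm_nonneg f less_imp_le[OF vec_weight_pos]) simp
  also have "\<dots> = (schwartz_norm ?N f * schwartz_norm ?N g * vec_weight x) * (power_weight s x * vec_weight x)" by simp
  also have "\<dots> \<le> (schwartz_norm ?N f * schwartz_norm ?N g * vec_weight x) * 1"
    by (intro mult_left_mono power_weight_vec_weight s mult_nonneg_nonneg schwartz_norm_nonneg f g less_imp_le[OF vec_weight_pos])
  finally show "norm (f x * g x * power_weight s x) \<le> (schwartz_norm ?N f * schwartz_norm ?N g) * vec_weight x"
    using pw by (simp add: abs_mult)
qed

definition weighted_form :: "real \<Rightarrow> (real^'n::finite \<Rightarrow> real) \<Rightarrow> (real^'n \<Rightarrow> real) \<Rightarrow> real" where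
  "weighted_form s f g = (\<integral>x. f x * g x * power_weight s x \<partial>lborel)"

lemma weighted_form_nonneg: "0 \<le> s \<Longrightarrow> 0 \<le> weighted_form s f f"
  unfolding weighted_form_def
  by (intro integral_nonneg_AE AE_I2 mult_nonneg_nonneg[OF zero_le_square order_trans[OF zero_le_one power_weight_ge_1]])

lemma weighted_form_sum:
  fixes h :: "nat \<Rightarrow> real^'n::finite \<Rightarrow> real"
  assumes s: "0 \<le> s" "s \<le> 1" and h: "\<And>j. h j \<in> schwartz"
  shows "weighted_form s (\<lambda>x. \<Sum>i<n. t i * h i x) (\<lambda>x. \<Sum>i<n. t i * h i x) = (\<Sum>i<n. \<Sum>j<n. t i * t j * weighted_form s (h i) (h j))"
proof -
  have "(\<Sum>i<n. t i * h i x) * (\<Sum>i<n. t i * h i x) * power_weight s x = (\<Sum>i<n. \<Sum>j<n. (t i * t j) * (h i x * h j x * power_weight s x))" for x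
    unfolding sum_product sum_distrib_right by (intro sum.cong refl) (simp add: mult_ac sum_distrib_left)
  then have "weighted_form s (\<lambda>x. \<Sum>i<n. t i * h i x) (\<lambda>x. \<Sum>i<n. t i * h i x) = (\<integral>x. (\<Sum>i<n. \<Sum>j<n. (t i * t j) * (h i x * h j x * power_weight s x)) \<partial>lborel)"
    unfolding weighted_form_def by simp
  also have "\<dots> = (\<Sum>i<n. \<integral>x. (\<Sum>j<n. (t i * t j) * (h i x * h j x * power_weight s x)) \<partial>lborel)"
    by (intro Bochner_Integration.integral_sum Bochner_Integration.integrable_sum integrable_mult_right power_weight_integrable s h)
  also have "\<dots> = (\<Sum>i<n. \<Sum>j<n. \<integral>x. (t i * t j) * (h i x * h j x * power_weight s x) \<partial>lborel)"
    by (intro sum.cong refl Bochner_Integration.integral_sum integrable_mult_right power_weight_integrable s h)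
  finally show ?thesis by (simp add: weighted_form_def)
qed

text \<open>Interpolation between the zeroth and the second moment: with
  \<open>y = (1 + x^2) / (n + 1)\<close>, whose mean against \<open>h_n^2\<close> stays bounded, the
  inequality \<open>y powr s \<le> 1 + y\<close> costs only a constant.\<close>

lemma hermite_fractional_moment:
  assumes s: "0 \<le> s" "s \<le> 1"
  shows "integrable lborel (\<lambda>x. (hermite_fun n x)\<^sup>2 * (1 + x\<^sup>2) powr s)"
    and "(\<integral>x. (hermite_fun n x)\<^sup>2 * (1 + x\<^sup>2) powr s \<partial>lborel) \<le> 3 * (real n + 1) powr s"
proof -
  let ?h = "hermite_fun n" and ?N = "real n + 1"
  have i0: "integrable lborel (\<lambda>x. (?h x)\<^sup>2)"
    using rapid_integrable[OF rapid_mult[OF hermite_rapid[of n] hermite_rapid[of n]]] by (simp add: power2_eq_square)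
  have i2: "integrable lborel (\<lambda>x. x\<^sup>2 * (?h x)\<^sup>2)"
    using rapid_integrable[OF rapid_times_x[OF rapid_times_x[OF rapid_mult[OF hermite_rapid[of n] hermite_rapid[of n]]]]]
    by (simp add: power2_eq_square mult_ac)
  have e0: "(\<integral>x. (?h x)\<^sup>2 \<partial>lborel) = 1" using hermite_orthonormal[of n n] by (simp add: power2_eq_square)
  define M where "M x = ?N powr s * ((1 + 1 / ?N) * (?h x)\<^sup>2 + 1 / ?N * (x\<^sup>2 * (?h x)\<^sup>2))" for x
  have Mi: "integrable lborel M" unfolding M_def[abs_def] by (intro integrable_mult_right Bochner_Integration.integrable_add i0 i2)
  have young: "y powr s \<le> 1 + y" if "y \<ge> 0" for y :: real
  proof (cases "y \<le> 1")
    case True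
    then have "y powr s \<le> 1" using that s by (simp add: powr_le1)
    then show ?thesis using that by linarith
  next
    case False
    then have "y powr s \<le> y powr 1" by (intro powr_mono s) simp
    then show ?thesis using False by simp
  qed
  have le: "(?h x)\<^sup>2 * (1 + x\<^sup>2) powr s \<le> M x" for x
  proof -
    have "(1 + x\<^sup>2) powr s = ?N powr s * ((1 + x\<^sup>2) / ?N) powr s"
      by (subst powr_mult[symmetric]) (simp_all add: add_nonneg_nonneg)
    also have "\<dots> \<le> ?N powr s * (1 + (1 + x\<^sup>2) / ?N)" by (intro mult_left_mono young) simp_all
    finally have "(?h x)\<^sup>2 * (1 + x\<^sup>2) powr s \<le> (?h x)\<^sup>2 * (?N powr s * (1 + (1 + x\<^sup>2) / ?N))" by (rule mult_left_mono) simp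
    also have "\<dots> = M x" by (simp add: M_def add_divide_distrib algebra_simps)
    finally show ?thesis .
  qed
  have hm: "?h \<in> borel_measurable borel" using hermite_rapid[of n] by (simp add: rapid_def borel_measurable_continuous_onI)
  show i: "integrable lborel (\<lambda>x. (?h x)\<^sup>2 * (1 + x\<^sup>2) powr s)"
  proof (rule Bochner_Integration.integrable_bound[OF Mi])
    show "(\<lambda>x. (?h x)\<^sup>2 * (1 + x\<^sup>2) powr s) \<in> borel_measurable lborel" using hm by simp
    show "AE x in lborel. norm ((?h x)\<^sup>2 * (1 + x\<^sup>2) powr s) \<le> norm (M x)"
      using le by (intro AE_I2) (simp add: abs_mult order_trans[OF le abs_ge_self])
  qed
  have "(\<integral>x. (?h x)\<^sup>2 * (1 + x\<^sup>2) powr s \<partial>lborel) \<le> (\<integral>x. M x \<partial>lborel)"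
    by (rule integral_mono[OF i Mi le])
  also have "\<dots> = ?N powr s * ((1 + 1 / ?N) * 1 + 1 / ?N * (real n + 1 / 2))"
    unfolding M_def using i0 i2 by (simp add: e0 hermite_second_moment)
  also have "\<dots> \<le> ?N powr s * 3"
  proof (intro mult_left_mono)
    have alg: "(1 + y) * 1 + y * (a + 1 / 2) = 1 + (a + 3 / 2) * y" for a y :: real by (simp add: algebra_simps)
    have "(1 + 1 / ?N) * 1 + 1 / ?N * (real n + 1 / 2) = 1 + (real n + 3 / 2) * (1 / ?N)"
      using alg[of "1 / ?N" "real n"] .
    moreover have "(real n + 3 / 2) * (1 / ?N) \<le> 2" by (simp add: pos_divide_le_eq)
    ultimately show "(1 + 1 / ?N) * 1 + 1 / ?N * (real n + 1 / 2) \<le> 3" by linarith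
  qed simp
  finally show "(\<integral>x. (?h x)\<^sup>2 * (1 + x\<^sup>2) powr s \<partial>lborel) \<le> 3 * ?N powr s" by simp
qed

lemma weighted_form_hermite:
  assumes s: "0 \<le> s" "s \<le> 1"
  shows "weighted_form s (hermite_tensor \<alpha>) (hermite_tensor \<alpha> :: real^'n::finite \<Rightarrow> real) \<le> 3 ^ CARD('n) * hermite_index \<alpha> powr s"
proof -
  have "hermite_tensor \<alpha> x * hermite_tensor \<alpha> x * power_weight s x = (\<Prod>i\<in>UNIV. (hermite_fun (\<alpha> i) (x $ i))\<^sup>2 * (1 + (x $ i)\<^sup>2) powr s)" for x :: "real^'n"
    by (simp add: hermite_tensor_def power_weight_def prod.distrib power2_eq_square)
  then have "weighted_form s (hermite_tensor \<alpha>) (hermite_tensor \<alpha>) = (\<integral>x. (\<Prod>i\<in>UNIV. (hermite_fun (\<alpha> i) ((x :: real^'n) $ i))\<^sup>2 * (1 + (x $ i)\<^sup>2) powr s) \<partial>lborel)"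
    by (simp add: weighted_form_def)
  also have "\<dots> = (\<Prod>i\<in>UNIV. \<integral>x. (hermite_fun (\<alpha> i) x)\<^sup>2 * (1 + x\<^sup>2) powr s \<partial>lborel)"
    by (rule vec_integral_prod(2)[where u="\<lambda>i x. (hermite_fun (\<alpha> i) x)\<^sup>2 * (1 + x\<^sup>2) powr s"]) (rule hermite_fractional_moment[OF s])
  also have "\<dots> \<le> (\<Prod>i\<in>UNIV. 3 * (2 * real (\<alpha> i) + 1) powr s)"
  proof (intro prod_mono conjI)
    fix i
    show "0 \<le> (\<integral>x. (hermite_fun (\<alpha> i) x)\<^sup>2 * (1 + x\<^sup>2) powr s \<partial>lborel)" by (rule integral_nonneg_AE) simp
    have "(real (\<alpha> i) + 1) powr s \<le> (2 * real (\<alpha> i) + 1) powr s" using s by (intro powr_mono2) auto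
    then show "(\<integral>x. (hermite_fun (\<alpha> i) x)\<^sup>2 * (1 + x\<^sup>2) powr s \<partial>lborel) \<le> 3 * (2 * real (\<alpha> i) + 1) powr s"
      using hermite_fractional_moment(2)[OF s, of "\<alpha> i"] by linarith
  qed
  also have "\<dots> = 3 ^ CARD('n) * hermite_index \<alpha> powr s"
    by (simp add: prod.distrib hermite_index_def prod_powr_distrib)
  finally show ?thesis .
qed

section \<open>Gaussian vectors and almost sure square summability\<close>

lemma gaussian_product_cos:
  fixes y :: "nat \<Rightarrow> real"
  shows "(\<integral>g. cos (\<Sum>j<n. y j * g j) \<partial>(Pi\<^sub>M {..<n} (\<lambda>_. std_normal_distribution))) = exp (- (\<Sum>j<n. (y j)\<^sup>2) / 2)"
proof -
  let ?G = "std_normal_distribution" and ?P = "Pi\<^sub>M {..<n} (\<lambda>_::nat. std_normal_distribution)"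
  interpret G: real_distribution ?G by (rule real_dist_normal_dist)
  interpret product_sigma_finite "\<lambda>_::nat. ?G" ..
  interpret P: prob_space ?P by (intro prob_space_PiM) (rule G.prob_space_axioms)
  have cis_m: "(\<lambda>x. cis (c * x)) \<in> borel_measurable borel" for c :: real
    by (intro borel_measurable_continuous_onI continuous_intros)
  have ic: "integrable ?G (\<lambda>x. cis (c * x))" for c :: real
    by (rule G.integrable_const_bound[where B=1]) (use cis_m in simp_all)
  have cis_sum: "cis (\<Sum>j<n. y j * g j) = (\<Prod>j<n. cis (y j * g j))" for g
    by (induction n) (auto simp: cis_mult[symmetric])
  have cm: "(\<lambda>g. cis (\<Sum>j<n. y j * g j)) \<in> borel_measurable ?P"
    unfolding cis_sum by (intro borel_measurable_prod measurable_compose[OF measurable_component_singleton]) (use cis_m in simp_all)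
  have ip: "integrable ?P (\<lambda>g. cis (\<Sum>j<n. y j * g j))"
    by (rule P.integrable_const_bound[where B=1]) (use cm in simp_all)
  have "(\<integral>g. cis (\<Sum>j<n. y j * g j) \<partial>?P) = (\<integral>g. (\<Prod>j<n. cis (y j * g j)) \<partial>?P)" by (simp only: cis_sum)
  also have "\<dots> = (\<Prod>j<n. \<integral>x. cis (y j * x) \<partial>?G)"
    by (rule product_integral_prod[where f="\<lambda>j x. cis (y j * x)"]) (simp_all add: ic)
  also have "\<dots> = (\<Prod>j<n. complex_of_real (exp (- (y j)\<^sup>2 / 2)))"
  proof (rule prod.cong[OF refl])
    fix j
    have "(\<integral>x. cis (y j * x) \<partial>?G) = char ?G (y j)" by (simp add: char_def cis_conv_exp)
    then show "(\<integral>x. cis (y j * x) \<partial>?G) = complex_of_real (exp (- (y j)\<^sup>2 / 2))"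
      by (simp add: char_std_normal_distribution)
  qed
  also have "\<dots> = complex_of_real (exp (- (\<Sum>j<n. (y j)\<^sup>2) / 2))"
    by (simp add: exp_sum[symmetric] sum_negf sum_divide_distrib flip: of_real_prod)
  finally have "Re (\<integral>g. cis (\<Sum>j<n. y j * g j) \<partial>?P) = exp (- (\<Sum>j<n. (y j)\<^sup>2) / 2)" by simp
  moreover have "Re (\<integral>g. cis (\<Sum>j<n. y j * g j) \<partial>?P) = (\<integral>g. cos (\<Sum>j<n. y j * g j) \<partial>?P)"
    using integral_Re[OF ip] by simp
  ultimately show ?thesis by simp
qed

lemma gaussian_product_covariance:
  assumes ij: "i < n" "j < n"
  shows "integrable (Pi\<^sub>M {..<n} (\<lambda>_::nat. std_normal_distribution)) (\<lambda>g. g i * g j)"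
    and "(\<integral>g. g i * g j \<partial>(Pi\<^sub>M {..<n} (\<lambda>_::nat. std_normal_distribution))) = (if i = j then 1 else 0)"
proof -
  let ?G = "std_normal_distribution" and ?P = "Pi\<^sub>M {..<n} (\<lambda>_::nat. std_normal_distribution)"
  interpret G: real_distribution ?G by (rule real_dist_normal_dist)
  interpret product_sigma_finite "\<lambda>_::nat. ?G" ..
  \<comment> \<open>One factor per coordinate, arranged so that the product over all
    \<open>k\<close> is \<open>g i * g j\<close> also when \<open>i = j\<close>.\<close>
  define f where "f k x = (if k = i then x else 1) * (if k = j then x else 1 :: real)" for k x
  have m1: "integrable ?G (\<lambda>x. x)" "(\<integral>x. x \<partial>?G) = 0"
    using integrable_std_normal_distribution_moment[of 1] integral_std_normal_distribution_moment_odd[of 1] by simp_all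
  have m2: "integrable ?G (\<lambda>x. x * x)" "(\<integral>x. x * x \<partial>?G) = 1"
    using integrable_std_normal_distribution_moment[of 2] std_normal_distribution_even_moments(1)[of 1] by (simp_all add: power2_eq_square)
  have fi: "integrable ?G (f k)" for k unfolding f_def[abs_def] using m1 m2 by (cases "k = i"; cases "k = j") simp_all
  have prod: "(\<Prod>k<n. f k (g k)) = g i * g j" for g
  proof -
    have "(\<Prod>k<n. f k (g k)) = (\<Prod>k<n. if k = i then g k else 1) * (\<Prod>k<n. if k = j then g k else 1)"
      unfolding f_def prod.distrib ..
    then show ?thesis using ij by (simp add: prod.delta)
  qed
  have "integrable ?P (\<lambda>g. \<Prod>k<n. f k (g k))" by (rule product_integrable_prod) (simp_all add: fi)
  then show "integrable ?P (\<lambda>g. g i * g j)" by (simp only: prod)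
  have "(\<integral>g. (\<Prod>k<n. f k (g k)) \<partial>?P) = (\<Prod>k<n. \<integral>x. f k x \<partial>?G)" by (rule product_integral_prod) (simp_all add: fi)
  also have "\<dots> = (if i = j then 1 else 0)"
  proof (cases "i = j")
    case True
    then have "(\<integral>x. f k x \<partial>?G) = 1" for k unfolding f_def using m2 G.prob_space by (cases "k = i") simp_all
    then show ?thesis using True by simp
  next
    case False
    then have "(\<integral>x. f i x \<partial>?G) = 0" unfolding f_def using m1 by simp
    then have "(\<Prod>k<n. \<integral>x. f k x \<partial>?G) = 0" using ij by (intro prod_zero bexI[of _ i]) simp_all
    then show ?thesis using False by simp
  qed
  finally show "(\<integral>g. g i * g j \<partial>?P) = (if i = j then 1 else 0)" by (simp only: prod)
qed

text \<open>The bound is averaged over \<open>t j = a j * g j\<close> with independent standard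
  Gaussian \<open>g j\<close>. By Fubini the cosine becomes a Gaussian exponential in the
  \<open>Z j\<close>, while on the other side only the diagonal of \<open>b\<close> survives,
  because the covariance is the identity.\<close>

lemma gaussian_average:
  fixes Z :: "nat \<Rightarrow> 'a \<Rightarrow> real" and b :: "nat \<Rightarrow> nat \<Rightarrow> real"
  assumes \<nu>: "prob_space \<nu>" and Z: "\<And>j. Z j \<in> borel_measurable \<nu>"
    and bound: "\<And>t :: nat \<Rightarrow> real. 1 - (\<integral>s. cos (\<Sum>j<n. t j * Z j s) \<partial>\<nu>) \<le> \<epsilon> + (\<Sum>i<n. \<Sum>j<n. t i * t j * b i j)"
  shows "1 - \<epsilon> - (\<Sum>j<n. (a j)\<^sup>2 * b j j) \<le> (\<integral>s. exp (- (\<Sum>j<n. (a j * Z j s)\<^sup>2) / 2) \<partial>\<nu>)"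
proof -
  let ?P = "Pi\<^sub>M {..<n} (\<lambda>_::nat. std_normal_distribution)"
  interpret G: real_distribution std_normal_distribution by (rule real_dist_normal_dist)
  interpret \<nu>: prob_space \<nu> by (rule \<nu>)
  interpret P: prob_space ?P by (intro prob_space_PiM) (rule G.prob_space_axioms)
  interpret PP: pair_prob_space \<nu> ?P ..
  define f where "f s g = cos (\<Sum>j<n. (a j * Z j s) * g j)" for s g
  have gm: "(\<lambda>p. snd p j) \<in> borel_measurable (\<nu> \<Otimes>\<^sub>M ?P)" if "j < n" for j
    by (rule measurable_compose[OF measurable_snd]) (use measurable_component_singleton[of j "{..<n}" "\<lambda>_. std_normal_distribution"] that in simp)
  have Zm: "(\<lambda>p. Z j (fst p)) \<in> borel_measurable (\<nu> \<Otimes>\<^sub>M ?P)" for j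
    by (rule measurable_compose[OF measurable_fst Z])
  have fm: "case_prod f \<in> borel_measurable (\<nu> \<Otimes>\<^sub>M ?P)"
    unfolding f_def[abs_def] case_prod_beta
    by (intro measurable_compose[OF _ borel_measurable_cos] borel_measurable_sum borel_measurable_times borel_measurable_const gm Zm) simp
  have fi: "integrable (\<nu> \<Otimes>\<^sub>M ?P) (case_prod f)"
    by (rule PP.integrable_const_bound[where B=1]) (use fm in \<open>simp_all add: f_def case_prod_beta\<close>)
  have "(\<integral>s. exp (- (\<Sum>j<n. (a j * Z j s)\<^sup>2) / 2) \<partial>\<nu>) = (\<integral>s. (\<integral>g. f s g \<partial>?P) \<partial>\<nu>)"
    unfolding f_def gaussian_product_cos ..
  also have "\<dots> = (\<integral>g. (\<integral>s. f s g \<partial>\<nu>) \<partial>?P)" by (rule PP.Fubini_integral[OF fi, symmetric])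
  finally have e: "(\<integral>s. exp (- (\<Sum>j<n. (a j * Z j s)\<^sup>2) / 2) \<partial>\<nu>) = (\<integral>g. (\<integral>s. f s g \<partial>\<nu>) \<partial>?P)" .
  have ii: "integrable ?P (\<lambda>g. \<integral>s. f s g \<partial>\<nu>)" by (rule PP.integrable_snd[OF fi])
  define R where "R g = (\<Sum>i<n. \<Sum>j<n. (a i * a j * b i j) * (g i * g j))" for g :: "nat \<Rightarrow> real"
  have Ri: "integrable ?P R"
    unfolding R_def[abs_def] by (intro Bochner_Integration.integrable_sum integrable_mult_right gaussian_product_covariance) simp_all
  have "(\<integral>g. R g \<partial>?P) = (\<Sum>i<n. \<integral>g. (\<Sum>j<n. (a i * a j * b i j) * (g i * g j)) \<partial>?P)"
    unfolding R_def
    by (intro Bochner_Integration.integral_sum Bochner_Integration.integrable_sum integrable_mult_right gaussian_product_covariance) simp_all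
  also have "\<dots> = (\<Sum>i<n. \<Sum>j<n. \<integral>g. (a i * a j * b i j) * (g i * g j) \<partial>?P)"
    by (intro sum.cong refl Bochner_Integration.integral_sum integrable_mult_right gaussian_product_covariance) simp_all
  also have "\<dots> = (\<Sum>i<n. \<Sum>j<n. (a i * a j * b i j) * (\<integral>g. g i * g j \<partial>?P))"
    by simp
  also have "\<dots> = (\<Sum>i<n. \<Sum>j<n. if i = j then (a i)\<^sup>2 * b i i else 0)"
    by (intro sum.cong refl) (auto simp: gaussian_product_covariance power2_eq_square)
  also have "\<dots> = (\<Sum>j<n. (a j)\<^sup>2 * b j j)" by simp
  finally have R: "(\<integral>g. R g \<partial>?P) = (\<Sum>j<n. (a j)\<^sup>2 * b j j)" .
  have "1 - \<epsilon> - (\<Sum>j<n. (a j)\<^sup>2 * b j j) = (\<integral>g. (1 - \<epsilon>) - R g \<partial>?P)"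
    using Ri P.prob_space by (simp add: Bochner_Integration.integral_diff R)
  also have "\<dots> \<le> (\<integral>g. (\<integral>s. f s g \<partial>\<nu>) \<partial>?P)"
  proof (rule integral_mono[OF _ ii])
    show "integrable ?P (\<lambda>g. (1 - \<epsilon>) - R g)" using Ri by (intro Bochner_Integration.integrable_diff) simp_all
    fix g
    have "(\<integral>s. f s g \<partial>\<nu>) = (\<integral>s. cos (\<Sum>j<n. (a j * g j) * Z j s) \<partial>\<nu>)" by (simp add: f_def mult_ac)
    moreover have "R g = (\<Sum>i<n. \<Sum>j<n. (a i * g i) * (a j * g j) * b i j)" by (simp add: R_def mult_ac)
    ultimately show "(1 - \<epsilon>) - R g \<le> (\<integral>s. f s g \<partial>\<nu>)" using bound[of "\<lambda>j. a j * g j"] by simp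
  qed
  finally show ?thesis unfolding e .
qed

text \<open>Averaging with weights proportional to \<sigma> bounds the mean of
  \<open>exp (- c / 2 * S n)\<close> below by \<open>1 - 2 * \<epsilon>\<close> for all
  \<open>n\<close>. In the limit the outcomes with divergent sum contribute 0, so convergence has
  probability at least \<open>1 - 2 * \<epsilon>\<close>.\<close>

lemma minlos_support:
  fixes Z :: "nat \<Rightarrow> 'a \<Rightarrow> real" and b :: "nat \<Rightarrow> nat \<Rightarrow> real"
  assumes \<nu>: "prob_space \<nu>" and Z: "\<And>j. Z j \<in> borel_measurable \<nu>"
    and bound: "\<And>\<epsilon>. \<epsilon> > 0 \<Longrightarrow> \<exists>K\<ge>0. \<forall>n (t :: nat \<Rightarrow> real).
      1 - (\<integral>s. cos (\<Sum>j<n. t j * Z j s) \<partial>\<nu>) \<le> \<epsilon> + K * (\<Sum>i<n. \<Sum>j<n. t i * t j * b i j)"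
    and b: "\<And>j. 0 \<le> b j j" and sm: "summable (\<lambda>j. (\<sigma> j)\<^sup>2 * b j j)"
  shows "AE s in \<nu>. summable (\<lambda>j. (\<sigma> j * Z j s)\<^sup>2)"
proof -
  interpret \<nu>: prob_space \<nu> by (rule \<nu>)
  define S where "S n s = (\<Sum>j<n. (\<sigma> j * Z j s)\<^sup>2)" for n s
  have Sm[measurable]: "S n \<in> borel_measurable \<nu>" for n
    unfolding S_def[abs_def] using Z by (intro borel_measurable_sum borel_measurable_power borel_measurable_times borel_measurable_const)
  \<comment> \<open>For nondecreasing partial sums convergence is boundedness by some integer, a
    countable condition, which makes the event measurable.\<close>
  define D where "D = {s \<in> space \<nu>. \<exists>B::nat. \<forall>n. S n s \<le> real B}"
  have Dm: "D \<in> sets \<nu>" unfolding D_def by measurable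
  have D: "summable (\<lambda>j. (\<sigma> j * Z j s)\<^sup>2)" if "s \<in> D" for s
  proof -
    obtain B :: nat where B: "\<And>n. S n s \<le> real B" using \<open>s \<in> D\<close> unfolding D_def by blast
    show ?thesis by (rule summableI_nonneg_bounded[where x="real B"]) (use B in \<open>simp_all add: S_def\<close>)
  qed
  define T where "T = (\<Sum>j. (\<sigma> j)\<^sup>2 * b j j)"
  have T0: "T \<ge> 0" unfolding T_def by (rule suminf_nonneg[OF sm]) (simp add: b)
  have "1 - 2 * \<epsilon> \<le> measure \<nu> D" if \<epsilon>: "\<epsilon> > 0" for \<epsilon>
  proof -
    obtain K where K: "K \<ge> 0" "\<And>n (t :: nat \<Rightarrow> real). 1 - (\<integral>s. cos (\<Sum>j<n. t j * Z j s) \<partial>\<nu>) \<le> \<epsilon> + K * (\<Sum>i<n. \<Sum>j<n. t i * t j * b i j)"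
      using bound[OF \<epsilon>] by blast
    \<comment> \<open>Small enough for the quadratic term to cost at most another \<epsilon>; the
      added 1 keeps the denominator positive when \<open>K * T\<close> is 0.\<close>
    define c where "c = \<epsilon> / (K * T + 1)"
    have c: "c > 0" "K * (c * T) \<le> \<epsilon>"
    proof -
      have p: "K * T + 1 > 0" using K(1) T0 by (simp add: add_nonneg_pos)
      then show "c > 0" using \<epsilon> by (simp add: c_def)
      show "K * (c * T) \<le> \<epsilon>" using p \<epsilon> by (simp add: c_def field_simps)
    qed
    define u where "u n s = exp (- (c / 2 * S n s))" for n s
    define l where "l s = (if s \<in> D then exp (- (c / 2 * (\<Sum>j. (\<sigma> j * Z j s)\<^sup>2))) else 0)" for s
    have S0: "0 \<le> S n s" for n s unfolding S_def by (intro sum_nonneg) simp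
    have low: "1 - 2 * \<epsilon> \<le> (\<integral>s. u n s \<partial>\<nu>)" for n
    proof -
      have b': "1 - (\<integral>s. cos (\<Sum>j<n. t j * Z j s) \<partial>\<nu>) \<le> \<epsilon> + (\<Sum>i<n. \<Sum>j<n. t i * t j * (K * b i j))" for t :: "nat \<Rightarrow> real"
        using K(2)[of t n] by (simp add: sum_distrib_left mult_ac)
      have "1 - \<epsilon> - (\<Sum>j<n. (sqrt c * \<sigma> j)\<^sup>2 * (K * b j j)) \<le> (\<integral>s. exp (- (\<Sum>j<n. ((sqrt c * \<sigma> j) * Z j s)\<^sup>2) / 2) \<partial>\<nu>)"
        by (rule gaussian_average[OF \<nu> Z b'])
      moreover have "(\<Sum>j<n. ((sqrt c * \<sigma> j) * Z j s)\<^sup>2) = c * S n s" for s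
        using c(1) by (simp add: S_def power_mult_distrib sum_distrib_left mult_ac)
      moreover have "(\<Sum>j<n. (sqrt c * \<sigma> j)\<^sup>2 * (K * b j j)) \<le> \<epsilon>"
      proof -
        have "(\<Sum>j<n. (sqrt c * \<sigma> j)\<^sup>2 * (K * b j j)) = K * (c * (\<Sum>j<n. (\<sigma> j)\<^sup>2 * b j j))"
          using c(1) by (simp add: power_mult_distrib sum_distrib_left mult_ac)
        also have "\<dots> \<le> K * (c * T)"
          unfolding T_def using c(1) K(1) by (intro mult_left_mono sum_le_suminf[OF sm]) (auto simp: b)
        finally show ?thesis using c(2) by linarith
      qed
      ultimately show ?thesis by (simp add: u_def)
    qed
    have lim: "(\<lambda>n. u n s) \<longlonglongrightarrow> l s" if s: "s \<in> space \<nu>" for s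
    proof (cases "s \<in> D")
      case True
      have "(\<lambda>n. S n s) \<longlonglongrightarrow> (\<Sum>j. (\<sigma> j * Z j s)\<^sup>2)" unfolding S_def by (rule summable_LIMSEQ[OF D[OF True]])
      then have "(\<lambda>n. exp (- (c / 2 * S n s))) \<longlonglongrightarrow> exp (- (c / 2 * (\<Sum>j. (\<sigma> j * Z j s)\<^sup>2)))"
        by (intro tendsto_exp tendsto_minus tendsto_mult tendsto_const)
      then show ?thesis using True by (simp add: u_def l_def)
    next
      case False
      have mono: "S n s \<le> S m s" if "n \<le> m" for n m unfolding S_def using that by (intro sum_mono2) auto
      have "filterlim (\<lambda>n. S n s) at_top sequentially"
        unfolding filterlim_at_top
      proof
        fix y :: real
        have "\<not> (\<forall>n. S n s \<le> real (nat \<lceil>y\<rceil>))" using False s unfolding D_def by blast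
        then obtain n where "S n s > real (nat \<lceil>y\<rceil>)" by (auto simp: not_le)
        then have "y \<le> S n s" by linarith
        then show "\<forall>\<^sub>F n in sequentially. y \<le> S n s"
          unfolding eventually_sequentially using mono order_trans by blast
      qed
      then have "filterlim (\<lambda>n. c / 2 * S n s) at_top sequentially"
        using c(1) by (intro filterlim_tendsto_pos_mult_at_top[OF tendsto_const]) simp_all
      then have "filterlim (\<lambda>n. - (c / 2 * S n s)) at_bot sequentially" by (simp add: filterlim_uminus_at_bot)
      from filterlim_compose[OF exp_at_bot this] show ?thesis using False by (simp add: u_def l_def)
    qed
    have um: "u n \<in> borel_measurable \<nu>" for n unfolding u_def[abs_def] by measurable
    have lm: "l \<in> borel_measurable \<nu>"
      by (rule borel_measurable_LIMSEQ_real[OF lim um])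
    have ub: "norm (u n s) \<le> 1" for n s using S0[of n s] c(1) by (simp add: u_def mult_nonneg_nonneg)
    have "(\<lambda>n. \<integral>s. u n s \<partial>\<nu>) \<longlonglongrightarrow> (\<integral>s. l s \<partial>\<nu>)"
      by (rule integral_dominated_convergence[where w="\<lambda>_. 1"]) (use lm um lim ub in auto)
    then have "1 - 2 * \<epsilon> \<le> (\<integral>s. l s \<partial>\<nu>)" by (rule LIMSEQ_le_const) (use low in blast)
    also have "\<dots> \<le> (\<integral>s. indicator D s \<partial>\<nu>)"
    proof (rule integral_mono)
      have l01: "0 \<le> l s" "l s \<le> 1" for s
        using c(1) suminf_nonneg[OF D] by (auto simp: l_def mult_nonneg_nonneg)
      show "integrable \<nu> l" by (rule \<nu>.integrable_const_bound[where B=1]) (use l01 lm in auto)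
      show "integrable \<nu> (\<lambda>s. indicator D s :: real)"
        by (rule \<nu>.integrable_const_bound[where B=1]) (use Dm in auto)
      show "l s \<le> indicator D s" for s using l01[of s] by (auto simp: l_def indicator_def)
    qed
    also have "\<dots> = measure \<nu> D" using Dm by simp
    finally show ?thesis .
  qed
  note lb = this
  have "1 \<le> measure \<nu> D"
  proof (rule field_le_epsilon)
    fix e :: real assume "e > 0"
    then show "1 \<le> measure \<nu> D + e" using lb[of "e / 2"] by simp
  qed
  then have "measure \<nu> D = 1" using \<nu>.prob_le_1[of D] by linarith
  then have "AE s in \<nu>. s \<in> D" using \<nu>.prob_eq_1[OF Dm] by simp
  then show ?thesis by (rule eventually_mono) (rule D)
qed

section \<open>The Bochner-Minlos theorem\<close>

lemma trip_norm_small: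
  assumes s: "1 / 2 < s" "s \<le> 1" and \<delta>: "\<delta> > 0"
  shows "\<exists>\<eta>>0. \<forall>f\<in>(schwartz :: (real^'n::finite \<Rightarrow> real) set). weighted_form s f f < \<eta>\<^sup>2 \<longrightarrow> trip_norm f < \<delta>"
proof -
  have s0: "0 \<le> s" using s by simp
  define iw where "iw x = (\<Prod>i\<in>UNIV. (1 + (x $ i)\<^sup>2) powr (- s))" for x :: "real^'n"
  have iwi: "integrable lborel iw"
    unfolding iw_def[abs_def] by (rule vec_integral_prod(1)) (rule integrable_one_plus_square_powr[OF s(1)])
  have iw0: "0 \<le> iw x" for x unfolding iw_def by (intro prod_nonneg) simp
  have iww: "power_weight s x * iw x = 1" for x
    unfolding iw_def power_weight_def prod.distrib[symmetric]
  proof (rule prod.neutral, rule ballI)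
    fix i
    have "1 + (x $ i)\<^sup>2 \<noteq> 0" using zero_le_power2[of "x $ i"] by linarith
    then show "(1 + (x $ i)\<^sup>2) powr s * (1 + (x $ i)\<^sup>2) powr (- s) = 1" by (simp add: powr_add[symmetric])
  qed
  define I where "I = (\<integral>x. iw x \<partial>lborel)"
  have I0: "I \<ge> 0" unfolding I_def by (rule integral_nonneg_AE) (simp add: iw0)
  \<comment> \<open>The L1 part will be at most \<open>\<eta> * ((1 + I) / 2)\<close> and the L2
    part at most \<eta>; \<open>c\<close> collects both coefficients.\<close>
  define c where "c = (1 + I) / 2 + 1"
  have c: "c > 0" using I0 by (simp add: c_def add_nonneg_pos)
  define \<eta> where "\<eta> = \<delta> / (2 * c)"
  have \<eta>: "\<eta> > 0" "\<eta> * c < \<delta>" using \<delta> c by (simp_all add: \<eta>_def)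
  show ?thesis
  proof (intro exI[of _ \<eta>] conjI ballI impI \<eta>(1))
    fix f :: "real^'n \<Rightarrow> real" assume f: "f \<in> schwartz" and A: "weighted_form s f f < \<eta>\<^sup>2"
    have wi: "integrable lborel (\<lambda>x. f x * f x * power_weight s x)" by (rule power_weight_integrable[OF s0 s(2) f f])
    have fi: "integrable lborel f"
      by (rule integrable_weight_bound[where C="schwartz_norm (2 * CARD('n)) f"])
         (use schwartz_measurable[OF f, of "[]"] schwartz_weight_bound[OF f, of "2 * CARD('n)" "[]"] in simp_all)
    have pw: "1 \<le> power_weight s x" for x :: "real^'n" by (rule power_weight_ge_1[OF s0])
    \<comment> \<open>The arithmetic-geometric mean inequality at scale \<eta>, a pointwise form of
      Cauchy-Schwarz: once the form is below \<open>\<eta>^2\<close>, both terms integrate to order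
      \<eta>.\<close>
    have pt: "\<bar>f x\<bar> \<le> 1 / (2 * \<eta>) * (f x * f x * power_weight s x) + \<eta> / 2 * iw x" for x
    proof -
      have "sqrt ((f x * f x * power_weight s x / \<eta>) * (\<eta> * iw x)) \<le> (f x * f x * power_weight s x / \<eta> + \<eta> * iw x) / 2"
        by (rule arith_geo_mean_sqrt) (use \<eta>(1) iw0[of x] pw[of x] in simp_all)
      moreover have "(f x * f x * power_weight s x / \<eta>) * (\<eta> * iw x) = (f x)\<^sup>2 * (power_weight s x * iw x)"
        using \<eta>(1) by (simp add: power2_eq_square)
      ultimately show ?thesis unfolding iww using \<eta>(1) by (simp add: add_divide_distrib)
    qed
    have "L1_norm f \<le> (\<integral>x. 1 / (2 * \<eta>) * (f x * f x * power_weight s x) + \<eta> / 2 * iw x \<partial>lborel)"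
      unfolding L1_norm_def
      by (intro integral_mono integrable_abs fi Bochner_Integration.integrable_add integrable_mult_right wi iwi pt)
    also have "\<dots> = 1 / (2 * \<eta>) * weighted_form s f f + \<eta> / 2 * I"
      using wi iwi by (subst Bochner_Integration.integral_add) (simp_all add: weighted_form_def I_def)
    also have "\<dots> \<le> 1 / (2 * \<eta>) * \<eta>\<^sup>2 + \<eta> / 2 * I"
      using A \<eta>(1) by (intro add_right_mono mult_left_mono) simp_all
    also have "\<dots> = \<eta> * ((1 + I) / 2)" using \<eta>(1) by (simp add: power2_eq_square field_simps)
    finally have L1: "L1_norm f \<le> \<eta> * ((1 + I) / 2)" .
    have "(\<integral>x. (f x)\<^sup>2 \<partial>lborel) \<le> weighted_form s f f"
      unfolding weighted_form_def
    proof (rule integral_mono[OF _ wi])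
      show "integrable lborel (\<lambda>x. (f x)\<^sup>2)" using schwartz_integrable_mult[OF f f] by (simp add: power2_eq_square)
      show "(f x)\<^sup>2 \<le> f x * f x * power_weight s x" for x
        using mult_left_mono[OF pw[of x], of "(f x)\<^sup>2"] by (simp add: power2_eq_square)
    qed
    then have "L2_norm f \<le> sqrt (\<eta>\<^sup>2)" unfolding L2_norm_def using A by (intro real_sqrt_le_mono) linarith
    then have L2: "L2_norm f \<le> \<eta>" using \<eta>(1) by simp
    have nn: "0 \<le> L1_norm f" "0 \<le> L2_norm f"
      unfolding L1_norm_def L2_norm_def by (auto intro!: integral_nonneg_AE)
    have "trip_norm f \<le> L1_norm f + L2_norm f" unfolding trip_norm_def by (rule sqrt_sum_squares_le_sum[OF nn])
    also have "\<dots> \<le> \<eta> * c" using L1 L2 by (simp add: c_def field_simps)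
    also have "\<dots> < \<delta>" by (rule \<eta>(2))
    finally show "trip_norm f < \<delta>" .
  qed
qed

lemma trip_norm_tendsto:
  fixes F :: "nat \<Rightarrow> real^'n::finite \<Rightarrow> real"
  assumes F: "\<And>r. F r \<in> schwartz" and lim: "\<And>N. (\<lambda>r. schwartz_norm N (F r)) \<longlonglongrightarrow> 0"
  shows "(\<lambda>r. trip_norm (F r)) \<longlonglongrightarrow> 0"
proof -
  obtain C M where C: "C \<ge> 0" "\<And>f :: real^'n \<Rightarrow> real. f \<in> schwartz \<Longrightarrow> trip_norm f \<le> C * schwartz_norm M f"
    using dominated_trip_norm[where 'n='n] unfolding dominated_def by blast
  have "(\<lambda>r. C * schwartz_norm M (F r)) \<longlonglongrightarrow> C * 0" by (intro tendsto_mult tendsto_const lim)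
  then have l: "(\<lambda>r. C * schwartz_norm M (F r)) \<longlonglongrightarrow> 0" by simp
  show ?thesis
  proof (rule Lim_null_comparison[OF _ l])
    have "trip_norm (F r) \<ge> 0" for r by (simp add: trip_norm_def)
    then show "\<forall>\<^sub>F r in sequentially. norm (trip_norm (F r)) \<le> C * schwartz_norm M (F r)"
      using C(2)[OF F] by (intro always_eventually allI) simp
  qed
qed

lemma trip_continuous_tendsto:
  assumes \<phi>: "trip_continuous \<phi>" and f: "f \<in> schwartz" and g: "\<And>r. g r \<in> schwartz"
    and lim: "\<And>N. (\<lambda>r. schwartz_norm N (\<lambda>x. g r x - f x)) \<longlonglongrightarrow> 0"
  shows "(\<lambda>r. \<phi> (g r)) \<longlonglongrightarrow> \<phi> f"
proof (rule LIMSEQ_I)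
  fix e :: real assume "e > 0"
  then obtain \<delta> where \<delta>: "\<delta> > 0" "\<And>g. g \<in> schwartz \<Longrightarrow> trip_norm (\<lambda>x. g x - f x) < \<delta> \<Longrightarrow> cmod (\<phi> g - \<phi> f) < e"
    using \<phi> f unfolding trip_continuous_def by blast
  have d: "(\<lambda>x. g r x - f x) \<in> schwartz" for r using schwartz_lincomb[OF g f, of 1 r "-1"] by simp
  have "(\<lambda>r. trip_norm (\<lambda>x. g r x - f x)) \<longlonglongrightarrow> 0" by (rule trip_norm_tendsto[OF d lim])
  then have "\<forall>\<^sub>F r in sequentially. trip_norm (\<lambda>x. g r x - f x) < \<delta>" by (rule order_tendstoD) (rule \<delta>(1))
  then have "\<forall>\<^sub>F r in sequentially. norm (\<phi> (g r) - \<phi> f) < e" by (rule eventually_mono) (rule \<delta>(2)[OF g])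
  then show "\<exists>no. \<forall>r\<ge>no. norm (\<phi> (g r) - \<phi> f) < e" by (simp add: eventually_sequentially)
qed

lemma coef_seq_lincomb:
  assumes "f \<in> schwartz" "g \<in> schwartz"
  shows "coef_seq (\<lambda>x. a * f x + b * g x) n = a * coef_seq f n + b * coef_seq g n"
proof -
  have i: "integrable lborel (\<lambda>x. a * (f x * hermite_tensor (multi_index n) x))" "integrable lborel (\<lambda>x. b * (g x * hermite_tensor (multi_index n) x))"
    by (intro integrable_mult_right schwartz_integrable_mult assms hermite_tensor_schwartz)+
  have "coef_seq (\<lambda>x. a * f x + b * g x) n = (\<integral>x. a * (f x * hermite_tensor (multi_index n) x) + b * (g x * hermite_tensor (multi_index n) x) \<partial>lborel)"
    by (simp add: coef_seq_def hermite_coef_def algebra_simps)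
  also have "\<dots> = (\<integral>x. a * (f x * hermite_tensor (multi_index n) x) \<partial>lborel) + (\<integral>x. b * (g x * hermite_tensor (multi_index n) x) \<partial>lborel)"
    by (rule Bochner_Integration.integral_add[OF i])
  finally show ?thesis by (simp add: coef_seq_def hermite_coef_def)
qed

lemma coef_seq_hermite: "coef_seq (hermite_seq m :: real^'n::finite \<Rightarrow> real) n = (if n = m then 1 else 0)"
proof -
  have "inj (multi_index :: nat \<Rightarrow> 'n::finite \<Rightarrow> nat)" by (rule bij_betw_imp_inj_on[OF bij_multi_index])
  then show ?thesis by (auto simp: coef_seq_def hermite_seq_def hermite_coef_tensor dest: injD)
qed

text \<open>The condition on \<open>z\<close> places it in the weighted l2 space dual to
  \<open>hermite_norm q\<close>. Cauchy-Schwarz then bounds the pairing by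
  \<open>hermite_norm q\<close>, and the sum is tempered because that norm is dominated by a
  Schwartz norm.\<close>

lemma hermite_functional:
  fixes z :: "nat \<Rightarrow> real" and q :: real
  defines "L \<equiv> restrict (\<lambda>f :: real^'n::finite \<Rightarrow> real. \<Sum>n. coef_seq f n * z n) schwartz"
  assumes q: "q \<ge> 0" and z: "summable (\<lambda>n. (hermite_eigenvalue (multi_index n :: 'n \<Rightarrow> nat) powr (- q) * z n)\<^sup>2)"
  shows "L \<in> tempered_q q" and "\<And>m. L (hermite_seq m) = z m" and "\<And>f. f \<in> schwartz \<Longrightarrow> (\<lambda>n. coef_seq f n * z n) sums L f"
proof -
  let ?e = "\<lambda>n. hermite_eigenvalue (multi_index n :: 'n \<Rightarrow> nat)"
  have e: "?e n > 0" for n using hermite_eigenvalue_ge_1[of "multi_index n :: 'n \<Rightarrow> nat"] by linarith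
  define b where "b n = ?e n powr (- q) * z n" for n
  define a where "a f n = ?e n powr q * coef_seq f n" for f :: "real^'n \<Rightarrow> real" and n
  have ab: "coef_seq f n * z n = a f n * b n" for f n
    using e[of n] by (simp add: a_def b_def powr_minus)
  have bs: "summable (\<lambda>n. (b n)\<^sup>2)" using z by (simp add: b_def)
  have a2: "(a f n)\<^sup>2 = ?e n powr (2 * q) * (coef_seq f n)\<^sup>2" for f n
  proof -
    have "(?e n powr q)\<^sup>2 = ?e n powr (2 * q)" by (simp add: power2_eq_square powr_add[symmetric])
    then show ?thesis by (simp add: a_def power_mult_distrib)
  qed
  have as: "summable (\<lambda>n. (a f n)\<^sup>2)" "hermite_norm q f = sqrt (\<Sum>n. (a f n)\<^sup>2)" if "f \<in> schwartz" for f
    using hermite_norm_summable(1,2)[OF q that] unfolding a2 by simp_all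
  have sm: "summable (\<lambda>n. coef_seq f n * z n)" if f: "f \<in> schwartz" for f :: "real^'n \<Rightarrow> real"
  proof (rule summable_comparison_test')
    show "summable (\<lambda>n. ((a f n)\<^sup>2 + (b n)\<^sup>2) / 2)" by (intro summable_divide summable_add as f bs)
    show "norm (coef_seq f n * z n) \<le> ((a f n)\<^sup>2 + (b n)\<^sup>2) / 2" for n
    proof -
      have "2 * (\<bar>a f n\<bar> * \<bar>b n\<bar>) \<le> (a f n)\<^sup>2 + (b n)\<^sup>2"
        using zero_le_power2[of "\<bar>a f n\<bar> - \<bar>b n\<bar>"] by (simp add: power2_diff)
      then show ?thesis unfolding ab by (simp add: abs_mult)
    qed
  qed
  have Lf: "L f = (\<Sum>n. coef_seq f n * z n)" if "f \<in> schwartz" for f using that by (simp add: L_def)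
  show sums: "(\<lambda>n. coef_seq f n * z n) sums L f" if "f \<in> schwartz" for f
    unfolding Lf[OF that] by (rule summable_sums[OF sm[OF that]])
  show "L (hermite_seq m) = z m" for m
  proof -
    have "(\<lambda>n. coef_seq (hermite_seq m :: real^'n \<Rightarrow> real) n * z n) = (\<lambda>n. if n = m then z n else 0)"
      by (auto simp: coef_seq_hermite)
    then show ?thesis using sums_unique[OF sums_single[of m z]] by (simp add: Lf[OF hermite_seq_schwartz])
  qed
  define B where "B = sqrt (\<Sum>n. (b n)\<^sup>2)"
  have B0: "B \<ge> 0" unfolding B_def by (intro real_sqrt_ge_zero suminf_nonneg bs) simp
  have hn0: "hermite_norm q f \<ge> 0" if "f \<in> schwartz" for f :: "real^'n \<Rightarrow> real"
    unfolding as(2)[OF that] by (intro real_sqrt_ge_zero suminf_nonneg as that) simp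
  have bound: "\<bar>L f\<bar> \<le> B * hermite_norm q f" if f: "f \<in> schwartz" for f
  proof (rule LIMSEQ_le_const2)
    show "(\<lambda>m. \<bar>\<Sum>n<m. coef_seq f n * z n\<bar>) \<longlonglongrightarrow> \<bar>L f\<bar>"
      using sums[OF f] unfolding sums_def by (rule tendsto_rabs)
    have "\<bar>\<Sum>n<m. coef_seq f n * z n\<bar> \<le> B * hermite_norm q f" for m
    proof -
      have "\<bar>\<Sum>n<m. coef_seq f n * z n\<bar> \<le> (\<Sum>n<m. \<bar>a f n\<bar> * \<bar>b n\<bar>)"
        unfolding ab using sum_abs[of "\<lambda>n. a f n * b n" "{..<m}"] by (simp add: abs_mult)
      also have "\<dots> \<le> L2_set (a f) {..<m} * L2_set b {..<m}" by (rule L2_set_mult_ineq)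
      also have "\<dots> \<le> hermite_norm q f * B"
      proof (intro mult_mono L2_set_nonneg hn0 f)
        show "L2_set (a f) {..<m} \<le> hermite_norm q f"
          unfolding L2_set_def as(2)[OF f] by (intro real_sqrt_le_mono sum_le_suminf as f) auto
        show "L2_set b {..<m} \<le> B" unfolding L2_set_def B_def by (intro real_sqrt_le_mono sum_le_suminf bs) auto
      qed
      finally show ?thesis by (simp add: mult.commute)
    qed
    then show "\<exists>N. \<forall>m\<ge>N. \<bar>\<Sum>n<m. coef_seq f n * z n\<bar> \<le> B * hermite_norm q f" by blast
  qed
  have "L \<in> tempered"
    unfolding tempered_def
  proof (intro CollectI conjI ballI allI)
    show "L \<in> extensional schwartz" by (simp add: L_def)
    fix f g :: "real^'n \<Rightarrow> real" and u v assume fg: "f \<in> schwartz" "g \<in> schwartz"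
    have "(\<lambda>n. u * (coef_seq f n * z n) + v * (coef_seq g n * z n)) sums (u * L f + v * L g)"
      by (intro sums_add sums_mult sums fg)
    moreover have "(\<lambda>n. u * (coef_seq f n * z n) + v * (coef_seq g n * z n)) = (\<lambda>n. coef_seq (\<lambda>x. u * f x + v * g x) n * z n)"
      by (simp add: coef_seq_lincomb[OF fg] algebra_simps)
    ultimately show "L (\<lambda>x. u * f x + v * g x) = u * L f + v * L g"
      using sums_unique2[OF sums[OF schwartz_lincomb[OF fg]]] by simp
  next
    obtain C M where C: "C \<ge> 0" "\<And>f :: real^'n \<Rightarrow> real. f \<in> schwartz \<Longrightarrow> hermite_norm q f \<le> C * schwartz_norm M f"
      using hermite_norm_summable(3)[OF q, where 'n='n] unfolding dominated_def by blast
    have "\<bar>L f\<bar> \<le> (B * C) * schwartz_norm M f" if "f \<in> schwartz" for f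
      using order_trans[OF bound[OF that] mult_left_mono[OF C(2)[OF that] B0]] by simp
    then show "\<exists>C N. \<forall>f\<in>schwartz. \<bar>L f\<bar> \<le> C * (\<Sum>k\<le>N. \<Sum>is\<in>{is. length is \<le> N}. schwartz_seminorm k is f)"
      unfolding schwartz_norm_def[symmetric] by blast
  qed
  \<comment> \<open>\<open>B + 1\<close> in place of \<open>B\<close>, since
    \<open>tempered_q\<close> asks for a strictly positive constant.\<close>
  moreover have "\<bar>L f\<bar> \<le> (B + 1) * hermite_norm q f" if "f \<in> schwartz" for f
    using bound[OF that] hn0[OF that] by (simp add: distrib_right)
  ultimately show "L \<in> tempered_q q" unfolding tempered_q_def using B0 by (auto intro!: exI[of _ "B + 1"])
qed

lemma minlos_existence:
  fixes \<phi> :: "(real^'n::finite \<Rightarrow> real) \<Rightarrow> complex"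
  assumes pd: "positive_definite \<phi>" and cont: "trip_continuous \<phi>" and one: "\<phi> (\<lambda>x. 0) = 1"
    and q: "q > 3 * real CARD('n) / 4"
  shows "\<exists>\<mu>. prob_space \<mu> \<and> sets \<mu> = sets (tempered_borel :: ((real^'n \<Rightarrow> real) \<Rightarrow> real) measure)
    \<and> (\<forall>f\<in>schwartz. char_fun \<mu> f = \<phi> f) \<and> emeasure \<mu> (tempered_q q) = 1"
proof -
  let ?d = "real CARD('n)" and ?h = "hermite_seq :: nat \<Rightarrow> real^'n \<Rightarrow> real"
  have d: "?d > 0" by simp
  have q0: "q \<ge> 0" using q d by linarith
  have hS: "?h j \<in> schwartz" for j by (rule hermite_seq_schwartz)
  define comb where "comb t n x = (\<Sum>j<n. t j * ?h j x)" for t :: "nat \<Rightarrow> real" and n :: nat and x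
  have combS: "comb t n \<in> schwartz" for t n
    unfolding comb_def[abs_def] by (intro schwartz_sum hS finite_lessThan)
  have comb_diff: "(\<lambda>x. comb t n x - comb u n x) = comb (\<lambda>j. t j - u j) n" for t u n
    by (simp add: comb_def fun_eq_iff sum_subtractf left_diff_distrib)
  \<comment> \<open>Summing over the support instead of \<open>{..<n}\<close> makes \<psi>
    independent of the number of coordinates considered; it is evaluated only at finitely supported
    \<open>t\<close>.\<close>
  define \<psi> where "\<psi> t = \<phi> (\<lambda>x. \<Sum>j\<in>{j. t j \<noteq> 0}. t j * ?h j x)" for t
  have \<psi>: "\<psi> t = \<phi> (comb t n)" if "\<And>j. j \<ge> n \<Longrightarrow> t j = 0" for t n
  proof -
    have "(\<Sum>j\<in>{j. t j \<noteq> 0}. t j * ?h j x) = comb t n x" for x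
      unfolding comb_def by (rule sum.mono_neutral_left) (use that in \<open>auto simp: not_less[symmetric]\<close>)
    then show ?thesis by (simp add: \<psi>_def)
  qed
  have one': "\<psi> (\<lambda>_. 0) = 1" using one by (simp add: \<psi>_def)
  have pd': "Im (\<Sum>i\<in>I. \<Sum>l\<in>I. cnj (c i) * \<psi> (\<lambda>j. a i j - a l j) * c l) = 0 \<and>
      Re (\<Sum>i\<in>I. \<Sum>l\<in>I. cnj (c i) * \<psi> (\<lambda>j. a i j - a l j) * c l) \<ge> 0"
    if I: "finite I" and a: "\<And>i j. i \<in> I \<Longrightarrow> j \<ge> k \<Longrightarrow> a i j = 0" for k and I :: "(nat \<Rightarrow> nat) set" and a c
  proof -
    \<comment> \<open>Positive definiteness of \<phi> speaks of families indexed by an initial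
      segment, so the finite set \<open>I\<close> of grid points is enumerated.\<close>
    obtain e where e: "bij_betw e {0..<card I} I" using ex_bij_betw_nat_finite[OF I] by blast
    then have e': "bij_betw e {..<card I} I" by (simp add: atLeast0LessThan)
    define fs where "fs i = comb (a (e i)) k" for i
    have fsS: "\<forall>i<card I. fs i \<in> schwartz" by (simp add: fs_def combS)
    have A: "\<phi> (\<lambda>x. fs i x - fs l x) = \<psi> (\<lambda>j. a (e i) j - a (e l) j)" if "i < card I" "l < card I" for i l
    proof -
      have "e i \<in> I" "e l \<in> I" using that e' by (auto simp: bij_betw_def)
      then show ?thesis unfolding fs_def comb_diff by (intro \<psi>[symmetric]) (simp add: a)
    qed
    have "(\<Sum>i<card I. \<Sum>l<card I. cnj (c (e i)) * \<phi> (\<lambda>x. fs i x - fs l x) * c (e l))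
      = (\<Sum>i<card I. \<Sum>l<card I. cnj (c (e i)) * \<psi> (\<lambda>j. a (e i) j - a (e l) j) * c (e l))"
      by (intro sum.cong refl) (simp add: A)
    also have "\<dots> = (\<Sum>i<card I. \<Sum>l\<in>I. cnj (c (e i)) * \<psi> (\<lambda>j. a (e i) j - a l j) * c l)"
      by (intro sum.cong refl) (rule sum.reindex_bij_betw[OF e'])
    also have "\<dots> = (\<Sum>i\<in>I. \<Sum>l\<in>I. cnj (c i) * \<psi> (\<lambda>j. a i j - a l j) * c l)"
      by (rule sum.reindex_bij_betw[OF e'])
    finally have eq: "(\<Sum>i<card I. \<Sum>l<card I. cnj (c (e i)) * \<phi> (\<lambda>x. fs i x - fs l x) * c (e l)) = \<dots>" .
    have "\<forall>c :: nat \<Rightarrow> complex. Im (\<Sum>i<card I. \<Sum>l<card I. cnj (c i) * \<phi> (\<lambda>x. fs i x - fs l x) * c l) = 0 \<and>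
       Re (\<Sum>i<card I. \<Sum>l<card I. cnj (c i) * \<phi> (\<lambda>x. fs i x - fs l x) * c l) \<ge> 0"
      by (rule mp[OF spec[OF spec[OF pd[unfolded positive_definite_def Let_def]]] fsS, THEN conjunct2])
    from this[rule_format, of "\<lambda>i. c (e i)"] show ?thesis unfolding eq .
  qed
  have cont': "(\<lambda>r. \<psi> (\<tau> r)) \<longlonglongrightarrow> \<psi> t"
    if \<tau>: "\<And>j. (\<lambda>r. \<tau> r j) \<longlonglongrightarrow> t j" and \<tau>0: "\<And>r j. j \<ge> k \<Longrightarrow> \<tau> r j = 0" for k and \<tau> :: "nat \<Rightarrow> nat \<Rightarrow> real" and t
  proof -
    have t0: "t j = 0" if "j \<ge> k" for j
    proof (rule LIMSEQ_unique[OF \<tau>[of j]])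
      show "(\<lambda>r. \<tau> r j) \<longlonglongrightarrow> 0" by (simp only: \<tau>0[OF that] tendsto_const)
    qed
    have "(\<lambda>r. \<phi> (comb (\<tau> r) k)) \<longlonglongrightarrow> \<phi> (comb t k)"
    proof (rule trip_continuous_tendsto[OF cont combS combS])
      fix N
      have "(\<lambda>r. \<Sum>j<k. \<bar>\<tau> r j - t j\<bar> * schwartz_norm N (?h j)) \<longlonglongrightarrow> (\<Sum>j<k. \<bar>t j - t j\<bar> * schwartz_norm N (?h j))"
        by (intro tendsto_sum tendsto_mult tendsto_rabs tendsto_diff \<tau> tendsto_const)
      then have l: "(\<lambda>r. \<Sum>j<k. \<bar>\<tau> r j - t j\<bar> * schwartz_norm N (?h j)) \<longlonglongrightarrow> 0" by simp
      show "(\<lambda>r. schwartz_norm N (\<lambda>x. comb (\<tau> r) k x - comb t k x)) \<longlonglongrightarrow> 0"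
        unfolding comb_diff
      proof (rule Lim_null_comparison[OF _ l])
        have "schwartz_norm N (comb (\<lambda>j. \<tau> r j - t j) k) \<le> (\<Sum>j<k. \<bar>\<tau> r j - t j\<bar> * schwartz_norm N (?h j))" for r
          unfolding comb_def[abs_def] by (rule schwartz_norm_sum) (simp_all add: hS)
        then show "\<forall>\<^sub>F r in sequentially. norm (schwartz_norm N (comb (\<lambda>j. \<tau> r j - t j) k)) \<le> (\<Sum>j<k. \<bar>\<tau> r j - t j\<bar> * schwartz_norm N (?h j))"
          using schwartz_norm_nonneg[OF combS] by (intro always_eventually allI) simp
      qed
    qed
    then show ?thesis by (simp add: \<psi>[OF t0] \<psi>[OF \<tau>0])
  qed
  obtain \<nu> Z where \<nu>: "real_distribution \<nu>" and Z: "\<And>j. Z j \<in> borel_measurable borel"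
    and EZ: "\<And>n t. (\<And>j. j \<ge> n \<Longrightarrow> t j = 0) \<Longrightarrow> (\<integral>s. cis (\<Sum>j<n. t j * Z j s) \<partial>\<nu>) = \<psi> t"
  proof (rule countable_bochner[OF pd' one' cont'], assumption+)
    fix \<nu> :: "real measure" and Z
    assume "real_distribution \<nu>" "\<And>j. Z j \<in> borel_measurable borel"
      "\<And>n t. (\<And>j. j \<ge> n \<Longrightarrow> t j = 0) \<Longrightarrow> (\<integral>s. cis (\<Sum>j<n. t j * Z j s) \<partial>\<nu>) = \<psi> t"
    then show thesis by (rule that[of \<nu> Z])
  qed
  interpret \<nu>: real_distribution \<nu> by (rule \<nu>)
  have Zm[measurable]: "Z j \<in> borel_measurable \<nu>" for j using Z by simp
  have E: "(\<integral>s. cis (\<Sum>j<n. t j * Z j s) \<partial>\<nu>) = \<phi> (comb t n)" for n t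
  proof -
    define u where "u j = (if j < n then t j else 0)" for j
    have "(\<integral>s. cis (\<Sum>j<n. u j * Z j s) \<partial>\<nu>) = \<psi> u" by (rule EZ) (simp add: u_def)
    also have "\<psi> u = \<phi> (comb u n)" by (rule \<psi>) (simp add: u_def)
    also have "comb u n = comb t n" by (simp add: u_def comb_def fun_eq_iff)
    finally show ?thesis by (simp add: u_def)
  qed
  have cm: "(\<lambda>s. cis (\<Sum>j<n. t j * Z j s)) \<in> borel_measurable \<nu>" for n t
  proof -
    have "(\<lambda>s. \<Sum>j<n. t j * Z j s) \<in> borel_measurable \<nu>" by measurable
    moreover have "cis \<in> borel_measurable borel"
      by (intro borel_measurable_continuous_onI continuous_on_cis continuous_on_id)
    ultimately show ?thesis by (rule measurable_compose)
  qed
  have ci: "integrable \<nu> (\<lambda>s. cis (\<Sum>j<n. t j * Z j s))" for n t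
    by (rule \<nu>.integrable_const_bound[where B=1]) (use cm in simp_all)
  have Ecos: "(\<integral>s. cos (\<Sum>j<n. t j * Z j s) \<partial>\<nu>) = Re (\<phi> (comb t n))" for n t
    using integral_Re[OF ci[of t n]] E[of t n] by simp
  have Ecos_le: "1 - (\<integral>s. cos (\<Sum>j<n. t j * Z j s) \<partial>\<nu>) \<le> 2" for n t
  proof -
    have "\<bar>\<integral>s. cos (\<Sum>j<n. t j * Z j s) \<partial>\<nu>\<bar> \<le> (\<integral>s. 1 \<partial>\<nu>)"
    proof -
      have "\<bar>\<integral>s. cos (\<Sum>j<n. t j * Z j s) \<partial>\<nu>\<bar> \<le> (\<integral>s. \<bar>cos (\<Sum>j<n. t j * Z j s)\<bar> \<partial>\<nu>)"
        using integral_norm_bound[of \<nu> "\<lambda>s. cos (\<Sum>j<n. t j * Z j s)"] by simp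
      also have "\<dots> \<le> (\<integral>s. 1 \<partial>\<nu>)"
        by (rule integral_mono) (auto intro!: \<nu>.integrable_const_bound[where B=1])
      finally show ?thesis .
    qed
    then show ?thesis using \<nu>.prob_space by simp
  qed
  \<comment> \<open>The hypothesis on \<open>q\<close> amounts to \<open>e > 1/2\<close>, and
    summability below requires \<open>2 * q / d - s > 1\<close>, that is, \<open>s < e\<close>. The
    midpoint of \<open>1/2\<close> and \<open>e\<close>, capped at 1, meets all conditions on
    \<open>s\<close>.\<close>
  define e where "e = 2 * q / ?d - 1"
  have e: "e > 1 / 2" using q d by (simp add: e_def field_simps)
  define s where "s = min 1 ((1 / 2 + e) / 2)"
  have s: "1 / 2 < s" "s \<le> 1" "s < e" using e by (auto simp: s_def min_def)
  have s0: "0 \<le> s" using s by simp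
  have bound: "\<exists>K\<ge>0. \<forall>n (t :: nat \<Rightarrow> real).
      1 - (\<integral>x. cos (\<Sum>j<n. t j * Z j x) \<partial>\<nu>) \<le> \<epsilon> + K * (\<Sum>i<n. \<Sum>j<n. t i * t j * weighted_form s (?h i) (?h j))"
    if \<epsilon>: "\<epsilon> > 0" for \<epsilon>
  proof -
    obtain \<delta> where \<delta>: "\<delta> > 0" "\<And>g. g \<in> schwartz \<Longrightarrow> trip_norm (\<lambda>x. g x - 0) < \<delta> \<Longrightarrow> cmod (\<phi> g - \<phi> (\<lambda>x. 0)) < \<epsilon>"
      using cont[unfolded trip_continuous_def, rule_format, OF schwartz_zero \<epsilon>] by blast
    obtain \<eta> where \<eta>: "\<eta> > 0" "\<And>f :: real^'n \<Rightarrow> real. f \<in> schwartz \<Longrightarrow> weighted_form s f f < \<eta>\<^sup>2 \<Longrightarrow> trip_norm f < \<delta>"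
      using trip_norm_small[OF s(1,2) \<delta>(1), where 'n='n] by blast
    \<comment> \<open>If the form is below \<open>\<eta>^2\<close>, the norm is small and continuity
      at 0 yields \<epsilon>; otherwise the term with \<open>2 / \<eta>^2\<close> is at least 2,
      which bounds the left-hand side in all cases.\<close>
    show ?thesis
    proof (intro exI[of _ "2 / \<eta>\<^sup>2"] conjI allI)
      fix n and t :: "nat \<Rightarrow> real"
      have w: "(\<Sum>i<n. \<Sum>j<n. t i * t j * weighted_form s (?h i) (?h j)) = weighted_form s (comb t n) (comb t n)"
        unfolding comb_def[abs_def] by (rule weighted_form_sum[OF s0 s(2) hS, symmetric])
      have w0: "0 \<le> weighted_form s (comb t n) (comb t n)" by (rule weighted_form_nonneg[OF s0])
      show "1 - (\<integral>x. cos (\<Sum>j<n. t j * Z j x) \<partial>\<nu>) \<le> \<epsilon> + 2 / \<eta>\<^sup>2 * (\<Sum>i<n. \<Sum>j<n. t i * t j * weighted_form s (?h i) (?h j))"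
        unfolding w
      proof (cases "weighted_form s (comb t n) (comb t n) < \<eta>\<^sup>2")
        case True
        then have "trip_norm (comb t n) < \<delta>" by (rule \<eta>(2)[OF combS])
        then have "cmod (\<phi> (comb t n) - 1) < \<epsilon>" using \<delta>(2)[OF combS, of t n] one by simp
        moreover have "1 - Re (\<phi> (comb t n)) \<le> cmod (\<phi> (comb t n) - 1)"
          using complex_Re_le_cmod[of "1 - \<phi> (comb t n)"] by (simp add: norm_minus_commute)
        moreover have "0 \<le> 2 / \<eta>\<^sup>2 * weighted_form s (comb t n) (comb t n)" using w0 by simp
        ultimately show "1 - (\<integral>x. cos (\<Sum>j<n. t j * Z j x) \<partial>\<nu>) \<le> \<epsilon> + 2 / \<eta>\<^sup>2 * weighted_form s (comb t n) (comb t n)"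
          unfolding Ecos by linarith
      next
        case False
        then have "2 / \<eta>\<^sup>2 * \<eta>\<^sup>2 \<le> 2 / \<eta>\<^sup>2 * weighted_form s (comb t n) (comb t n)" by (intro mult_left_mono) auto
        then have "2 \<le> 2 / \<eta>\<^sup>2 * weighted_form s (comb t n) (comb t n)" using \<eta>(1) by simp
        then show "1 - (\<integral>x. cos (\<Sum>j<n. t j * Z j x) \<partial>\<nu>) \<le> \<epsilon> + 2 / \<eta>\<^sup>2 * weighted_form s (comb t n) (comb t n)"
          using Ecos_le[of t n] \<epsilon> by linarith
      qed
    qed simp
  qed
  define ev where "ev n = hermite_eigenvalue (multi_index n :: 'n \<Rightarrow> nat)" for n
  have sm: "summable (\<lambda>j. (ev j powr (- q))\<^sup>2 * weighted_form s (?h j) (?h j))"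
  proof (rule summable_comparison_test')
    show "summable (\<lambda>j. 3 ^ CARD('n) * hermite_index (multi_index j :: 'n \<Rightarrow> nat) powr (- (2 * q / ?d - s)))"
      by (intro summable_mult summable_hermite_index) (use s(3) in \<open>simp add: e_def\<close>)
    fix j :: nat
    let ?i = "hermite_index (multi_index j :: 'n \<Rightarrow> nat)"
    have i: "?i \<ge> 1" by (rule hermite_index_ge_1)
    have ev: "ev j \<ge> 1" unfolding ev_def by (rule hermite_eigenvalue_ge_1)
    \<comment> \<open>Comparing the eigenvalue with the d-th root of \<open>hermite_index\<close>
      turns its exponent \<open>2 * q\<close> into \<open>2 * q / d\<close>, after which the sum
      over multi-indices factorises.\<close>
    have "?i powr (1 / ?d) \<le> (ev j ^ CARD('n)) powr (1 / ?d)"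
      unfolding ev_def using i by (intro powr_mono2 hermite_index_le_eigenvalue) simp_all
    also have "\<dots> = ev j" using ev d by (simp add: powr_realpow[symmetric] powr_powr)
    finally have le: "?i powr (1 / ?d) \<le> ev j" .
    have "(ev j powr (- q))\<^sup>2 = ev j powr (- (2 * q))" by (simp add: power2_eq_square powr_add[symmetric])
    also have "\<dots> \<le> (?i powr (1 / ?d)) powr (- (2 * q))" using le i q0 by (intro powr_mono2') auto
    also have "\<dots> = ?i powr (- (2 * q / ?d))" by (simp add: powr_powr)
    finally have 1: "(ev j powr (- q))\<^sup>2 \<le> ?i powr (- (2 * q / ?d))" .
    have 2: "weighted_form s (?h j) (?h j) \<le> 3 ^ CARD('n) * ?i powr s"
      unfolding hermite_seq_def by (rule weighted_form_hermite[OF s0 s(2)])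
    have "(ev j powr (- q))\<^sup>2 * weighted_form s (?h j) (?h j) \<le> ?i powr (- (2 * q / ?d)) * (3 ^ CARD('n) * ?i powr s)"
      by (intro mult_mono 1 2 weighted_form_nonneg s0) simp
    also have "\<dots> = 3 ^ CARD('n) * ?i powr (- (2 * q / ?d - s))" by (simp add: powr_add[symmetric])
    finally show "norm ((ev j powr (- q))\<^sup>2 * weighted_form s (?h j) (?h j)) \<le> 3 ^ CARD('n) * ?i powr (- (2 * q / ?d - s))"
      using weighted_form_nonneg[OF s0, of "?h j"] by simp
  qed
  have "AE x in \<nu>. summable (\<lambda>j. (ev j powr (- q) * Z j x)\<^sup>2)"
    by (rule minlos_support[OF \<nu>.prob_space_axioms Zm bound weighted_form_nonneg[OF s0] sm])
  then obtain N where N: "{x \<in> space \<nu>. \<not> summable (\<lambda>j. (ev j powr (- q) * Z j x)\<^sup>2)} \<subseteq> N" "emeasure \<nu> N = 0" "N \<in> sets \<nu>"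
    by (rule AE_E)
  have Nn: "N \<in> null_sets \<nu>" using N by (simp add: null_sets_def)
  \<comment> \<open>Setting the coordinates to 0 on the null set makes every outcome, not just
    almost every one, produce an element of \<open>tempered_q q\<close>, so the functional is
    defined everywhere as a measurable map.\<close>
  define z where "z x j = (if x \<in> N then 0 else Z j x)" for x j
  have zs: "summable (\<lambda>j. (ev j powr (- q) * z x j)\<^sup>2)" for x
    using N(1) by (cases "x \<in> N") (auto simp: z_def)
  have zm: "(\<lambda>x. z x j) \<in> borel_measurable \<nu>" for j
    unfolding z_def using N(3) by measurable
  define \<omega> where "\<omega> x = restrict (\<lambda>f :: real^'n \<Rightarrow> real. \<Sum>n. coef_seq f n * z x n) schwartz" for x
  note hf = hermite_functional[OF q0 zs[unfolded ev_def], folded \<omega>_def]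
  have \<omega>m: "\<omega> \<in> measurable \<nu> tempered_borel"
  proof (rule measurable_into_tempered)
    show "\<omega> x \<in> tempered" for x using hf(1)[of x] by (simp add: tempered_q_def)
    show "(\<lambda>x. \<omega> x (hermite_seq n)) \<in> borel_measurable \<nu>" for n unfolding hf(2) by (rule zm)
  qed
  define \<mu> where "\<mu> = distr \<nu> tempered_borel \<omega>"
  have "prob_space \<mu>" unfolding \<mu>_def by (rule \<nu>.prob_space_distr[OF \<omega>m])
  moreover have "sets \<mu> = sets tempered_borel" by (simp add: \<mu>_def)
  moreover have "char_fun \<mu> f = \<phi> f" if f: "f \<in> schwartz" for f
  proof -
    have cism: "cis \<in> borel_measurable borel"
      by (intro borel_measurable_continuous_onI continuous_on_cis continuous_on_id)
    have fm: "(\<lambda>w. cis (w f)) \<in> borel_measurable tempered_borel"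
      by (rule measurable_compose[OF measurable_evaluation[OF f refl] cism])
    have c: "char_fun \<mu> f = (\<integral>x. cis (\<omega> x f) \<partial>\<nu>)"
      unfolding char_fun_def \<mu>_def by (rule integral_distr[OF \<omega>m fm])
    have "(\<lambda>n. \<integral>x. cis (\<Sum>j<n. coef_seq f j * Z j x) \<partial>\<nu>) \<longlonglongrightarrow> (\<integral>x. cis (\<omega> x f) \<partial>\<nu>)"
    proof (rule integral_dominated_convergence[where w="\<lambda>_. 1"])
      show "(\<lambda>x. cis (\<omega> x f)) \<in> borel_measurable \<nu>" by (rule measurable_compose[OF \<omega>m fm])
      show "(\<lambda>x. cis (\<Sum>j<n. coef_seq f j * Z j x)) \<in> borel_measurable \<nu>" for n by (rule cm)
      show "AE x in \<nu>. (\<lambda>n. cis (\<Sum>j<n. coef_seq f j * Z j x)) \<longlonglongrightarrow> cis (\<omega> x f)"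
      proof (rule eventually_mono[OF AE_not_in[OF Nn]])
        fix x assume "x \<notin> N"
        then have "(\<lambda>n. \<Sum>j<n. coef_seq f j * Z j x) \<longlonglongrightarrow> \<omega> x f"
          using hf(3)[OF f, of x] by (simp add: sums_def z_def)
        then show "(\<lambda>n. cis (\<Sum>j<n. coef_seq f j * Z j x)) \<longlonglongrightarrow> cis (\<omega> x f)" by (rule tendsto_cis)
      qed
    qed simp_all
    moreover have "(\<lambda>n. \<integral>x. cis (\<Sum>j<n. coef_seq f j * Z j x) \<partial>\<nu>) \<longlonglongrightarrow> \<phi> f"
      unfolding E
    proof (rule trip_continuous_tendsto[OF cont f combS])
      fix N
      have "schwartz_norm N (\<lambda>x. comb (coef_seq f) n x - f x) \<le> schwartz_norm N (\<lambda>x. f x - comb (coef_seq f) n x)" for n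
      proof -
        have g: "(\<lambda>x. f x - comb (coef_seq f) n x) \<in> schwartz"
          using schwartz_lincomb[OF f combS, of 1 "-1"] by simp
        show ?thesis using schwartz_norm_lincomb[OF g g, of N "-1" 0] by simp
      qed
      moreover have nn: "0 \<le> schwartz_norm N (\<lambda>x. comb (coef_seq f) n x - f x)" for n
        using schwartz_norm_nonneg[OF schwartz_lincomb[OF combS f, of 1 _ n "-1"]] by simp
      moreover have l: "(\<lambda>n. schwartz_norm N (\<lambda>x. f x - comb (coef_seq f) n x)) \<longlonglongrightarrow> 0"
        unfolding comb_def by (rule hermite_partial_sums_tendsto[OF f])
      ultimately show "(\<lambda>n. schwartz_norm N (\<lambda>x. comb (coef_seq f) n x - f x)) \<longlonglongrightarrow> 0"
        by (intro Lim_null_comparison[OF _ l] always_eventually allI) simp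
    qed
    ultimately show ?thesis unfolding c by (rule LIMSEQ_unique)
  qed
  moreover have "emeasure \<mu> (tempered_q q) = 1"
  proof -
    have "\<omega> -` tempered_q q \<inter> space \<nu> = space \<nu>" using hf(1) by blast
    then show ?thesis unfolding \<mu>_def using \<nu>.emeasure_space_1
      by (subst emeasure_distr[OF \<omega>m tempered_q_measurable]) simp
  qed
  ultimately show ?thesis by blast
qed

theorem theorem2p8:
  fixes \<phi> :: "(real^'n::finite \<Rightarrow> real) \<Rightarrow> complex"
  assumes "positive_definite \<phi>"
    and "trip_continuous \<phi>"
    and "\<phi> (\<lambda>x. 0) = 1"
  shows "(\<exists>!\<mu>. prob_space \<mu> \<and> sets \<mu> = sets (tempered_borel :: ((real^'n \<Rightarrow> real) \<Rightarrow> real) measure)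
              \<and> (\<forall>f\<in>schwartz. char_fun \<mu> f = \<phi> f))
       \<and> (\<forall>\<mu>. prob_space \<mu> \<and> sets \<mu> = sets (tempered_borel :: ((real^'n \<Rightarrow> real) \<Rightarrow> real) measure)
              \<and> (\<forall>f\<in>schwartz. char_fun \<mu> f = \<phi> f) \<longrightarrow>
            (\<forall>q. q > 3 * real CARD('n) / 4 \<longrightarrow> tempered_q q \<in> sets \<mu> \<and> emeasure \<mu> (tempered_q q) = 1))"
proof -
  let ?P = "\<lambda>\<mu>. prob_space \<mu> \<and> sets \<mu> = sets (tempered_borel :: ((real^'n \<Rightarrow> real) \<Rightarrow> real) measure)
              \<and> (\<forall>f\<in>schwartz. char_fun \<mu> f = \<phi> f)"
  have uniq: "\<mu> = \<mu>'" if "?P \<mu>" "?P \<mu>'" for \<mu> \<mu>'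
    by (rule char_fun_determines_measure) (use that in simp_all)
  have ex: "\<exists>\<mu>. ?P \<mu> \<and> emeasure \<mu> (tempered_q q) = 1" if "q > 3 * real CARD('n) / 4" for q
    using minlos_existence[OF assms that] by simp
  \<comment> \<open>Any admissible \<open>q\<close> will do here; the added 1 picks one.\<close>
  obtain \<mu>\<^sub>0 where "?P \<mu>\<^sub>0" using ex[of "3 * real CARD('n) / 4 + 1"] by auto
  then have "\<exists>!\<mu>. ?P \<mu>" using uniq by (intro ex1I[of ?P \<mu>\<^sub>0]) simp_all
  moreover have "tempered_q q \<in> sets \<mu> \<and> emeasure \<mu> (tempered_q q) = 1" if P: "?P \<mu>" and q: "q > 3 * real CARD('n) / 4" for \<mu> q
  proof -
    \<comment> \<open>The measure supplied by the existence result may depend on \<open>q\<close>;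
      uniqueness identifies all of them with \<mu>.\<close>
    obtain \<mu>' where \<mu>': "?P \<mu>'" "emeasure \<mu>' (tempered_q q) = 1" using ex[OF q] by blast
    then have "\<mu> = \<mu>'" using uniq[OF P] by blast
    then show ?thesis using \<mu>'(2) P tempered_q_measurable[of q] by simp
  qed
  ultimately show ?thesis by blast
qed

end
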